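(* Let $Y$ be a MUCOGARCH$(1,1)$ volatility process with parameters $A,B\in M_d(\mathbb{R})$, $C\in\mathbb{S}_d^{++}$ driven by a $d$-dimensional Lévy process $L$ with Lévy measure $\nu_L$, and let $V_t=C+Y_t$. Assume that there exists $\sigma_L\in\mathbb{R}^+$ such that $\int_{\mathbb{R}^d}xx^*\,\nu_L(dx)=\sigma_LI_d$. (i) If $Y$ is second-order stationary, then its autocovariance function satisfies $$\frac{d}{dh}\operatorname{acov}_Y(h)=(B\otimes I_d+I_d\otimes B+\sigma_LA\otimes A)\operatorname{acov}_Y(h)$$ for $h\ge0$. Hence, $$\operatorname{acov}_Y(h)=\operatorname{acov}_V(h)=e^{(B\otimes I_d+I_d\otimes B+\sigma_LA\otimes A)h}\operatorname{var}(\operatorname{vec}(Y_0)),\qquad h\ge0.$$ (ii) If $E(\|Y_0\|^2)$ and $E(\|L_1\|^4)$ are finite, then $$\operatorname{cov}(\operatorname{vec}(Y_{u+h}),\operatorname{vec}(Y_u))=\operatorname{cov}(\operatorname{vec}(V_{u+h}),\operatorname{vec}(V_u))=e^{(B\otimes I_d+I_d\otimes B+\sigma_LA\otimes A)h}\operatorname{var}(\operatorname{vec}(Y_u))$$ for all $u,h\ge0$.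
   Context: $M_d(\mathbb{R})$: real $d\times d$ matrices; $I_d$ the identity; $\mathbb{S}_d^+$ (resp. $\mathbb{S}_d^{++}$): positive semidefinite (resp. positive definite) symmetric $d\times d$ matrices; $X^*$ is the transpose; $X^{1/2}$ the positive semidefinite square root; $\otimes$ the Kronecker product; $\operatorname{vec}$ stacks the columns of a matrix; $\mathbb{R}^+=[0,\infty)$. For random vectors, $\operatorname{cov}(X,Z)=E(XZ^* )-E(X)E(Z)^*$, $\operatorname{var}(X)=\operatorname{cov}(X,X)$. All processes live on a filtered probability space satisfying the usual conditions; $L$ is a càdlàg $\mathbb{R}^d$-valued Lévy process with respect to this filtration, $L_0=0$; $Y_0$ is $\mathcal{F}_0$-measurable. $[L,L]^{\mathfrak{d}}_t=\sum_{0\le s\le t}(\Delta L_s)(\Delta L_s)^*$. The MUCOGARCH$(1,1)$ volatility process with parameters $A,B,C$ driven by $L$ is the (unique) $\mathbb{S}_d^+$-valued càdlàg adapted solution of $$dY_t=(BY_{t-}+Y_{t-}B^* )\,dt+A(C+Y_{t-})^{1/2}\,d[L,L]_t^{\mathfrak{d}}\,(C+Y_{t-})^{1/2}A^*$$ with initial value $Y_0$ in $\mathbb{S}_d^+$. Second-order stationary means finite second moments, mean constant in time, and $\operatorname{cov}(\operatorname{vec}(Y_{t+h}),\operatorname{vec}(Y_t))$ depending only on $h\ge0$. For a second-order stationary matrix-valued process $Z$, $\operatorname{acov}_Z(h)=\operatorname{cov}(\operatorname{vec}(Z_h),\operatorname{vec}(Z_0))$ for $h\ge0$. *)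

theory Defs
  imports "HOL-Probability.Probability"
begin

section \<open>Matrices\<close>

definition psd :: "real^'n^'n \<Rightarrow> bool" where
  "psd X \<longleftrightarrow> transpose X = X \<and> (\<forall>x. 0 \<le> x \<bullet> (X *v x))"

definition pos_def :: "real^'n^'n \<Rightarrow> bool" where
  "pos_def X \<longleftrightarrow> transpose X = X \<and> (\<forall>x. x \<noteq> 0 \<longrightarrow> 0 < x \<bullet> (X *v x))"

definition psd_sqrt :: "real^'n^'n \<Rightarrow> real^'n^'n" where
  "psd_sqrt X = (THE R. psd R \<and> R ** R = X)"

definition outer :: "real^'m \<Rightarrow> real^'n \<Rightarrow> real^'n^'m" where
  "outer x z = (\<chi> i j. x $ i * z $ j)"

text \<open>Vectors of length \<open>d\<^sup>2\<close> are indexed by pairs (block, position inside the block), ordered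
  lexicographically. So the \<open>j\<close>-th block of the vectorisation of \<open>X\<close> is the \<open>j\<close>-th column of \<open>X\<close>, and
  the blocks of the Kronecker product of \<open>P\<close> and \<open>Q\<close> are the matrices \<open>P\<^sub>i\<^sub>j Q\<close>.\<close>

definition vectorize :: "real^'n^'m \<Rightarrow> real^('n \<times> 'm)" where
  "vectorize X = (\<chi> p. X $ snd p $ fst p)"

definition kronecker ::
    "real^'n^'m \<Rightarrow> real^'q^'p \<Rightarrow> real^('n \<times> 'q)^('m \<times> 'p)" (infixl \<open>\<otimes>\<^sub>K\<close> 75) where
  "P \<otimes>\<^sub>K Q = (\<chi> r c. P $ fst r $ fst c * Q $ snd r $ snd c)"

text \<open>The library's \<^const>\<open>exp\<close> and \<open>*\<close>, \<open>^\<close> act on \<open>real^'n^'n\<close> componentwise, so the matrix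
  exponential has to be built from \<open>**\<close>.\<close>

definition matrix_exp :: "real^'n^'n \<Rightarrow> real^'n^'n" where
  "matrix_exp X = (\<Sum>k. (1 / fact k) *\<^sub>R (((**) X ^^ k) (mat 1)))"


section \<open>Covariances\<close>

definition cov :: "'a measure \<Rightarrow> ('a \<Rightarrow> real^'m) \<Rightarrow> ('a \<Rightarrow> real^'n) \<Rightarrow> real^'n^'m" where
  "cov M X Z = (\<integral>\<omega>. outer (X \<omega>) (Z \<omega>) \<partial>M) - outer (\<integral>\<omega>. X \<omega> \<partial>M) (\<integral>\<omega>. Z \<omega> \<partial>M)"

definition var :: "'a measure \<Rightarrow> ('a \<Rightarrow> real^'m) \<Rightarrow> real^'m^'m" where
  "var M X = cov M X X"

text \<open>Processes are families \<open>real \<Rightarrow> 'a \<Rightarrow> _\<close> of which only the times \<open>t \<ge> 0\<close> matter.\<close>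

definition second_order_stationary ::
    "'a measure \<Rightarrow> (real \<Rightarrow> 'a \<Rightarrow> real^'n^'m) \<Rightarrow> bool" where
  "second_order_stationary M Z \<longleftrightarrow>
     (\<forall>t\<ge>0. Z t \<in> borel_measurable M \<and> integrable M (\<lambda>\<omega>. (norm (Z t \<omega>))\<^sup>2)) \<and>
     (\<forall>t\<ge>0. (\<integral>\<omega>. Z t \<omega> \<partial>M) = (\<integral>\<omega>. Z 0 \<omega> \<partial>M)) \<and>
     (\<forall>s\<ge>0. \<forall>t\<ge>0. \<forall>h\<ge>0.
        cov M (\<lambda>\<omega>. vectorize (Z (t + h) \<omega>)) (\<lambda>\<omega>. vectorize (Z t \<omega>)) =
        cov M (\<lambda>\<omega>. vectorize (Z (s + h) \<omega>)) (\<lambda>\<omega>. vectorize (Z s \<omega>)))"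

definition acov ::
    "'a measure \<Rightarrow> (real \<Rightarrow> 'a \<Rightarrow> real^'n^'m) \<Rightarrow> real \<Rightarrow> real^('n \<times> 'm)^('n \<times> 'm)" where
  "acov M Z h = cov M (\<lambda>\<omega>. vectorize (Z h \<omega>)) (\<lambda>\<omega>. vectorize (Z 0 \<omega>))"


section \<open>Paths\<close>

definition cadlag :: "(real \<Rightarrow> 'b::topological_space) \<Rightarrow> bool" where
  "cadlag f \<longleftrightarrow> (\<forall>t\<ge>0. (f \<longlongrightarrow> f t) (at_right t)) \<and> (\<forall>t>0. \<exists>l. (f \<longlongrightarrow> l) (at_left t))"

text \<open>The convention \<open>f(0-) = f(0)\<close> means that there is no jump at time 0.\<close>

definition left_limit :: "(real \<Rightarrow> 'b::t2_space) \<Rightarrow> real \<Rightarrow> 'b" where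
  "left_limit f t = (if t \<le> 0 then f 0 else Lim (at_left t) f)"

definition jump :: "(real \<Rightarrow> 'b::real_normed_vector) \<Rightarrow> real \<Rightarrow> 'b" where
  "jump f t = f t - left_limit f t"

definition disc_qv :: "(real \<Rightarrow> real^'n) \<Rightarrow> real \<Rightarrow> real^'n^'n" where
  "disc_qv f t = (\<Sum>\<^sub>\<infinity>s\<in>{0..t}. outer (jump f s) (jump f s))"

text \<open>Lebesgue-Stieltjes integral of \<open>f\<close> over \<open>(a,b]\<close> with respect to a right-continuous integrator
  \<open>g\<close> of finite variation, via a decomposition of \<open>g\<close> into a difference of nondecreasing functions;
  the value does not depend on the decomposition.\<close>

definition has_LS_integral ::
    "(real \<Rightarrow> real) \<Rightarrow> (real \<Rightarrow> real) \<Rightarrow> real \<Rightarrow> real \<Rightarrow> real \<Rightarrow> bool" where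
  "has_LS_integral f g a b I \<longleftrightarrow>
     (\<exists>p n. mono p \<and> mono n \<and>
        (\<forall>s. continuous (at_right s) p) \<and> (\<forall>s. continuous (at_right s) n) \<and>
        (\<forall>s\<in>{a..b}. g s = p s - n s) \<and>
        set_integrable (interval_measure p) {a<..b} f \<and>
        set_integrable (interval_measure n) {a<..b} f \<and>
        I = (LINT s:{a<..b}|interval_measure p. f s) - (LINT s:{a<..b}|interval_measure n. f s))"

text \<open>\<open>J = \<integral> X dG Z\<close> over \<open>(a,b]\<close>, i.e. \<open>J\<^sub>i\<^sub>j = \<Sum>\<^sub>k \<Sum>\<^sub>l \<integral> X\<^sub>i\<^sub>k Z\<^sub>l\<^sub>j dG\<^sub>k\<^sub>l\<close>.\<close>

definition has_matrix_LS_integral ::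
    "(real \<Rightarrow> real^'k^'m) \<Rightarrow> (real \<Rightarrow> real^'l^'k) \<Rightarrow> (real \<Rightarrow> real^'n^'l) \<Rightarrow>
      real \<Rightarrow> real \<Rightarrow> real^'n^'m \<Rightarrow> bool" where
  "has_matrix_LS_integral X G Z a b J \<longleftrightarrow>
     (\<exists>I. (\<forall>i j k l. has_LS_integral (\<lambda>s. X s $ i $ k * Z s $ l $ j) (\<lambda>s. G s $ k $ l) a b
                       (I i j k l)) \<and>
          (\<forall>i j. J $ i $ j = (\<Sum>k\<in>UNIV. \<Sum>l\<in>UNIV. I i j k l)))"


section \<open>Filtrations, Levy processes and the MUCOGARCH volatility\<close>

text \<open>The library's filtrations are indexed by a whole type. A filtration on \<open>[0,\<infinity>)\<close> is regarded as
  indexed by \<open>real\<close> by extending it to negative times by \<open>F 0\<close>; negative times play no role.\<close>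

definition usual_conditions :: "'a measure \<Rightarrow> (real \<Rightarrow> 'a measure) \<Rightarrow> bool" where
  "usual_conditions M F \<longleftrightarrow>
     filtration (space M) F \<and> (\<forall>t\<ge>0. subalgebra M (F t)) \<and>
     complete_measure M \<and> null_sets M \<subseteq> sets (F 0) \<and>
     (\<forall>t\<ge>0. sets (F t) = (\<Inter>s\<in>{t<..}. sets (F s)))"

definition adapted :: "(real \<Rightarrow> 'a measure) \<Rightarrow> (real \<Rightarrow> 'a \<Rightarrow> 'b::topological_space) \<Rightarrow> bool" where
  "adapted F X \<longleftrightarrow> (\<forall>t\<ge>0. X t \<in> borel_measurable (F t))"

definition levy_process ::
    "'a measure \<Rightarrow> (real \<Rightarrow> 'a measure) \<Rightarrow> (real \<Rightarrow> 'a \<Rightarrow> real^'n) \<Rightarrow> bool" where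
  "levy_process M F L \<longleftrightarrow>
     adapted F L \<and>
     (AE \<omega> in M. L 0 \<omega> = 0) \<and>
     (AE \<omega> in M. cadlag (\<lambda>t. L t \<omega>)) \<and>
     (\<forall>s t. 0 \<le> s \<and> s \<le> t \<longrightarrow>
        prob_space.indep_set M (sets (F s))
          (sets (vimage_algebra (space M) (\<lambda>\<omega>. L t \<omega> - L s \<omega>) borel))) \<and>
     (\<forall>s t. 0 \<le> s \<and> s \<le> t \<longrightarrow>
        distr M borel (\<lambda>\<omega>. L t \<omega> - L s \<omega>) = distr M borel (L (t - s))) \<and>
     (\<forall>t\<ge>0. \<forall>e>0.
        ((\<lambda>s. measure M {\<omega> \<in> space M. dist (L s \<omega>) (L t \<omega>) > e}) \<longlongrightarrow> 0) (at t within {0..}))"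

text \<open>\<open>\<nu>(D)\<close> is the expected number of nonzero jumps in \<open>D\<close> during one unit of time.\<close>

definition is_levy_measure ::
    "'a measure \<Rightarrow> (real \<Rightarrow> 'a \<Rightarrow> real^'n) \<Rightarrow> (real^'n) measure \<Rightarrow> bool" where
  "is_levy_measure M L \<nu> \<longleftrightarrow>
     sets \<nu> = sets borel \<and>
     (\<forall>D\<in>sets borel. emeasure \<nu> D =
        (\<integral>\<^sup>+\<omega>. emeasure (count_space UNIV)
                {s \<in> {0<..1}. jump (\<lambda>r. L r \<omega>) s \<in> D - {0}} \<partial>M))"

definition mucogarch_volatility ::
    "'a measure \<Rightarrow> (real \<Rightarrow> 'a measure) \<Rightarrow> (real \<Rightarrow> 'a \<Rightarrow> real^'n) \<Rightarrow>
      real^'n^'n \<Rightarrow> real^'n^'n \<Rightarrow> real^'n^'n \<Rightarrow> (real \<Rightarrow> 'a \<Rightarrow> real^'n^'n) \<Rightarrow> bool" where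
  "mucogarch_volatility M F L A B C Y \<longleftrightarrow>
     adapted F Y \<and>
     (AE \<omega> in M. cadlag (\<lambda>t. Y t \<omega>)) \<and>
     (AE \<omega> in M. \<forall>t\<ge>0. psd (Y t \<omega>)) \<and>
     (AE \<omega> in M. \<forall>t\<ge>0.
        let Ym = left_limit (\<lambda>r. Y r \<omega>) in
        \<exists>J. has_matrix_LS_integral
              (\<lambda>s. A ** psd_sqrt (C + Ym s))
              (disc_qv (\<lambda>r. L r \<omega>))
              (\<lambda>s. psd_sqrt (C + Ym s) ** transpose A) 0 t J \<and>
            Y t \<omega> = Y 0 \<omega> + (LINT s:{0..t}|lborel. B ** Ym s + Ym s ** transpose B) + J)"

end

theory Submission
  imports Defs
begin

text \<open>Let \<open>u \<ge> 0\<close> and let \<open>Z\<close> be a centred, square integrable, \<open>F\<^sub>u\<close>-measurable random variable. The compensation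
  formula \<open>E (Z \<Sum>\<^bsub>u < s \<le> t\<^esub> X\<^bsub>s-\<^esub> (\<Delta>L\<^sub>s)\<^sub>k (\<Delta>L\<^sub>s)\<^sub>l) = \<sigma> \<delta>\<^bsub>kl\<^esub> E (Z \<integral>\<^bsub>(u, t]\<^esub> X\<^sub>r dr)\<close> turns the jump part of the
  volatility equation into \<open>\<sigma> A (C + Y) A\<^sup>*\<close>, because the two square roots multiply to \<open>C + Y\<close>. The constant \<open>C\<close>
  drops out since \<open>Z\<close> is centred, so with \<open>Z\<close> a centred entry of \<open>vec Y\<^sub>u\<close> the covariance \<open>D(h)\<close> solves \<open>D' = K D\<close>
  with \<open>K = B \<otimes> I + I \<otimes> B + \<sigma> A \<otimes> A\<close>. It is enough that second moments of \<open>Y\<close> are bounded on compact time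
  intervals. In the stationary case they are constant. In the other case a Gronwall inequality with jumps
  bounds \<open>tr (C + Y\<^sub>t)\<close> by \<open>tr (C + Y\<^sub>0) e\<^bsup>c t\<^esup> \<Prod>\<^bsub>s \<le> t\<^esub> (1 + 2 a |\<Delta>L\<^sub>s|\<^sup>2)\<close>, and the square of the product has finite
  expectation as \<open>E |L\<^bsub>1/N\<^esub>|\<^sup>4 = O(1/N)\<close>.\<close>

section \<open>The positive semidefinite square root\<close>

text \<open>No stochastic integral enters: sums over jumps are formed path by path, and probability
  is used only through independence of increments along equidistant grids. The obstacle is that jump
  times are random, so neither the measurability nor the mean of a jump sum can be read off from its
  definition. Functions of the jumps that vanish near 0 give limits of grid sums, whose Laplace
  transforms are bounded and factor along the grid; further nonnegative functions are reached by
  limits from below, and signed products of jumps by polarisation. Continuity of the matrix square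
  root makes the coefficients adapted and cadlag. They grow only linearly in \<open>Y\<close>,
  because the squared Frobenius norm of a root is the trace of the matrix. The factor 2 in 1 + 2 a
  |x|^2 is the price of a Gronwall argument that works with suprema. It is affordable, since the
  square of this factor is still a polynomial of degree 4 in |x|, and this is where the fourth
  moment of \<open>L 1\<close> is spent.\<close>

lemma norm_matrix_vector_le: "norm (A *v x) \<le> norm A * norm x" for A :: "real^'n^'m"
proof -
  have "norm (A *v x) = L2_set (\<lambda>i. \<bar>A $ i \<bullet> x\<bar>) UNIV"
    by (simp add: norm_vec_def matrix_vector_mul_component)
  also have "\<dots> \<le> L2_set (\<lambda>i. norm (A $ i) * norm x) UNIV"
    by (intro L2_set_mono) (auto simp: Cauchy_Schwarz_ineq2)
  also have "\<dots> = norm A * norm x"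
    by (simp add: norm_vec_def[of A] L2_set_left_distrib)
  finally show ?thesis .
qed

lemma norm_transpose: "norm (transpose A) = norm A" for A :: "real^'n^'m"
proof -
  have "(norm (transpose A))\<^sup>2 = (norm A)\<^sup>2"
    unfolding power2_norm_eq_inner inner_vec_def transpose_def
    by (subst sum.swap) simp
  then show ?thesis by simp
qed

text \<open>The norm is the Frobenius norm. Row i of the product is \<open>transpose B\<close>
  applied to row i of \<open>A\<close>, so the Cauchy-Schwarz bound for a matrix times a vector
  applies row by row.\<close>

lemma norm_matrix_mult_le: "norm (A ** B) \<le> norm A * norm B"
  for A :: "real^'n^'m" and B :: "real^'k^'n"
proof -
  have "(A ** B) $ i = transpose B *v (A $ i)" for i
    by (simp add: vec_eq_iff matrix_matrix_mult_def matrix_vector_mult_def transpose_def mult.commute)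
  then have "norm (A ** B) = L2_set (\<lambda>i. norm (transpose B *v (A $ i))) UNIV"
    by (simp add: norm_vec_def[of "A ** B"])
  also have "\<dots> \<le> L2_set (\<lambda>i. norm (A $ i) * norm B) UNIV"
    using norm_matrix_vector_le[of "transpose B"]
    by (intro L2_set_mono) (simp_all add: norm_transpose mult.commute[of "norm (A $ _)"] del: transpose_matrix_vector)
  also have "\<dots> = norm A * norm B"
    by (simp add: norm_vec_def[of A] L2_set_left_distrib)
  finally show ?thesis .
qed

section \<open>Spectral theorem for symmetric linear maps\<close>

lemma max_eigenvector:
  fixes f :: "'a::euclidean_space \<Rightarrow> 'a"
  assumes f: "linear f" and sym: "\<And>x y. x \<bullet> f y = f x \<bullet> y"
    and S: "subspace S" and inv: "f ` S \<subseteq> S" and ne: "S \<noteq> {0}"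
  obtains v l where "v \<in> S" "norm v = 1" "f v = l *\<^sub>R v"
    "\<And>x. x \<in> S \<Longrightarrow> x \<bullet> f x \<le> l * (norm x)\<^sup>2"
proof -
  from ne S obtain w where w: "w \<in> S" "w \<noteq> 0" by (auto dest: subspace_0)
  have "w /\<^sub>R norm w \<in> sphere 0 1 \<inter> S" using w S by (auto intro: subspace_scale)
  moreover have "compact (sphere 0 1 \<inter> S)"
    by (intro compact_Int_closed closed_subspace S compact_sphere)
  moreover have "continuous_on (sphere 0 1 \<inter> S) (\<lambda>x. x \<bullet> f x)"
    by (intro continuous_intros linear_continuous_on linear_conv_bounded_linear[THEN iffD1] f)
  ultimately obtain v where "v \<in> sphere 0 1 \<inter> S"
    "\<forall>x\<in>sphere 0 1 \<inter> S. x \<bullet> f x \<le> v \<bullet> f v"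
    using continuous_attains_sup[of "sphere 0 1 \<inter> S" "\<lambda>x. x \<bullet> f x"] by blast
  then have v: "v \<in> S" "norm v = 1"
    and max: "\<And>x. x \<in> S \<Longrightarrow> norm x = 1 \<Longrightarrow> x \<bullet> f x \<le> v \<bullet> f v" by auto
  define l where "l = v \<bullet> f v"
  have le: "x \<bullet> f x \<le> l * (norm x)\<^sup>2" if x: "x \<in> S" for x
  proof (cases "x = 0")
    case False
    define y where "y = x /\<^sub>R norm x"
    have y: "y \<in> S" "norm y = 1" and xy: "x = norm x *\<^sub>R y"
      using False x S by (auto simp: y_def intro: subspace_scale)
    have "x \<bullet> f x = (norm x)\<^sup>2 * (y \<bullet> f y)"
      by (subst (1 2) xy) (simp add: linear_scale[OF f] power2_eq_square)
    also have "\<dots> \<le> (norm x)\<^sup>2 * l" unfolding l_def by (intro mult_left_mono max y) simp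
    finally show ?thesis by (simp add: mult.commute)
  qed (simp add: linear_0[OF f])
  \<comment> \<open>The residual of the eigenvalue equation. Unless it vanishes, moving from
    \<open>v\<close> in its direction raises the Rayleigh quotient to first order; \<open>q\<close>
    is this comparison, written as a quadratic polynomial in \<open>t\<close>.\<close>
  define w where "w = f v - l *\<^sub>R v"
  have w: "w \<in> S" using v inv S by (auto simp: w_def intro!: subspace_diff subspace_scale)
  define e where "e = w \<bullet> f w - l * (norm w)\<^sup>2"
  have vw: "w \<bullet> f v - l * (v \<bullet> w) = (norm w)\<^sup>2"
    using v(2) by (simp add: w_def power2_norm_eq_inner inner_simps inner_commute norm_eq_1 l_def)
  have q: "2 * t * (norm w)\<^sup>2 + t\<^sup>2 * e \<le> 0" for t
  proof -
    have n: "(norm (v + t *\<^sub>R w))\<^sup>2 = 1 + 2 * t * (v \<bullet> w) + t\<^sup>2 * (norm w)\<^sup>2"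
      using v(2) unfolding power2_norm_eq_inner
      by (simp add: inner_simps inner_commute norm_eq_1 algebra_simps power2_eq_square)
    have "v + t *\<^sub>R w \<in> S" using v w S by (auto intro!: subspace_add subspace_scale)
    from le[OF this] have "(v + t *\<^sub>R w) \<bullet> f (v + t *\<^sub>R w) - l * (norm (v + t *\<^sub>R w))\<^sup>2 \<le> 0" by simp
    also have "(v + t *\<^sub>R w) \<bullet> f (v + t *\<^sub>R w) - l * (norm (v + t *\<^sub>R w))\<^sup>2
      = 2 * t * (w \<bullet> f v - l * (v \<bullet> w)) + t\<^sup>2 * e"
      using sym[of v w] unfolding n by (simp add: e_def l_def linear_add[OF f] linear_scale[OF f]
         inner_simps inner_commute algebra_simps power2_eq_square)
    finally show ?thesis unfolding vw by simp
  qed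
  have "w = 0"
  proof (rule ccontr)
    assume "w \<noteq> 0"
    define n where "n = (norm w)\<^sup>2"
    have n: "n > 0" using \<open>w \<noteq> 0\<close> by (simp add: n_def)
    \<comment> \<open>So small that the quadratic term \<open>t\<^sup>2 * e\<close> can use up at
      most half of the linear term \<open>2 * t * n\<close>.\<close>
    define t where "t = n / (\<bar>e\<bar> + 1)"
    have t: "t > 0" using n by (simp add: t_def)
    have "t * \<bar>e\<bar> \<le> n" using n by (simp add: t_def field_simps)
    then have "t * (t * \<bar>e\<bar>) \<le> t * n" using t by (intro mult_left_mono) auto
    moreover have "t\<^sup>2 * (- e) \<le> t\<^sup>2 * \<bar>e\<bar>" by (intro mult_left_mono) auto
    then have "- (t\<^sup>2 * e) \<le> t * (t * \<bar>e\<bar>)" by (simp add: power2_eq_square mult.assoc)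
    ultimately have "2 * t * n + t\<^sup>2 * e \<ge> t * n" by (simp add: mult.commute)
    moreover have "t * n > 0" using t n by simp
    ultimately show False using q[of t] unfolding n_def[symmetric] by linarith
  qed
  with v le that show ?thesis by (auto simp: w_def)
qed

text \<open>Induction on the dimension: an eigenvector \<open>v\<close> splits off, and symmetry of
  \<open>f\<close> makes the orthogonal complement of \<open>v\<close> in \<open>S\<close>
  invariant. The dimension drops because \<open>v\<close> is not in its own complement.\<close>

lemma orthonormal_eigenbasis:
  fixes f :: "'a::euclidean_space \<Rightarrow> 'a"
  assumes f: "linear f" and sym: "\<And>x y. x \<bullet> f y = f x \<bullet> y"
    and S: "subspace S" and inv: "f ` S \<subseteq> S"
  shows "\<exists>B l. finite B \<and> B \<subseteq> S \<and> S \<subseteq> span B \<and> (\<forall>b\<in>B. norm b = 1 \<and> f b = l b *\<^sub>R b) \<and>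
    (\<forall>b\<in>B. \<forall>c\<in>B. b \<noteq> c \<longrightarrow> b \<bullet> c = 0)"
  using S inv
proof (induction "dim S" arbitrary: S rule: less_induct)
  case less
  show ?case
  proof (cases "S = {0}")
    case True
    then show ?thesis by (intro exI[of _ "{}"]) auto
  next
    case False
    obtain v l where v: "v \<in> S" "norm v = 1" "f v = l *\<^sub>R v"
      using max_eigenvector[OF f sym less.prems False] by metis
    define T where "T = S \<inter> {x. v \<bullet> x = 0}"
    have T: "subspace T" unfolding T_def using less.prems(1)
      by (simp add: subspace_inter subspace_hyperplane)
    have fT: "f ` T \<subseteq> T"
      using less.prems(2) v by (auto simp: T_def sym)
    have "v \<notin> T" using v by (auto simp: T_def norm_eq_1)
    then have "T \<noteq> S" using v by auto
    moreover have "T \<subseteq> S" by (auto simp: T_def)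
    ultimately have "dim T < dim S"
      using subspace_dim_equal[OF T less.prems(1)] by (metis not_le)
    from less.hyps[OF this T fT] obtain B m where B: "finite B" "B \<subseteq> T" "T \<subseteq> span B"
      "\<forall>b\<in>B. norm b = 1 \<and> f b = m b *\<^sub>R b" "\<forall>b\<in>B. \<forall>c\<in>B. b \<noteq> c \<longrightarrow> b \<bullet> c = 0" by blast
    have vB: "v \<notin> B" using B(2) v by (auto simp: T_def norm_eq_1)
    have "x \<in> span (insert v B)" if x: "x \<in> S" for x
    proof -
      have "x - (v \<bullet> x) *\<^sub>R v \<in> T" using x v less.prems(1)
        by (auto simp: T_def inner_simps norm_eq_1 intro!: subspace_diff subspace_scale)
      then have "x - (v \<bullet> x) *\<^sub>R v \<in> span B" using B by blast
      then show ?thesis by (metis span_breakdown_eq)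
    qed
    then have "finite (insert v B) \<and> insert v B \<subseteq> S \<and> S \<subseteq> span (insert v B) \<and>
      (\<forall>b\<in>insert v B. norm b = 1 \<and> f b = (m(v := l)) b *\<^sub>R b) \<and>
      (\<forall>b\<in>insert v B. \<forall>c\<in>insert v B. b \<noteq> c \<longrightarrow> b \<bullet> c = 0)"
      using B v vB by (auto simp: T_def inner_commute)
    then show ?thesis by blast
  qed
qed

lemma symmetric_inner: "transpose X = X \<Longrightarrow> x \<bullet> (X *v y) = (X *v x) \<bullet> y" for X :: "real^'n^'n"
  using dot_lmul_matrix[of x X y] transpose_matrix_vector[of X x] by simp

lemma psd_symmetric: "psd X \<Longrightarrow> transpose X = X"
  and psd_nonneg: "psd X \<Longrightarrow> 0 \<le> x \<bullet> (X *v x)"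
  by (auto simp: psd_def)

text \<open>In an orthonormal eigenbasis the root is the sum of the projections
  \<open>outer b b\<close> weighted with the roots of the eigenvalues. Its square needs to be
  compared with \<open>X\<close> on the basis only.\<close>

lemma psd_sqrt_exists:
  fixes X :: "real^'n^'n"
  assumes X: "psd X"
  shows "\<exists>R. psd R \<and> R ** R = X"
proof -
  have "\<exists>B l. finite B \<and> B \<subseteq> UNIV \<and> UNIV \<subseteq> span B \<and> (\<forall>b\<in>B. norm b = 1 \<and> X *v b = l b *\<^sub>R b) \<and>
    (\<forall>b\<in>B. \<forall>c\<in>B. b \<noteq> c \<longrightarrow> b \<bullet> c = 0)"
    by (rule orthonormal_eigenbasis)
       (auto intro: symmetric_inner psd_symmetric X)
  then obtain B l where B: "finite B" "UNIV \<subseteq> span B"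
    "\<And>b. b \<in> B \<Longrightarrow> norm b = 1" "\<And>b. b \<in> B \<Longrightarrow> X *v b = l b *\<^sub>R b"
    "\<And>b c. b \<in> B \<Longrightarrow> c \<in> B \<Longrightarrow> b \<noteq> c \<Longrightarrow> b \<bullet> c = 0" by blast
  have l: "l b \<ge> 0" if "b \<in> B" for b
    using psd_nonneg[OF X, of b] B(3,4)[OF that] by (simp add: norm_eq_1)
  define R where "R = (\<Sum>b\<in>B. sqrt (l b) *\<^sub>R outer b b)"
  have o: "outer b b *v x = (b \<bullet> x) *\<^sub>R b" for b x :: "real^'n"
    by (simp add: outer_def vec_eq_iff matrix_vector_mult_def inner_vec_def sum_distrib_left ac_simps)
  have Rx: "R *v x = (\<Sum>b\<in>B. (sqrt (l b) * (b \<bullet> x)) *\<^sub>R b)" for x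
  proof -
    have "R *v x = (\<Sum>b\<in>B. (sqrt (l b) *\<^sub>R outer b b) *v x)"
      unfolding R_def using B(1) by (induction B rule: finite_induct) (auto simp: matrix_vector_mult_add_rdistrib)
    then show ?thesis by (simp add: scaleR_matrix_vector_assoc[symmetric] o)
  qed
  have Rb: "R *v b = sqrt (l b) *\<^sub>R b" if b: "b \<in> B" for b
  proof -
    have "R *v b = (\<Sum>c\<in>B. if c = b then sqrt (l b) *\<^sub>R b else 0)"
      unfolding Rx using B b by (intro sum.cong) (auto simp: norm_eq_1)
    then show ?thesis using b B(1) by simp
  qed
  have "transpose R = R"
    by (auto simp: R_def transpose_def vec_eq_iff outer_def intro!: sum.cong)
  moreover have "0 \<le> x \<bullet> (R *v x)" for x
  proof -
    have "x \<bullet> (R *v x) = (\<Sum>b\<in>B. sqrt (l b) * (b \<bullet> x)\<^sup>2)"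
      unfolding Rx by (simp add: inner_sum_right inner_commute[of x] power2_eq_square mult.assoc)
    then show ?thesis by (simp add: sum_nonneg l)
  qed
  moreover have "R ** R = X"
  proof -
    have "(R ** R) *v x = X *v x" for x
    proof (rule linear_eq_on_span[of "(*v) (R ** R)" "(*v) X" B])
      show "x \<in> span B" using B by blast
      show "(R ** R) *v b = X *v b" if "b \<in> B" for b
        using Rb[OF that] B(4)[OF that] l[OF that]
        by (simp add: matrix_vector_mul_assoc[symmetric] matrix_vector_mult_scaleR)
    qed auto
    then show ?thesis by (simp add: matrix_eq)
  qed
  ultimately show ?thesis by (auto simp: psd_def)
qed

text \<open>At an eigenvector \<open>v\<close> of \<open>R - S\<close> for its largest eigenvalue \<open>l \<ge> 0\<close>, the quadratic form of
  \<open>R\<^sup>2 - S\<^sup>2\<close> is \<open>l (2 \<langle>v, S v\<rangle> + l) \<ge> l\<^sup>2\<close>. This gives uniqueness and continuity of the square root.\<close>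

lemma psd_quadratic_diff_le:
  fixes R S :: "real^'n^'n"
  assumes R: "psd R" and S: "psd S"
  shows "x \<bullet> ((R - S) *v x) \<le> sqrt (norm (R ** R - S ** S)) * (norm x)\<^sup>2"
proof -
  define D where "D = R - S"
  have sym: "transpose D = D"
    using psd_symmetric[OF R] psd_symmetric[OF S] by (simp add: D_def transpose_def vec_eq_iff)
  have "(UNIV :: (real^'n) set) \<noteq> {0}"
    by (metis UNIV_I UNIV_not_singleton)
  obtain v l where v: "norm v = 1" "D *v v = l *\<^sub>R v" and le: "\<And>x. x \<bullet> (D *v x) \<le> l * (norm x)\<^sup>2"
    using max_eigenvector[of "(*v) D" UNIV] symmetric_inner[OF sym] \<open>(UNIV :: (real^'n) set) \<noteq> {0}\<close>
    by (auto simp: subspace_UNIV)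
  have "l \<le> sqrt (norm (R ** R - S ** S))"
  proof (cases "l \<ge> 0")
    case True
    have Rv: "R *v v = S *v v + l *\<^sub>R v" using v(2) by (simp add: D_def matrix_vector_mult_diff_rdistrib algebra_simps)
    have "v \<bullet> ((R ** R - S ** S) *v v) = (R *v v) \<bullet> (R *v v) - (S *v v) \<bullet> (S *v v)"
      by (simp add: matrix_vector_mult_diff_rdistrib inner_diff_right matrix_vector_mul_assoc[symmetric]
          symmetric_inner[OF psd_symmetric[OF R]] symmetric_inner[OF psd_symmetric[OF S]])
    also have "\<dots> = l * (2 * (v \<bullet> (S *v v)) + l)"
      using v(1) by (simp add: Rv inner_simps inner_commute norm_eq_1 algebra_simps)
    also have "\<dots> \<ge> l * l"
      using True psd_nonneg[OF S, of v] by (intro mult_left_mono) auto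
    finally have "l * l \<le> v \<bullet> ((R ** R - S ** S) *v v)" .
    also have "\<dots> \<le> norm v * norm ((R ** R - S ** S) *v v)"
      by (rule norm_cauchy_schwarz)
    also have "\<dots> \<le> norm (R ** R - S ** S)"
      using norm_matrix_vector_le[of "R ** R - S ** S" v] v(1) by simp
    finally show ?thesis by (intro real_le_rsqrt) (simp add: power2_eq_square)
  next
    case False
    then show ?thesis by (smt (verit) real_sqrt_ge_zero norm_ge_zero)
  qed
  then show ?thesis
    using le[of x] by (fold D_def) (meson mult_right_mono order_trans zero_le_power2)
qed

text \<open>Exchanging \<open>R\<close> and \<open>S\<close> bounds the quadratic form of
  \<open>R - S\<close> from both sides, and polarisation carries the bound over to each of the d^2
  entries. The square root is thus Hoelder continuous of order 1/2, singular matrices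
  included.\<close>

lemma psd_sqrt_dist_le:
  fixes R S :: "real^'n^'n"
  assumes R: "psd R" and S: "psd S"
  shows "norm (R - S) \<le> real CARD('n) * real CARD('n) * sqrt (norm (R ** R - S ** S))"
proof -
  define D where "D = R - S"
  define c where "c = sqrt (norm (R ** R - S ** S))"
  have sym: "transpose D = D"
    using psd_symmetric[OF R] psd_symmetric[OF S] by (simp add: D_def transpose_def vec_eq_iff)
  have up: "x \<bullet> (D *v x) \<le> c * (norm x)\<^sup>2" for x
    using psd_quadratic_diff_le[OF R S] by (simp add: D_def c_def)
  have lo: "- (c * (norm x)\<^sup>2) \<le> x \<bullet> (D *v x)" for x
    using psd_quadratic_diff_le[OF S R, of x]
    by (simp add: D_def c_def norm_minus_commute matrix_vector_mult_diff_rdistrib inner_diff_right)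
  have comp: "\<bar>D $ i $ j\<bar> \<le> c" for i j
  proof -
    let ?e = "\<lambda>k. axis k (1::real) :: real^'n"
    have "D $ i $ j = ?e i \<bullet> (D *v ?e j)"
      by (simp add: inner_axis' matrix_vector_mul_component inner_axis)
    moreover have "?e j \<bullet> (D *v ?e i) = ?e i \<bullet> (D *v ?e j)"
      by (subst symmetric_inner[OF sym]) (rule inner_commute)
    ultimately have 4: "4 * (D $ i $ j) = (?e i + ?e j) \<bullet> (D *v (?e i + ?e j)) - (?e i - ?e j) \<bullet> (D *v (?e i - ?e j))"
      by (simp add: inner_simps matrix_vector_mult_diff_distrib matrix_vector_right_distrib)
    \<comment> \<open>The parallelogram law, valid for \<open>i = j\<close> as well, so the 4
      cancels against the factor from polarisation.\<close>
    have "(norm (?e i + ?e j))\<^sup>2 + (norm (?e i - ?e j))\<^sup>2 = 4"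
      by (simp add: power2_norm_eq_inner inner_simps inner_axis_axis)
    then have n: "c * (norm (?e i + ?e j))\<^sup>2 + c * (norm (?e i - ?e j))\<^sup>2 = c * 4"
      by (metis distrib_left)
    show ?thesis
      using 4 n up[of "?e i + ?e j"] up[of "?e i - ?e j"] lo[of "?e i + ?e j"] lo[of "?e i - ?e j"]
      by (simp add: abs_le_iff)
  qed
  have "norm D \<le> (\<Sum>i\<in>UNIV. norm (D $ i))"
    unfolding norm_vec_def[of D] by (rule L2_set_le_sum) auto
  also have "\<dots> \<le> (\<Sum>i::'n\<in>UNIV. \<Sum>j::'n\<in>UNIV. c)"
    by (intro sum_mono order_trans[OF norm_le_l1_cart] comp)
  finally show ?thesis by (simp add: D_def c_def mult.assoc)
qed

text \<open>By the Hoelder bound two roots of the same matrix have distance 0, so the definite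
  description in \<open>psd_sqrt\<close> is meaningful.\<close>

lemma psd_sqrt:
  assumes "psd X"
  shows psd_psd_sqrt: "psd (psd_sqrt X)" and psd_sqrt_mult: "psd_sqrt X ** psd_sqrt X = X"
proof -
  obtain R where R: "psd R" "R ** R = X" using psd_sqrt_exists[OF assms] by blast
  have "S = R" if "psd S" "S ** S = X" for S
    using psd_sqrt_dist_le[OF that(1) R(1)] R that by simp
  then have "psd_sqrt X = R" unfolding psd_sqrt_def using R by blast
  with R show "psd (psd_sqrt X)" "psd_sqrt X ** psd_sqrt X = X" by auto
qed

text \<open>Through this continuity the coefficients of the jump part inherit adaptedness, cadlag
  paths and left limits from \<open>Y\<close>.\<close>

lemma continuous_on_psd_sqrt: "continuous_on {X :: real^'n^'n. psd X} psd_sqrt"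
  unfolding continuous_on_def
proof (safe)
  fix X :: "real^'n^'n" assume X: "psd X"
  let ?c = "real CARD('n) * real CARD('n)"
  have "((\<lambda>Y. ?c * sqrt (norm (Y - X))) \<longlongrightarrow> ?c * sqrt (norm (X - X))) (at X within {X. psd X})"
    by (intro tendsto_intros)
  then have "((\<lambda>Y. ?c * sqrt (norm (Y - X))) \<longlongrightarrow> 0) (at X within {X. psd X})" by simp
  moreover have "norm (psd_sqrt Y - psd_sqrt X) \<le> ?c * sqrt (norm (Y - X))" if "psd Y" for Y
    using psd_sqrt_dist_le[OF psd_psd_sqrt[OF that] psd_psd_sqrt[OF X]]
    by (simp add: psd_sqrt_mult X that)
  then have "\<forall>\<^sub>F Y in at X within {X. psd X}. norm (psd_sqrt Y - psd_sqrt X) \<le> ?c * sqrt (norm (Y - X))"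
    by (simp add: eventually_at_filter)
  ultimately show "(psd_sqrt \<longlongrightarrow> psd_sqrt X) (at X within {X. psd X})"
    by (subst Lim_null) (rule Lim_null_comparison[rotated])
qed

text \<open>Closedness keeps the left limits of \<open>Y\<close> inside the cone on which the square
  root is continuous.\<close>

lemma closed_psd: "closed {X :: real^'n^'n. psd X}"
proof -
  have "{X :: real^'n^'n. psd X} = (\<Inter>i j. {X. X $ i $ j = X $ j $ i}) \<inter> (\<Inter>x. {X. 0 \<le> x \<bullet> (X *v x)})"
    by (auto simp: psd_def transpose_def vec_eq_iff)
  moreover have "closed {X :: real^'n^'n. 0 \<le> x \<bullet> (X *v x)}" for x
    unfolding inner_vec_def matrix_vector_mult_def
    by (intro closed_Collect_le) (auto intro!: continuous_intros)
  moreover have "closed {X :: real^'n^'n. X $ i $ j = X $ j $ i}" for i j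
    by (intro closed_Collect_eq continuous_intros)
  ultimately show ?thesis by (simp only:) (intro closed_Int closed_INT ballI)
qed

lemma psd_add: "psd X \<Longrightarrow> psd Y \<Longrightarrow> psd (X + Y)"
  by (auto simp: psd_def transpose_def vec_eq_iff matrix_vector_mult_add_rdistrib inner_add_right)

lemma pos_def_imp_psd: "pos_def X \<Longrightarrow> psd X"
  unfolding pos_def_def psd_def by (metis inner_zero_left order.refl less_imp_le)

text \<open>For symmetric \<open>R\<close> the trace of \<open>R ** R\<close> is the squared
  Frobenius norm of \<open>R\<close>. A term that is quadratic in the root of \<open>C + Y\<close>
  therefore grows only linearly in \<open>Y\<close>.\<close>

lemma norm_psd_sqrt:
  assumes "psd X"
  shows "(norm (psd_sqrt X))\<^sup>2 = trace X"
proof -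
  let ?R = "psd_sqrt X"
  have s: "?R $ i $ j = ?R $ j $ i" for i j
    using psd_symmetric[OF psd_psd_sqrt[OF assms]] by (auto simp: transpose_def vec_eq_iff)
  have "trace X = trace (?R ** ?R)" by (simp add: psd_sqrt_mult assms)
  also have "\<dots> = (norm ?R)\<^sup>2"
  proof -
    have r: "?R $ i $ j * ?R $ j $ i = ?R $ i $ j * ?R $ i $ j" for i j by (simp add: s[of j i])
    show ?thesis
      unfolding trace_def matrix_matrix_mult_def power2_norm_eq_inner inner_vec_def
      by (simp, intro sum.cong refl r)
  qed
  finally show ?thesis ..
qed

text \<open>With \<open>R\<close> the root of \<open>X\<close>, |R R| <= |R|^2 = tr X. On the cone
  the trace controls the norm and is at the same time linear, which makes it the right quantity for
  a Gronwall inequality.\<close>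

lemma norm_le_trace: "psd X \<Longrightarrow> norm X \<le> trace X"
  using norm_matrix_mult_le[of "psd_sqrt X" "psd_sqrt X"] norm_psd_sqrt[of X]
  by (simp add: psd_sqrt_mult power2_eq_square)

section \<open>Cadlag paths\<close>

lemma cadlag_right: "cadlag f \<Longrightarrow> 0 \<le> t \<Longrightarrow> (f \<longlongrightarrow> f t) (at_right t)"
  by (simp add: cadlag_def)

lemma cadlag_left:
  fixes f :: "real \<Rightarrow> 'b::t2_space"
  assumes "cadlag f" "0 < t"
  shows "(f \<longlongrightarrow> left_limit f t) (at_left t)"
proof -
  obtain l where l: "(f \<longlongrightarrow> l) (at_left t)" using assms by (auto simp: cadlag_def)
  moreover have "Lim (at_left t) f = l" using l by (intro tendsto_Lim) auto
  ultimately show ?thesis using assms by (simp add: left_limit_def)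
qed

lemma left_limit_eqI:
  fixes f :: "real \<Rightarrow> 'b::t2_space"
  assumes "(f \<longlongrightarrow> l) (at_left t)" "0 < t"
  shows "left_limit f t = l"
  using assms by (auto simp: left_limit_def intro!: tendsto_Lim)

lemma left_limit_0 [simp]: "left_limit f 0 = f 0"
  by (simp add: left_limit_def)

lemma jump_0 [simp]: "jump f 0 = 0"
  by (simp add: jump_def)

lemma eventually_at_left_nonneg: "0 < t \<Longrightarrow> eventually (\<lambda>s::real. 0 \<le> s) (at_left t)"
  by (rule eventually_mono[OF eventually_at_left_real[of 0 t]]) auto

lemma left_limit_in_closed:
  fixes f :: "real \<Rightarrow> 'b::t2_space"
  assumes "cadlag f" "closed S" "\<And>s. 0 \<le> s \<Longrightarrow> f s \<in> S" "0 \<le> t"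
  shows "left_limit f t \<in> S"
proof (cases "t = 0")
  case False
  with assms have t: "0 < t" by simp
  show ?thesis
    by (rule Lim_in_closed_set[OF assms(2) _ _ cadlag_left[OF assms(1) t]])
       (auto intro: eventually_mono[OF eventually_at_left_nonneg[OF t]] assms)
qed (use assms in simp)

text \<open>The set \<open>S\<close> is closed so that left limits of the path stay where
  \<open>g\<close> is continuous. For functions of the square root it is the positive semidefinite
  cone.\<close>

lemma cadlag_compose:
  fixes f :: "real \<Rightarrow> 'b::t2_space" and g :: "'b \<Rightarrow> 'c::t2_space"
  assumes f: "cadlag f" and S: "closed S" "\<And>s. 0 \<le> s \<Longrightarrow> f s \<in> S" and g: "continuous_on S g"
  shows cadlag_comp: "cadlag (\<lambda>t. g (f t))"
    and left_limit_comp: "0 \<le> t \<Longrightarrow> left_limit (\<lambda>t. g (f t)) t = g (left_limit f t)"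
proof -
  have left: "((\<lambda>t. g (f t)) \<longlongrightarrow> g (left_limit f t)) (at_left t)" if t: "0 < t" for t
    by (rule continuous_on_tendsto_compose[OF g cadlag_left[OF f t]])
       (use t in \<open>auto intro!: left_limit_in_closed[OF f S] eventually_mono[OF eventually_at_left_nonneg[OF t]] S(2)\<close>)
  have right: "((\<lambda>t. g (f t)) \<longlongrightarrow> g (f t)) (at_right t)" if t: "0 \<le> t" for t
    by (rule continuous_on_tendsto_compose[OF g cadlag_right[OF f t]])
       (use t in \<open>auto intro!: S(2) eventually_mono[OF eventually_at_right_less[of t]]\<close>)
  show "cadlag (\<lambda>t. g (f t))" using left right by (auto simp: cadlag_def)
  show "left_limit (\<lambda>t. g (f t)) t = g (left_limit f t)" if "0 \<le> t"
    using that left[of t] by (cases "t = 0") (auto intro: left_limit_eqI)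
qed

lemma cadlag_const: "cadlag (\<lambda>_. c)"
  by (auto simp: cadlag_def)

lemma cadlag_left_sequence:
  fixes f :: "real \<Rightarrow> 'b::t2_space"
  assumes "cadlag f" "0 < t" "s \<longlonglongrightarrow> t" "eventually (\<lambda>n. s n < t) sequentially"
  shows "(\<lambda>n. f (s n)) \<longlonglongrightarrow> left_limit f t"
  by (rule filterlim_compose[OF cadlag_left[OF assms(1,2)]])
     (use assms(3,4) in \<open>auto simp: filterlim_at elim!: eventually_mono\<close>)

lemma cadlag_right_sequence:
  fixes f :: "real \<Rightarrow> 'b::t2_space"
  assumes "cadlag f" "0 \<le> t" "s \<longlonglongrightarrow> t" "eventually (\<lambda>n. t \<le> s n) sequentially"
  shows "(\<lambda>n. f (s n)) \<longlonglongrightarrow> f t"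
  by (rule continuous_within_tendsto_compose[of t "{t..}" f])
     (use assms cadlag_right[of f t] in \<open>auto simp: continuous_within at_within_Ici_at_right\<close>)

section \<open>Oscillation, boundedness and jumps of cadlag paths\<close>

text \<open>A half-open interval \<open>{y<..z}\<close> avoids \<open>x\<close> exactly when
  \<open>y\<close> and \<open>z\<close> lie on the same side of \<open>x\<close>, where
  \<open>x\<close> itself counts to the right. On the right both values are close to
  \<open>f x\<close>, on the left to the left limit.\<close>

lemma cadlag_local:
  fixes f :: "real \<Rightarrow> 'b::real_normed_vector"
  assumes f: "cadlag f" and x: "0 \<le> x" and e: "0 < e"
  shows "\<exists>d>0. \<forall>y z. 0 \<le> y \<and> y \<le> z \<and> x - d < y \<and> z < x + d \<and> x \<notin> {y<..z} \<longrightarrow> norm (f z - f y) < e"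
proof -
  have e2: "0 < e / 2" using e by simp
  have "eventually (\<lambda>y. dist (f y) (f x) < e / 2) (at_right x)"
    using tendstoD[OF cadlag_right[OF f x] e2] .
  then obtain b where b: "b > x" "\<And>y. x < y \<Longrightarrow> y < b \<Longrightarrow> dist (f y) (f x) < e / 2"
    by (auto simp: eventually_at_right_field)
  obtain a where a: "a < x" "\<And>y. a < y \<Longrightarrow> y < x \<Longrightarrow> 0 \<le> y \<Longrightarrow> dist (f y) (left_limit f x) < e / 2"
  proof (cases "x = 0")
    case True
    \<comment> \<open>No nonnegative time lies to the left of 0, so any negative \<open>a\<close>
      serves.\<close>
    then show ?thesis using that[of "-1"] by auto
  next
    case False
    with x have "eventually (\<lambda>y. dist (f y) (left_limit f x) < e / 2) (at_left x)"
      using tendstoD[OF cadlag_left[OF f] e2] by simp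
    then show ?thesis using that by (auto simp: eventually_at_left_field)
  qed
  have "norm (f z - f y) < e"
    if "0 \<le> y" "y \<le> z" "x - min (x - a) (b - x) < y" "z < x + min (x - a) (b - x)" "x \<notin> {y<..z}" for y z
  proof (cases "z < x")
    case True
    then have "dist (f y) (left_limit f x) < e / 2" "dist (f z) (left_limit f x) < e / 2"
      using that by (intro a(2); auto)+
    then show ?thesis by (metis dist_norm dist_triangle_half_l dist_commute)
  next
    case False
    then have "dist (f w) (f x) < e / 2" if "w = y \<or> w = z" for w
      using that \<open>0 \<le> y\<close> \<open>y \<le> z\<close> \<open>x \<notin> {y<..z}\<close> \<open>z < x + _\<close> e b(2)[of w] by (cases "w = x") auto
    then have "dist (f y) (f x) < e / 2" "dist (f z) (f x) < e / 2" by blast+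
    then show ?thesis by (metis dist_norm dist_triangle_half_l dist_commute)
  qed
  then show ?thesis using a(1) b(1) by (intro exI[of _ "min (x - a) (b - x)"]) auto
qed

text \<open>The substitute for uniform continuity: apart from intervals that meet a finite set of
  times, short intervals carry small increments. Bolzano's bisection principle takes the place of a
  compactness argument.\<close>

lemma cadlag_finite_oscillation:
  fixes f :: "real \<Rightarrow> 'b::real_normed_vector"
  assumes f: "cadlag f" and a: "0 \<le> a" "a \<le> b" and e: "0 < e"
  obtains X d where "finite X" "X \<subseteq> {a<..b}" "d > 0"
    "\<And>y z. a \<le> y \<Longrightarrow> y \<le> z \<Longrightarrow> z \<le> b \<Longrightarrow> z - y < d \<Longrightarrow> X \<inter> {y<..z} = {} \<Longrightarrow> norm (f z - f y) < e"
proof -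
  define Q where "Q a b X d \<longleftrightarrow> finite X \<and> d > 0 \<and>
    (\<forall>y z. a \<le> y \<and> y \<le> z \<and> z \<le> b \<and> z - y < d \<and> X \<inter> {y<..z} = {} \<longrightarrow> norm (f z - f y) < e)" for a b X and d :: real
  define P where "P a b \<longleftrightarrow> (0 \<le> a \<longrightarrow> (\<exists>X d. Q a b X d))" for a b
  have QD: "norm (f z - f y) < e"
    if "Q a b X d" "a \<le> y" "y \<le> z" "z \<le> b" "z - y < d" "X \<inter> {y<..z} = {}" for a b X d y z
    using that unfolding Q_def by blast
  have "P a b" using a(2)
  proof (induction rule: Bolzano)
    case (trans a b c)
    show ?case unfolding P_def
    proof
      assume "0 \<le> a"
      then obtain X c1 Y c2 where 1: "Q a b X c1" and 2: "Q b c Y c2"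
        using trans by (auto simp: P_def)
      \<comment> \<open>With \<open>b\<close> among the exceptional points, an admissible interval
        cannot straddle the joint of the two pieces.\<close>
      have "Q a c (insert b (X \<union> Y)) (min c1 c2)"
        unfolding Q_def
      proof (intro conjI allI impI, goal_cases)
        case (3 y z)
        show ?case
        proof (cases "z \<le> b")
          case True
          with 3 show ?thesis by (intro QD[OF 1]) auto
        next
          case False
          with 3 have "b \<le> y" by auto
          with 3 show ?thesis by (intro QD[OF 2]) auto
        qed
      qed (use 1 2 in \<open>simp_all add: Q_def\<close>)
      then show "\<exists>X d. Q a c X d" by blast
    qed
  next
    case (local x)
    with a(1) have "0 \<le> x" by simp
    from cadlag_local[OF f this e] obtain d where d: "d > 0"
      "\<And>y z. 0 \<le> y \<Longrightarrow> y \<le> z \<Longrightarrow> x - d < y \<Longrightarrow> z < x + d \<Longrightarrow> x \<notin> {y<..z} \<Longrightarrow> norm (f z - f y) < e" by blast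
    have "P a b" if "a \<le> x \<and> x \<le> b \<and> b - a < d" for a b
    proof -
      have "Q a b {x} d" if "0 \<le> a"
        unfolding Q_def
      proof (intro conjI allI impI, goal_cases)
        case (3 y z)
        then show ?case
          using that \<open>a \<le> x \<and> x \<le> b \<and> b - a < d\<close> by (intro d(2)) auto
      qed (use d(1) in auto)
      then show ?thesis unfolding P_def by blast
    qed
    with d(1) show ?case by blast
  qed
  then obtain X d where Q: "Q a b X d" using a by (auto simp: P_def)
  show ?thesis
  proof (rule that[of "X \<inter> {a<..b}" d])
    show "norm (f z - f y) < e"
      if "a \<le> y" "y \<le> z" "z \<le> b" "z - y < d" "X \<inter> {a<..b} \<inter> {y<..z} = {}" for y z
    proof -
      have "X \<inter> {y<..z} = {}" using that by auto
      then show ?thesis using that by (intro QD[OF Q]) auto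
    qed
  qed (use Q in \<open>simp_all add: Q_def\<close>)
qed

text \<open>The jump at \<open>r\<close> is the limit of increments over \<open>{y<..r}\<close> as
  \<open>y\<close> approaches \<open>r\<close> from the left, and these intervals eventually avoid
  the finite set \<open>X\<close>.\<close>

lemma cadlag_small_jump:
  fixes f :: "real \<Rightarrow> 'b::real_normed_vector"
  assumes f: "cadlag f" and "0 \<le> a" and X: "finite X" and d: "d > 0" and r: "r \<in> {a<..b} - X"
    and small: "\<And>y z. a \<le> y \<Longrightarrow> y \<le> z \<Longrightarrow> z \<le> b \<Longrightarrow> z - y < d \<Longrightarrow> X \<inter> {y<..z} = {} \<Longrightarrow> norm (f z - f y) < e"
  shows "norm (jump f r) \<le> e"
proof -
  have "0 < r" using r \<open>0 \<le> a\<close> by auto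
  obtain c where c: "c > 0" "\<forall>x\<in>X. x \<noteq> r \<longrightarrow> c \<le> dist r x"
    using finite_set_avoid[OF X] by blast
  \<comment> \<open>Beyond \<open>?l\<close> the point \<open>y\<close> stays in the interval,
    within \<open>d\<close> of \<open>r\<close>, and closer to \<open>r\<close> than every other
    point of \<open>X\<close>.\<close>
  let ?l = "Max {a, r - d, r - c}"
  have "?l < r" using r d c by auto
  then have "eventually (\<lambda>y. y \<in> {?l<..<r}) (at_left r)" by (rule eventually_at_left_real)
  then have "eventually (\<lambda>y. norm (f r - f y) \<le> e) (at_left r)"
  proof eventually_elim
    case (elim y)
    have "X \<inter> {y<..r} = {}" using c r elim by (fastforce simp: dist_real_def)
    then show ?case using elim r by (intro less_imp_le[OF small]) auto
  qed
  moreover have "((\<lambda>y. norm (f r - f y)) \<longlongrightarrow> norm (f r - left_limit f r)) (at_left r)"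
    by (intro tendsto_intros cadlag_left f \<open>0 < r\<close>)
  ultimately show ?thesis
    unfolding jump_def by (intro tendsto_upperbound[where F = "at_left r"]) auto
qed

text \<open>Boundedness passes from two adjacent intervals to their union, so bisection applies
  again. One constant serves values and left limits, since both occur as integrands.\<close>

lemma cadlag_bounded:
  fixes f :: "real \<Rightarrow> 'b::real_normed_vector"
  assumes f: "cadlag f"
  obtains K where "\<And>s. 0 \<le> s \<Longrightarrow> s \<le> T \<Longrightarrow> norm (f s) \<le> K"
    "\<And>s. 0 \<le> s \<Longrightarrow> s \<le> T \<Longrightarrow> norm (left_limit f s) \<le> K"
proof (cases "0 \<le> T")
  case T: True
  have "\<exists>K. \<forall>s\<in>{0..T}. norm (f s) \<le> K"
  proof -
    define P where "P a b \<longleftrightarrow> (\<exists>K. \<forall>s\<in>{a..b}. 0 \<le> s \<longrightarrow> norm (f s) \<le> K)" for a b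
    have "P 0 T" using T
    proof (induction rule: Bolzano)
      case (trans a b c)
      then obtain K1 K2 where "\<forall>s\<in>{a..b}. 0 \<le> s \<longrightarrow> norm (f s) \<le> K1" "\<forall>s\<in>{b..c}. 0 \<le> s \<longrightarrow> norm (f s) \<le> K2"
        by (auto simp: P_def)
      then have "\<forall>s\<in>{a..c}. 0 \<le> s \<longrightarrow> norm (f s) \<le> max K1 K2"
        by (metis atLeastAtMost_iff le_max_iff_disj linear)
      then show ?case unfolding P_def by blast
    next
      case (local x)
      from cadlag_local[OF f local(1) zero_less_one] obtain d where d: "d > 0"
        "\<And>y z. 0 \<le> y \<Longrightarrow> y \<le> z \<Longrightarrow> x - d < y \<Longrightarrow> z < x + d \<Longrightarrow> x \<notin> {y<..z} \<Longrightarrow> norm (f z - f y) < 1" by blast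
      have "P a b" if ab: "a \<le> x \<and> x \<le> b \<and> b - a < d" for a b
      proof -
        \<comment> \<open>The interval may begin before time 0, where the path is not
          controlled.\<close>
        define c where "c = max a 0"
        have "norm (f s) \<le> max (norm (f c) + 1) (norm (f x) + 1)" if "s \<in> {a..b}" "0 \<le> s" for s
        proof (cases "s < x")
          case True
          then have "norm (f s - f c) < 1" using that ab by (intro d(2)) (auto simp: c_def)
          then show ?thesis using norm_triangle_sub[of "f s" "f c"] by auto
        next
          case False
          then have "norm (f s - f x) < 1" using that ab local by (intro d(2)) auto
          then show ?thesis using norm_triangle_sub[of "f s" "f x"] by auto
        qed
        then show ?thesis unfolding P_def by blast
      qed
      with d(1) show ?case by blast
    qed
    then show ?thesis by (auto simp: P_def)
  qed
  then obtain K where K: "\<And>s. 0 \<le> s \<Longrightarrow> s \<le> T \<Longrightarrow> norm (f s) \<le> K" by (meson atLeastAtMost_iff)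
  have "norm (left_limit f s) \<le> K" if "0 \<le> s" "s \<le> T" for s
  proof (cases "s = 0")
    case True
    with K[of s] that show ?thesis by simp
  next
    case False
    with that have s: "0 < s" by simp
    have "eventually (\<lambda>r. norm (f r) \<le> K) (at_left s)"
      using eventually_at_left_real[OF s] by eventually_elim (use that in \<open>auto intro!: K\<close>)
    with tendsto_norm[OF cadlag_left[OF f s]] show ?thesis
      by (rule tendsto_upperbound) simp
  qed
  with K that show ?thesis by blast
qed (auto intro: that[of 0])

text \<open>Up to time \<open>n\<close> all jumps larger than 1 / (n + 1) lie in the finite set of
  the oscillation lemma, and every nonzero jump is caught for some \<open>n\<close>.\<close>

lemma countable_jumps:
  fixes f :: "real \<Rightarrow> 'b::real_normed_vector"
  assumes f: "cadlag f"
  shows "countable {r. 0 \<le> r \<and> jump f r \<noteq> 0}"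
proof -
  have "\<exists>X. finite X \<and> (\<forall>r. 0 < r \<and> r \<le> real n \<and> r \<notin> X \<longrightarrow> norm (jump f r) \<le> 1 / real (Suc n))" for n
  proof -
    have pos: "0 < 1 / real (Suc n)" by simp
    obtain X d where X: "finite X" "d > 0"
      "\<And>y z. 0 \<le> y \<Longrightarrow> y \<le> z \<Longrightarrow> z \<le> real n \<Longrightarrow> z - y < d \<Longrightarrow> X \<inter> {y<..z} = {} \<Longrightarrow> norm (f z - f y) < 1 / real (Suc n)"
      by (rule cadlag_finite_oscillation[OF f order.refl of_nat_0_le_iff[of n] pos]) (rule that)
    have "norm (jump f r) \<le> 1 / real (Suc n)" if "0 < r" "r \<le> real n" "r \<notin> X" for r
      by (rule cadlag_small_jump[OF f order.refl X(1,2) _ X(3)]) (use that in auto)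
    with X(1) show ?thesis by blast
  qed
  then have "\<forall>n. \<exists>X. finite X \<and> (\<forall>r. 0 < r \<and> r \<le> real n \<and> r \<notin> X \<longrightarrow> norm (jump f r) \<le> 1 / real (Suc n))"
    by blast
  from choice[OF this] obtain X where X: "\<And>n. finite (X n)"
    "\<And>n r. 0 < r \<Longrightarrow> r \<le> real n \<Longrightarrow> r \<notin> X n \<Longrightarrow> norm (jump f r) \<le> 1 / real (Suc n)" by blast
  have sub: "r \<in> (\<Union>n. X n)" if r: "0 \<le> r" "jump f r \<noteq> 0" for r
  proof (rule ccontr)
    assume notin: "r \<notin> (\<Union>n. X n)"
    have "0 < r" using r by (cases "r = 0") auto
    obtain n where n: "1 / real (Suc n) < norm (jump f r)"
      by (rule nat_approx_posE[of "norm (jump f r)"]) (use r in auto)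
    obtain m where "r \<le> real m" using real_arch_simple by blast
    then have "norm (jump f r) \<le> 1 / real (Suc (max m n))"
      using notin \<open>0 < r\<close> by (intro X) auto
    also have "\<dots> \<le> 1 / real (Suc n)" by (intro divide_left_mono) auto
    finally show False using n by simp
  qed
  show ?thesis
    by (rule countable_subset[of _ "\<Union>n. X n"]) (use sub X(1) in \<open>auto intro: countable_finite\<close>)
qed

text \<open>\<open>cell u t N r\<close> is the index \<open>i < N\<close> with \<open>r \<in> (grid u t N i, grid u t N (i + 1)]\<close>, for \<open>r \<in> (u, t]\<close>.\<close>

definition grid :: "real \<Rightarrow> real \<Rightarrow> nat \<Rightarrow> nat \<Rightarrow> real" where
  "grid u t N i = u + real i * (t - u) / real N"

definition cell :: "real \<Rightarrow> real \<Rightarrow> nat \<Rightarrow> real \<Rightarrow> nat" where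
  "cell u t N r = nat (\<lceil>(r - u) * real N / (t - u)\<rceil> - 1)"

lemma grid_0 [simp]: "grid u t N 0 = u" and grid_N [simp]: "N > 0 \<Longrightarrow> grid u t N N = t"
  by (simp_all add: grid_def)

lemma grid_Suc: "grid u t N (Suc i) = grid u t N i + (t - u) / real N"
  by (simp add: grid_def add_divide_distrib distrib_right)

lemma grid_mono: "u \<le> t \<Longrightarrow> i \<le> j \<Longrightarrow> grid u t N i \<le> grid u t N j"
  by (auto simp: grid_def intro!: divide_right_mono mult_right_mono)

lemma grid_ge: "u \<le> t \<Longrightarrow> u \<le> grid u t N i"
  by (simp add: grid_def)

lemma grid_le: "u \<le> t \<Longrightarrow> i \<le> N \<Longrightarrow> grid u t N i \<le> t"
  using grid_mono[of u t i N N] by (cases "N = 0") (auto simp: grid_def)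

lemma cell_bounds:
  assumes "u < r" "r \<le> t" "N > 0"
  shows cell_less: "cell u t N r < N"
    and grid_cell_less: "grid u t N (cell u t N r) < r"
    and le_grid_cell: "r \<le> grid u t N (Suc (cell u t N r))"
proof -
  define y where "y = (r - u) * real N / (t - u)"
  have y: "0 < y" "y \<le> real N"
    using assms mult_right_mono[of "r - u" "t - u" "real N"] by (auto simp: y_def divide_le_eq mult.commute)
  then have c: "\<lceil>y\<rceil> \<ge> 1" "\<lceil>y\<rceil> \<le> int N" by (simp_all add: ceiling_le_iff one_le_ceiling)
  then have n: "real (cell u t N r) = of_int \<lceil>y\<rceil> - 1" by (simp add: cell_def y_def)
  show "cell u t N r < N" using c by (auto simp: cell_def y_def[symmetric] nat_less_iff)
  have 1: "real (cell u t N r) < y" "y \<le> real (cell u t N r) + 1"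
    unfolding n by linarith+
  have e: "y * ((t - u) / real N) = r - u" using assms by (simp add: y_def)
  have "real (cell u t N r) * ((t - u) / real N) < y * ((t - u) / real N)"
    using 1 assms by (intro mult_strict_right_mono) auto
  then show "grid u t N (cell u t N r) < r" unfolding e by (simp add: grid_def)
  have "y * ((t - u) / real N) \<le> (real (cell u t N r) + 1) * ((t - u) / real N)"
    using 1 assms by (intro mult_right_mono) auto
  then show "r \<le> grid u t N (Suc (cell u t N r))" unfolding e by (simp add: grid_def add.commute)
qed

lemma cell_unique:
  assumes "u < t" "N > 0" "r \<in> {grid u t N i<..grid u t N (Suc i)}"
  shows "i = cell u t N r"
proof -
  have "real i * (t - u) / real N < r - u" "r - u \<le> (real i + 1) * (t - u) / real N"
    using assms(3) by (auto simp: grid_def add.commute)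
  then have "real i * (t - u) < (r - u) * real N" "(r - u) * real N \<le> (real i + 1) * (t - u)"
    using assms(2) by (simp_all add: pos_divide_less_eq pos_le_divide_eq)
  then have "real i < (r - u) * real N / (t - u)" "(r - u) * real N / (t - u) \<le> real i + 1"
    using assms(1) by (simp_all add: pos_less_divide_eq pos_divide_le_eq)
  then have "\<lceil>(r - u) * real N / (t - u)\<rceil> = int i + 1" by (intro ceiling_unique) auto
  then show ?thesis by (simp add: cell_def)
qed

lemma grid_cell_tendsto:
  assumes "u < r" "r \<le> t"
  shows "(\<lambda>N. grid u t N (cell u t N r)) \<longlonglongrightarrow> r" "(\<lambda>N. grid u t N (Suc (cell u t N r))) \<longlonglongrightarrow> r"
proof -
  have l: "(\<lambda>N. r - (t - u) / real N) \<longlonglongrightarrow> r - 0" "(\<lambda>N. r + (t - u) / real N) \<longlonglongrightarrow> r + 0"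
    by (intro tendsto_intros lim_const_over_n)+
  have ev: "eventually (\<lambda>N. N > (0::nat)) sequentially" by (rule eventually_gt_at_top)
  have b: "eventually (\<lambda>N. r - (t - u) / real N \<le> grid u t N (cell u t N r) \<and> grid u t N (cell u t N r) \<le> r \<and>
      r \<le> grid u t N (Suc (cell u t N r)) \<and> grid u t N (Suc (cell u t N r)) \<le> r + (t - u) / real N) sequentially"
    using ev
  proof eventually_elim
    case (elim N)
    from grid_cell_less[OF assms elim] le_grid_cell[OF assms elim] show ?case
      unfolding grid_Suc by linarith
  qed
  show "(\<lambda>N. grid u t N (cell u t N r)) \<longlonglongrightarrow> r"
    by (rule tendsto_sandwich[OF _ _ l(1)[unfolded diff_0_right] tendsto_const]) (rule eventually_mono[OF b], blast)+
  show "(\<lambda>N. grid u t N (Suc (cell u t N r))) \<longlonglongrightarrow> r"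
    by (rule tendsto_sandwich[OF _ _ tendsto_const l(2)[unfolded add_0_right]]) (rule eventually_mono[OF b], blast)+
qed

text \<open>The path is sampled at the left end of half-open cells. The weight on a cell is then
  known before the increment over that cell, and the limit for fine grids is the left limit of the
  path.\<close>

definition step_fun :: "(real \<Rightarrow> real) \<Rightarrow> real \<Rightarrow> real \<Rightarrow> nat \<Rightarrow> real \<Rightarrow> real" where
  "step_fun f u t N r = (\<Sum>i<N. f (grid u t N i) * indicator {grid u t N i<..grid u t N (Suc i)} r)"

lemma step_fun_eq:
  assumes "u < r" "r \<le> t" "N > 0"
  shows "step_fun f u t N r = f (grid u t N (cell u t N r))"
proof -
  have "step_fun f u t N r = (\<Sum>i<N. if i = cell u t N r then f (grid u t N i) else 0)"
    unfolding step_fun_def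
  proof (intro sum.cong refl)
    fix i
    show "f (grid u t N i) * indicator {grid u t N i<..grid u t N (Suc i)} r = (if i = cell u t N r then f (grid u t N i) else 0)"
    proof (cases "i = cell u t N r")
      case True
      then show ?thesis using grid_cell_less[OF assms] le_grid_cell[OF assms] by simp
    next
      case False
      then have "r \<notin> {grid u t N i<..grid u t N (Suc i)}"
        using cell_unique[of u t N r i] assms by fastforce
      with False show ?thesis by simp
    qed
  qed
  then show ?thesis using cell_less[OF assms] by simp
qed

lemma step_fun_outside: "u \<le> t \<Longrightarrow> r \<notin> {u<..t} \<Longrightarrow> step_fun f u t N r = 0"
proof -
  assume r: "u \<le> t" "r \<notin> {u<..t}"
  have "r \<notin> {grid u t N i<..grid u t N (Suc i)}" if "i < N" for i
    using r grid_ge[OF r(1), of N i] grid_le[OF r(1), of "Suc i" N] that by auto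
  then show ?thesis unfolding step_fun_def by (intro sum.neutral) auto
qed

lemma step_fun_bound:
  assumes "u \<le> t" "\<And>s. u \<le> s \<Longrightarrow> s \<le> t \<Longrightarrow> \<bar>f s\<bar> \<le> K"
  shows "\<bar>step_fun f u t N r\<bar> \<le> K * indicator {u<..t} r"
proof (cases "r \<in> {u<..t} \<and> N > 0")
  case True
  then have "cell u t N r \<le> N" using cell_less[of u r t N] by auto
  with True show ?thesis
    using assms by (auto simp: step_fun_eq intro!: assms grid_ge grid_le)
next
  case False
  have "0 \<le> K" using assms(2)[of u] assms(1) by auto
  then show ?thesis using False step_fun_outside[OF assms(1)] by (cases "N = 0") (auto simp: step_fun_def)
qed

lemma step_fun_tendsto:
  assumes f: "cadlag f" and u: "0 \<le> u" "u \<le> t"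
  shows "(\<lambda>N. step_fun f u t N r) \<longlonglongrightarrow> left_limit f r * indicator {u<..t} r"
proof (cases "r \<in> {u<..t}")
  case True
  have ev: "eventually (\<lambda>N. N > (0::nat)) sequentially" by (rule eventually_gt_at_top)
  have "(\<lambda>N. f (grid u t N (cell u t N r))) \<longlonglongrightarrow> left_limit f r"
    using True u by (intro cadlag_left_sequence f grid_cell_tendsto)
      (auto intro!: eventually_mono[OF ev] grid_cell_less)
  moreover have "eventually (\<lambda>N. f (grid u t N (cell u t N r)) = step_fun f u t N r) sequentially"
    using ev by eventually_elim (use True in \<open>auto simp: step_fun_eq\<close>)
  ultimately show ?thesis using True by (simp add: tendsto_cong)
next
  case False
  with u show ?thesis by (simp add: step_fun_outside)
qed

text \<open>Once the mesh is below \<open>d\<close>, a cell that contains no point of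
  \<open>X\<close> has an increment of norm less than \<open>e\<close> and contributes 0, while the
  increment over the cell of a point of \<open>X\<close> tends to the jump there. All but a fixed
  finite number of terms disappear.\<close>

lemma cadlag_grid_sum_tendsto:
  fixes f :: "real \<Rightarrow> 'b::real_normed_vector" and \<phi> :: "'b \<Rightarrow> real"
  assumes f: "cadlag f" and u: "0 \<le> u" "u \<le> t" and e: "e > 0"
    and \<phi>: "continuous_on UNIV \<phi>" "\<And>x. norm x \<le> e \<Longrightarrow> \<phi> x = 0"
  obtains X where "finite X" "X \<subseteq> {u<..t}" "\<And>r. r \<in> {u<..t} - X \<Longrightarrow> \<phi> (jump f r) = 0"
    "(\<lambda>N. \<Sum>i<N. \<phi> (f (grid u t N (Suc i)) - f (grid u t N i))) \<longlonglongrightarrow> (\<Sum>r\<in>X. \<phi> (jump f r))"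
proof -
  obtain X d where X: "finite X" "X \<subseteq> {u<..t}" "d > 0"
      "\<And>y z. u \<le> y \<Longrightarrow> y \<le> z \<Longrightarrow> z \<le> t \<Longrightarrow> z - y < d \<Longrightarrow> X \<inter> {y<..z} = {} \<Longrightarrow> norm (f z - f y) < e"
    by (rule cadlag_finite_oscillation[OF f u e]) (rule that)
  have zero: "\<phi> (jump f r) = 0" if "r \<in> {u<..t} - X" for r
    by (rule \<phi>(2), rule cadlag_small_jump[OF f u(1) X(1,3) that]) (rule X(4))
  let ?g = "\<lambda>N i. grid u t N i" and ?c = "\<lambda>N r. cell u t N r"
  have ev0: "eventually (\<lambda>N. N > (0::nat)) sequentially" by (rule eventually_gt_at_top)
  have lim: "(\<lambda>N. \<phi> (f (?g N (Suc (?c N r))) - f (?g N (?c N r)))) \<longlonglongrightarrow> \<phi> (jump f r)" if r: "r \<in> X" for r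
  proof -
    have r: "u < r" "r \<le> t" using r X(2) by auto
    have "(\<lambda>N. f (?g N (Suc (?c N r))) - f (?g N (?c N r))) \<longlonglongrightarrow> f r - left_limit f r"
      using u r by (intro tendsto_diff cadlag_left_sequence[OF f] cadlag_right_sequence[OF f] grid_cell_tendsto)
       (auto intro!: eventually_mono[OF ev0] grid_cell_less le_grid_cell)
    then show ?thesis unfolding jump_def
      by (intro continuous_on_tendsto_compose[OF \<phi>(1)]) auto
  qed
  \<comment> \<open>Distinct points of \<open>X\<close> eventually lie in distinct cells, because
    the midpoint of two such points separates the cells around them.\<close>
  have inj: "eventually (\<lambda>N. inj_on (?c N) X) sequentially"
  proof -
    have "eventually (\<lambda>N. ?c N x \<noteq> ?c N y) sequentially" if "x \<in> X" "y \<in> X" "x < y" for x y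
    proof -
      have "eventually (\<lambda>N. ?g N (Suc (?c N x)) < (x + y) / 2) sequentially"
        by (rule order_tendstoD(2)[OF grid_cell_tendsto(2)]) (use that X(2) in auto)
      moreover have "eventually (\<lambda>N. ?g N (?c N y) > (x + y) / 2) sequentially"
        by (rule order_tendstoD(1)[OF grid_cell_tendsto(1)]) (use that X(2) in auto)
      ultimately show ?thesis
      proof eventually_elim
        case (elim N)
        show ?case
        proof
          assume "?c N x = ?c N y"
          with elim grid_mono[OF u(2), of "?c N y" "Suc (?c N y)" N] show False by simp
        qed
      qed
    qed
    then have "eventually (\<lambda>N. x < y \<longrightarrow> ?c N x \<noteq> ?c N y) sequentially" if "x \<in> X" "y \<in> X" for x y
      using that by (cases "x < y") simp_all
    then have "eventually (\<lambda>N. \<forall>x\<in>X. \<forall>y\<in>X. x < y \<longrightarrow> ?c N x \<noteq> ?c N y) sequentially"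
      by (intro eventually_ball_finite X(1) ballI) simp
    then show ?thesis
    proof eventually_elim
      case (elim N)
      show ?case
      proof (rule inj_onI)
        fix x y assume "x \<in> X" "y \<in> X" "?c N x = ?c N y"
        with elim have "\<not> x < y" "\<not> y < x" by metis+
        then show "x = y" by simp
      qed
    qed
  qed
  have mesh: "eventually (\<lambda>N. (t - u) / real N < d) sequentially"
    using order_tendstoD(2)[OF lim_const_over_n[of "t - u"] X(3)] .
  have eq: "eventually (\<lambda>N. (\<Sum>r\<in>X. \<phi> (f (?g N (Suc (?c N r))) - f (?g N (?c N r)))) =
      (\<Sum>i<N. \<phi> (f (?g N (Suc i)) - f (?g N i)))) sequentially"
    using inj mesh ev0
  proof eventually_elim
    case (elim N)
    have sub: "?c N ` X \<subseteq> {..<N}" using X(2) elim by (auto intro!: cell_less)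
    have "\<phi> (f (?g N (Suc i)) - f (?g N i)) = 0" if i: "i \<in> {..<N} - ?c N ` X" for i
    proof -
      have "X \<inter> {?g N i<..?g N (Suc i)} = {}"
      proof (rule ccontr)
        assume "X \<inter> {?g N i<..?g N (Suc i)} \<noteq> {}"
        then obtain r where r: "r \<in> X" "r \<in> {?g N i<..?g N (Suc i)}" by blast
        then have "u < t" using X(2) by auto
        then have "i = ?c N r" using elim r by (intro cell_unique) auto
        with r i show False by auto
      qed
      then have "norm (f (?g N (Suc i)) - f (?g N i)) < e"
        using i u elim by (intro X(4) grid_ge grid_le grid_mono) (auto simp: grid_Suc)
      then show ?thesis by (intro \<phi>) simp
    qed
    then have "(\<Sum>i<N. \<phi> (f (?g N (Suc i)) - f (?g N i))) = (\<Sum>i\<in>?c N ` X. \<phi> (f (?g N (Suc i)) - f (?g N i)))"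
      by (intro sum.mono_neutral_right sub) auto
    then show ?case by (simp add: sum.reindex elim)
  qed
  have "(\<lambda>N. \<Sum>r\<in>X. \<phi> (f (?g N (Suc (?c N r))) - f (?g N (?c N r)))) \<longlonglongrightarrow> (\<Sum>r\<in>X. \<phi> (jump f r))"
    by (intro tendsto_sum lim)
  then have "(\<lambda>N. \<Sum>i<N. \<phi> (f (grid u t N (Suc i)) - f (grid u t N i))) \<longlonglongrightarrow> (\<Sum>r\<in>X. \<phi> (jump f r))"
    by (rule Lim_transform_eventually[OF _ eq])
  from X(1,2) zero this show ?thesis by (rule that[of X])
qed

section \<open>Lebesgue-Stieltjes integrals against pure jump functions\<close>

text \<open>Differences of Stieltjes measures are compared in the form of equal sums of measures,
  which avoids signed measures and differences of infinite values.\<close>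

lemma nn_integral_add_measures_eq:
  assumes S: "sets M2 = sets M1" "sets N1 = sets M1" "sets N2 = sets M1"
    and eq: "\<And>B. B \<in> sets M1 \<Longrightarrow> emeasure M1 B + emeasure M2 B = emeasure N1 B + emeasure N2 B"
    and f: "f \<in> borel_measurable M1"
  shows "(\<integral>\<^sup>+x. f x \<partial>M1) + (\<integral>\<^sup>+x. f x \<partial>M2) = (\<integral>\<^sup>+x. f x \<partial>N1) + (\<integral>\<^sup>+x. f x \<partial>N2)"
proof -
  note [measurable_cong] = S
  have sp: "space M2 = space M1" "space N1 = space M1" "space N2 = space M1"
    using S by (auto dest: sets_eq_imp_space_eq)
  show ?thesis using f
  proof (induction rule: borel_measurable_induct)
    case (cong f g)
    then have "integral\<^sup>N K f = integral\<^sup>N K g" if "K \<in> {M1, M2, N1, N2}" for K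
      using that sp by (auto intro!: nn_integral_cong)
    then show ?case using cong by simp
  next
    case (set A)
    then show ?case using S eq by simp
  next
    case (mult u c)
    then show ?case by (simp add: nn_integral_cmult distrib_left[symmetric])
  next
    case (add u v)
    then show ?case by (simp add: nn_integral_add add_ac)
  next
    case (seq U)
    have m: "\<And>i. U i \<in> borel_measurable M2" "\<And>i. U i \<in> borel_measurable N1" "\<And>i. U i \<in> borel_measurable N2"
      using seq(1) by measurable
    have U: "incseq U" using seq by blast
    have inc: "incseq (\<lambda>i. integral\<^sup>N K (U i))" for K
      using U by (auto simp: incseq_def le_fun_def intro!: nn_integral_mono)
    have SU: "integral\<^sup>N K (\<Squnion>i. U i) = (\<Squnion>i. integral\<^sup>N K (U i))" if "\<And>i. U i \<in> borel_measurable K" for K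
    proof -
      have "(\<Squnion>i. U i) = (\<lambda>x. \<Squnion>i. U i x)" by (simp add: fun_eq_iff SUP_apply image_comp)
      then show ?thesis using nn_integral_monotone_convergence_SUP[OF U that] by simp
    qed
    show ?case
      unfolding SU[OF seq(1)] SU[OF m(1)] SU[OF m(2)] SU[OF m(3)] ennreal_SUP_add[OF inc inc, symmetric]
      using seq by simp
  qed
qed

lemma integral_add_measures_eq:
  fixes f :: "'a \<Rightarrow> real"
  assumes S: "sets M2 = sets M1" "sets N1 = sets M1" "sets N2 = sets M1"
    and eq: "\<And>B. B \<in> sets M1 \<Longrightarrow> emeasure M1 B + emeasure M2 B = emeasure N1 B + emeasure N2 B"
    and f: "integrable M1 f" "integrable M2 f" "integrable N1 f" "integrable N2 f"
  shows "(\<integral>x. f x \<partial>M1) + (\<integral>x. f x \<partial>M2) = (\<integral>x. f x \<partial>N1) + (\<integral>x. f x \<partial>N2)"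
proof -
  have pos: "(\<integral>x. g x \<partial>M1) + (\<integral>x. g x \<partial>M2) = (\<integral>x. g x \<partial>N1) + (\<integral>x. g x \<partial>N2)"
    if g: "integrable M1 g" "integrable M2 g" "integrable N1 g" "integrable N2 g" "\<And>x. 0 \<le> g x" for g :: "'a \<Rightarrow> real"
  proof -
    have "ennreal ((\<integral>x. g x \<partial>M1) + (\<integral>x. g x \<partial>M2)) = ennreal ((\<integral>x. g x \<partial>N1) + (\<integral>x. g x \<partial>N2))"
      using nn_integral_add_measures_eq[OF S eq, of "\<lambda>x. ennreal (g x)"] g
      by (simp add: nn_integral_eq_integral)
    then show ?thesis using g(5) by (subst (asm) ennreal_inj) (auto intro!: add_nonneg_nonneg integral_nonneg)
  qed
  have "(\<integral>x. f x \<partial>K) = (\<integral>x. max 0 (f x) \<partial>K) - (\<integral>x. max 0 (- f x) \<partial>K)" if "integrable K f" for K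
  proof -
    have "(\<integral>x. f x \<partial>K) = (\<integral>x. max 0 (f x) - max 0 (- f x) \<partial>K)" by (intro Bochner_Integration.integral_cong) auto
    then show ?thesis using that by simp
  qed
  with pos[of "\<lambda>x. max 0 (f x)"] pos[of "\<lambda>x. max 0 (- f x)"] f show ?thesis by simp
qed

text \<open>Dynkin's argument for sums of two measures, starting from the half-lines. Finite total
  masses allow equality to pass to complements by subtraction.\<close>

lemma add_measures_eq_borelI:
  fixes M1 :: "real measure"
  assumes S: "sets M1 = sets borel" "sets M2 = sets borel" "sets N1 = sets borel" "sets N2 = sets borel"
    and fin: "emeasure M1 UNIV < \<infinity>" "emeasure M2 UNIV < \<infinity>" "emeasure N1 UNIV < \<infinity>" "emeasure N2 UNIV < \<infinity>"
    and tot: "emeasure M1 UNIV + emeasure M2 UNIV = emeasure N1 UNIV + emeasure N2 UNIV"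
    and eq: "\<And>x. emeasure M1 {..x} + emeasure M2 {..x} = emeasure N1 {..x} + emeasure N2 {..x}"
    and B: "B \<in> sets borel"
  shows "emeasure M1 B + emeasure M2 B = emeasure N1 B + emeasure N2 B"
proof -
  have sp: "space M1 = UNIV" "space M2 = UNIV" "space N1 = UNIV" "space N2 = UNIV"
    using S by (metis sets_eq_imp_space_eq space_borel)+
  let ?G = "range (\<lambda>a::real. {..a})"
  have borel: "sets borel = sigma_sets UNIV ?G"
    by (subst borel_eq_atMost) (simp add: sets_measure_of)
  have "Int_stable ?G" by (auto simp: Int_stable_def image_iff)
  then show ?thesis
    using subset_UNIV[of "?G :: real set set", folded Pow_UNIV] B[unfolded borel]
  proof (induction rule: sigma_sets_induct_disjoint)
    case (basic A)
    then show ?case using eq by auto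
  next
    case empty
    then show ?case by simp
  next
    case (compl A)
    then have A: "A \<in> sets borel" by (simp add: borel)
    have c: "emeasure K (UNIV - A) = emeasure K UNIV - emeasure K A" "emeasure K A \<le> emeasure K UNIV"
      if "sets K = sets borel" "space K = UNIV" "emeasure K UNIV < \<infinity>" for K
    proof -
      show 1: "emeasure K A \<le> emeasure K UNIV" using that A by (intro emeasure_mono) auto
      show "emeasure K (UNIV - A) = emeasure K UNIV - emeasure K A"
        using emeasure_compl[of A K] that A order.strict_trans1[OF 1 that(3)] by auto
    qed
    have r: "\<exists>r. x = ennreal r \<and> 0 \<le> r" if "x < \<infinity>" for x :: ennreal
      using that by (cases x) auto
    obtain m1 m2 n1 n2 where u: "emeasure M1 UNIV = ennreal m1" "emeasure M2 UNIV = ennreal m2"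
      "emeasure N1 UNIV = ennreal n1" "emeasure N2 UNIV = ennreal n2" "0 \<le> m1" "0 \<le> m2" "0 \<le> n1" "0 \<le> n2"
      using r[OF fin(1)] r[OF fin(2)] r[OF fin(3)] r[OF fin(4)] by blast
    have fA: "emeasure M1 A < \<infinity>" "emeasure M2 A < \<infinity>" "emeasure N1 A < \<infinity>" "emeasure N2 A < \<infinity>"
      using order.strict_trans1[OF c(2)[OF S(1) sp(1) fin(1)] fin(1)] order.strict_trans1[OF c(2)[OF S(2) sp(2) fin(2)] fin(2)]
        order.strict_trans1[OF c(2)[OF S(3) sp(3) fin(3)] fin(3)] order.strict_trans1[OF c(2)[OF S(4) sp(4) fin(4)] fin(4)] by auto
    obtain a1 a2 b1 b2 where v: "emeasure M1 A = ennreal a1" "emeasure M2 A = ennreal a2"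
      "emeasure N1 A = ennreal b1" "emeasure N2 A = ennreal b2" "0 \<le> a1" "0 \<le> a2" "0 \<le> b1" "0 \<le> b2"
      using r[OF fA(1)] r[OF fA(2)] r[OF fA(3)] r[OF fA(4)] by blast
    have le: "a1 \<le> m1" "a2 \<le> m2" "b1 \<le> n1" "b2 \<le> n2"
      using c(2)[OF S(1) sp(1) fin(1)] c(2)[OF S(2) sp(2) fin(2)] c(2)[OF S(3) sp(3) fin(3)] c(2)[OF S(4) sp(4) fin(4)]
      using u v by simp_all
    have 1: "m1 + m2 = n1 + n2" using tot u by (simp flip: ennreal_plus)
    have 2: "a1 + a2 = b1 + b2" using compl(2) v by (simp flip: ennreal_plus)
    show ?case
      using 1 2 le by (simp add: c S sp fin u v ennreal_minus flip: ennreal_plus)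
  next
    case (union A)
    then have A: "range A \<subseteq> sets borel" by (auto simp: borel)
    have c: "emeasure K (\<Union>i. A i) = (\<Sum>i. emeasure K (A i))" if "sets K = sets borel" for K
      using suminf_emeasure[of A K] that A union(1) by simp
    have ss: "summable (\<lambda>i. emeasure K (A i))" for K :: "real measure" by (rule summableI)
    show ?case
      by (simp add: c S suminf_add[OF ss ss] union)
  qed
qed

text \<open>The identity in \<open>distr\<close> restricts the density of counting measure from all
  subsets to the Borel sets, where it can be compared with Stieltjes measures.\<close>

definition jump_measure :: "(real \<Rightarrow> real) \<Rightarrow> real measure" where
  "jump_measure h = distr (density (count_space UNIV) (\<lambda>r. ennreal (h r))) borel (\<lambda>r. r)"

lemma sets_jump_measure [simp, measurable_cong]: "sets (jump_measure h) = sets borel"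
  and space_jump_measure [simp]: "space (jump_measure h) = UNIV"
  by (simp_all add: jump_measure_def)

lemma emeasure_jump_measure:
  assumes "integrable (count_space UNIV) h" "\<And>r. 0 \<le> h r" "B \<in> sets borel"
  shows "emeasure (jump_measure h) B = ennreal (\<integral>r. h r * indicator B r \<partial>count_space UNIV)"
proof -
  have "emeasure (jump_measure h) B = (\<integral>\<^sup>+r. ennreal (h r * indicator B r) \<partial>count_space UNIV)"
    using assms(3) by (simp add: jump_measure_def emeasure_distr emeasure_density)
      (intro nn_integral_cong, auto split: split_indicator)
  also have "\<dots> = ennreal (\<integral>r. h r * indicator B r \<partial>count_space UNIV)"
    using assms by (intro nn_integral_eq_integral integrable_real_mult_indicator) auto
  finally show ?thesis .
qed

lemma integral_jump_measure:
  fixes F :: "real \<Rightarrow> real"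
  assumes "F \<in> borel_measurable borel" "\<And>r. 0 \<le> h r"
  shows "(\<integral>r. F r \<partial>jump_measure h) = (\<integral>r. h r * F r \<partial>count_space UNIV)"
    "integrable (jump_measure h) F \<longleftrightarrow> integrable (count_space UNIV) (\<lambda>r. h r * F r)"
  using assms unfolding jump_measure_def
  by (simp_all add: integral_distr integrable_distr_eq integral_density integrable_density)

text \<open>The decomposition \<open>p - n\<close> of \<open>g\<close> is arbitrary, so the
  integrals against \<open>p\<close> and \<open>n\<close> need not be sums over jumps one by one.
  But with the weights \<open>h\<close> split into \<open>hp - hn\<close>, the measure of
  \<open>p\<close> plus the jumps \<open>hn\<close> and the measure of \<open>n\<close> plus the
  jumps \<open>hp\<close> agree on half-lines and therefore on all Borel sets. Integrating
  \<open>f\<close> against both sums and rearranging gives the claim.\<close>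

lemma has_LS_integral_pure_jump:
  assumes LS: "has_LS_integral f g a b I" and ab: "a \<le> b"
    and h: "integrable (count_space UNIV) (\<lambda>r. h r * indicator {a<..b} r)"
    and g: "\<And>y. a \<le> y \<Longrightarrow> y \<le> b \<Longrightarrow> g y = g a + (\<integral>r. h r * indicator {a<..y} r \<partial>count_space UNIV)"
    and f: "\<And>r. a < r \<Longrightarrow> r \<le> b \<Longrightarrow> \<bar>f r\<bar> \<le> K"
  shows "I = (\<integral>r. f r * h r * indicator {a<..b} r \<partial>count_space UNIV)"
proof -
  obtain p n where mono: "mono p" "mono n"
    and rc: "\<And>s. continuous (at_right s) p" "\<And>s. continuous (at_right s) n"
    and gpn: "\<And>s. a \<le> s \<Longrightarrow> s \<le> b \<Longrightarrow> g s = p s - n s"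
    and int: "set_integrable (interval_measure p) {a<..b} f" "set_integrable (interval_measure n) {a<..b} f"
    and I: "I = (LINT s:{a<..b}|interval_measure p. f s) - (LINT s:{a<..b}|interval_measure n. f s)"
    using LS unfolding has_LS_integral_def by auto
  define F where "F r = indicator {a<..b} r * f r" for r
  define hp where "hp r = max 0 (h r) * indicator {a<..b} r" for r
  define hn where "hn r = max 0 (- h r) * indicator {a<..b} r" for r
  let ?c = "count_space (UNIV::real set)"
  have hi: "integrable ?c hp" "integrable ?c hn"
    by (rule Bochner_Integration.integrable_bound[OF h]; auto simp: hp_def hn_def split: split_indicator)+
  have nonneg: "0 \<le> hp r" "0 \<le> hn r" and hh: "hp r - hn r = h r * indicator {a<..b} r" for r
    by (auto simp: hp_def hn_def split: split_indicator)
  \<comment> \<open>The Stieltjes measure cut down to \<open>{a<..b}\<close> has finite total mass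
    on the line.\<close>
  define P where "P q = density (interval_measure q) (indicator {a<..b})" for q
  have sP [simp]: "sets (P q) = sets borel" "space (P q) = UNIV" for q by (simp_all add: P_def)
  have eP: "emeasure (P q) B = emeasure (interval_measure q) ({a<..b} \<inter> B)" if "B \<in> sets borel" for q B
  proof -
    have "emeasure (P q) B = (\<integral>\<^sup>+x. indicator ({a<..b} \<inter> B) x \<partial>interval_measure q)"
      using that by (simp add: P_def emeasure_density indicator_inter_arith)
    then show ?thesis using that by simp
  qed
  have eP_le: "emeasure (P q) {..x} = ennreal (q (max a (min x b)) - q a)"
    if "mono q" "\<And>s. continuous (at_right s) q" for q x
  proof -
    have "{a<..b} \<inter> {..x} = {a<..max a (min x b)}" by auto
    then show ?thesis using that
      by (subst eP) (auto intro!: emeasure_interval_measure_Ioc dest: monoD)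
  qed
  have fP: "emeasure (P q) UNIV = ennreal (q b - q a)"
    if "mono q" "\<And>s. continuous (at_right s) q" for q
    using that ab by (subst eP) (auto intro!: emeasure_interval_measure_Ioc dest: monoD)
  have H: "(\<integral>r. hp r * indicator B r \<partial>?c) - (\<integral>r. hn r * indicator B r \<partial>?c) = (\<integral>r. h r * indicator ({a<..b} \<inter> B) r \<partial>?c)" for B
  proof -
    have "(\<integral>r. hp r * indicator B r \<partial>?c) - (\<integral>r. hn r * indicator B r \<partial>?c)
      = (\<integral>r. hp r * indicator B r - hn r * indicator B r \<partial>?c)"
      by (intro Bochner_Integration.integral_diff[symmetric] integrable_real_mult_indicator hi) auto
    also have "\<dots> = (\<integral>r. h r * indicator ({a<..b} \<inter> B) r \<partial>?c)"
      by (intro Bochner_Integration.integral_cong) (auto simp: hp_def hn_def split: split_indicator)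
    finally show ?thesis .
  qed
  \<comment> \<open>The formula for \<open>g\<close>, with every term moved to the side on which it
    is nonnegative.\<close>
  have key: "p y - p a + (\<integral>r. hn r * indicator B r \<partial>?c) = n y - n a + (\<integral>r. hp r * indicator B r \<partial>?c)"
    if "a \<le> y" "y \<le> b" "{a<..b} \<inter> B = {a<..y}" for y B
    using H[of B, unfolded that(3)] g[OF that(1,2)] gpn[OF that(1,2)] gpn[OF order.refl ab] by linarith
  have nn: "0 \<le> (\<integral>r. hp r * indicator B r \<partial>?c)" "0 \<le> (\<integral>r. hn r * indicator B r \<partial>?c)" for B
    using nonneg by (auto intro!: integral_nonneg)
  have le: "emeasure (P p) {..x} + emeasure (jump_measure hn) {..x} = emeasure (P n) {..x} + emeasure (jump_measure hp) {..x}" for x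
  proof -
    have "{a<..b} \<inter> {..x} = {a<..max a (min x b)}" by auto
    from key[OF _ _ this] ab monoD[OF mono(1), of a "max a (min x b)"] monoD[OF mono(2), of a "max a (min x b)"]
    show ?thesis using nn
      by (simp add: eP_le mono rc emeasure_jump_measure hi nonneg flip: ennreal_plus)
  qed
  have UN: "emeasure (P p) UNIV + emeasure (jump_measure hn) UNIV = emeasure (P n) UNIV + emeasure (jump_measure hp) UNIV"
    using key[of b UNIV] ab monoD[OF mono(1), of a b] monoD[OF mono(2), of a b] nn[of UNIV]
    by (simp add: fP mono rc emeasure_jump_measure hi nonneg flip: ennreal_plus)
  \<comment> \<open>Measurability of \<open>f\<close> on the interval is part of its integrability
    against the measure of \<open>p\<close>.\<close>
  have Fm [measurable]: "F \<in> borel_measurable borel"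
    using int(1) unfolding set_integrable_def F_def by (auto dest!: borel_measurable_integrable)
  have Fb: "\<bar>F r\<bar> \<le> \<bar>K\<bar>" for r using f[of r] by (auto simp: F_def split: split_indicator)
  have Fi: "integrable ?c (\<lambda>r. k r * F r)" if "integrable ?c k" for k
    by (rule Bochner_Integration.integrable_bound[OF integrable_mult_left[OF integrable_norm[OF that], of K]])
       (auto simp: abs_mult intro!: mult_left_mono Fb)
  have PF: "integrable (P q) F" "(\<integral>r. F r \<partial>P q) = (LINT s:{a<..b}|interval_measure q. f s)"
    if "set_integrable (interval_measure q) {a<..b} f" for q
  proof -
    have 1: "indicator {a<..b} r * F r = indicator {a<..b} r * f r" for r by (auto simp: F_def split: split_indicator)
    have 2: "(indicator {a<..b} r :: ennreal) = ennreal (indicator {a<..b} r)" for r by (simp split: split_indicator)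
    show "integrable (P q) F" "(\<integral>r. F r \<partial>P q) = (LINT s:{a<..b}|interval_measure q. f s)"
      using that unfolding P_def 2 set_integrable_def set_lebesgue_integral_def
      by (simp_all add: integrable_density integral_density 1)
  qed
  have "(\<integral>r. F r \<partial>P p) + (\<integral>r. F r \<partial>jump_measure hn) = (\<integral>r. F r \<partial>P n) + (\<integral>r. F r \<partial>jump_measure hp)"
  proof (rule integral_add_measures_eq)
    show "emeasure (P p) B + emeasure (jump_measure hn) B = emeasure (P n) B + emeasure (jump_measure hp) B"
      if "B \<in> sets (P p)" for B
      by (rule add_measures_eq_borelI[OF _ _ _ _ _ _ _ _ UN le])
        (use that in \<open>auto simp: fP mono rc emeasure_jump_measure hi nonneg\<close>)
  qed (auto simp: PF int integral_jump_measure nonneg Fi hi)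
  then have "I = (\<integral>r. hp r * F r \<partial>?c) - (\<integral>r. hn r * F r \<partial>?c)"
    by (simp add: I PF int integral_jump_measure nonneg)
  also have "\<dots> = (\<integral>r. hp r * F r - hn r * F r \<partial>?c)"
    by (intro Bochner_Integration.integral_diff[symmetric] Fi hi)
  also have "\<dots> = (\<integral>r. f r * h r * indicator {a<..b} r \<partial>?c)"
    by (intro Bochner_Integration.integral_cong refl, subst left_diff_distrib[symmetric], subst hh)
       (auto simp: F_def split: split_indicator)
  finally show ?thesis .
qed

section \<open>Jump sums of Levy paths\<close>

text \<open>Fatou's lemma gives the lower bound, domination by the limit itself the upper one;
  infinite integrals are allowed.\<close>

lemma nn_integral_tendsto_below:
  fixes f :: "nat \<Rightarrow> 'a \<Rightarrow> ennreal"
  assumes m: "\<And>n. f n \<in> borel_measurable M" and le: "\<And>n. AE x in M. f n x \<le> g x"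
    and lim: "AE x in M. (\<lambda>n. f n x) \<longlonglongrightarrow> g x"
  shows "(\<lambda>n. \<integral>\<^sup>+x. f n x \<partial>M) \<longlonglongrightarrow> (\<integral>\<^sup>+x. g x \<partial>M)"
proof -
  have "(\<integral>\<^sup>+x. g x \<partial>M) = (\<integral>\<^sup>+x. liminf (\<lambda>n. f n x) \<partial>M)"
    using lim by (intro nn_integral_cong_AE) (auto simp: tendsto_iff_Liminf_eq_Limsup)
  also have "\<dots> \<le> liminf (\<lambda>n. \<integral>\<^sup>+x. f n x \<partial>M)" by (intro nn_integral_liminf m)
  finally have 1: "(\<integral>\<^sup>+x. g x \<partial>M) \<le> liminf (\<lambda>n. \<integral>\<^sup>+x. f n x \<partial>M)" .
  have 2: "limsup (\<lambda>n. \<integral>\<^sup>+x. f n x \<partial>M) \<le> (\<integral>\<^sup>+x. g x \<partial>M)"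
    by (rule Limsup_bounded) (auto intro!: always_eventually nn_integral_mono_AE le)
  have 3: "liminf (\<lambda>n. \<integral>\<^sup>+x. f n x \<partial>M) \<le> limsup (\<lambda>n. \<integral>\<^sup>+x. f n x \<partial>M)"
    by (intro Liminf_le_Limsup) simp
  show ?thesis
    using 1 2 3 by (subst tendsto_iff_Liminf_eq_Limsup) (auto intro: antisym order_trans)
qed

text \<open>Cauchy's functional equation. With values in the extended nonnegative reals additivity
  implies monotonicity, and this squeezes \<open>n\<close> times the value at \<open>t\<close>
  between consecutive multiples of the value at 1.\<close>

lemma additive_ennreal_linear:
  fixes c :: "real \<Rightarrow> ennreal"
  assumes add: "\<And>s t. 0 \<le> s \<Longrightarrow> 0 \<le> t \<Longrightarrow> c (s + t) = c s + c t" and fin: "c 1 < \<infinity>" and t: "0 \<le> t"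
  shows "c t = ennreal t * c 1"
proof -
  have mono: "c s \<le> c t" if "0 \<le> s" "s \<le> t" for s t
    using add[of s "t - s"] that by simp
  have c0: "c 0 = 0"
  proof -
    have "c 0 + c 1 = 0 + c 1" using add[of 0 1] by simp
    then show ?thesis using fin by (metis add.commute ennreal_add_left_cancel less_irrefl)
  qed
  have mult: "c (real n * s) = of_nat n * c s" if "0 \<le> s" for n s
    by (induction n) (use that add in \<open>auto simp: c0 distrib_right add.commute\<close>)
  have finite: "c t < \<infinity>" if "0 \<le> t" for t
  proof -
    obtain n where n: "t \<le> real n" using real_arch_simple by blast
    have "c t \<le> c (real n * 1)" using that n by (intro mono) auto
    also have "\<dots> < \<infinity>" using fin by (subst mult) (auto simp: ennreal_mult_less_top of_nat_less_top)
    finally show ?thesis .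
  qed
  define a where "a t = enn2real (c t)" for t
  have c: "c t = ennreal (a t)" if "0 \<le> t" for t
    using finite[OF that] by (simp add: a_def)
  have a0: "0 \<le> a t" for t by (simp add: a_def)
  have amult: "a (real n * s) = real n * a s" if "0 \<le> s" for n s
    using mult[OF that, of n] that a0 by (simp add: c ennreal_of_nat_eq_real_of_nat flip: ennreal_mult)
  have amono: "a s \<le> a t" if "0 \<le> s" "s \<le> t" for s t
    using mono[OF that] that a0 by (simp add: c)
  have bound: "\<bar>a t - t * a 1\<bar> \<le> a 1 / real n" if n: "n > 0" for n
  proof -
    define k where "k = nat \<lfloor>real n * t\<rfloor>"
    have k: "real k \<le> real n * t" "real n * t \<le> real (Suc k)"
      using t by (auto simp: k_def) linarith
    have "real k * a 1 = a (real k * 1)" by (subst amult) auto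
    also have "\<dots> \<le> a (real n * t)" using k by (intro amono) auto
    also have "\<dots> = real n * a t" using t by (rule amult)
    finally have 1: "real k * a 1 \<le> real n * a t" .
    have "real n * a t = a (real n * t)" using t by (rule amult[symmetric])
    also have "\<dots> \<le> a (real (Suc k) * 1)" using k t by (intro amono) auto
    also have "\<dots> = real (Suc k) * a 1" by (subst amult) auto
    finally have 2: "real n * a t \<le> real (Suc k) * a 1" .
    have 3: "real k * a 1 \<le> real n * t * a 1" "real n * t * a 1 \<le> real (Suc k) * a 1"
      using k a0[of 1] by (auto intro: mult_right_mono)
    have "\<bar>real n * a t - real n * t * a 1\<bar> \<le> a 1" using 1 2 3 by (simp add: distrib_right abs_le_iff)
    moreover have "real n * \<bar>a t - t * a 1\<bar> = \<bar>real n * (a t - t * a 1)\<bar>" by (simp add: abs_mult)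
    ultimately have "real n * \<bar>a t - t * a 1\<bar> \<le> a 1" by (simp add: right_diff_distrib mult.assoc)
    then show ?thesis using n by (simp add: pos_le_divide_eq mult.commute)
  qed
  have "\<bar>a t - t * a 1\<bar> \<le> 0"
  proof (rule tendsto_lowerbound[OF lim_const_over_n[of "a 1"]])
    show "\<forall>\<^sub>F n in sequentially. \<bar>a t - t * a 1\<bar> \<le> a 1 / real n"
      using eventually_gt_at_top[of 0] by eventually_elim (rule bound)
  qed simp
  then show ?thesis using t a0 by (simp add: c ennreal_mult)
qed

section \<open>Nonnegative sums over jumps\<close>

text \<open>The value is an extended real because summability of the jumps is established only later
  and only almost surely.\<close>

definition jump_sum :: "('b \<Rightarrow> real) \<Rightarrow> (real \<Rightarrow> 'b::real_normed_vector) \<Rightarrow> real \<Rightarrow> real \<Rightarrow> ennreal" where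
  "jump_sum \<phi> f s t = (\<integral>\<^sup>+r. ennreal (\<phi> (jump f r)) * indicator {s<..t} r \<partial>count_space UNIV)"

text \<open>Such a function ignores small jumps, so only finitely many jumps of a cadlag path
  contribute on a bounded interval and grid sums converge path by path.\<close>

definition vanishes_near_0 :: "('b::real_normed_vector \<Rightarrow> real) \<Rightarrow> bool" where
  "vanishes_near_0 \<phi> \<longleftrightarrow> continuous_on UNIV \<phi> \<and> (\<forall>x. 0 \<le> \<phi> x) \<and> (\<exists>e>0. \<forall>x. norm x \<le> e \<longrightarrow> \<phi> x = 0)"

lemma jump_sum_grid:
  assumes f: "cadlag f" and u: "0 \<le> u" "u \<le> t" and \<phi>: "vanishes_near_0 \<phi>"
  shows jump_sum_finite: "jump_sum \<phi> f u t < \<infinity>"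
    and jump_sum_tendsto: "(\<lambda>N. \<Sum>i<N. \<phi> (f (grid u t N (Suc i)) - f (grid u t N i))) \<longlonglongrightarrow> enn2real (jump_sum \<phi> f u t)"
proof -
  obtain e where e: "e > 0" "\<And>x. norm x \<le> e \<Longrightarrow> \<phi> x = 0" and c: "continuous_on UNIV \<phi>" and n: "\<And>x. 0 \<le> \<phi> x"
    using \<phi> unfolding vanishes_near_0_def by blast
  obtain X where X: "finite X" "X \<subseteq> {u<..t}" "\<And>r. r \<in> {u<..t} - X \<Longrightarrow> \<phi> (jump f r) = 0"
    "(\<lambda>N. \<Sum>i<N. \<phi> (f (grid u t N (Suc i)) - f (grid u t N i))) \<longlonglongrightarrow> (\<Sum>r\<in>X. \<phi> (jump f r))"
    by (rule cadlag_grid_sum_tendsto[OF f u e(1) c e(2)]) (assumption, rule that)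
  have "jump_sum \<phi> f u t = (\<Sum>r\<in>X. ennreal (\<phi> (jump f r)) * indicator {u<..t} r)"
    unfolding jump_sum_def
  proof (rule nn_integral_count_space')
    show "ennreal (\<phi> (jump f r)) * indicator {u<..t} r = 0" if "r \<notin> X" for r
      using X(3)[of r] that by (auto simp: indicator_def)
  qed (use X in auto)
  also have "\<dots> = (\<Sum>r\<in>X. ennreal (\<phi> (jump f r)))"
    using X(2) by (intro sum.cong) (auto simp: indicator_def)
  also have "\<dots> = ennreal (\<Sum>r\<in>X. \<phi> (jump f r))" using n by simp
  finally have J: "jump_sum \<phi> f u t = ennreal (\<Sum>r\<in>X. \<phi> (jump f r))" .
  then show "jump_sum \<phi> f u t < \<infinity>" by simp
  show "(\<lambda>N. \<Sum>i<N. \<phi> (f (grid u t N (Suc i)) - f (grid u t N i))) \<longlonglongrightarrow> enn2real (jump_sum \<phi> f u t)"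
    using X(4) n by (simp add: J sum_nonneg)
qed

lemma jump_sum_add:
  assumes "s \<le> t" "t \<le> u"
  shows "jump_sum \<phi> f s u = jump_sum \<phi> f s t + jump_sum \<phi> f t u"
proof -
  have "indicator {s<..u} r = indicator {s<..t} r + (indicator {t<..u} r :: ennreal)" for r
    using assms by (auto split: split_indicator)
  then show ?thesis
    unfolding jump_sum_def by (simp add: distrib_left nn_integral_add)
qed

lemma jump_sum_cmult: "0 \<le> c \<Longrightarrow> (\<And>x. 0 \<le> \<phi> x) \<Longrightarrow> jump_sum (\<lambda>x. c * \<phi> x) f s t = ennreal c * jump_sum \<phi> f s t"
  unfolding jump_sum_def by (simp add: ennreal_mult mult.assoc nn_integral_cmult)

lemma jump_sum_tendsto_below:
  assumes "\<And>n x. \<phi> n x \<le> \<psi> x" "\<And>x. (\<lambda>n. \<phi> n x) \<longlonglongrightarrow> \<psi> x"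
  shows "(\<lambda>n. jump_sum (\<phi> n) f s t) \<longlonglongrightarrow> jump_sum \<psi> f s t"
  unfolding jump_sum_def
  using assms by (intro nn_integral_tendsto_below AE_I2)
   (auto intro!: mult_right_mono ennreal_leI tendsto_ennrealI split: split_indicator)

lemma jump_sum_mono: "(\<And>x. \<phi> x \<le> \<psi> x) \<Longrightarrow> jump_sum \<phi> f s t \<le> jump_sum \<psi> f s t"
  unfolding jump_sum_def by (intro nn_integral_mono mult_right_mono ennreal_leI) auto

text \<open>Near 0 the continuous \<open>q\<close> stays below \<open>c\<close>, where
  \<open>g\<close> is 0. The instances either cut off small values of \<open>q\<close> or
  approximate the indicator of a superlevel set of \<open>q\<close>.\<close>

lemma vanishes_near_0_truncate:
  fixes q :: "'b::real_normed_vector \<Rightarrow> real"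
  assumes q: "continuous_on UNIV q" "q 0 = 0" and c: "0 < c"
    and g: "continuous_on UNIV g" "\<And>x. 0 \<le> g x" "\<And>x. x \<le> c \<Longrightarrow> g x = 0"
  shows "vanishes_near_0 (\<lambda>x. g (q x))"
proof -
  have "\<exists>e>0. \<forall>x. dist x 0 < e \<longrightarrow> dist (q x) (q 0) < c"
    using q(1) c unfolding continuous_on_iff by blast
  then obtain e where e: "e > 0" "\<And>x. norm x < e \<Longrightarrow> \<bar>q x\<bar> < c" using q(2) by (auto simp: dist_real_def)
  have "g (q x) = 0" if "norm x \<le> e / 2" for x
    using e(2)[of x] that e(1) by (intro g(3)) auto
  moreover have "continuous_on UNIV (\<lambda>x. g (q x))"
    using continuous_on_compose2[OF g(1) q(1)] by simp
  ultimately show ?thesis using e(1) g(2) unfolding vanishes_near_0_def by (intro conjI exI[of _ "e / 2"]) auto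
qed

text \<open>The last assumption encodes independence of the increments from the past together with their
  stationarity. Paths are cadlag for every \<open>\<omega>\<close>, so that no null sets have to be carried along.\<close>

locale levy_path = prob_space M for M :: "'a measure" +
  fixes F :: "real \<Rightarrow> 'a measure" and L :: "real \<Rightarrow> 'a \<Rightarrow> real^'d::finite"
  assumes F_subalgebra: "\<And>t. 0 \<le> t \<Longrightarrow> subalgebra M (F t)"
    and F_mono: "\<And>s t. 0 \<le> s \<Longrightarrow> s \<le> t \<Longrightarrow> sets (F s) \<subseteq> sets (F t)"
    and L_adapted: "\<And>t. 0 \<le> t \<Longrightarrow> L t \<in> borel_measurable (F t)"
    and L_cadlag: "\<And>\<omega>. cadlag (\<lambda>t. L t \<omega>)"
    and increments: "\<And>s t H (g :: real^'d \<Rightarrow> ennreal). 0 \<le> s \<Longrightarrow> s \<le> t \<Longrightarrow> H \<in> borel_measurable (F s) \<Longrightarrow> g \<in> borel_measurable borel \<Longrightarrow>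
       (\<integral>\<^sup>+\<omega>. H \<omega> * g (L t \<omega> - L s \<omega>) \<partial>M) = (\<integral>\<^sup>+\<omega>. H \<omega> \<partial>M) * (\<integral>\<^sup>+\<omega>. g (L (t - s) \<omega>) \<partial>M)"
begin

lemma F_subalgebra_mono: "0 \<le> s \<Longrightarrow> s \<le> t \<Longrightarrow> subalgebra (F t) (F s)"
  using F_subalgebra[of s] F_subalgebra[of t] F_mono[of s t] by (simp add: subalgebra_def)

lemma measurable_F_mono: "f \<in> measurable (F s) N \<Longrightarrow> 0 \<le> s \<Longrightarrow> s \<le> t \<Longrightarrow> f \<in> measurable (F t) N"
  using measurable_from_subalg[OF F_subalgebra_mono] by blast

lemma measurable_F_M: "f \<in> measurable (F s) N \<Longrightarrow> 0 \<le> s \<Longrightarrow> f \<in> measurable M N"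
  using measurable_from_subalg[OF F_subalgebra] by blast

lemma L_measurable [measurable]: "0 \<le> t \<Longrightarrow> L t \<in> borel_measurable M"
  by (rule measurable_F_M[OF L_adapted])

section \<open>Independence along grids and Laplace transforms of jump sums\<close>

text \<open>The factors of the earlier cells are measurable at the left end of the last cell, so the
  increment over that cell splits off. By stationarity every cell contributes the same
  factor.\<close>

lemma increments_prod:
  fixes g :: "real^'d \<Rightarrow> ennreal"
  assumes st: "0 \<le> s" "s \<le> t" and H: "H \<in> borel_measurable (F s)" and g: "g \<in> borel_measurable borel" and "k \<le> N"
  shows "(\<integral>\<^sup>+\<omega>. H \<omega> * (\<Prod>i<k. g (L (grid s t N (Suc i)) \<omega> - L (grid s t N i) \<omega>)) \<partial>M)
    = (\<integral>\<^sup>+\<omega>. H \<omega> \<partial>M) * (\<integral>\<^sup>+\<omega>. g (L ((t - s) / real N) \<omega>) \<partial>M) ^ k"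
  using \<open>k \<le> N\<close>
proof (induction k)
  case (Suc k)
  let ?g = "grid s t N"
  let ?P = "\<lambda>\<omega>. H \<omega> * (\<Prod>i<k. g (L (?g (Suc i)) \<omega> - L (?g i) \<omega>))"
  have nn: "0 \<le> ?g i" for i using grid_ge[OF st(2), of N i] st by simp
  have Lm: "L (?g i) \<in> borel_measurable (F (?g k))" if "i \<le> k" for i
    by (rule measurable_F_mono[OF L_adapted]) (use nn grid_mono[OF st(2) that] in auto)
  have "H \<in> borel_measurable (F (?g k))"
    by (rule measurable_F_mono[OF H]) (use st grid_ge in auto)
  moreover have "(\<lambda>\<omega>. g (L (?g (Suc i)) \<omega> - L (?g i) \<omega>)) \<in> borel_measurable (F (?g k))" if "i < k" for i
    by (rule measurable_compose[OF borel_measurable_diff g]) (use that in \<open>auto intro!: Lm\<close>)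
  ultimately have P: "?P \<in> borel_measurable (F (?g k))"
    by (intro borel_measurable_times_ennreal borel_measurable_prod_ennreal) auto
  have "(\<integral>\<^sup>+\<omega>. H \<omega> * (\<Prod>i<Suc k. g (L (?g (Suc i)) \<omega> - L (?g i) \<omega>)) \<partial>M)
    = (\<integral>\<^sup>+\<omega>. ?P \<omega> * g (L (?g (Suc k)) \<omega> - L (?g k) \<omega>) \<partial>M)"
    by (simp add: mult.assoc)
  also have "\<dots> = (\<integral>\<^sup>+\<omega>. ?P \<omega> \<partial>M) * (\<integral>\<^sup>+\<omega>. g (L (?g (Suc k) - ?g k) \<omega>) \<partial>M)"
    by (intro increments nn grid_mono st P g) simp
  also have "?g (Suc k) - ?g k = (t - s) / real N" by (simp add: grid_Suc)
  finally show ?case using Suc by (simp add: mult_ac)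
qed simp

lemma jump_sum_measurable_vanish:
  assumes "0 \<le> s" "s \<le> t" "vanishes_near_0 \<phi>"
  shows "(\<lambda>\<omega>. enn2real (jump_sum \<phi> (\<lambda>t. L t \<omega>) s t)) \<in> borel_measurable M"
proof (rule borel_measurable_LIMSEQ_real[OF jump_sum_tendsto[OF L_cadlag assms]])
  have c: "\<phi> \<in> borel_measurable borel"
    using assms(3) by (intro borel_measurable_continuous_onI) (simp add: vanishes_near_0_def)
  have "0 \<le> grid s t N i" for i N using grid_ge[OF assms(2), of N i] assms by simp
  then show "(\<lambda>\<omega>. \<Sum>i<N. \<phi> (L (grid s t N (Suc i)) \<omega> - L (grid s t N i) \<omega>)) \<in> borel_measurable M" for N
    by (intro borel_measurable_sum measurable_compose[OF _ c] borel_measurable_diff L_measurable) auto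
qed

lemma exp_jump_sum_grid:
  assumes st: "0 \<le> s" "s \<le> t" and H: "H \<in> borel_measurable (F s)" and \<phi>: "continuous_on UNIV \<phi>"
  shows "(\<integral>\<^sup>+\<omega>. H \<omega> * ennreal (exp (\<Sum>i<N. \<phi> (L (grid s t N (Suc i)) \<omega> - L (grid s t N i) \<omega>))) \<partial>M)
    = (\<integral>\<^sup>+\<omega>. H \<omega> \<partial>M) * (\<integral>\<^sup>+\<omega>. ennreal (exp (\<phi> (L ((t - s) / real N) \<omega>))) \<partial>M) ^ N"
proof -
  have [measurable]: "\<phi> \<in> borel_measurable borel"
    using \<phi> by (intro borel_measurable_continuous_onI)
  have "(\<lambda>x. ennreal (exp (\<phi> x))) \<in> borel_measurable borel" by measurable
  from increments_prod[OF st H this order.refl] show ?thesis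
    by (simp add: exp_sum prod_ennreal)
qed

text \<open>Exponentials turn the grid sum into a product, to which independence applies, and since
  \<open>exp\<close> of a nonpositive number is at most 1 the limit of fine grids is dominated by
  \<open>H\<close>. For the sums themselves no such majorant is at hand.\<close>

lemma laplace_jump_sum:
  assumes st: "0 \<le> s" "s \<le> t" and H: "H \<in> borel_measurable (F s)" "(\<integral>\<^sup>+\<omega>. H \<omega> \<partial>M) < \<infinity>" and \<phi>: "vanishes_near_0 \<phi>"
  shows "(\<integral>\<^sup>+\<omega>. H \<omega> * ennreal (exp (- enn2real (jump_sum \<phi> (\<lambda>t. L t \<omega>) s t))) \<partial>M)
    = (\<integral>\<^sup>+\<omega>. H \<omega> \<partial>M) * (\<integral>\<^sup>+\<omega>. ennreal (exp (- enn2real (jump_sum \<phi> (\<lambda>t. L t \<omega>) 0 (t - s)))) \<partial>M)"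
proof -
  define S where "S s t N \<omega> = (\<Sum>i<N. \<phi> (L (grid s t N (Suc i)) \<omega> - L (grid s t N i) \<omega>))" for s t N \<omega>
  have c: "continuous_on UNIV \<phi>" and n: "\<And>x. 0 \<le> \<phi> x"
    using \<phi> by (auto simp: vanishes_near_0_def)
  have [measurable]: "\<phi> \<in> borel_measurable borel"
    using c by (intro borel_measurable_continuous_onI)
  have Sm [measurable]: "S s t N \<in> borel_measurable M" if "0 \<le> s" "s \<le> t" for s t N
  proof -
    have "0 \<le> grid s t N i" for i using grid_ge[OF that(2), of N i] that by simp
    then show ?thesis unfolding S_def
      by (intro borel_measurable_sum measurable_compose[OF _ \<open>\<phi> \<in> borel_measurable borel\<close>] borel_measurable_diff L_measurable) auto
  qed
  have S0: "0 \<le> S s t N \<omega>" for s t N \<omega> unfolding S_def by (intro sum_nonneg n)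
  \<comment> \<open>Stated for all \<open>s\<close>, \<open>t\<close> and \<open>G\<close>, because
    it is used both for \<open>H\<close> on the given interval and for the constant 1 on the
    interval shifted to the origin.\<close>
  have lim: "(\<lambda>N. \<integral>\<^sup>+\<omega>. G \<omega> * ennreal (exp (- S s t N \<omega>)) \<partial>M) \<longlonglongrightarrow> (\<integral>\<^sup>+\<omega>. G \<omega> * ennreal (exp (- enn2real (jump_sum \<phi> (\<lambda>t. L t \<omega>) s t))) \<partial>M)"
    if st: "0 \<le> s" "s \<le> t" and G: "G \<in> borel_measurable M" "(\<integral>\<^sup>+\<omega>. G \<omega> \<partial>M) < \<infinity>" for s t G
  proof (rule nn_integral_dominated_convergence[where w = G])
    have "AE \<omega> in M. G \<omega> \<noteq> \<infinity>" using G by (intro nn_integral_noteq_infinite) auto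
    then show "AE \<omega> in M. (\<lambda>N. G \<omega> * ennreal (exp (- S s t N \<omega>))) \<longlonglongrightarrow> G \<omega> * ennreal (exp (- enn2real (jump_sum \<phi> (\<lambda>t. L t \<omega>) s t)))"
    proof eventually_elim
      case (elim \<omega>)
      have "(\<lambda>N. S s t N \<omega>) \<longlonglongrightarrow> enn2real (jump_sum \<phi> (\<lambda>t. L t \<omega>) s t)"
        unfolding S_def by (rule jump_sum_tendsto[OF L_cadlag st \<phi>])
      then show ?case using elim
        by (intro ennreal_tendsto_cmult tendsto_ennrealI tendsto_exp tendsto_minus) (auto simp: less_top)
    qed
    have "G \<omega> * ennreal (exp (- S s t N \<omega>)) \<le> G \<omega> * 1" for N \<omega>
      using S0 by (intro mult_left_mono) auto
    then show "AE \<omega> in M. G \<omega> * ennreal (exp (- S s t N \<omega>)) \<le> G \<omega>" for N by simp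
    show "(\<lambda>\<omega>. G \<omega> * ennreal (exp (- S s t N \<omega>))) \<in> borel_measurable M" for N
      using G(1) Sm[OF st] by measurable
    show "(\<lambda>\<omega>. G \<omega> * ennreal (exp (- enn2real (jump_sum \<phi> (\<lambda>t. L t \<omega>) s t)))) \<in> borel_measurable M"
      using G(1) jump_sum_measurable_vanish[OF st \<phi>] by measurable
  qed (use G in auto)
  have eq: "(\<integral>\<^sup>+\<omega>. H \<omega> * ennreal (exp (- S s t N \<omega>)) \<partial>M) = (\<integral>\<^sup>+\<omega>. H \<omega> \<partial>M) * (\<integral>\<^sup>+\<omega>. 1 * ennreal (exp (- S 0 (t - s) N \<omega>)) \<partial>M)" for N
    using exp_jump_sum_grid[OF st H(1), of "\<lambda>x. - \<phi> x" N] exp_jump_sum_grid[of 0 "t - s" "\<lambda>_. 1" "\<lambda>x. - \<phi> x" N] st c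
    by (simp add: S_def sum_negf emeasure_space_1 continuous_on_minus)
  have "(\<lambda>N. \<integral>\<^sup>+\<omega>. H \<omega> * ennreal (exp (- S s t N \<omega>)) \<partial>M) \<longlonglongrightarrow>
    (\<integral>\<^sup>+\<omega>. H \<omega> \<partial>M) * (\<integral>\<^sup>+\<omega>. 1 * ennreal (exp (- enn2real (jump_sum \<phi> (\<lambda>t. L t \<omega>) 0 (t - s)))) \<partial>M)"
    unfolding eq using H(2) st by (intro ennreal_tendsto_cmult lim) (auto simp: emeasure_space_1)
  from LIMSEQ_unique[OF lim[OF st measurable_F_M[OF H(1) st(1)] H(2)] this] show ?thesis by simp
qed

text \<open>Measurability in \<open>\<omega>\<close> is not automatic, as the jump times are random. For \<open>\<phi>\<close> vanishing near 0 a jump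
  sum is a limit of sums of \<open>\<phi>\<close> over grid increments, and the identity below is the derivative at
  \<open>c = 0\<close> of the product formula for \<open>E (H exp (- c J))\<close>; other \<open>\<phi>\<close> are reached by increasing limits.\<close>

definition regular :: "(real^'d \<Rightarrow> real) \<Rightarrow> bool" where
  "regular \<phi> \<longleftrightarrow> (\<forall>x. 0 \<le> \<phi> x) \<and> (\<forall>s t. 0 \<le> s \<longrightarrow> s \<le> t \<longrightarrow>
     (\<lambda>\<omega>. jump_sum \<phi> (\<lambda>t. L t \<omega>) s t) \<in> borel_measurable M \<and>
     (\<forall>H. H \<in> borel_measurable (F s) \<longrightarrow> (\<integral>\<^sup>+\<omega>. H \<omega> \<partial>M) < \<infinity> \<longrightarrow>
       (\<integral>\<^sup>+\<omega>. H \<omega> * jump_sum \<phi> (\<lambda>t. L t \<omega>) s t \<partial>M) = (\<integral>\<^sup>+\<omega>. H \<omega> \<partial>M) * (\<integral>\<^sup>+\<omega>. jump_sum \<phi> (\<lambda>t. L t \<omega>) 0 (t - s) \<partial>M)))"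

text \<open>The mean of a jump sum \<open>J\<close> is recovered from the rescaled quantities (n +
  1) (1 - exp (- J / (n + 1))), to which the Laplace identity applies. They lie below
  \<open>J\<close> and tend to it, so the limit is legitimate before the mean of \<open>J\<close> is
  known to be finite.\<close>

lemma regular_vanishes:
  assumes \<phi>: "vanishes_near_0 \<phi>"
  shows "regular \<phi>"
proof -
  have n: "\<And>x. 0 \<le> \<phi> x" using \<phi> by (auto simp: vanishes_near_0_def)
  let ?J = "\<lambda>s t \<omega>. enn2real (jump_sum \<phi> (\<lambda>t. L t \<omega>) s t)"
  have J: "jump_sum \<phi> (\<lambda>t. L t \<omega>) s t = ennreal (?J s t \<omega>)" if "0 \<le> s" "s \<le> t" for s t \<omega>
    using jump_sum_finite[OF L_cadlag that \<phi>] by simp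
  have Jm [measurable]: "?J s t \<in> borel_measurable M" if "0 \<le> s" "s \<le> t" for s t
    using jump_sum_measurable_vanish[OF that \<phi>] .
  have Js: "(\<lambda>\<omega>. jump_sum \<phi> (\<lambda>t. L t \<omega>) s t) \<in> borel_measurable M" if "0 \<le> s" "s \<le> t" for s t
  proof -
    have "(\<lambda>\<omega>. ennreal (?J s t \<omega>)) \<in> borel_measurable M" using Jm[OF that] by (rule measurable_compose) simp
    then show ?thesis by (simp only: J[OF that, symmetric])
  qed
  let ?e = "\<lambda>n x. real (Suc n) * (1 - exp (- (x / real (Suc n))))"
  have e: "?e n x \<le> x" "0 \<le> ?e n x" if "0 \<le> x" for n x
  proof -
    have "1 - x / real (Suc n) \<le> exp (- (x / real (Suc n)))" using exp_ge_add_one_self[of "- (x / real (Suc n))"] by simp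
    then have "?e n x \<le> real (Suc n) * (x / real (Suc n))" by (intro mult_left_mono) auto
    then show "?e n x \<le> x" by simp
    show "0 \<le> ?e n x" using that by (intro mult_nonneg_nonneg) auto
  qed
  have elim: "(\<lambda>n. ?e n x) \<longlonglongrightarrow> x" for x
  proof -
    have "((\<lambda>h. (exp (0 + h) - exp 0) / h) \<longlongrightarrow> exp 0) (at (0::real))"
      using DERIV_exp[of "0::real"] unfolding has_field_derivative_iff by simp
    moreover have "(exp (0 + h) - exp 0) / h = (1 - exp h) / (- h)" for h :: real
      by (cases "h = 0") (auto simp: field_simps)
    ultimately have d: "((\<lambda>h. (1 - exp h) / (- h)) \<longlongrightarrow> 1) (at (0::real))" by simp
    show ?thesis
    proof (cases "x = 0")
      case False
      have "filterlim (\<lambda>n. - (x / real (Suc n))) (at 0) sequentially"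
        using False tendsto_minus[OF LIMSEQ_Suc[OF lim_const_over_n[of x]]]
        by (auto simp: filterlim_at)
      from tendsto_mult_right[OF filterlim_compose[OF d this], of x] False show ?thesis
        by (simp add: mult.commute)
    qed simp
  qed
  have "(\<integral>\<^sup>+\<omega>. H \<omega> * jump_sum \<phi> (\<lambda>t. L t \<omega>) s t \<partial>M) = (\<integral>\<^sup>+\<omega>. H \<omega> \<partial>M) * (\<integral>\<^sup>+\<omega>. jump_sum \<phi> (\<lambda>t. L t \<omega>) 0 (t - s) \<partial>M)"
    if st: "0 \<le> s" "s \<le> t" and H: "H \<in> borel_measurable (F s)" "(\<integral>\<^sup>+\<omega>. H \<omega> \<partial>M) < \<infinity>" for s t H
  proof -
    have HM [measurable]: "H \<in> borel_measurable M" by (rule measurable_F_M[OF H(1) st(1)])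
    have ts: "0 \<le> t - s" using st by simp
    have eq: "(\<integral>\<^sup>+\<omega>. H \<omega> * ennreal (?e n (?J s t \<omega>)) \<partial>M) = (\<integral>\<^sup>+\<omega>. H \<omega> \<partial>M) * (\<integral>\<^sup>+\<omega>. ennreal (?e n (?J 0 (t - s) \<omega>)) \<partial>M)" for n
    proof -
      let ?d = "\<lambda>s t \<omega>. ?J s t \<omega> / real (Suc n)"
      have v: "vanishes_near_0 (\<lambda>x. (1 / real (Suc n)) * \<phi> x)"
        using \<phi> unfolding vanishes_near_0_def by (auto intro!: continuous_intros)
      have js: "enn2real (jump_sum (\<lambda>x. (1 / real (Suc n)) * \<phi> x) (\<lambda>t. L t \<omega>) s t) = ?d s t \<omega>" for s t \<omega>
        by (subst jump_sum_cmult) (auto simp: n enn2real_mult)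
      note [measurable] = Js[OF st] Js[OF order.refl ts]
      define h where "h = (\<integral>\<^sup>+\<omega>. H \<omega> \<partial>M)"
      define a where "a = (\<integral>\<^sup>+\<omega>. H \<omega> * ennreal (1 - exp (- ?d s t \<omega>)) \<partial>M)"
      define b where "b = (\<integral>\<^sup>+\<omega>. H \<omega> * ennreal (exp (- ?d s t \<omega>)) \<partial>M)"
      define a0 where "a0 = (\<integral>\<^sup>+\<omega>. ennreal (1 - exp (- ?d 0 (t - s) \<omega>)) \<partial>M)"
      define b0 where "b0 = (\<integral>\<^sup>+\<omega>. ennreal (exp (- ?d 0 (t - s) \<omega>)) \<partial>M)"
      have one: "ennreal (1 - exp (- ?d s t \<omega>)) + ennreal (exp (- ?d s t \<omega>)) = 1" for s t \<omega>
        by (subst ennreal_plus[symmetric]) (auto simp del: of_nat_Suc)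
      have b: "b = h * b0" unfolding b_def b0_def h_def
        using laplace_jump_sum[OF st H v] unfolding js .
      have "a + b = (\<integral>\<^sup>+\<omega>. H \<omega> * ennreal (1 - exp (- ?d s t \<omega>)) + H \<omega> * ennreal (exp (- ?d s t \<omega>)) \<partial>M)"
        unfolding a_def b_def by (intro nn_integral_add[symmetric]) measurable
      then have ab: "a + b = h" unfolding h_def by (simp only: distrib_left[symmetric] one mult_1_right)
      have "a0 + b0 = (\<integral>\<^sup>+\<omega>. ennreal (1 - exp (- ?d 0 (t - s) \<omega>)) + ennreal (exp (- ?d 0 (t - s) \<omega>)) \<partial>M)"
        unfolding a0_def b0_def by (intro nn_integral_add[symmetric]) measurable
      then have ab0: "a0 + b0 = 1" by (simp only: one) (simp add: emeasure_space_1)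
      have "h * b0 + a = h * b0 + h * a0"
        using ab b ab0 by (metis add.commute distrib_left mult.right_neutral)
      \<comment> \<open>Cancellation in the extended reals requires finiteness, which holds since
        this product equals \<open>b\<close> and \<open>a + b = h\<close> is finite.\<close>
      moreover have "h * b0 \<noteq> \<infinity>" using ab b H(2) unfolding h_def[symmetric] by auto
      ultimately have "a = h * a0" by (simp add: ennreal_add_left_cancel)
      then have "ennreal (real (Suc n)) * a = h * (ennreal (real (Suc n)) * a0)" by (simp add: mult_ac)
      also have "ennreal (real (Suc n)) * a = (\<integral>\<^sup>+\<omega>. H \<omega> * ennreal (?e n (?J s t \<omega>)) \<partial>M)"
        unfolding a_def using Jm[OF st]
        by (subst nn_integral_cmult[symmetric]) (auto simp: ennreal_mult' mult_ac simp del: of_nat_Suc)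
      also have "ennreal (real (Suc n)) * a0 = (\<integral>\<^sup>+\<omega>. ennreal (?e n (?J 0 (t - s) \<omega>)) \<partial>M)"
        unfolding a0_def using Jm[OF order.refl ts]
        by (subst nn_integral_cmult[symmetric]) (auto simp: ennreal_mult' mult_ac simp del: of_nat_Suc)
      finally show ?thesis unfolding h_def .
    qed
    have fin: "AE \<omega> in M. H \<omega> \<noteq> \<infinity>" using H by (intro nn_integral_noteq_infinite) auto
    have 1: "(\<lambda>n. \<integral>\<^sup>+\<omega>. H \<omega> * ennreal (?e n (?J s t \<omega>)) \<partial>M) \<longlonglongrightarrow> (\<integral>\<^sup>+\<omega>. H \<omega> * ennreal (?J s t \<omega>) \<partial>M)"
    proof (rule nn_integral_tendsto_below)
      show "AE \<omega> in M. (\<lambda>n. H \<omega> * ennreal (?e n (?J s t \<omega>))) \<longlonglongrightarrow> H \<omega> * ennreal (?J s t \<omega>)"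
        using fin by eventually_elim (intro ennreal_tendsto_cmult tendsto_ennrealI elim, auto simp: less_top)
    qed (use Jm[OF st] in \<open>auto intro!: AE_I2 mult_left_mono ennreal_leI e simp del: of_nat_Suc\<close>)
    have 2: "(\<lambda>n. \<integral>\<^sup>+\<omega>. ennreal (?e n (?J 0 (t - s) \<omega>)) \<partial>M) \<longlonglongrightarrow> (\<integral>\<^sup>+\<omega>. ennreal (?J 0 (t - s) \<omega>) \<partial>M)"
      by (rule nn_integral_tendsto_below)
         (use Jm[OF order.refl ts] in \<open>auto intro!: AE_I2 ennreal_leI tendsto_ennrealI e elim simp del: of_nat_Suc\<close>)
    have "(\<integral>\<^sup>+\<omega>. H \<omega> * ennreal (?J s t \<omega>) \<partial>M) = (\<integral>\<^sup>+\<omega>. H \<omega> \<partial>M) * (\<integral>\<^sup>+\<omega>. ennreal (?J 0 (t - s) \<omega>) \<partial>M)"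
      using LIMSEQ_unique[OF 1[unfolded eq] ennreal_tendsto_cmult[OF _ 2]] H(2) by simp
    then show ?thesis using J[OF st] J[OF order.refl ts] by simp
  qed
  moreover have "(\<lambda>\<omega>. jump_sum \<phi> (\<lambda>t. L t \<omega>) s t) \<in> borel_measurable M" if "0 \<le> s" "s \<le> t" for s t
    by (rule Js[OF that])
  ultimately show ?thesis unfolding regular_def using n by blast
qed

text \<open>Both sides of the identity of means converge when the functions converge from below. In
  this way functions that see infinitely many jumps are reached.\<close>

lemma regular_limit:
  assumes \<phi>: "\<And>n. regular (\<phi> n)" and le: "\<And>n x. \<phi> n x \<le> \<psi> x" and lim: "\<And>x. (\<lambda>n. \<phi> n x) \<longlonglongrightarrow> \<psi> x"
  shows "regular \<psi>"
proof -
  have n: "0 \<le> \<psi> x" for x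
    using \<phi>[of 0] le[of 0 x] unfolding regular_def by (meson order_trans)
  have m: "(\<lambda>\<omega>. jump_sum (\<phi> n) (\<lambda>t. L t \<omega>) s t) \<in> borel_measurable M" if "0 \<le> s" "s \<le> t" for n s t
    using \<phi>[of n] that unfolding regular_def by blast
  note js = jump_sum_tendsto_below[of \<phi> \<psi>, OF le lim]
  have m': "(\<lambda>\<omega>. jump_sum \<psi> (\<lambda>t. L t \<omega>) s t) \<in> borel_measurable M" if "0 \<le> s" "s \<le> t" for s t
    by (rule borel_measurable_LIMSEQ_order[OF js m[OF that]])
  have "(\<integral>\<^sup>+\<omega>. H \<omega> * jump_sum \<psi> (\<lambda>t. L t \<omega>) s t \<partial>M) = (\<integral>\<^sup>+\<omega>. H \<omega> \<partial>M) * (\<integral>\<^sup>+\<omega>. jump_sum \<psi> (\<lambda>t. L t \<omega>) 0 (t - s) \<partial>M)"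
    if st: "0 \<le> s" "s \<le> t" and H: "H \<in> borel_measurable (F s)" "(\<integral>\<^sup>+\<omega>. H \<omega> \<partial>M) < \<infinity>" for s t H
  proof -
    have HM [measurable]: "H \<in> borel_measurable M" by (rule measurable_F_M[OF H(1) st(1)])
    have ts: "0 \<le> t - s" using st by simp
    have fin: "AE \<omega> in M. H \<omega> \<noteq> \<infinity>" using H by (intro nn_integral_noteq_infinite) auto
    have 1: "(\<lambda>n. \<integral>\<^sup>+\<omega>. H \<omega> * jump_sum (\<phi> n) (\<lambda>t. L t \<omega>) s t \<partial>M) \<longlonglongrightarrow> (\<integral>\<^sup>+\<omega>. H \<omega> * jump_sum \<psi> (\<lambda>t. L t \<omega>) s t \<partial>M)"
    proof (rule nn_integral_tendsto_below)
      show "AE \<omega> in M. (\<lambda>n. H \<omega> * jump_sum (\<phi> n) (\<lambda>t. L t \<omega>) s t) \<longlonglongrightarrow> H \<omega> * jump_sum \<psi> (\<lambda>t. L t \<omega>) s t"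
        using fin by eventually_elim (intro ennreal_tendsto_cmult js, auto simp: less_top)
    qed (use m[OF st] in \<open>auto intro!: AE_I2 mult_left_mono jump_sum_mono le\<close>)
    have 2: "(\<lambda>n. \<integral>\<^sup>+\<omega>. jump_sum (\<phi> n) (\<lambda>t. L t \<omega>) 0 (t - s) \<partial>M) \<longlonglongrightarrow> (\<integral>\<^sup>+\<omega>. jump_sum \<psi> (\<lambda>t. L t \<omega>) 0 (t - s) \<partial>M)"
      by (rule nn_integral_tendsto_below)
         (use m[OF order.refl ts] in \<open>auto intro!: AE_I2 jump_sum_mono le js\<close>)
    have eq: "(\<integral>\<^sup>+\<omega>. H \<omega> * jump_sum (\<phi> n) (\<lambda>t. L t \<omega>) s t \<partial>M) = (\<integral>\<^sup>+\<omega>. H \<omega> \<partial>M) * (\<integral>\<^sup>+\<omega>. jump_sum (\<phi> n) (\<lambda>t. L t \<omega>) 0 (t - s) \<partial>M)" for n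
      using \<phi>[of n] st H unfolding regular_def by blast
    show ?thesis
      using LIMSEQ_unique[OF 1[unfolded eq] ennreal_tendsto_cmult[OF _ 2]] H(2) by simp
  qed
  with n m' show ?thesis unfolding regular_def by blast
qed

lemma regular_continuous:
  assumes q: "continuous_on UNIV q" "q 0 = 0" "\<And>x. 0 \<le> q x"
  shows "regular q"
proof (rule regular_limit)
  show "regular (\<lambda>x. max 0 (q x - 1 / real (Suc n)))" for n
    by (rule regular_vanishes, rule vanishes_near_0_truncate[OF q(1,2), of "1 / real (Suc n)"])
       (auto intro!: continuous_intros)
  show "(\<lambda>n. max 0 (q x - 1 / real (Suc n))) \<longlonglongrightarrow> q x" for x
  proof -
    have "(\<lambda>n. max 0 (q x - 1 / real (Suc n))) \<longlonglongrightarrow> max 0 (q x - 0)"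
      by (intro tendsto_intros LIMSEQ_Suc[OF lim_const_over_n])
    then show ?thesis by (simp only: diff_0_right max_absorb2[OF q(3)])
  qed
qed (use q in auto)

text \<open>The Levy measure is specified by its values on sets, so indicators have to be covered
  too. The indicator of this open set is a limit from below of continuous functions that vanish near
  0.\<close>

lemma regular_superlevel:
  fixes q :: "real^'d \<Rightarrow> real"
  assumes q: "continuous_on UNIV q" "q 0 = 0" and c: "0 < c"
  shows "regular (indicator {x. c < q x})"
proof (rule regular_limit)
  show "regular (\<lambda>x. min 1 (real n * max 0 (q x - c)))" for n
    by (rule regular_vanishes, rule vanishes_near_0_truncate[OF q c]) (auto intro!: continuous_intros)
  show "min 1 (real n * max 0 (q x - c)) \<le> indicator {x. c < q x} x" for n x
    by (auto simp: indicator_def)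
  show "(\<lambda>n. min 1 (real n * max 0 (q x - c))) \<longlonglongrightarrow> indicator {x. c < q x} x" for x
  proof (cases "c < q x")
    case True
    obtain N where N: "1 < real N * (q x - c)" using reals_Archimedean3[of "q x - c"] True by auto
    have "eventually (\<lambda>n. min 1 (real n * max 0 (q x - c)) = 1) sequentially"
      using eventually_ge_at_top[of N]
    proof eventually_elim
      case (elim n)
      then have "real N * (q x - c) \<le> real n * (q x - c)" using True by (intro mult_right_mono) auto
      then have "1 \<le> real n * (q x - c)" using N by linarith
      with True show ?case by simp
    qed
    then show ?thesis using True by (simp add: tendsto_eventually)
  qed simp
qed

text \<open>Time homogeneity makes the expected jump sum additive in the length of the interval,
  hence linear once it is finite on the unit interval.\<close>

lemma regular_mean:
  assumes \<phi>: "regular \<phi>" and fin: "(\<integral>\<^sup>+\<omega>. jump_sum \<phi> (\<lambda>t. L t \<omega>) 0 1 \<partial>M) < \<infinity>"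
    and st: "0 \<le> s" "s \<le> t" and H: "H \<in> borel_measurable (F s)" "(\<integral>\<^sup>+\<omega>. H \<omega> \<partial>M) < \<infinity>"
  shows "(\<integral>\<^sup>+\<omega>. H \<omega> * jump_sum \<phi> (\<lambda>t. L t \<omega>) s t \<partial>M) =
    (\<integral>\<^sup>+\<omega>. H \<omega> \<partial>M) * (ennreal (t - s) * (\<integral>\<^sup>+\<omega>. jump_sum \<phi> (\<lambda>t. L t \<omega>) 0 1 \<partial>M))"
proof -
  define c where "c t = (\<integral>\<^sup>+\<omega>. jump_sum \<phi> (\<lambda>t. L t \<omega>) 0 t \<partial>M)" for t
  have m: "(\<lambda>\<omega>. jump_sum \<phi> (\<lambda>t. L t \<omega>) s t) \<in> borel_measurable M" if "0 \<le> s" "s \<le> t" for s t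
    using \<phi> that unfolding regular_def by blast
  have r: "(\<integral>\<^sup>+\<omega>. H \<omega> * jump_sum \<phi> (\<lambda>t. L t \<omega>) s t \<partial>M) = (\<integral>\<^sup>+\<omega>. H \<omega> \<partial>M) * c (t - s)"
    if "0 \<le> s" "s \<le> t" "H \<in> borel_measurable (F s)" "(\<integral>\<^sup>+\<omega>. H \<omega> \<partial>M) < \<infinity>" for s t H
    using \<phi> that unfolding regular_def c_def by blast
  have "c (t - s) = ennreal (t - s) * c 1"
  proof (rule additive_ennreal_linear)
    show "c (s + t) = c s + c t" if "0 \<le> s" "0 \<le> t" for s t
    proof -
      have "c (s + t) = c s + (\<integral>\<^sup>+\<omega>. jump_sum \<phi> (\<lambda>t. L t \<omega>) s (s + t) \<partial>M)"
        using that m unfolding c_def by (subst jump_sum_add[of 0 s]) (auto intro!: nn_integral_add)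
      then show ?thesis using r[of s "s + t" "\<lambda>_. 1"] that by (simp add: emeasure_space_1)
    qed
  qed (use st fin in \<open>auto simp: c_def\<close>)
  then show ?thesis using r[OF st H] by (simp add: c_def)
qed

end

section \<open>The compensation formula\<close>

text \<open>Completeness enters here. Jump integrals are identified with limits of measurable
  functions outside a null set only, and they are to be measurable nevertheless.\<close>

lemma (in complete_measure) measurable_AE_eq:
  assumes f: "f \<in> measurable M N" and g: "g \<in> space M \<rightarrow> space N" and eq: "AE x in M. f x = g x"
  shows "g \<in> measurable M N"
proof (rule measurableI)
  fix A assume A: "A \<in> sets N"
  show "g -` A \<inter> space M \<in> sets M"
  proof (rule in_sets_AE)
    show "AE x in M. (x \<in> f -` A \<inter> space M) \<longleftrightarrow> (x \<in> g -` A \<inter> space M)"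
      using eq by eventually_elim auto
  qed (use f A in \<open>auto intro: measurable_sets\<close>)
qed (use g in auto)

lemma (in complete_measure) borel_measurable_AE_eq:
  "f \<in> borel_measurable M \<Longrightarrow> AE x in M. f x = g x \<Longrightarrow> g \<in> borel_measurable M"
  by (rule measurable_AE_eq) auto

text \<open>The countably many jump times form a Lebesgue null set, so drift integrals may use
  values in place of left limits.\<close>

lemma AE_lborel_left_limit:
  fixes f :: "real \<Rightarrow> 'b::real_normed_vector"
  assumes "cadlag f" "0 \<le> u"
  shows "AE r in lborel. r \<in> {u<..t} \<longrightarrow> left_limit f r = f r"
proof -
  have "{r. 0 \<le> r \<and> jump f r \<noteq> 0} \<in> null_sets lborel"
    using countable_jumps[OF assms(1)] by (rule countable_imp_null_set_lborel)
  then have "AE r in lborel. r \<notin> {r. 0 \<le> r \<and> jump f r \<noteq> 0}" by (rule AE_not_in)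
  then show ?thesis by eventually_elim (use assms(2) in \<open>auto simp: jump_def\<close>)
qed

text \<open>Sampling at the right end of each cell yields the value of the path rather than its left
  limit. This approximation looks ahead in time and serves measurability only.\<close>

lemma right_step_tendsto:
  assumes f: "cadlag f" and u: "0 \<le> u" "u \<le> t"
  shows "(\<lambda>N. step_fun (\<lambda>s. f (s + (t - u) / real N)) u t N r) \<longlonglongrightarrow> f r * indicator {u<..t} r"
proof (cases "r \<in> {u<..t}")
  case True
  have ev: "eventually (\<lambda>N. N > (0::nat)) sequentially" by (rule eventually_gt_at_top)
  have "(\<lambda>N. f (grid u t N (Suc (cell u t N r)))) \<longlonglongrightarrow> f r"
    using True u by (intro cadlag_right_sequence[OF f] grid_cell_tendsto)
      (auto intro!: eventually_mono[OF ev] le_grid_cell)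
  moreover have "eventually (\<lambda>N. f (grid u t N (Suc (cell u t N r))) = step_fun (\<lambda>s. f (s + (t - u) / real N)) u t N r) sequentially"
    using ev by eventually_elim (use True in \<open>auto simp: step_fun_eq grid_Suc\<close>)
  ultimately show ?thesis using True by (simp add: tendsto_cong)
next
  case False
  with u show ?thesis by (simp add: step_fun_outside)
qed

lemma step_fun_measurable [measurable]: "step_fun f u t N \<in> borel_measurable borel"
  unfolding step_fun_def[abs_def] by measurable

lemma cadlag_measurable:
  assumes f: "cadlag f" and u: "0 \<le> u" "u \<le> t"
  shows "(\<lambda>r. f r * indicator {u<..t} r :: real) \<in> borel_measurable borel"
    and "(\<lambda>r. left_limit f r * indicator {u<..t} r :: real) \<in> borel_measurable borel"
proof -
  show "(\<lambda>r. f r * indicator {u<..t} r :: real) \<in> borel_measurable borel"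
    by (rule borel_measurable_LIMSEQ_real[OF right_step_tendsto[OF f u]]) (rule step_fun_measurable)
  show "(\<lambda>r. left_limit f r * indicator {u<..t} r :: real) \<in> borel_measurable borel"
    by (rule borel_measurable_LIMSEQ_real[OF step_fun_tendsto[OF f u]]) (rule step_fun_measurable)
qed

lemma integral_step_fun:
  assumes "u \<le> t" "N > 0"
  shows "(\<integral>r. step_fun f u t N r \<partial>lborel) = (\<Sum>i<N. f (grid u t N i) * ((t - u) / real N))"
proof -
  have i: "integrable lborel (\<lambda>r. indicator {a<..b} r :: real)" for a b :: real
    by (cases "a \<le> b") (auto intro!: integrable_real_indicator)
  have m: "measure lborel {grid u t N i<..grid u t N (Suc i)} = (t - u) / real N" for i
    using assms by (simp add: grid_Suc)
  have "(\<integral>r. step_fun f u t N r \<partial>lborel) = (\<Sum>i<N. f (grid u t N i) * (\<integral>r. indicator {grid u t N i<..grid u t N (Suc i)} r \<partial>lborel))"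
    unfolding step_fun_def by (subst Bochner_Integration.integral_sum) (auto intro!: integrable_mult_right i)
  then show ?thesis by (simp add: m del: measure_lborel_Ioc)
qed

lemma integrable_indicator_Ioc: "integrable lborel (\<lambda>r. c * indicator {a<..b} r :: real)" for a b c :: real
  by (cases "a \<le> b") (auto intro!: integrable_mult_right integrable_real_indicator)

lemma integral_step_fun_tendsto:
  assumes f: "cadlag f" and u: "0 \<le> u" "u \<le> t" and K: "\<And>s. u \<le> s \<Longrightarrow> s \<le> t \<Longrightarrow> \<bar>f s\<bar> \<le> K"
  shows "(\<lambda>N. \<integral>r. step_fun f u t N r \<partial>lborel) \<longlonglongrightarrow> (\<integral>r. f r * indicator {u<..t} r \<partial>lborel)"
proof -
  have "(\<lambda>N. \<integral>r. step_fun f u t N r \<partial>lborel) \<longlonglongrightarrow> (\<integral>r. left_limit f r * indicator {u<..t} r \<partial>lborel)"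
  proof (rule integral_dominated_convergence[where w = "\<lambda>r. K * indicator {u<..t} r"])
    show "AE r in lborel. norm (step_fun f u t N r) \<le> K * indicator {u<..t} r" for N
      using step_fun_bound[OF u(2) K] by simp
    show "step_fun f u t N \<in> borel_measurable lborel" for N
      by measurable
  qed (use cadlag_measurable(2)[OF f u] step_fun_tendsto[OF f u] integrable_indicator_Ioc in auto)
  also have "(\<integral>r. left_limit f r * indicator {u<..t} r \<partial>lborel) = (\<integral>r. f r * indicator {u<..t} r \<partial>lborel)"
  proof (rule integral_cong_AE)
    show "AE r in lborel. left_limit f r * indicator {u<..t} r = f r * indicator {u<..t} r"
      using AE_lborel_left_limit[OF f u(1), of t] by eventually_elim (auto simp: indicator_def)
  qed (use cadlag_measurable[OF f u] in auto)
  finally show ?thesis .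
qed

definition jump_prod :: "(real \<Rightarrow> real^'n) \<Rightarrow> 'n \<Rightarrow> 'n \<Rightarrow> real \<Rightarrow> real" where
  "jump_prod f k l r = jump f r $ k * jump f r $ l"

abbreviation (input) sq_norm :: "'b::real_normed_vector \<Rightarrow> real" where
  "sq_norm x \<equiv> (norm x)\<^sup>2"

lemma abs_jump_prod_le: "\<bar>jump_prod f k l r\<bar> \<le> sq_norm (jump f r)"
proof -
  have "\<bar>jump f r $ k\<bar> * \<bar>jump f r $ l\<bar> \<le> norm (jump f r) * norm (jump f r)"
    by (intro mult_mono component_le_norm_cart) auto
  then show ?thesis by (simp add: jump_prod_def abs_mult power2_eq_square)
qed

lemma sq_norm_jump: "sq_norm (jump f r) = (\<Sum>k\<in>UNIV. jump_prod f k k r)" for f :: "real \<Rightarrow> real^'n"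
  by (simp add: power2_norm_eq_inner inner_vec_def jump_prod_def)

lemma integrable_count_space_iff_jump_sum:
  "jump_sum sq_norm f s t < \<infinity> \<Longrightarrow> integrable (count_space UNIV) (\<lambda>r. sq_norm (jump f r) * indicator {s<..t} r)"
  unfolding integrable_iff_bounded jump_sum_def by (simp add: ennreal_mult' abs_mult ennreal_indicator)

lemma integrable_jump_prod:
  assumes "jump_sum sq_norm f s t < \<infinity>" and g: "\<And>r. s < r \<Longrightarrow> r \<le> t \<Longrightarrow> \<bar>g r\<bar> \<le> K"
  shows "integrable (count_space UNIV) (\<lambda>r. g r * jump_prod f k l r * indicator {s<..t} r)"
proof (rule Bochner_Integration.integrable_bound[OF integrable_mult_right[OF integrable_count_space_iff_jump_sum[OF assms(1)], of K]])
  show "AE r in count_space UNIV. norm (g r * jump_prod f k l r * indicator {s<..t} r) \<le> norm (K * (sq_norm (jump f r) * indicator {s<..t} r))"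
  proof (rule AE_I2)
    fix r
    show "norm (g r * jump_prod f k l r * indicator {s<..t} r) \<le> norm (K * (sq_norm (jump f r) * indicator {s<..t} r))"
    proof (cases "r \<in> {s<..t}")
      case True
      then have "\<bar>g r\<bar> * \<bar>jump_prod f k l r\<bar> \<le> \<bar>K\<bar> * sq_norm (jump f r)"
        using g[of r] by (intro mult_mono abs_jump_prod_le) auto
      then show ?thesis using True by (simp add: abs_mult)
    qed simp
  qed
qed simp

lemma jump_sum_sq_norm:
  fixes f :: "real \<Rightarrow> real^'n"
  shows "jump_sum sq_norm f s t = (\<Sum>i\<in>UNIV. jump_sum (\<lambda>x. (axis i 1 \<bullet> x)\<^sup>2) f s t)"
proof -
  have sq: "ennreal (sq_norm x) = (\<Sum>i\<in>UNIV. ennreal ((axis i 1 \<bullet> x)\<^sup>2))" for x :: "real^'n"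
    unfolding power2_norm_eq_inner inner_axis' inner_vec_def[of x x] by (simp add: power2_eq_square)
  show ?thesis unfolding jump_sum_def sq sum_distrib_right by (rule nn_integral_sum) simp
qed

lemma abs_integral_jump_prod_le:
  assumes S: "jump_sum sq_norm f s t < \<infinity>" and g: "\<And>r. s < r \<Longrightarrow> r \<le> t \<Longrightarrow> \<bar>g r\<bar> \<le> K"
  shows "\<bar>\<integral>r. g r * jump_prod f k l r * indicator {s<..t} r \<partial>count_space UNIV\<bar> \<le> K * enn2real (jump_sum sq_norm f s t)"
proof -
  note i = integrable_count_space_iff_jump_sum[OF S]
  have J: "enn2real (jump_sum sq_norm f s t) = (\<integral>r. sq_norm (jump f r) * indicator {s<..t} r \<partial>count_space UNIV)"
  proof -
    have "jump_sum sq_norm f s t = (\<integral>\<^sup>+r. ennreal (sq_norm (jump f r) * indicator {s<..t} r) \<partial>count_space UNIV)"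
      unfolding jump_sum_def by (intro nn_integral_cong) (auto split: split_indicator)
    also have "\<dots> = ennreal (\<integral>r. sq_norm (jump f r) * indicator {s<..t} r \<partial>count_space UNIV)"
      by (rule nn_integral_eq_integral[OF i]) auto
    finally show ?thesis by (simp add: Bochner_Integration.integral_nonneg)
  qed
  have "\<bar>\<integral>r. g r * jump_prod f k l r * indicator {s<..t} r \<partial>count_space UNIV\<bar>
    \<le> (\<integral>r. \<bar>g r * jump_prod f k l r * indicator {s<..t} r\<bar> \<partial>count_space UNIV)"
    by (rule integral_abs_bound)
  also have "\<dots> \<le> (\<integral>r. K * (sq_norm (jump f r) * indicator {s<..t} r) \<partial>count_space UNIV)"
  proof (rule Bochner_Integration.integral_mono)
    show "integrable (count_space UNIV) (\<lambda>r. \<bar>g r * jump_prod f k l r * indicator {s<..t} r\<bar>)"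
      by (intro integrable_abs integrable_jump_prod[OF S g])
    show "\<bar>g r * jump_prod f k l r * indicator {s<..t} r\<bar> \<le> K * (sq_norm (jump f r) * indicator {s<..t} r)" for r
    proof (cases "r \<in> {s<..t}")
      case True
      then have "\<bar>g r\<bar> * \<bar>jump_prod f k l r\<bar> \<le> K * sq_norm (jump f r)"
        using g[of r] by (intro mult_mono abs_jump_prod_le) auto
      then show ?thesis using True by (simp add: abs_mult)
    qed simp
  qed (intro integrable_mult_right i)
  finally show ?thesis by (simp add: J)
qed

lemma jump_sum_interval_mono: "s' \<le> s \<Longrightarrow> t \<le> t' \<Longrightarrow> jump_sum \<phi> f s t \<le> jump_sum \<phi> f s' t'"
  unfolding jump_sum_def by (intro nn_integral_mono mult_left_mono) (auto split: split_indicator)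

text \<open>The left-hand side is the Riemann sum to which independence applies, cell by cell; the
  right-hand side is the form in which its limit can be taken along a path.\<close>

lemma jump_integral_step:
  assumes u: "0 \<le> u" "u \<le> t" and S: "jump_sum sq_norm g u t < \<infinity>"
  shows "(\<Sum>i<N. f (grid u t N i) * (\<integral>r. jump_prod g k l r * indicator {grid u t N i<..grid u t N (Suc i)} r \<partial>count_space UNIV)) =
    (\<integral>r. step_fun f u t N r * jump_prod g k l r * indicator {u<..t} r \<partial>count_space UNIV)"
proof -
  have i: "integrable (count_space UNIV) (\<lambda>r. jump_prod g k l r * indicator {grid u t N i<..grid u t N (Suc i)} r)" if "i < N" for i
  proof -
    have "jump_sum sq_norm g (grid u t N i) (grid u t N (Suc i)) \<le> jump_sum sq_norm g u t"
      using that by (intro jump_sum_interval_mono grid_ge grid_le u) auto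
    then have "jump_sum sq_norm g (grid u t N i) (grid u t N (Suc i)) < \<infinity>" using S by (rule order.strict_trans1)
    from integrable_jump_prod[OF this, of "\<lambda>_. 1" 1 k l] show ?thesis by simp
  qed
  have "step_fun f u t N r * jump_prod g k l r * indicator {u<..t} r = step_fun f u t N r * jump_prod g k l r" for r
    using step_fun_outside[OF u(2), of r f N] by (auto simp: indicator_def)
  then have "(\<integral>r. step_fun f u t N r * jump_prod g k l r * indicator {u<..t} r \<partial>count_space UNIV) =
    (\<integral>r. (\<Sum>i<N. f (grid u t N i) * (jump_prod g k l r * indicator {grid u t N i<..grid u t N (Suc i)} r)) \<partial>count_space UNIV)"
    unfolding step_fun_def sum_distrib_right by (simp only: mult_ac)
  also have "\<dots> = (\<Sum>i<N. f (grid u t N i) * (\<integral>r. jump_prod g k l r * indicator {grid u t N i<..grid u t N (Suc i)} r \<partial>count_space UNIV))"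
    by (subst Bochner_Integration.integral_sum) (auto intro!: integrable_mult_right i)
  finally show ?thesis by simp
qed

text \<open>Dominated convergence over the jump times: the path is bounded by some \<open>K\<close>
  on the interval, and \<open>K\<close> times the squared jump is a summable majorant.\<close>

lemma jump_integral_step_tendsto:
  assumes f: "cadlag f" and u: "0 \<le> u" "u \<le> t" and S: "jump_sum sq_norm g u t < \<infinity>"
  shows "(\<lambda>N. \<integral>r. step_fun f u t N r * jump_prod g k l r * indicator {u<..t} r \<partial>count_space UNIV)
     \<longlonglongrightarrow> (\<integral>r. left_limit f r * jump_prod g k l r * indicator {u<..t} r \<partial>count_space UNIV)"
proof -
  obtain K where K: "\<And>s. 0 \<le> s \<Longrightarrow> s \<le> t \<Longrightarrow> norm (f s) \<le> K"
    using cadlag_bounded[OF f, of t] by metis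
  show ?thesis
  proof (rule integral_dominated_convergence[where w = "\<lambda>r. K * (sq_norm (jump g r) * indicator {u<..t} r)"])
    show "AE r in count_space UNIV. norm (step_fun f u t N r * jump_prod g k l r * indicator {u<..t} r) \<le> K * (sq_norm (jump g r) * indicator {u<..t} r)" for N
    proof (rule AE_I2)
      fix r
      have b: "\<bar>step_fun f u t N r\<bar> \<le> K * indicator {u<..t} r"
        using K u by (intro step_fun_bound) auto
      have "\<bar>step_fun f u t N r\<bar> * \<bar>jump_prod g k l r\<bar> \<le> (K * indicator {u<..t} r) * sq_norm (jump g r)"
        using order_trans[OF abs_ge_zero b] by (intro mult_mono b abs_jump_prod_le) auto
      then show "norm (step_fun f u t N r * jump_prod g k l r * indicator {u<..t} r) \<le> K * (sq_norm (jump g r) * indicator {u<..t} r)"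
        by (cases "r \<in> {u<..t}") (simp_all add: abs_mult mult_ac)
    qed
    show "integrable (count_space UNIV) (\<lambda>r. K * (sq_norm (jump g r) * indicator {u<..t} r))"
      by (intro integrable_mult_right integrable_count_space_iff_jump_sum S)
    show "AE r in count_space UNIV. (\<lambda>N. step_fun f u t N r * jump_prod g k l r * indicator {u<..t} r) \<longlonglongrightarrow>
      left_limit f r * jump_prod g k l r * indicator {u<..t} r"
    proof (rule AE_I2)
      fix r
      have "(\<lambda>N. step_fun f u t N r * jump_prod g k l r * indicator {u<..t} r) \<longlonglongrightarrow>
        left_limit f r * indicator {u<..t} r * jump_prod g k l r * indicator {u<..t} r"
        by (intro tendsto_mult tendsto_const step_fun_tendsto f u)
      then show "(\<lambda>N. step_fun f u t N r * jump_prod g k l r * indicator {u<..t} r) \<longlonglongrightarrow>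
        left_limit f r * jump_prod g k l r * indicator {u<..t} r"
        by (cases "r \<in> {u<..t}") simp_all
    qed
  qed auto
qed

lemma integrable_cadlag:
  fixes f :: "real \<Rightarrow> real"
  assumes f: "cadlag f" and u: "0 \<le> u" "u \<le> t"
  shows "integrable lborel (\<lambda>r. f r * indicator {u<..t} r)"
proof -
  obtain K where K: "\<And>s. 0 \<le> s \<Longrightarrow> s \<le> t \<Longrightarrow> norm (f s) \<le> K"
    using cadlag_bounded[OF f, of t] by metis
  show ?thesis
  proof (rule Bochner_Integration.integrable_bound[OF integrable_indicator_Ioc[of K u t]])
    show "AE r in lborel. norm (f r * indicator {u<..t} r) \<le> norm (K * indicator {u<..t} r)"
      using K u by (intro AE_I2) (auto simp: indicator_def intro!: order_trans[OF K[unfolded real_norm_def] abs_ge_self])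
  qed (use cadlag_measurable(1)[OF f u] in simp)
qed

context levy_path
begin

text \<open>Layer cake: the superlevel sets of \<open>q\<close> have regular indicators, and \<open>\<nu>\<close> is given by its values on sets.\<close>

lemma nn_integral_levy_measure:
  assumes \<nu>: "is_levy_measure M L \<nu>" and q: "continuous_on UNIV q" "q 0 = 0" "\<And>x. 0 \<le> q x"
  shows "(\<integral>\<^sup>+x. ennreal (q x) \<partial>\<nu>) = (\<integral>\<^sup>+\<omega>. jump_sum q (\<lambda>t. L t \<omega>) 0 1 \<partial>M)"
proof -
  have S [measurable_cong]: "sets \<nu> = sets borel"
    and e: "\<And>D. D \<in> sets borel \<Longrightarrow> emeasure \<nu> D = (\<integral>\<^sup>+\<omega>. emeasure (count_space UNIV) {s \<in> {0<..1}. jump (\<lambda>r. L r \<omega>) s \<in> D - {0}} \<partial>M)"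
    using \<nu> unfolding is_levy_measure_def by auto
  have qm [measurable]: "q \<in> borel_measurable borel" using q(1) by (rule borel_measurable_continuous_onI)
  define I where "I n k x = (indicator {x. real k / real (Suc n) < q x} x :: real)" for n k x
  \<comment> \<open>The levels \<open>k / (n + 1)\<close> run up to height \<open>n + 1\<close>.
    Starting at \<open>k = 1\<close> keeps the superlevel sets away from the origin, as regularity
    of their indicators demands.\<close>
  define R where "R n = {1..Suc n * Suc n}" for n
  have R: "finite (R n)" "\<And>k. k \<in> R n \<Longrightarrow> k \<ge> 1" for n by (auto simp: R_def)
  define \<phi> where "\<phi> n x = (\<Sum>k\<in>R n. (1 / real (Suc n)) * I n k x)" for n x
  have I0: "0 \<le> I n k x" for n k x by (simp add: I_def)
  have reg: "regular (I n k)" if "k \<ge> 1" for n k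
    unfolding I_def using that by (intro regular_superlevel[OF q(1,2)]) auto
  have Im: "(\<lambda>\<omega>. jump_sum (I n k) (\<lambda>t. L t \<omega>) 0 1) \<in> borel_measurable M" if "k \<ge> 1" for n k
    using reg[OF that] unfolding regular_def by simp
  have Inu: "(\<integral>\<^sup>+x. ennreal (I n k x) \<partial>\<nu>) = (\<integral>\<^sup>+\<omega>. jump_sum (I n k) (\<lambda>t. L t \<omega>) 0 1 \<partial>M)" if k: "k \<ge> 1" for n k
  proof -
    let ?D = "{x. real k / real (Suc n) < q x}"
    have D: "?D \<in> sets borel" by measurable
    have z: "0 \<notin> ?D" by (simp add: q(2) not_less)
    have "(\<integral>\<^sup>+x. ennreal (I n k x) \<partial>\<nu>) = emeasure \<nu> ?D"
      using D by (simp add: I_def ennreal_indicator S)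
    also have "\<dots> = (\<integral>\<^sup>+\<omega>. jump_sum (I n k) (\<lambda>t. L t \<omega>) 0 1 \<partial>M)"
      unfolding e[OF D]
    proof (rule nn_integral_cong)
      fix \<omega>
      have "jump_sum (I n k) (\<lambda>t. L t \<omega>) 0 1 = (\<integral>\<^sup>+r. indicator {s \<in> {0<..1}. jump (\<lambda>r. L r \<omega>) s \<in> ?D - {0}} r \<partial>count_space UNIV)"
        unfolding jump_sum_def using z by (intro nn_integral_cong) (auto simp: I_def indicator_def)
      then show "emeasure (count_space UNIV) {s \<in> {0<..1}. jump (\<lambda>r. L r \<omega>) s \<in> ?D - {0}} = jump_sum (I n k) (\<lambda>t. L t \<omega>) 0 1"
        by (simp del: indicator_simps)
    qed
    finally show ?thesis .
  qed
  have e\<phi>: "ennreal (\<phi> n x) = (\<Sum>k\<in>R n. ennreal (1 / real (Suc n)) * ennreal (I n k x))" for n x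
  proof -
    have "ennreal (\<phi> n x) = (\<Sum>k\<in>R n. ennreal ((1 / real (Suc n)) * I n k x))"
      unfolding \<phi>_def by (rule sum_ennreal[symmetric]) (simp add: I0)
    also have "\<dots> = (\<Sum>k\<in>R n. ennreal (1 / real (Suc n)) * ennreal (I n k x))"
      by (intro sum.cong refl ennreal_mult) (simp_all add: I0)
    finally show ?thesis .
  qed
  have js: "jump_sum (\<phi> n) f s t = (\<Sum>k\<in>R n. ennreal (1 / real (Suc n)) * jump_sum (I n k) f s t)" for n f s t
    unfolding jump_sum_def e\<phi> sum_distrib_right
    by (subst nn_integral_sum) (auto simp: nn_integral_cmult mult.assoc simp del: of_nat_Suc intro!: nn_integral_cong sum.cong)
  have step: "(\<integral>\<^sup>+x. ennreal (\<phi> n x) \<partial>\<nu>) = (\<integral>\<^sup>+\<omega>. jump_sum (\<phi> n) (\<lambda>t. L t \<omega>) 0 1 \<partial>M)" for n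
  proof -
    have [measurable]: "I n k \<in> borel_measurable borel" for k unfolding I_def by measurable
    have "(\<integral>\<^sup>+x. ennreal (\<phi> n x) \<partial>\<nu>) = (\<Sum>k\<in>R n. ennreal (1 / real (Suc n)) * (\<integral>\<^sup>+x. ennreal (I n k x) \<partial>\<nu>))"
      unfolding e\<phi> by (simp add: nn_integral_sum nn_integral_cmult del: of_nat_Suc)
    also have "\<dots> = (\<Sum>k\<in>R n. ennreal (1 / real (Suc n)) * (\<integral>\<^sup>+\<omega>. jump_sum (I n k) (\<lambda>t. L t \<omega>) 0 1 \<partial>M))"
      using Inu R by (intro sum.cong) auto
    also have "\<dots> = (\<integral>\<^sup>+\<omega>. (\<Sum>k\<in>R n. ennreal (1 / real (Suc n)) * jump_sum (I n k) (\<lambda>t. L t \<omega>) 0 1) \<partial>M)"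
      using Im R by (subst nn_integral_sum) (auto simp: nn_integral_cmult simp del: of_nat_Suc intro!: sum.cong)
    also have "\<dots> = (\<integral>\<^sup>+\<omega>. jump_sum (\<phi> n) (\<lambda>t. L t \<omega>) 0 1 \<partial>M)"
      by (simp only: js)
    finally show ?thesis .
  qed
  have bounds: "\<phi> n x \<le> q x" "q x \<le> real n \<Longrightarrow> q x - 1 / real (Suc n) \<le> \<phi> n x" for n x
  proof -
    define y where "y = q x * real (Suc n)"
    \<comment> \<open>The number of integers \<open>k\<close> with \<open>1 \<le> k\<close> and
      \<open>k < y\<close>. The strict inequality makes it one less than the ceiling, and
      \<open>nat\<close> returns 0 for \<open>y = 0\<close>.\<close>
    define K where "K = nat (\<lceil>y\<rceil> - 1)"
    have y0: "0 \<le> y" using q(3) by (simp add: y_def)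
    have K: "real K < y \<longleftrightarrow> y > 0" "y \<le> real K + 1" "real K \<le> y"
      using y0 by (auto simp: K_def) linarith+
    have kK: "real k < y \<longleftrightarrow> k \<le> K" if "k \<ge> 1" for k
      using that y0 unfolding K_def by linarith
    have "\<phi> n x = real (card {k \<in> {1..Suc n * Suc n}. real k < y}) / real (Suc n)"
      unfolding \<phi>_def I_def y_def R_def
    proof -
      have "(\<Sum>k\<in>{1..Suc n * Suc n}. (1 / real (Suc n)) * (indicator {x. real k / real (Suc n) < q x} x :: real))
        = (\<Sum>k\<in>{1..Suc n * Suc n}. if real k < q x * real (Suc n) then 1 / real (Suc n) else 0)"
        by (intro sum.cong refl) (simp add: indicator_def pos_divide_less_eq del: of_nat_Suc)
      also have "\<dots> = (\<Sum>k\<in>{k \<in> {1..Suc n * Suc n}. real k < q x * real (Suc n)}. 1 / real (Suc n))"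
        by (rule sum.inter_filter[symmetric]) simp
      finally show "(\<Sum>k\<in>{1..Suc n * Suc n}. (1 / real (Suc n)) * (indicator {x. real k / real (Suc n) < q x} x :: real))
        = real (card {k \<in> {1..Suc n * Suc n}. real k < q x * real (Suc n)}) / real (Suc n)" by simp
    qed
    moreover have sub: "{k \<in> {1..Suc n * Suc n}. real k < y} = {1..min K (Suc n * Suc n)}"
      using kK by auto
    ultimately have \<phi>: "\<phi> n x = real (min K (Suc n * Suc n)) / real (Suc n)" by (simp del: of_nat_Suc)
    have "\<phi> n x \<le> y / real (Suc n)"
      unfolding \<phi> using K(3) by (intro divide_right_mono) auto
    then show "\<phi> n x \<le> q x" by (simp add: y_def del: of_nat_Suc)
    assume "q x \<le> real n"
    then have "y \<le> real n * real (Suc n)" unfolding y_def by (intro mult_right_mono) auto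
    also have "\<dots> \<le> real (Suc n * Suc n)" by (simp add: algebra_simps)
    finally have "K \<le> Suc n * Suc n" using K(3) by linarith
    then have "\<phi> n x = real K / real (Suc n)" using \<phi> by simp
    also have "\<dots> \<ge> (y - 1) / real (Suc n)" using K(2) by (intro divide_right_mono) auto
    also have "(y - 1) / real (Suc n) = q x - 1 / real (Suc n)" by (simp add: y_def diff_divide_distrib del: of_nat_Suc)
    finally show "q x - 1 / real (Suc n) \<le> \<phi> n x" .
  qed
  have lim: "(\<lambda>n. \<phi> n x) \<longlonglongrightarrow> q x" for x
  proof (rule tendsto_sandwich)
    obtain m where m: "q x \<le> real m" using real_arch_simple by blast
    show "\<forall>\<^sub>F n in sequentially. q x - 1 / real (Suc n) \<le> \<phi> n x"
      using eventually_ge_at_top[of m]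
    proof eventually_elim
      case (elim n)
      then have "q x \<le> real n" using m by linarith
      then show ?case by (rule bounds)
    qed
    have "(\<lambda>n. q x - 1 / real (Suc n)) \<longlonglongrightarrow> q x - 0"
      by (intro tendsto_intros LIMSEQ_Suc[OF lim_const_over_n])
    then show "(\<lambda>n. q x - 1 / real (Suc n)) \<longlonglongrightarrow> q x" by (simp del: of_nat_Suc)
  qed (use bounds in auto)
  have 1: "(\<lambda>n. \<integral>\<^sup>+x. ennreal (\<phi> n x) \<partial>\<nu>) \<longlonglongrightarrow> (\<integral>\<^sup>+x. ennreal (q x) \<partial>\<nu>)"
  proof (rule nn_integral_tendsto_below)
    show "(\<lambda>x. ennreal (\<phi> n x)) \<in> borel_measurable \<nu>" for n
      unfolding \<phi>_def I_def by measurable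
  qed (auto intro!: AE_I2 ennreal_leI bounds tendsto_ennrealI lim)
  have 2: "(\<lambda>n. \<integral>\<^sup>+\<omega>. jump_sum (\<phi> n) (\<lambda>t. L t \<omega>) 0 1 \<partial>M) \<longlonglongrightarrow> (\<integral>\<^sup>+\<omega>. jump_sum q (\<lambda>t. L t \<omega>) 0 1 \<partial>M)"
  proof (rule nn_integral_tendsto_below)
    show "(\<lambda>\<omega>. jump_sum (\<phi> n) (\<lambda>t. L t \<omega>) 0 1) \<in> borel_measurable M" for n
      unfolding js using Im R by (intro borel_measurable_sum borel_measurable_times_ennreal) auto
  qed (auto intro!: AE_I2 jump_sum_mono bounds jump_sum_tendsto_below lim)
  show ?thesis using LIMSEQ_unique[OF 1[unfolded step] 2] .
qed

end

lemma outer_mult_vector: "outer x y *v v = (y \<bullet> v) *\<^sub>R x"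
  by (simp add: outer_def vec_eq_iff matrix_vector_mult_def inner_vec_def sum_distrib_left ac_simps)

lemma bounded_linear_quadratic_form: "bounded_linear (\<lambda>X :: real^'n^'n. v \<bullet> (X *v v))"
  by (rule linear_conv_bounded_linear[THEN iffD1], rule linearI)
     (simp_all add: matrix_vector_mult_add_rdistrib inner_add_right scaleR_matrix_vector_assoc[symmetric])

definition clip :: "real \<Rightarrow> real \<Rightarrow> real" where
  "clip K x = max (- K) (min K x)"

lemma clip_bound: "0 \<le> K \<Longrightarrow> \<bar>clip K x\<bar> \<le> K" and abs_clip_le: "0 \<le> K \<Longrightarrow> \<bar>clip K x\<bar> \<le> \<bar>x\<bar>"
  and clip_nonneg: "0 \<le> K \<Longrightarrow> 0 \<le> x \<Longrightarrow> 0 \<le> clip K x" and clip_le: "0 \<le> K \<Longrightarrow> 0 \<le> x \<Longrightarrow> clip K x \<le> x"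
  by (auto simp: clip_def)

lemma clip_eq: "\<bar>x\<bar> \<le> K \<Longrightarrow> clip K x = x"
  by (auto simp: clip_def)

lemma continuous_clip: "continuous_on UNIV (clip K)"
  unfolding clip_def[abs_def] by (intro continuous_intros)

lemma clip_measurable [measurable]: "clip K \<in> borel_measurable borel"
  by (rule borel_measurable_continuous_onI[OF continuous_clip])

lemma cadlag_clip:
  assumes "cadlag f"
  shows "cadlag (\<lambda>t. clip K (f t))" "0 \<le> t \<Longrightarrow> left_limit (\<lambda>t. clip K (f t)) t = clip K (left_limit f t)"
  using cadlag_compose[OF assms closed_UNIV _ continuous_clip] by auto

lemma cadlag_abs:
  fixes f :: "real \<Rightarrow> real"
  assumes "cadlag f"
  shows "cadlag (\<lambda>t. \<bar>f t\<bar>)" "0 \<le> t \<Longrightarrow> left_limit (\<lambda>t. \<bar>f t\<bar>) t = \<bar>left_limit f t\<bar>"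
proof -
  have "continuous_on UNIV (abs :: real \<Rightarrow> real)" using continuous_on_rabs[OF continuous_on_id] by simp
  from cadlag_compose[OF assms closed_UNIV _ this] show "cadlag (\<lambda>t. \<bar>f t\<bar>)"
    "0 \<le> t \<Longrightarrow> left_limit (\<lambda>t. \<bar>f t\<bar>) t = \<bar>left_limit f t\<bar>" by auto
qed

section \<open>Means of products of jump components\<close>

locale second_moment_levy_path = levy_path M F L + complete_measure M
  for M :: "'a measure" and F and L :: "real \<Rightarrow> 'a \<Rightarrow> real^'d::finite" +
  fixes \<nu> :: "(real^'d) measure" and \<sigma> :: real
  assumes levy_measure: "is_levy_measure M L \<nu>"
    and \<sigma>_nonneg: "0 \<le> \<sigma>"
    and second_moment: "has_bochner_integral \<nu> (\<lambda>x. outer x x) (\<sigma> *\<^sub>R mat 1)"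
begin

text \<open>Pairing with the quadratic form of \<open>v\<close> turns the matrix moment into a
  scalar one with nonnegative integrand, which is comparable with the mean of a jump sum.\<close>

lemma nn_integral_quadratic:
  "(\<integral>\<^sup>+x. ennreal ((v \<bullet> x)\<^sup>2) \<partial>\<nu>) = ennreal (\<sigma> * sq_norm v)"
proof -
  have "has_bochner_integral \<nu> (\<lambda>x. v \<bullet> (outer x x *v v)) (v \<bullet> ((\<sigma> *\<^sub>R mat 1) *v v))"
    by (rule has_bochner_integral_bounded_linear[OF bounded_linear_quadratic_form second_moment])
  moreover have "v \<bullet> (outer x x *v v) = (v \<bullet> x)\<^sup>2" for x
    by (simp add: outer_mult_vector power2_eq_square inner_commute)
  moreover have "v \<bullet> ((\<sigma> *\<^sub>R mat 1) *v v) = \<sigma> * sq_norm v"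
    by (simp add: scaleR_matrix_vector_assoc[symmetric] power2_norm_eq_inner)
  ultimately have "has_bochner_integral \<nu> (\<lambda>x. (v \<bullet> x)\<^sup>2) (\<sigma> * sq_norm v)" by simp
  then show ?thesis
    by (subst nn_integral_eq_integral) (auto simp: has_bochner_integral_iff)
qed

lemma regular_quadratic: "regular (\<lambda>x. (v \<bullet> x)\<^sup>2)"
  by (rule regular_continuous) (auto intro!: continuous_intros)

lemma jump_sum_quadratic_measurable:
  "0 \<le> s \<Longrightarrow> s \<le> t \<Longrightarrow> (\<lambda>\<omega>. jump_sum (\<lambda>x. (v \<bullet> x)\<^sup>2) (\<lambda>t. L t \<omega>) s t) \<in> borel_measurable M"
  using regular_quadratic[of v] unfolding regular_def by blast

lemma jump_sum_quadratic_mean: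
  assumes st: "0 \<le> s" "s \<le> t" and H: "H \<in> borel_measurable (F s)" "(\<integral>\<^sup>+\<omega>. H \<omega> \<partial>M) < \<infinity>"
  shows "(\<integral>\<^sup>+\<omega>. H \<omega> * jump_sum (\<lambda>x. (v \<bullet> x)\<^sup>2) (\<lambda>t. L t \<omega>) s t \<partial>M) =
    (\<integral>\<^sup>+\<omega>. H \<omega> \<partial>M) * ennreal ((t - s) * (\<sigma> * sq_norm v))"
proof -
  have 1: "(\<integral>\<^sup>+\<omega>. jump_sum (\<lambda>x. (v \<bullet> x)\<^sup>2) (\<lambda>t. L t \<omega>) 0 1 \<partial>M) = ennreal (\<sigma> * sq_norm v)"
    unfolding nn_integral_quadratic[symmetric]
    by (rule nn_integral_levy_measure[OF levy_measure, symmetric]) (auto intro!: continuous_intros)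
  have "(\<integral>\<^sup>+\<omega>. jump_sum (\<lambda>x. (v \<bullet> x)\<^sup>2) (\<lambda>t. L t \<omega>) 0 1 \<partial>M) < \<infinity>" unfolding 1 by simp
  from regular_mean[OF regular_quadratic this st H, unfolded 1] show ?thesis
    using st \<sigma>_nonneg by (simp add: ennreal_mult)
qed

text \<open>Countably many null sets, one for each coordinate and integer horizon, are enough for
  all times because jump sums are monotone in the interval.\<close>

lemma AE_jump_sum_finite: "AE \<omega> in M. \<forall>s t. 0 \<le> s \<longrightarrow> jump_sum sq_norm (\<lambda>t. L t \<omega>) s t < \<infinity>"
proof -
  have "AE \<omega> in M. jump_sum (\<lambda>x. (axis i 1 \<bullet> x)\<^sup>2) (\<lambda>t. L t \<omega>) 0 (real n) \<noteq> \<infinity>" for i n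
  proof (rule nn_integral_noteq_infinite)
    show "(\<integral>\<^sup>+\<omega>. jump_sum (\<lambda>x. (axis i 1 \<bullet> x)\<^sup>2) (\<lambda>t. L t \<omega>) 0 (real n) \<partial>M) \<noteq> \<infinity>"
      using jump_sum_quadratic_mean[of 0 "real n" "\<lambda>_. 1" "axis i 1"] by (simp add: emeasure_space_1)
  qed (rule jump_sum_quadratic_measurable, auto)
  then have "AE \<omega> in M. \<forall>n. \<forall>i\<in>UNIV. jump_sum (\<lambda>x. (axis i 1 \<bullet> x)\<^sup>2) (\<lambda>t. L t \<omega>) 0 (real n) \<noteq> \<infinity>"
    by (simp add: AE_all_countable)
  then show ?thesis
  proof eventually_elim
    case (elim \<omega>)
    show ?case
    proof (intro allI impI)
      fix s t :: real assume "0 \<le> s"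
      obtain n where n: "t \<le> real n" using real_arch_simple by blast
      have "jump_sum sq_norm (\<lambda>t. L t \<omega>) 0 (real n) = (\<Sum>i\<in>UNIV. jump_sum (\<lambda>x. (axis i 1 \<bullet> x)\<^sup>2) (\<lambda>t. L t \<omega>) 0 (real n))"
        by (rule jump_sum_sq_norm)
      also have "\<dots> < \<infinity>" using elim by (simp add: less_top)
      finally have "jump_sum sq_norm (\<lambda>t. L t \<omega>) 0 (real n) < \<infinity>" .
      then show "jump_sum sq_norm (\<lambda>t. L t \<omega>) s t < \<infinity>"
        using jump_sum_interval_mono[OF \<open>0 \<le> s\<close> n] by (rule order.strict_trans1[rotated])
    qed
  qed
qed

text \<open>The increment over \<open>{s<..t}\<close> of the (k, l) entry of the discontinuous
  quadratic variation.\<close>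

definition covariation :: "'d \<Rightarrow> 'd \<Rightarrow> real \<Rightarrow> real \<Rightarrow> 'a \<Rightarrow> real" where
  "covariation k l s t \<omega> = (\<integral>r. jump_prod (\<lambda>t. L t \<omega>) k l r * indicator {s<..t} r \<partial>count_space UNIV)"

lemma quadratic_mean_real:
  assumes st: "0 \<le> s" "s \<le> t" and H: "H \<in> borel_measurable (F s)" "integrable M H"
  shows "has_bochner_integral M (\<lambda>\<omega>. H \<omega> * enn2real (jump_sum (\<lambda>x. (v \<bullet> x)\<^sup>2) (\<lambda>t. L t \<omega>) s t))
    ((\<integral>\<omega>. H \<omega> \<partial>M) * ((t - s) * (\<sigma> * sq_norm v)))"
proof -
  let ?J = "\<lambda>\<omega>. jump_sum (\<lambda>x. (v \<bullet> x)\<^sup>2) (\<lambda>t. L t \<omega>) s t"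
  let ?c = "(t - s) * (\<sigma> * sq_norm v)"
  have c: "0 \<le> ?c" using st \<sigma>_nonneg by simp
  have Jm [measurable]: "?J \<in> borel_measurable M" by (rule jump_sum_quadratic_measurable[OF st])
  have fin: "AE \<omega> in M. ?J \<omega> \<noteq> \<infinity>"
  proof (rule nn_integral_noteq_infinite)
    show "(\<integral>\<^sup>+\<omega>. ?J \<omega> \<partial>M) \<noteq> \<infinity>"
      using jump_sum_quadratic_mean[OF st, of "\<lambda>_. 1" v] by (simp add: emeasure_space_1)
  qed measurable
  have pos: "has_bochner_integral M (\<lambda>\<omega>. G \<omega> * enn2real (?J \<omega>)) ((\<integral>\<omega>. G \<omega> \<partial>M) * ?c)"
    if G: "G \<in> borel_measurable (F s)" "integrable M G" "\<And>\<omega>. 0 \<le> G \<omega>" for G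
  proof (rule has_bochner_integral_nn_integral)
    have "(\<integral>\<^sup>+\<omega>. ennreal (G \<omega> * enn2real (?J \<omega>)) \<partial>M) = (\<integral>\<^sup>+\<omega>. ennreal (G \<omega>) * ?J \<omega> \<partial>M)"
      using fin G(3) by (intro nn_integral_cong_AE) (auto simp: ennreal_mult less_top)
    also have "\<dots> = (\<integral>\<^sup>+\<omega>. ennreal (G \<omega>) \<partial>M) * ennreal ?c"
      using G(1,2,3) by (intro jump_sum_quadratic_mean st) (auto simp: nn_integral_eq_integral)
    also have "\<dots> = ennreal ((\<integral>\<omega>. G \<omega> \<partial>M) * ?c)"
    proof -
      have "(\<integral>\<^sup>+\<omega>. ennreal (G \<omega>) \<partial>M) = ennreal (\<integral>\<omega>. G \<omega> \<partial>M)"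
        using G by (intro nn_integral_eq_integral) auto
      then show ?thesis using ennreal_mult[OF Bochner_Integration.integral_nonneg[of M G] c] G(3) st \<sigma>_nonneg by simp
    qed
    finally show "(\<integral>\<^sup>+\<omega>. ennreal (G \<omega> * enn2real (?J \<omega>)) \<partial>M) = ennreal ((\<integral>\<omega>. G \<omega> \<partial>M) * ?c)" .
    show "0 \<le> (\<integral>\<omega>. G \<omega> \<partial>M) * ?c" by (rule mult_nonneg_nonneg[OF Bochner_Integration.integral_nonneg c]) (rule G(3))
    show "(\<lambda>\<omega>. G \<omega> * enn2real (?J \<omega>)) \<in> borel_measurable M"
      using borel_measurable_integrable[OF G(2)] by measurable
  qed (use G(3) in auto)
  have m: "(\<lambda>\<omega>. max 0 (H \<omega>)) \<in> borel_measurable (F s)" "(\<lambda>\<omega>. max 0 (- H \<omega>)) \<in> borel_measurable (F s)"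
    using H(1) by measurable
  have i: "integrable M (\<lambda>\<omega>. max 0 (H \<omega>))" "integrable M (\<lambda>\<omega>. max 0 (- H \<omega>))" using H(2) by auto
  have e: "H \<omega> = max 0 (H \<omega>) - max 0 (- H \<omega>)" for \<omega> by auto
  have E: "(\<integral>\<omega>. H \<omega> \<partial>M) = (\<integral>\<omega>. max 0 (H \<omega>) \<partial>M) - (\<integral>\<omega>. max 0 (- H \<omega>) \<partial>M)"
    by (subst Bochner_Integration.integral_diff[symmetric, OF i]) (simp flip: e)
  have "has_bochner_integral M (\<lambda>\<omega>. max 0 (H \<omega>) * enn2real (?J \<omega>) - max 0 (- H \<omega>) * enn2real (?J \<omega>))
     ((\<integral>\<omega>. max 0 (H \<omega>) \<partial>M) * ?c - (\<integral>\<omega>. max 0 (- H \<omega>) \<partial>M) * ?c)"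
    by (intro has_bochner_integral_diff pos m i) auto
  then show ?thesis unfolding left_diff_distrib[symmetric] E[symmetric] by (simp flip: e)
qed

text \<open>Jump sums exist for nonnegative functions only, so the signed product is expressed
  through squares by polarisation. One null set serves all intervals.\<close>

lemma AE_covariation_eq:
  "AE \<omega> in M. \<forall>s t. 0 \<le> s \<longrightarrow> covariation k l s t \<omega> =
     (enn2real (jump_sum (\<lambda>x. ((axis k 1 + axis l 1) \<bullet> x)\<^sup>2) (\<lambda>t. L t \<omega>) s t) -
      enn2real (jump_sum (\<lambda>x. ((axis k 1 - axis l 1) \<bullet> x)\<^sup>2) (\<lambda>t. L t \<omega>) s t)) / 4"
  using AE_jump_sum_finite
proof eventually_elim
  case (elim \<omega>)
  show ?case
  proof (intro allI impI)
    fix s t :: real assume "0 \<le> s"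
    define f where "f = (\<lambda>t. L t \<omega>)"
    have S: "jump_sum sq_norm f s t < \<infinity>" using elim \<open>0 \<le> s\<close> by (simp add: f_def)
    have i: "integrable (count_space UNIV) (\<lambda>r. (v \<bullet> jump f r)\<^sup>2 * indicator {s<..t} r)" for v
    proof (rule Bochner_Integration.integrable_bound[OF integrable_mult_right[OF integrable_count_space_iff_jump_sum[OF S], of "sq_norm v"]])
      have "(v \<bullet> x)\<^sup>2 \<le> sq_norm v * sq_norm x" for x :: "real^'d"
        using Cauchy_Schwarz_ineq[of v x] by (simp add: power2_norm_eq_inner)
      then show "AE r in count_space UNIV. norm ((v \<bullet> jump f r)\<^sup>2 * indicator {s<..t} r)
        \<le> norm (sq_norm v * (sq_norm (jump f r) * indicator {s<..t} r))"
        by (intro AE_I2) (auto split: split_indicator)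
    qed simp
    have J: "enn2real (jump_sum (\<lambda>x. (v \<bullet> x)\<^sup>2) f s t) = (\<integral>r. (v \<bullet> jump f r)\<^sup>2 * indicator {s<..t} r \<partial>count_space UNIV)" for v
    proof -
      have "jump_sum (\<lambda>x. (v \<bullet> x)\<^sup>2) f s t = (\<integral>\<^sup>+r. ennreal ((v \<bullet> jump f r)\<^sup>2 * indicator {s<..t} r) \<partial>count_space UNIV)"
        unfolding jump_sum_def by (intro nn_integral_cong) (auto split: split_indicator)
      also have "\<dots> = ennreal (\<integral>r. (v \<bullet> jump f r)\<^sup>2 * indicator {s<..t} r \<partial>count_space UNIV)"
        by (rule nn_integral_eq_integral[OF i]) auto
      finally show ?thesis by (simp add: Bochner_Integration.integral_nonneg)
    qed
    have "(enn2real (jump_sum (\<lambda>x. ((axis k 1 + axis l 1) \<bullet> x)\<^sup>2) f s t) -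
      enn2real (jump_sum (\<lambda>x. ((axis k 1 - axis l 1) \<bullet> x)\<^sup>2) f s t)) / 4
      = (\<integral>r. (((axis k 1 + axis l 1) \<bullet> jump f r)\<^sup>2 * indicator {s<..t} r - ((axis k 1 - axis l 1) \<bullet> jump f r)\<^sup>2 * indicator {s<..t} r) / 4 \<partial>count_space UNIV)"
      unfolding J by (simp add: Bochner_Integration.integral_diff[OF i i])
    also have "\<dots> = covariation k l s t \<omega>"
      unfolding covariation_def f_def[symmetric]
      by (intro Bochner_Integration.integral_cong)
         (auto simp: jump_prod_def inner_simps inner_axis' power2_eq_square algebra_simps split: split_indicator)
    finally show "covariation k l s t \<omega> =
     (enn2real (jump_sum (\<lambda>x. ((axis k 1 + axis l 1) \<bullet> x)\<^sup>2) (\<lambda>t. L t \<omega>) s t) -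
      enn2real (jump_sum (\<lambda>x. ((axis k 1 - axis l 1) \<bullet> x)\<^sup>2) (\<lambda>t. L t \<omega>) s t)) / 4"
      unfolding f_def[symmetric] by simp
  qed
qed

lemma covariation_measurable:
  assumes st: "0 \<le> s" "s \<le> t"
  shows "covariation k l s t \<in> borel_measurable M"
proof (rule borel_measurable_AE_eq)
  show "(\<lambda>\<omega>. (enn2real (jump_sum (\<lambda>x. ((axis k 1 + axis l 1) \<bullet> x)\<^sup>2) (\<lambda>t. L t \<omega>) s t) -
      enn2real (jump_sum (\<lambda>x. ((axis k 1 - axis l 1) \<bullet> x)\<^sup>2) (\<lambda>t. L t \<omega>) s t)) / 4) \<in> borel_measurable M"
    using jump_sum_quadratic_measurable[OF st, of "axis k 1 + axis l 1"] jump_sum_quadratic_measurable[OF st, of "axis k 1 - axis l 1"]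
    by measurable
qed (use AE_covariation_eq[of k l] st in \<open>auto elim!: eventually_mono\<close>)

text \<open>The two squared norms that come out of the polarisation differ by 4 if
  \<open>k = l\<close> and are equal otherwise. This is how the second moment of the jumps, being a
  multiple of the identity, produces the Kronecker delta.\<close>

lemma covariation_mean:
  assumes st: "0 \<le> s" "s \<le> t" and H: "H \<in> borel_measurable (F s)" "integrable M H"
  shows "has_bochner_integral M (\<lambda>\<omega>. H \<omega> * covariation k l s t \<omega>)
    ((\<integral>\<omega>. H \<omega> \<partial>M) * ((t - s) * (if k = l then \<sigma> else 0)))"
proof -
  let ?J = "\<lambda>v \<omega>. enn2real (jump_sum (\<lambda>x. (v \<bullet> x)\<^sup>2) (\<lambda>t. L t \<omega>) s t)"
  let ?p = "axis k 1 + axis l 1 :: real^'d" and ?m = "axis k 1 - axis l 1 :: real^'d"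
  have n: "sq_norm ?p - sq_norm ?m = (if k = l then 4 else 0)"
    unfolding power2_norm_eq_inner by (auto simp: inner_simps inner_axis_axis)
  have "has_bochner_integral M (\<lambda>\<omega>. (H \<omega> * ?J ?p \<omega> - H \<omega> * ?J ?m \<omega>) / 4)
     (((\<integral>\<omega>. H \<omega> \<partial>M) * ((t - s) * (\<sigma> * sq_norm ?p)) - (\<integral>\<omega>. H \<omega> \<partial>M) * ((t - s) * (\<sigma> * sq_norm ?m))) / 4)"
    by (intro has_bochner_integral_divide has_bochner_integral_diff quadratic_mean_real st H)
  also have "((\<integral>\<omega>. H \<omega> \<partial>M) * ((t - s) * (\<sigma> * sq_norm ?p)) - (\<integral>\<omega>. H \<omega> \<partial>M) * ((t - s) * (\<sigma> * sq_norm ?m))) / 4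
    = (\<integral>\<omega>. H \<omega> \<partial>M) * ((t - s) * (if k = l then \<sigma> else 0))"
    unfolding right_diff_distrib[symmetric] n by simp
  finally show ?thesis
  proof (subst has_bochner_integral_cong_AE[rotated 2])
    show "AE \<omega> in M. H \<omega> * covariation k l s t \<omega> = (H \<omega> * ?J ?p \<omega> - H \<omega> * ?J ?m \<omega>) / 4"
      using AE_covariation_eq[of k l]
    proof eventually_elim
      case (elim \<omega>)
      show ?case unfolding elim[rule_format, OF st(1), of t] by (simp add: right_diff_distrib)
    qed
    show "(\<lambda>\<omega>. H \<omega> * covariation k l s t \<omega>) \<in> borel_measurable M"
      using covariation_measurable[OF st] H(2) by (auto dest!: borel_measurable_integrable)
  qed (auto dest: has_bochner_integral_integrable)
qed

section \<open>Compensation of jump integrals\<close>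

definition jump_integral :: "(real \<Rightarrow> 'a \<Rightarrow> real) \<Rightarrow> 'd \<Rightarrow> 'd \<Rightarrow> real \<Rightarrow> real \<Rightarrow> 'a \<Rightarrow> real" where
  "jump_integral X k l u t \<omega> =
    (\<integral>r. left_limit (\<lambda>s. X s \<omega>) r * jump_prod (\<lambda>s. L s \<omega>) k l r * indicator {u<..t} r \<partial>count_space UNIV)"

lemma integrable_jump_sum_sq_norm:
  assumes st: "0 \<le> s" "s \<le> t"
  shows "integrable M (\<lambda>\<omega>. enn2real (jump_sum sq_norm (\<lambda>t. L t \<omega>) s t))"
proof (rule integrableI_bounded)
  have m: "(\<lambda>\<omega>. jump_sum sq_norm (\<lambda>t. L t \<omega>) s t) \<in> borel_measurable M"
    unfolding jump_sum_sq_norm using jump_sum_quadratic_measurable[OF st] by measurable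
  then show "(\<lambda>\<omega>. enn2real (jump_sum sq_norm (\<lambda>t. L t \<omega>) s t)) \<in> borel_measurable M" by measurable
  have "(\<integral>\<^sup>+\<omega>. ennreal (norm (enn2real (jump_sum sq_norm (\<lambda>t. L t \<omega>) s t))) \<partial>M) \<le> (\<integral>\<^sup>+\<omega>. jump_sum sq_norm (\<lambda>t. L t \<omega>) s t \<partial>M)"
    by (intro nn_integral_mono) (auto simp: ennreal_enn2real_if)
  also have "\<dots> = (\<Sum>i\<in>UNIV. \<integral>\<^sup>+\<omega>. jump_sum (\<lambda>x. (axis i 1 \<bullet> x)\<^sup>2) (\<lambda>t. L t \<omega>) s t \<partial>M)"
    unfolding jump_sum_sq_norm using jump_sum_quadratic_measurable[OF st] by (intro nn_integral_sum) auto
  also have "\<dots> < \<infinity>"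
    using jump_sum_quadratic_mean[OF st, of "\<lambda>_. 1"]
    by (simp add: emeasure_space_1 ennreal_mult_less_top of_nat_less_top)
  finally show "(\<integral>\<^sup>+\<omega>. ennreal (norm (enn2real (jump_sum sq_norm (\<lambda>t. L t \<omega>) s t))) \<partial>M) < \<infinity>" .
qed

lemma path_integral_measurable:
  fixes X :: "real \<Rightarrow> 'a \<Rightarrow> real"
  assumes u: "0 \<le> u" "u \<le> t" and X: "\<And>s. 0 \<le> s \<Longrightarrow> X s \<in> borel_measurable M" and cad: "\<And>\<omega>. cadlag (\<lambda>s. X s \<omega>)"
  shows "(\<lambda>\<omega>. \<integral>r. X r \<omega> * indicator {u<..t} r \<partial>lborel) \<in> borel_measurable M"
proof (rule borel_measurable_LIMSEQ_real)
  fix \<omega>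
  obtain K where K: "\<And>s. 0 \<le> s \<Longrightarrow> s \<le> t \<Longrightarrow> norm (X s \<omega>) \<le> K"
    using cadlag_bounded[OF cad[of \<omega>], of t] by metis
  have "(\<lambda>N. \<integral>r. step_fun (\<lambda>s. X s \<omega>) u t N r \<partial>lborel) \<longlonglongrightarrow> (\<integral>r. X r \<omega> * indicator {u<..t} r \<partial>lborel)"
    by (rule integral_step_fun_tendsto[OF cad u, of _ K]) (use K u in auto)
  \<comment> \<open>The shift to \<open>Suc N\<close> excludes the grid without cells, for which the
    Riemann sum formula is not stated.\<close>
  then show "(\<lambda>N. \<integral>r. step_fun (\<lambda>s. X s \<omega>) u t (Suc N) r \<partial>lborel) \<longlonglongrightarrow> (\<integral>r. X r \<omega> * indicator {u<..t} r \<partial>lborel)"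
    by (rule LIMSEQ_Suc)
next
  fix N
  have "0 \<le> grid u t (Suc N) i" for i using grid_ge[OF u(2), of "Suc N" i] u by simp
  then show "(\<lambda>\<omega>. \<integral>r. step_fun (\<lambda>s. X s \<omega>) u t (Suc N) r \<partial>lborel) \<in> borel_measurable M"
    using X by (subst integral_step_fun[OF u(2)]) (auto intro!: borel_measurable_sum borel_measurable_times)
qed

text \<open>For a step integrand the identity is the mean of the covariation over each cell, with
  \<open>Z\<close> times the value at the left end as the variable known from the past. For fine
  grids the jump side is dominated by \<open>K * K\<close> times the sum of squared jumps, which is
  integrable, and the Lebesgue side by a constant.\<close>

lemma bounded_compensation:
  fixes X :: "real \<Rightarrow> 'a \<Rightarrow> real"
  assumes u: "0 \<le> u" "u \<le> t" and X: "\<And>s. 0 \<le> s \<Longrightarrow> X s \<in> borel_measurable (F s)" and cad: "\<And>\<omega>. cadlag (\<lambda>s. X s \<omega>)"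
    and XK: "\<And>s \<omega>. \<bar>X s \<omega>\<bar> \<le> K" and Z: "Z \<in> borel_measurable (F u)" and ZK: "\<And>\<omega>. \<bar>Z \<omega>\<bar> \<le> K"
  shows "has_bochner_integral M (\<lambda>\<omega>. Z \<omega> * jump_integral X k l u t \<omega>)
    ((if k = l then \<sigma> else 0) * (\<integral>\<omega>. Z \<omega> * (\<integral>r. X r \<omega> * indicator {u<..t} r \<partial>lborel) \<partial>M))"
proof -
  have K: "0 \<le> K" using XK[of 0 undefined] by linarith
  define g where "g = grid u t"
  define c where "c = (if k = l then \<sigma> else 0)"
  have g0: "0 \<le> g N i" "u \<le> g N i" for N i using grid_ge[OF u(2), of N i] u by (auto simp: g_def)
  have XM: "X s \<in> borel_measurable M" if "0 \<le> s" for s by (rule measurable_F_M[OF X]) (use that in auto)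
  have ZM [measurable]: "Z \<in> borel_measurable M" by (rule measurable_F_M[OF Z u(1)])
  have H: "(\<lambda>\<omega>. Z \<omega> * X (g N i) \<omega>) \<in> borel_measurable (F (g N i))" for N i
    using measurable_F_mono[OF Z u(1) g0(2)] X[OF g0(1)] by (rule borel_measurable_times)
  have Hi: "integrable M (\<lambda>\<omega>. Z \<omega> * X (g N i) \<omega>)" for N i
  proof (rule integrable_const_bound[where B = "K * K"])
    show "AE \<omega> in M. norm (Z \<omega> * X (g N i) \<omega>) \<le> K * K"
      using K XK ZK by (intro AE_I2) (auto simp: abs_mult intro!: mult_mono)
  qed (rule measurable_F_M[OF H g0(1)])
  define W where "W N \<omega> = (\<Sum>i<N. Z \<omega> * X (g N i) \<omega> * covariation k l (g N i) (g N (Suc i)) \<omega>)" for N \<omega>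
  have W: "has_bochner_integral M (W N) (\<Sum>i<N. (\<integral>\<omega>. Z \<omega> * X (g N i) \<omega> \<partial>M) * ((g N (Suc i) - g N i) * c))" for N
    unfolding W_def c_def
    by (intro has_bochner_integral_sum covariation_mean g0 H Hi) (auto simp: g_def intro!: grid_mono u)
  define B where "B N \<omega> = Z \<omega> * (\<integral>r. step_fun (\<lambda>s. X s \<omega>) u t N r \<partial>lborel)" for N \<omega>
  have Beq: "B N \<omega> = (\<Sum>i<N. Z \<omega> * X (g N i) \<omega> * ((t - u) / real N))" if "N > 0" for N \<omega>
    unfolding B_def integral_step_fun[OF u(2) that] g_def by (simp add: sum_distrib_left mult.assoc)
  have WB: "(\<integral>\<omega>. W N \<omega> \<partial>M) = c * (\<integral>\<omega>. B N \<omega> \<partial>M)" if N: "N > 0" for N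
  proof -
    have "(\<integral>\<omega>. B N \<omega> \<partial>M) = (\<Sum>i<N. (\<integral>\<omega>. Z \<omega> * X (g N i) \<omega> \<partial>M) * ((t - u) / real N))"
      unfolding Beq[OF N] by (subst Bochner_Integration.integral_sum) (auto intro!: integrable_mult_left Hi simp del: times_divide_eq_right)
    moreover have "(\<integral>\<omega>. W N \<omega> \<partial>M) = (\<Sum>i<N. (\<integral>\<omega>. Z \<omega> * X (g N i) \<omega> \<partial>M) * ((g N (Suc i) - g N i) * c))"
      using W by (rule has_bochner_integral_integral_eq)
    ultimately show ?thesis by (simp add: g_def grid_Suc sum_distrib_left mult_ac)
  qed
  let ?S = "\<lambda>\<omega>. jump_sum sq_norm (\<lambda>t. L t \<omega>) u t"
  have fin: "AE \<omega> in M. ?S \<omega> < \<infinity>" using AE_jump_sum_finite by eventually_elim (use u in auto)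
  have Weq: "W N \<omega> = Z \<omega> * (\<integral>r. step_fun (\<lambda>s. X s \<omega>) u t N r * jump_prod (\<lambda>t. L t \<omega>) k l r * indicator {u<..t} r \<partial>count_space UNIV)"
    if "?S \<omega> < \<infinity>" for N \<omega>
    unfolding jump_integral_step[OF u that, symmetric] W_def covariation_def g_def sum_distrib_left by (simp add: mult.assoc)
  have wi: "integrable M (\<lambda>\<omega>. K * (K * enn2real (?S \<omega>)))"
    by (intro integrable_mult_right integrable_jump_sum_sq_norm u)
  have lim: "AE \<omega> in M. (\<lambda>N. W N \<omega>) \<longlonglongrightarrow> Z \<omega> * jump_integral X k l u t \<omega>"
    using fin
  proof eventually_elim
    case (elim \<omega>)
    show ?case unfolding Weq[OF elim] jump_integral_def
      by (intro tendsto_mult tendsto_const jump_integral_step_tendsto cad u elim)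
  qed
  have bd: "AE \<omega> in M. norm (W N \<omega>) \<le> K * (K * enn2real (?S \<omega>))" for N
    using fin
  proof eventually_elim
    case (elim \<omega>)
    have b: "\<bar>step_fun (\<lambda>s. X s \<omega>) u t N r\<bar> \<le> K" if "u < r" "r \<le> t" for r
      using step_fun_bound[OF u(2), of "\<lambda>s. X s \<omega>" K N r] XK that by auto
    show ?case unfolding Weq[OF elim] real_norm_def abs_mult
      by (intro mult_mono ZK abs_integral_jump_prod_le elim b) (auto simp: K)
  qed
  have Wm: "W N \<in> borel_measurable M" for N
    using W by (auto dest!: has_bochner_integral_integrable)
  \<comment> \<open>The Riemann sums \<open>W N\<close> converge to the jump integral only almost
    surely; completeness makes the limit measurable.\<close>
  have Jm: "(\<lambda>\<omega>. Z \<omega> * jump_integral X k l u t \<omega>) \<in> borel_measurable M"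
  proof (rule borel_measurable_AE_eq)
    show "(\<lambda>\<omega>. lim (\<lambda>N. W N \<omega>)) \<in> borel_measurable M" using Wm by measurable
    show "AE \<omega> in M. lim (\<lambda>N. W N \<omega>) = Z \<omega> * jump_integral X k l u t \<omega>"
      using lim by eventually_elim (rule limI)
  qed
  have int: "integrable M (\<lambda>\<omega>. Z \<omega> * jump_integral X k l u t \<omega>)"
    by (rule integrable_dominated_convergence[OF Jm Wm wi lim bd])
  have 1: "(\<lambda>N. \<integral>\<omega>. W N \<omega> \<partial>M) \<longlonglongrightarrow> (\<integral>\<omega>. Z \<omega> * jump_integral X k l u t \<omega> \<partial>M)"
    by (rule integral_dominated_convergence[OF Jm Wm wi lim bd])
  have 2: "(\<lambda>N. \<integral>\<omega>. B (Suc N) \<omega> \<partial>M) \<longlonglongrightarrow> (\<integral>\<omega>. Z \<omega> * (\<integral>r. X r \<omega> * indicator {u<..t} r \<partial>lborel) \<partial>M)"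
  proof (rule integral_dominated_convergence[where w = "\<lambda>_. K * (K * (t - u))"])
    show "AE \<omega> in M. (\<lambda>N. B (Suc N) \<omega>) \<longlonglongrightarrow> Z \<omega> * (\<integral>r. X r \<omega> * indicator {u<..t} r \<partial>lborel)"
      unfolding B_def
      by (intro AE_I2 tendsto_mult tendsto_const LIMSEQ_Suc[OF integral_step_fun_tendsto[OF cad u XK]])
    show "AE \<omega> in M. norm (B (Suc N) \<omega>) \<le> K * (K * (t - u))" for N
    proof (rule AE_I2)
      fix \<omega>
      have "\<bar>\<integral>r. step_fun (\<lambda>s. X s \<omega>) u t (Suc N) r \<partial>lborel\<bar> \<le> (\<Sum>i<Suc N. K * ((t - u) / real (Suc N)))"
        unfolding integral_step_fun[OF u(2) zero_less_Suc]
        using u by (intro order_trans[OF sum_abs] sum_mono) (auto simp: abs_mult XK intro!: mult_right_mono divide_right_mono)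
      also have "\<dots> = K * (t - u)" by (simp del: of_nat_Suc)
      finally show "norm (B (Suc N) \<omega>) \<le> K * (K * (t - u))"
        unfolding B_def real_norm_def abs_mult using K by (intro mult_mono ZK) auto
    qed
    show "(\<lambda>\<omega>. Z \<omega> * (\<integral>r. X r \<omega> * indicator {u<..t} r \<partial>lborel)) \<in> borel_measurable M"
      using path_integral_measurable[OF u XM cad] by measurable
    show "B (Suc N) \<in> borel_measurable M" for N
      unfolding Beq[OF zero_less_Suc, abs_def]
      by (intro borel_measurable_sum borel_measurable_times ZM XM g0 borel_measurable_const)
  qed simp
  have "(\<lambda>N. \<integral>\<omega>. W (Suc N) \<omega> \<partial>M) \<longlonglongrightarrow> c * (\<integral>\<omega>. Z \<omega> * (\<integral>r. X r \<omega> * indicator {u<..t} r \<partial>lborel) \<partial>M)"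
    unfolding WB[OF zero_less_Suc] by (intro tendsto_mult tendsto_const 2)
  from LIMSEQ_unique[OF LIMSEQ_Suc[OF 1] this] int show ?thesis
    by (simp add: has_bochner_integral_iff c_def)
qed

text \<open>A path and its left limits are bounded on the interval, so clipping at a high enough
  level changes neither integral. The level depends on the path, whence eventual equality for each
  \<open>\<omega>\<close> separately.\<close>

lemma jump_integral_clip:
  assumes u: "0 \<le> u" and cad: "\<And>\<omega>. cadlag (\<lambda>s. X s \<omega>)"
  shows "\<forall>\<^sub>F n in sequentially. jump_integral (\<lambda>s \<omega>. clip (real n) (X s \<omega>)) k l u t \<omega> = jump_integral X k l u t \<omega>"
    and "\<forall>\<^sub>F n in sequentially. (\<integral>r. clip (real n) (X r \<omega>) * indicator {u<..t} r \<partial>lborel) = (\<integral>r. X r \<omega> * indicator {u<..t} r \<partial>lborel)"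
proof -
  obtain K where K: "\<And>s. 0 \<le> s \<Longrightarrow> s \<le> t \<Longrightarrow> norm (X s \<omega>) \<le> K"
    "\<And>s. 0 \<le> s \<Longrightarrow> s \<le> t \<Longrightarrow> norm (left_limit (\<lambda>s. X s \<omega>) s) \<le> K"
    using cadlag_bounded[OF cad[of \<omega>], of t] by metis
  obtain m where m: "K \<le> real m" using real_arch_simple by blast
  show "\<forall>\<^sub>F n in sequentially. jump_integral (\<lambda>s \<omega>. clip (real n) (X s \<omega>)) k l u t \<omega> = jump_integral X k l u t \<omega>"
    using eventually_ge_at_top[of m]
  proof eventually_elim
    case (elim n)
    have "left_limit (\<lambda>s. clip (real n) (X s \<omega>)) r = left_limit (\<lambda>s. X s \<omega>) r" if "r \<in> {u<..t}" for r
      using cadlag_clip(2)[OF cad, of r "real n"] clip_eq[of "left_limit (\<lambda>s. X s \<omega>) r" "real n"] K(2)[of r] that u elim m by auto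
    then show ?case
      unfolding jump_integral_def by (intro Bochner_Integration.integral_cong) (auto simp: indicator_def)
  qed
  show "\<forall>\<^sub>F n in sequentially. (\<integral>r. clip (real n) (X r \<omega>) * indicator {u<..t} r \<partial>lborel) = (\<integral>r. X r \<omega> * indicator {u<..t} r \<partial>lborel)"
    using eventually_ge_at_top[of m]
  proof eventually_elim
    case (elim n)
    have "clip (real n) (X r \<omega>) = X r \<omega>" if "r \<in> {u<..t}" for r
      using K(1)[of r] that u elim m by (intro clip_eq) auto
    then show ?case by (intro Bochner_Integration.integral_cong) (auto simp: indicator_def)
  qed
qed

text \<open>For \<open>k = l\<close> and nonnegative \<open>X\<close> and \<open>Z\<close> the
  clipped quantities stay below the unclipped ones, so the identity extends with infinite values
  allowed. It provides the integrable majorants for the signed case.\<close>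

lemma nonneg_compensation:
  fixes X :: "real \<Rightarrow> 'a \<Rightarrow> real"
  assumes u: "0 \<le> u" "u \<le> t" and X: "\<And>s. 0 \<le> s \<Longrightarrow> X s \<in> borel_measurable (F s)" and cad: "\<And>\<omega>. cadlag (\<lambda>s. X s \<omega>)"
    and X0: "\<And>s \<omega>. 0 \<le> X s \<omega>" and Z: "Z \<in> borel_measurable (F u)" and Z0: "\<And>\<omega>. 0 \<le> Z \<omega>"
  shows "(\<lambda>\<omega>. Z \<omega> * jump_integral X k k u t \<omega>) \<in> borel_measurable M"
    and "(\<integral>\<^sup>+\<omega>. ennreal (Z \<omega> * jump_integral X k k u t \<omega>) \<partial>M) =
      ennreal \<sigma> * (\<integral>\<^sup>+\<omega>. ennreal (Z \<omega> * (\<integral>r. X r \<omega> * indicator {u<..t} r \<partial>lborel)) \<partial>M)"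
proof -
  let ?X = "\<lambda>n s \<omega>. clip (real n) (X s \<omega>)" and ?Z = "\<lambda>n \<omega>. clip (real n) (Z \<omega>)"
  let ?I = "\<lambda>X \<omega>. \<integral>r. X r \<omega> * indicator {u<..t} r \<partial>lborel"
  have XM: "X s \<in> borel_measurable M" if "0 \<le> s" for s by (rule measurable_F_M[OF X]) (use that in auto)
  have ZM [measurable]: "Z \<in> borel_measurable M" by (rule measurable_F_M[OF Z u(1)])
  have IXm: "(\<lambda>\<omega>. ?I (?X n) \<omega>) \<in> borel_measurable M" for n
    by (rule path_integral_measurable[OF u _ cadlag_clip(1)[OF cad]]) (use XM in measurable)
  have b: "has_bochner_integral M (\<lambda>\<omega>. ?Z n \<omega> * jump_integral (?X n) k k u t \<omega>) (\<sigma> * (\<integral>\<omega>. ?Z n \<omega> * ?I (?X n) \<omega> \<partial>M))" for n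
  proof -
    have "has_bochner_integral M (\<lambda>\<omega>. ?Z n \<omega> * jump_integral (?X n) k k u t \<omega>)
      ((if k = k then \<sigma> else 0) * (\<integral>\<omega>. ?Z n \<omega> * ?I (?X n) \<omega> \<partial>M))"
      by (rule bounded_compensation[OF u, where K = "real n"])
         (auto intro!: measurable_compose[OF X clip_measurable] measurable_compose[OF Z clip_measurable] cadlag_clip(1) cad clip_bound)
    then show ?thesis by simp
  qed
  have ev: "\<forall>\<^sub>F n in sequentially. ?Z n \<omega> * jump_integral (?X n) k k u t \<omega> = Z \<omega> * jump_integral X k k u t \<omega>"
    and evI: "\<forall>\<^sub>F n in sequentially. ?Z n \<omega> * ?I (?X n) \<omega> = Z \<omega> * ?I X \<omega>" for \<omega>
  proof -
    obtain m where m: "\<bar>Z \<omega>\<bar> \<le> real m" using real_arch_simple by blast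
    have z: "\<forall>\<^sub>F n in sequentially. ?Z n \<omega> = Z \<omega>"
      using eventually_ge_at_top[of m] by eventually_elim (use m in \<open>auto intro!: clip_eq\<close>)
    from jump_integral_clip(1)[OF u(1), where X = X, OF cad, where t = t and k = k and l = k and \<omega> = \<omega>] z
    show "\<forall>\<^sub>F n in sequentially. ?Z n \<omega> * jump_integral (?X n) k k u t \<omega> = Z \<omega> * jump_integral X k k u t \<omega>"
      by eventually_elim simp
    from jump_integral_clip(2)[OF u(1), where X = X, OF cad, where t = t and \<omega> = \<omega>] z
    show "\<forall>\<^sub>F n in sequentially. ?Z n \<omega> * ?I (?X n) \<omega> = Z \<omega> * ?I X \<omega>"
      by eventually_elim simp
  qed
  have Am: "(\<lambda>\<omega>. ?Z n \<omega> * jump_integral (?X n) k k u t \<omega>) \<in> borel_measurable M" for n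
    using b by (auto dest!: has_bochner_integral_integrable)
  show "(\<lambda>\<omega>. Z \<omega> * jump_integral X k k u t \<omega>) \<in> borel_measurable M"
    by (rule borel_measurable_LIMSEQ_real[OF tendsto_eventually[OF ev] Am])
  have fin: "AE \<omega> in M. jump_sum sq_norm (\<lambda>t. L t \<omega>) u t < \<infinity>"
    using AE_jump_sum_finite by eventually_elim (use u in auto)
  have j0: "0 \<le> jump_prod f k k r" for f :: "real \<Rightarrow> real^'d" and r by (simp add: jump_prod_def)
  have l0: "0 \<le> left_limit (\<lambda>s. X s \<omega>) r" if "u < r" for r \<omega>
    using left_limit_in_closed[OF cad closed_atLeast[of 0], of \<omega> r] X0 that u by auto
  have le: "AE \<omega> in M. ?Z n \<omega> * jump_integral (?X n) k k u t \<omega> \<le> Z \<omega> * jump_integral X k k u t \<omega> \<and>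
      0 \<le> jump_integral (?X n) k k u t \<omega>" for n
    using fin
  proof eventually_elim
    case (elim \<omega>)
    obtain K where K: "\<And>s. 0 \<le> s \<Longrightarrow> s \<le> t \<Longrightarrow> norm (left_limit (\<lambda>s. X s \<omega>) s) \<le> K"
      using cadlag_bounded[OF cad[of \<omega>], of t] by metis
    have eq: "left_limit (\<lambda>s. ?X n s \<omega>) r = clip (real n) (left_limit (\<lambda>s. X s \<omega>) r)" if "u < r" for r
      using that u by (intro cadlag_clip(2) cad) auto
    have nn: "0 \<le> jump_integral (?X n) k k u t \<omega>"
      unfolding jump_integral_def
      by (intro Bochner_Integration.integral_nonneg) (auto simp: indicator_def eq intro!: mult_nonneg_nonneg j0 clip_nonneg l0)
    have "jump_integral (?X n) k k u t \<omega> \<le> jump_integral X k k u t \<omega>"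
      unfolding jump_integral_def
    proof (rule Bochner_Integration.integral_mono)
      show "integrable (count_space UNIV) (\<lambda>r. left_limit (\<lambda>s. X s \<omega>) r * jump_prod (\<lambda>s. L s \<omega>) k k r * indicator {u<..t} r)"
        by (rule integrable_jump_prod[OF elim, of _ K]) (use K u in auto)
      show "integrable (count_space UNIV) (\<lambda>r. left_limit (\<lambda>s. ?X n s \<omega>) r * jump_prod (\<lambda>s. L s \<omega>) k k r * indicator {u<..t} r)"
        by (rule integrable_jump_prod[OF elim, of _ "real n"]) (auto simp: eq clip_bound)
    qed (auto simp: indicator_def eq intro!: mult_right_mono j0 clip_le l0)
    with nn Z0 show ?case by (auto intro!: mult_mono clip_le)
  qed
  have l1: "(\<lambda>n. \<integral>\<^sup>+\<omega>. ennreal (?Z n \<omega> * jump_integral (?X n) k k u t \<omega>) \<partial>M) \<longlonglongrightarrow> (\<integral>\<^sup>+\<omega>. ennreal (Z \<omega> * jump_integral X k k u t \<omega>) \<partial>M)"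
  proof (rule nn_integral_tendsto_below)
    show "AE \<omega> in M. ennreal (?Z n \<omega> * jump_integral (?X n) k k u t \<omega>) \<le> ennreal (Z \<omega> * jump_integral X k k u t \<omega>)" for n
      using le[of n] by eventually_elim (auto intro: ennreal_leI)
    show "(\<lambda>\<omega>. ennreal (?Z n \<omega> * jump_integral (?X n) k k u t \<omega>)) \<in> borel_measurable M" for n
      using Am by measurable
  qed (auto intro!: AE_I2 tendsto_ennrealI tendsto_eventually[OF ev])
  have I0: "0 \<le> ?I (?X n) \<omega>" "?I (?X n) \<omega> \<le> ?I X \<omega>" for n \<omega>
  proof -
    show "0 \<le> ?I (?X n) \<omega>" by (intro Bochner_Integration.integral_nonneg mult_nonneg_nonneg clip_nonneg X0) auto
    show "?I (?X n) \<omega> \<le> ?I X \<omega>"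
      by (intro Bochner_Integration.integral_mono integrable_cadlag u cad cadlag_clip(1)) (auto intro!: mult_right_mono clip_le X0)
  qed
  have l2: "(\<lambda>n. \<integral>\<^sup>+\<omega>. ennreal (?Z n \<omega> * ?I (?X n) \<omega>) \<partial>M) \<longlonglongrightarrow> (\<integral>\<^sup>+\<omega>. ennreal (Z \<omega> * ?I X \<omega>) \<partial>M)"
  proof (rule nn_integral_tendsto_below)
    show "(\<lambda>\<omega>. ennreal (?Z n \<omega> * ?I (?X n) \<omega>)) \<in> borel_measurable M" for n
      using IXm[of n] by measurable
    show "AE \<omega> in M. ennreal (?Z n \<omega> * ?I (?X n) \<omega>) \<le> ennreal (Z \<omega> * ?I X \<omega>)" for n
      by (intro AE_I2 ennreal_leI mult_mono I0 clip_le Z0) auto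
  qed (auto intro!: AE_I2 tendsto_ennrealI tendsto_eventually[OF evI])
  have eq: "(\<integral>\<^sup>+\<omega>. ennreal (?Z n \<omega> * jump_integral (?X n) k k u t \<omega>) \<partial>M) = ennreal \<sigma> * (\<integral>\<^sup>+\<omega>. ennreal (?Z n \<omega> * ?I (?X n) \<omega>) \<partial>M)" for n
  proof -
    have Ib: "?I (?X n) \<omega> \<le> real n * (t - u)" for \<omega>
    proof -
      have "?I (?X n) \<omega> \<le> (\<integral>r. real n * indicator {u<..t} r \<partial>lborel)"
        by (intro Bochner_Integration.integral_mono integrable_cadlag u cadlag_clip(1) cad integrable_indicator_Ioc)
           (auto intro!: mult_right_mono order_trans[OF abs_ge_self clip_bound])
      also have "\<dots> = real n * (t - u)" using u by simp
      finally show ?thesis .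
    qed
    have i: "integrable M (\<lambda>\<omega>. ?Z n \<omega> * ?I (?X n) \<omega>)"
    proof (rule integrable_const_bound[where B = "real n * (real n * (t - u))"])
      show "AE \<omega> in M. norm (?Z n \<omega> * ?I (?X n) \<omega>) \<le> real n * (real n * (t - u))"
        using I0 Ib by (intro AE_I2) (auto simp: abs_mult intro!: mult_mono clip_bound)
    qed (use IXm[of n] in measurable)
    have "(\<integral>\<^sup>+\<omega>. ennreal (?Z n \<omega> * jump_integral (?X n) k k u t \<omega>) \<partial>M) = ennreal (\<integral>\<omega>. ?Z n \<omega> * jump_integral (?X n) k k u t \<omega> \<partial>M)"
    proof (rule nn_integral_eq_integral)
      show "AE \<omega> in M. 0 \<le> ?Z n \<omega> * jump_integral (?X n) k k u t \<omega>"
        using le[of n] by eventually_elim (auto intro!: mult_nonneg_nonneg clip_nonneg Z0)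
    qed (use b in \<open>auto simp: has_bochner_integral_iff\<close>)
    also have "\<dots> = ennreal (\<sigma> * (\<integral>\<omega>. ?Z n \<omega> * ?I (?X n) \<omega> \<partial>M))"
      using b by (simp add: has_bochner_integral_iff)
    also have "\<dots> = ennreal \<sigma> * ennreal (\<integral>\<omega>. ?Z n \<omega> * ?I (?X n) \<omega> \<partial>M)"
      by (rule ennreal_mult'[OF \<sigma>_nonneg])
    also have "ennreal (\<integral>\<omega>. ?Z n \<omega> * ?I (?X n) \<omega> \<partial>M) = (\<integral>\<^sup>+\<omega>. ennreal (?Z n \<omega> * ?I (?X n) \<omega>) \<partial>M)"
      by (rule nn_integral_eq_integral[symmetric, OF i]) (intro AE_I2 mult_nonneg_nonneg I0 clip_nonneg Z0, simp)
    finally show ?thesis .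
  qed
  show "(\<integral>\<^sup>+\<omega>. ennreal (Z \<omega> * jump_integral X k k u t \<omega>) \<partial>M) = ennreal \<sigma> * (\<integral>\<^sup>+\<omega>. ennreal (Z \<omega> * ?I X \<omega>) \<partial>M)"
    by (rule LIMSEQ_unique[OF l1[unfolded eq] ennreal_tendsto_cmult[OF _ l2]]) simp
qed

text \<open>By \<open>\<bar>a * b\<bar> \<le> a * a + b * b\<close> the clipped jump integrals are
  dominated by the two diagonal jump integrals of the absolute value of \<open>X\<close>, and these
  have finite mean by the nonnegative case. Dominated convergence removes the clipping.\<close>

theorem compensation:
  fixes X :: "real \<Rightarrow> 'a \<Rightarrow> real"
  assumes u: "0 \<le> u" "u \<le> t" and X: "\<And>s. 0 \<le> s \<Longrightarrow> X s \<in> borel_measurable (F s)" and cad: "\<And>\<omega>. cadlag (\<lambda>s. X s \<omega>)"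
    and Z: "Z \<in> borel_measurable (F u)"
    and fin: "(\<integral>\<^sup>+\<omega>. ennreal (\<bar>Z \<omega>\<bar> * (\<integral>r. \<bar>X r \<omega>\<bar> * indicator {u<..t} r \<partial>lborel)) \<partial>M) < \<infinity>"
  shows "has_bochner_integral M (\<lambda>\<omega>. Z \<omega> * jump_integral X k l u t \<omega>)
    ((if k = l then \<sigma> else 0) * (\<integral>\<omega>. Z \<omega> * (\<integral>r. X r \<omega> * indicator {u<..t} r \<partial>lborel) \<partial>M))"
proof -
  let ?X = "\<lambda>n s \<omega>. clip (real n) (X s \<omega>)" and ?Z = "\<lambda>n \<omega>. clip (real n) (Z \<omega>)"
  let ?I = "\<lambda>X \<omega>. \<integral>r. X r \<omega> * indicator {u<..t} r \<partial>lborel"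
  let ?c = "if k = l then \<sigma> else 0"
  define w where "w k \<omega> = \<bar>Z \<omega>\<bar> * jump_integral (\<lambda>s \<omega>. \<bar>X s \<omega>\<bar>) k k u t \<omega>" for k \<omega>
  have XM: "X s \<in> borel_measurable M" if "0 \<le> s" for s by (rule measurable_F_M[OF X]) (use that in auto)
  have ZM [measurable]: "Z \<in> borel_measurable M" by (rule measurable_F_M[OF Z u(1)])
  have XA: "(\<lambda>\<omega>. \<bar>X s \<omega>\<bar>) \<in> borel_measurable (F s)" if "0 \<le> s" for s
    using X[OF that] by measurable
  have ZA: "(\<lambda>\<omega>. \<bar>Z \<omega>\<bar>) \<in> borel_measurable (F u)" using Z by measurable
  have lf: "AE \<omega> in M. jump_sum sq_norm (\<lambda>t. L t \<omega>) u t < \<infinity>"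
    using AE_jump_sum_finite by eventually_elim (use u in auto)
  have w0: "0 \<le> w k \<omega>" for k \<omega>
  proof -
    have "0 \<le> left_limit (\<lambda>s. \<bar>X s \<omega>\<bar>) r" if "u < r" for r
      using that u by (subst cadlag_abs(2)[OF cad]) auto
    then have "0 \<le> left_limit (\<lambda>s. \<bar>X s \<omega>\<bar>) r * jump_prod (\<lambda>s. L s \<omega>) k k r * indicator {u<..t} r" for r
      by (cases "r \<in> {u<..t}") (simp_all add: jump_prod_def)
    then show ?thesis unfolding w_def jump_integral_def
      by (intro mult_nonneg_nonneg[OF abs_ge_zero Bochner_Integration.integral_nonneg])
  qed
  have wi: "integrable M (w k)" for k
  proof (rule integrableI_nonneg)
    show "w k \<in> borel_measurable M"
      unfolding w_def by (rule nonneg_compensation(1)[OF u XA cadlag_abs(1)[OF cad] _ ZA]) auto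
    have "(\<integral>\<^sup>+\<omega>. ennreal (w k \<omega>) \<partial>M) = ennreal \<sigma> * (\<integral>\<^sup>+\<omega>. ennreal (\<bar>Z \<omega>\<bar> * ?I (\<lambda>r \<omega>. \<bar>X r \<omega>\<bar>) \<omega>) \<partial>M)"
      unfolding w_def by (rule nonneg_compensation(2)[OF u XA cadlag_abs(1)[OF cad] _ ZA]) auto
    also have "\<dots> < \<infinity>" using fin by (simp add: ennreal_mult_less_top)
    finally show "(\<integral>\<^sup>+\<omega>. ennreal (w k \<omega>) \<partial>M) < \<infinity>" .
  qed (use w0 in auto)
  have b: "has_bochner_integral M (\<lambda>\<omega>. ?Z n \<omega> * jump_integral (?X n) k l u t \<omega>) (?c * (\<integral>\<omega>. ?Z n \<omega> * ?I (?X n) \<omega> \<partial>M))" for n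
    by (rule bounded_compensation[OF u, where K = "real n"])
       (auto intro!: measurable_compose[OF X clip_measurable] measurable_compose[OF Z clip_measurable] cadlag_clip(1) cad clip_bound)
  have ev: "\<forall>\<^sub>F n in sequentially. ?Z n \<omega> * jump_integral (?X n) k l u t \<omega> = Z \<omega> * jump_integral X k l u t \<omega>"
    and evI: "\<forall>\<^sub>F n in sequentially. ?Z n \<omega> * ?I (?X n) \<omega> = Z \<omega> * ?I X \<omega>" for \<omega>
  proof -
    obtain m where m: "\<bar>Z \<omega>\<bar> \<le> real m" using real_arch_simple by blast
    have z: "\<forall>\<^sub>F n in sequentially. ?Z n \<omega> = Z \<omega>"
      using eventually_ge_at_top[of m] by eventually_elim (use m in \<open>auto intro!: clip_eq\<close>)
    from jump_integral_clip(1)[OF u(1), where X = X, OF cad, where t = t and k = k and l = l and \<omega> = \<omega>] z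
    show "\<forall>\<^sub>F n in sequentially. ?Z n \<omega> * jump_integral (?X n) k l u t \<omega> = Z \<omega> * jump_integral X k l u t \<omega>"
      by eventually_elim simp
    from jump_integral_clip(2)[OF u(1), where X = X, OF cad, where t = t and \<omega> = \<omega>] z
    show "\<forall>\<^sub>F n in sequentially. ?Z n \<omega> * ?I (?X n) \<omega> = Z \<omega> * ?I X \<omega>"
      by eventually_elim simp
  qed
  have Am: "(\<lambda>\<omega>. ?Z n \<omega> * jump_integral (?X n) k l u t \<omega>) \<in> borel_measurable M" for n
    using b by (auto dest!: has_bochner_integral_integrable)
  have Jm: "(\<lambda>\<omega>. Z \<omega> * jump_integral X k l u t \<omega>) \<in> borel_measurable M"
    by (rule borel_measurable_LIMSEQ_real[OF tendsto_eventually[OF ev] Am])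
  have bd: "AE \<omega> in M. norm (?Z n \<omega> * jump_integral (?X n) k l u t \<omega>) \<le> w k \<omega> + w l \<omega>" for n
    using lf
  proof eventually_elim
    case (elim \<omega>)
    obtain K where K: "\<And>s. 0 \<le> s \<Longrightarrow> s \<le> t \<Longrightarrow> norm (left_limit (\<lambda>s. X s \<omega>) s) \<le> K"
      using cadlag_bounded[OF cad[of \<omega>], of t] by metis
    let ?f = "\<lambda>s. L s \<omega>" and ?x = "left_limit (\<lambda>s. X s \<omega>)"
    have e1: "left_limit (\<lambda>s. ?X n s \<omega>) r = clip (real n) (?x r)" if "u < r" for r
      using that u by (intro cadlag_clip(2) cad) auto
    have e2: "left_limit (\<lambda>s. \<bar>X s \<omega>\<bar>) r = \<bar>?x r\<bar>" if "u < r" for r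
      using that u by (intro cadlag_abs(2) cad) auto
    have i: "integrable (count_space UNIV) (\<lambda>r. left_limit (\<lambda>s. \<bar>X s \<omega>\<bar>) r * jump_prod ?f j j r * indicator {u<..t} r)" for j
      by (rule integrable_jump_prod[OF elim, of _ K]) (use K u in \<open>auto simp: e2\<close>)
    have "\<bar>jump_integral (?X n) k l u t \<omega>\<bar> \<le> (\<integral>r. \<bar>left_limit (\<lambda>s. ?X n s \<omega>) r * jump_prod ?f k l r * indicator {u<..t} r\<bar> \<partial>count_space UNIV)"
      unfolding jump_integral_def by (rule integral_abs_bound)
    also have "\<dots> \<le> (\<integral>r. left_limit (\<lambda>s. \<bar>X s \<omega>\<bar>) r * jump_prod ?f k k r * indicator {u<..t} r
        + left_limit (\<lambda>s. \<bar>X s \<omega>\<bar>) r * jump_prod ?f l l r * indicator {u<..t} r \<partial>count_space UNIV)"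
    proof (rule Bochner_Integration.integral_mono)
      show "integrable (count_space UNIV) (\<lambda>r. \<bar>left_limit (\<lambda>s. ?X n s \<omega>) r * jump_prod ?f k l r * indicator {u<..t} r\<bar>)"
        by (intro integrable_abs integrable_jump_prod[OF elim, of _ "real n"]) (auto simp: e1 clip_bound)
      show "\<bar>left_limit (\<lambda>s. ?X n s \<omega>) r * jump_prod ?f k l r * indicator {u<..t} r\<bar>
        \<le> left_limit (\<lambda>s. \<bar>X s \<omega>\<bar>) r * jump_prod ?f k k r * indicator {u<..t} r
        + left_limit (\<lambda>s. \<bar>X s \<omega>\<bar>) r * jump_prod ?f l l r * indicator {u<..t} r" for r
      proof (cases "r \<in> {u<..t}")
        case True
        have "\<bar>a * b\<bar> \<le> a * a + b * b" for a b :: real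
        proof -
          have "2 * (\<bar>a\<bar> * \<bar>b\<bar>) \<le> a * a + b * b" "0 \<le> \<bar>a\<bar> * \<bar>b\<bar>"
            using sum_squares_bound[of "\<bar>a\<bar>" "\<bar>b\<bar>"] by (simp_all add: power2_eq_square mult.assoc)
          then show ?thesis unfolding abs_mult by linarith
        qed
        then have "\<bar>jump_prod ?f k l r\<bar> \<le> jump_prod ?f k k r + jump_prod ?f l l r"
          by (simp add: jump_prod_def)
        then have "\<bar>clip (real n) (?x r)\<bar> * \<bar>jump_prod ?f k l r\<bar> \<le> \<bar>?x r\<bar> * (jump_prod ?f k k r + jump_prod ?f l l r)"
          by (intro mult_mono abs_clip_le) auto
        then show ?thesis using True by (simp add: e1 e2 abs_mult distrib_left)
      qed simp
    qed (intro Bochner_Integration.integrable_add i)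
    also have "\<dots> = jump_integral (\<lambda>s \<omega>. \<bar>X s \<omega>\<bar>) k k u t \<omega> + jump_integral (\<lambda>s \<omega>. \<bar>X s \<omega>\<bar>) l l u t \<omega>"
      unfolding jump_integral_def by (intro Bochner_Integration.integral_add i)
    finally have "\<bar>?Z n \<omega>\<bar> * \<bar>jump_integral (?X n) k l u t \<omega>\<bar> \<le> \<bar>Z \<omega>\<bar> * (jump_integral (\<lambda>s \<omega>. \<bar>X s \<omega>\<bar>) k k u t \<omega> + jump_integral (\<lambda>s \<omega>. \<bar>X s \<omega>\<bar>) l l u t \<omega>)"
      by (intro mult_mono abs_clip_le) auto
    then show ?case by (simp add: w_def abs_mult distrib_left)
  qed
  have w2: "integrable M (\<lambda>\<omega>. w k \<omega> + w l \<omega>)" by (intro Bochner_Integration.integrable_add wi)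
  have lim: "AE \<omega> in M. (\<lambda>n. ?Z n \<omega> * jump_integral (?X n) k l u t \<omega>) \<longlonglongrightarrow> Z \<omega> * jump_integral X k l u t \<omega>"
    by (intro AE_I2 tendsto_eventually ev)
  have int: "integrable M (\<lambda>\<omega>. Z \<omega> * jump_integral X k l u t \<omega>)"
    by (rule integrable_dominated_convergence[OF Jm Am w2 lim bd])
  have 1: "(\<lambda>n. \<integral>\<omega>. ?Z n \<omega> * jump_integral (?X n) k l u t \<omega> \<partial>M) \<longlonglongrightarrow> (\<integral>\<omega>. Z \<omega> * jump_integral X k l u t \<omega> \<partial>M)"
    by (rule integral_dominated_convergence[OF Jm Am w2 lim bd])
  have 2: "(\<lambda>n. \<integral>\<omega>. ?Z n \<omega> * ?I (?X n) \<omega> \<partial>M) \<longlonglongrightarrow> (\<integral>\<omega>. Z \<omega> * ?I X \<omega> \<partial>M)"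
  proof (rule integral_dominated_convergence[where w = "\<lambda>\<omega>. \<bar>Z \<omega>\<bar> * ?I (\<lambda>r \<omega>. \<bar>X r \<omega>\<bar>) \<omega>"])
    show "(\<lambda>\<omega>. Z \<omega> * ?I X \<omega>) \<in> borel_measurable M"
      using path_integral_measurable[OF u XM cad] by measurable
    have IXm: "(\<lambda>\<omega>. ?I (?X n) \<omega>) \<in> borel_measurable M" for n
      by (rule path_integral_measurable[OF u _ cadlag_clip(1)[OF cad]]) (use XM in measurable)
    then show "(\<lambda>\<omega>. ?Z n \<omega> * ?I (?X n) \<omega>) \<in> borel_measurable M" for n by measurable
    have IAm: "(\<lambda>\<omega>. ?I (\<lambda>r \<omega>. \<bar>X r \<omega>\<bar>) \<omega>) \<in> borel_measurable M"
      by (rule path_integral_measurable[OF u _ cadlag_abs(1)[OF cad]]) (use XM in measurable)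
    show "integrable M (\<lambda>\<omega>. \<bar>Z \<omega>\<bar> * ?I (\<lambda>r \<omega>. \<bar>X r \<omega>\<bar>) \<omega>)"
    proof (rule integrableI_nonneg)
      show "AE \<omega> in M. 0 \<le> \<bar>Z \<omega>\<bar> * ?I (\<lambda>r \<omega>. \<bar>X r \<omega>\<bar>) \<omega>"
        by (intro AE_I2 mult_nonneg_nonneg[OF abs_ge_zero Bochner_Integration.integral_nonneg]) simp
      show "(\<lambda>\<omega>. \<bar>Z \<omega>\<bar> * ?I (\<lambda>r \<omega>. \<bar>X r \<omega>\<bar>) \<omega>) \<in> borel_measurable M"
        using IAm by measurable
    qed (use fin in simp)
    show "AE \<omega> in M. norm (?Z n \<omega> * ?I (?X n) \<omega>) \<le> \<bar>Z \<omega>\<bar> * ?I (\<lambda>r \<omega>. \<bar>X r \<omega>\<bar>) \<omega>" for n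
    proof (rule AE_I2)
      fix \<omega>
      have "\<bar>?I (?X n) \<omega>\<bar> \<le> (\<integral>r. \<bar>?X n r \<omega> * indicator {u<..t} r\<bar> \<partial>lborel)" by (rule integral_abs_bound)
      also have "\<dots> \<le> ?I (\<lambda>r \<omega>. \<bar>X r \<omega>\<bar>) \<omega>"
        by (intro Bochner_Integration.integral_mono integrable_abs integrable_cadlag u cad cadlag_clip(1) cadlag_abs(1))
           (auto simp: abs_mult intro!: mult_right_mono abs_clip_le)
      finally show "norm (?Z n \<omega> * ?I (?X n) \<omega>) \<le> \<bar>Z \<omega>\<bar> * ?I (\<lambda>r \<omega>. \<bar>X r \<omega>\<bar>) \<omega>"
        unfolding real_norm_def abs_mult by (intro mult_mono abs_clip_le) auto
    qed
  qed (intro AE_I2 tendsto_eventually evI)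
  have "(\<lambda>n. \<integral>\<omega>. ?Z n \<omega> * jump_integral (?X n) k l u t \<omega> \<partial>M) \<longlonglongrightarrow> ?c * (\<integral>\<omega>. Z \<omega> * ?I X \<omega> \<partial>M)"
    unfolding has_bochner_integral_integral_eq[OF b] by (intro tendsto_mult tendsto_const 2)
  from LIMSEQ_unique[OF 1 this] int show ?thesis by (simp add: has_bochner_integral_iff)
qed

end

section \<open>Gronwall inequality with jumps and exponential moments\<close>

text \<open>Dominated convergence over the jump times: \<open>{0<..T n}\<close> shrinks to
  \<open>{0<..t}\<close> when \<open>T n\<close> tends to \<open>t\<close> from the right and grows
  to \<open>{0<..<t}\<close> when it does so from the left. The jump at \<open>t\<close> is the
  difference of the two limits.\<close>

lemma mono_cadlag_jump_sum:
  assumes S: "\<And>t. jump_sum sq_norm g 0 t < \<infinity>"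
  shows "cadlag (\<lambda>t. enn2real (jump_sum sq_norm g 0 t))"
proof -
  define h where "h r = sq_norm (jump g r)" for r
  have J: "enn2real (jump_sum sq_norm g 0 t) = (\<integral>r. h r * indicator {0<..t} r \<partial>count_space UNIV)" for t
  proof -
    have "jump_sum sq_norm g 0 t = (\<integral>\<^sup>+r. ennreal (h r * indicator {0<..t} r) \<partial>count_space UNIV)"
      unfolding jump_sum_def h_def by (intro nn_integral_cong) (auto split: split_indicator)
    also have "\<dots> = ennreal (\<integral>r. h r * indicator {0<..t} r \<partial>count_space UNIV)"
      unfolding h_def by (rule nn_integral_eq_integral[OF integrable_count_space_iff_jump_sum[OF S]]) auto
    finally show ?thesis by (simp add: h_def Bochner_Integration.integral_nonneg)
  qed
  have lim: "(\<lambda>n. \<integral>r. h r * indicator {0<..T n} r \<partial>count_space UNIV) \<longlonglongrightarrow> (\<integral>r. h r * indicator A r \<partial>count_space UNIV)"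
    if T: "\<And>n. T n \<le> b" and A: "\<And>r. (\<lambda>n. indicator {0<..T n} r :: real) \<longlonglongrightarrow> indicator A r" for T b A
  proof (rule integral_dominated_convergence[where w = "\<lambda>r. h r * indicator {0<..b} r"])
    show "integrable (count_space UNIV) (\<lambda>r. h r * indicator {0<..b} r)"
      unfolding h_def by (rule integrable_count_space_iff_jump_sum[OF S])
    show "AE r in count_space UNIV. norm (h r * indicator {0<..T n} r) \<le> h r * indicator {0<..b} r" for n
      using T[of n] by (intro AE_I2) (auto simp: h_def split: split_indicator)
  qed (auto intro!: AE_I2 tendsto_mult A)
  show ?thesis unfolding cadlag_def J
  proof (intro conjI allI impI)
    fix t :: real assume "0 \<le> t"
    show "((\<lambda>t. \<integral>r. h r * indicator {0<..t} r \<partial>count_space UNIV) \<longlongrightarrow> (\<integral>r. h r * indicator {0<..t} r \<partial>count_space UNIV)) (at_right t)"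
    proof (rule tendsto_at_right_sequentially[of t "t + 1"])
      fix T assume T: "\<And>n. t < T n" "\<And>n. T n < t + 1" "T \<longlonglongrightarrow> t"
      show "(\<lambda>n. \<integral>r. h r * indicator {0<..T n} r \<partial>count_space UNIV) \<longlonglongrightarrow> (\<integral>r. h r * indicator {0<..t} r \<partial>count_space UNIV)"
      proof (rule lim[where b = "t + 1"])
        show "(\<lambda>n. indicator {0<..T n} r :: real) \<longlonglongrightarrow> indicator {0<..t} r" for r
        proof (cases "r \<le> t")
          case True
          then have "indicator {0<..T n} r = (indicator {0<..t} r :: real)" for n
            using T(1)[of n] by (auto simp: indicator_def)
          then show ?thesis by simp
        next
          case False
          then have "eventually (\<lambda>n. T n < r) sequentially" using order_tendstoD(2)[OF T(3), of r] by simp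
          then have "eventually (\<lambda>n. indicator {0<..T n} r = (indicator {0<..t} r :: real)) sequentially"
            by eventually_elim (use False in \<open>auto simp: indicator_def\<close>)
          then show ?thesis by (rule tendsto_eventually)
        qed
      qed (use T(2) less_imp_le in blast)
    qed simp
  next
    fix t :: real assume "0 < t"
    show "\<exists>l. ((\<lambda>t. \<integral>r. h r * indicator {0<..t} r \<partial>count_space UNIV) \<longlongrightarrow> l) (at_left t)"
    proof (rule exI[of _ "\<integral>r. h r * indicator {0<..<t} r \<partial>count_space UNIV"], rule tendsto_at_left_sequentially[of 0 t])
      fix T assume T: "\<And>n. T n < t" "\<And>n. 0 < T n" "T \<longlonglongrightarrow> t"
      show "(\<lambda>n. \<integral>r. h r * indicator {0<..T n} r \<partial>count_space UNIV) \<longlonglongrightarrow> (\<integral>r. h r * indicator {0<..<t} r \<partial>count_space UNIV)"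
      proof (rule lim[where b = t])
        show "(\<lambda>n. indicator {0<..T n} r :: real) \<longlonglongrightarrow> indicator {0<..<t} r" for r
        proof (cases "t \<le> r")
          case True
          then have "indicator {0<..T n} r = (indicator {0<..<t} r :: real)" for n
            using T(1)[of n] by (auto simp: indicator_def)
          then show ?thesis by simp
        next
          case False
          then have "eventually (\<lambda>n. r < T n) sequentially" using order_tendstoD(1)[OF T(3), of r] by simp
          then have "eventually (\<lambda>n. indicator {0<..T n} r = (indicator {0<..<t} r :: real)) sequentially"
            by eventually_elim (use False in \<open>auto simp: indicator_def\<close>)
          then show ?thesis by (rule tendsto_eventually)
        qed
      qed (use T(1) less_imp_le in blast)
    qed (use \<open>0 < t\<close> in simp)
  qed
qed

text \<open>The chord of the concave logarithm from 1 to \<open>1 + Y\<close> lies below the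
  graph.\<close>

lemma ln_add_one_ge_linear:
  fixes y Y :: real
  assumes "0 \<le> y" "y \<le> Y" "0 < Y"
  shows "y / Y * ln (1 + Y) \<le> ln (1 + y)"
proof -
  have "concave_on {0<..} (ln :: real \<Rightarrow> real)" by (rule ln_concave)
  then have "convex_on {0<..} (\<lambda>x. - ln x :: real)" by (simp add: concave_on_def)
  from convex_onD[OF this, of "y / Y" 1 "1 + Y"] assms
  have "- ln ((1 - y / Y) *\<^sub>R 1 + (y / Y) *\<^sub>R (1 + Y)) \<le> (1 - y / Y) * (- ln 1) + y / Y * (- ln (1 + Y))"
    by auto
  moreover have "(1 - y / Y) *\<^sub>R 1 + (y / Y) *\<^sub>R (1 + Y) = 1 + y" using assms by (simp add: field_simps)
  ultimately show ?thesis by (simp only: ln_one)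
qed

text \<open>The familiar fact that a product of factors 1 + y_r with y_r >= 0 is at least 1 plus the
  sum of the y_r, for infinitely many factors, the product being the exponential of a sum of
  logarithms. With \<open>Y\<close> the total, the weights \<open>y r / Y\<close> distribute
  \<open>ln (1 + Y)\<close> over the jumps, and concavity of the logarithm compares the terms one by
  one.\<close>

lemma one_plus_jump_sum_le_exp:
  assumes S: "jump_sum sq_norm g s t < \<infinity>" and c: "0 \<le> c"
  shows "1 + c * enn2real (jump_sum sq_norm g s t) \<le> exp (enn2real (jump_sum (\<lambda>x. ln (1 + c * sq_norm x)) g s t))"
    and "jump_sum (\<lambda>x. ln (1 + c * sq_norm x)) g s t < \<infinity>"
proof -
  define y where "y r = c * (sq_norm (jump g r) * indicator {s<..t} r)" for r
  have y0: "0 \<le> y r" for r using c by (simp add: y_def)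
  have i: "integrable (count_space UNIV) y"
    unfolding y_def by (intro integrable_mult_right integrable_count_space_iff_jump_sum S)
  have il: "integrable (count_space UNIV) (\<lambda>r. ln (1 + y r))"
    by (rule Bochner_Integration.integrable_bound[OF i]) (auto simp: y0 ln_add_one_self_le_self)
  define Y where "Y = (\<integral>r. y r \<partial>count_space UNIV)"
  have JY: "c * enn2real (jump_sum sq_norm g s t) = Y"
  proof -
    have "jump_sum sq_norm g s t = (\<integral>\<^sup>+r. ennreal (sq_norm (jump g r) * indicator {s<..t} r) \<partial>count_space UNIV)"
      unfolding jump_sum_def by (intro nn_integral_cong) (auto split: split_indicator)
    also have "\<dots> = ennreal (\<integral>r. sq_norm (jump g r) * indicator {s<..t} r \<partial>count_space UNIV)"
      by (rule nn_integral_eq_integral[OF integrable_count_space_iff_jump_sum[OF S]]) auto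
    finally show ?thesis by (simp add: Y_def y_def Bochner_Integration.integral_nonneg)
  qed
  have Jl: "jump_sum (\<lambda>x. ln (1 + c * sq_norm x)) g s t = ennreal (\<integral>r. ln (1 + y r) \<partial>count_space UNIV)"
  proof -
    have "jump_sum (\<lambda>x. ln (1 + c * sq_norm x)) g s t = (\<integral>\<^sup>+r. ennreal (ln (1 + y r)) \<partial>count_space UNIV)"
      unfolding jump_sum_def y_def by (intro nn_integral_cong) (auto split: split_indicator)
    also have "\<dots> = ennreal (\<integral>r. ln (1 + y r) \<partial>count_space UNIV)"
      by (rule nn_integral_eq_integral[OF il]) (auto simp: y0)
    finally show ?thesis .
  qed
  then show "jump_sum (\<lambda>x. ln (1 + c * sq_norm x)) g s t < \<infinity>" by simp
  have l0: "0 \<le> (\<integral>r. ln (1 + y r) \<partial>count_space UNIV)" by (intro Bochner_Integration.integral_nonneg) (simp add: y0)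
  have Y0: "0 \<le> Y" unfolding Y_def by (intro Bochner_Integration.integral_nonneg y0)
  have "1 + Y \<le> exp (\<integral>r. ln (1 + y r) \<partial>count_space UNIV)"
  proof (cases "Y = 0")
    case False
    with Y0 have Y: "0 < Y" by simp
    have le: "y r \<le> Y" for r
    proof -
      have "y r = (\<integral>q. y r * indicator {r} q \<partial>count_space UNIV)" by simp
      also have "\<dots> \<le> Y" unfolding Y_def
        by (intro integral_mono' i) (auto simp: y0 split: split_indicator)
      finally show ?thesis .
    qed
    have "ln (1 + Y) = (\<integral>r. y r / Y * ln (1 + Y) \<partial>count_space UNIV)" using Y by (simp add: Y_def)
    also have "\<dots> \<le> (\<integral>r. ln (1 + y r) \<partial>count_space UNIV)"
      by (intro integral_mono' il ln_add_one_ge_linear y0 le Y) (simp add: y0)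
    finally show ?thesis using Y by (simp add: ln_le_cancel_iff[symmetric] del: ln_le_cancel_iff)
  qed (use l0 in simp)
  then show "1 + c * enn2real (jump_sum sq_norm g s t) \<le> exp (enn2real (jump_sum (\<lambda>x. ln (1 + c * sq_norm x)) g s t))"
    using l0 by (simp add: JY Jl)
qed

lemma enn2real_jump_sum_add:
  assumes "s \<le> t" "t \<le> u" "jump_sum \<phi> g s u < \<infinity>"
  shows "enn2real (jump_sum \<phi> g s u) = enn2real (jump_sum \<phi> g s t) + enn2real (jump_sum \<phi> g t u)"
proof -
  have e: "jump_sum \<phi> g s u = jump_sum \<phi> g s t + jump_sum \<phi> g t u" by (rule jump_sum_add[OF assms(1,2)])
  with assms(3) have "jump_sum \<phi> g s t < \<infinity>" "jump_sum \<phi> g t u < \<infinity>" by auto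
  then show ?thesis unfolding e by (simp add: enn2real_plus)
qed

text \<open>As long as \<open>f t = b t + a \<Sum> |\<Delta>g|\<^sup>2\<close> grows by at most \<open>1/2\<close> before the right endpoint, the supremum of \<open>v\<close> is at
  most twice its initial value, whence the factors 2. Bolzano's principle glues such intervals.\<close>

lemma jump_gronwall:
  fixes v :: "real \<Rightarrow> real"
  assumes v: "cadlag v" "\<And>t. 0 \<le> t \<Longrightarrow> 0 \<le> v t" and S: "\<And>t. jump_sum sq_norm g 0 t < \<infinity>"
    and ab: "0 \<le> a" "0 \<le> b"
    and ineq: "\<And>s t. 0 \<le> s \<Longrightarrow> s \<le> t \<Longrightarrow> v t \<le> v s + b * (\<integral>r. left_limit v r * indicator {s<..t} r \<partial>lborel)
        + a * (\<integral>r. left_limit v r * (sq_norm (jump g r) * indicator {s<..t} r) \<partial>count_space UNIV)"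
    and t: "0 \<le> t"
  shows "v t \<le> v 0 * exp (2 * b * t + enn2real (jump_sum (\<lambda>x. ln (1 + 2 * a * sq_norm x)) g 0 t))"
proof -
  let ?\<psi> = "\<lambda>x. ln (1 + 2 * a * sq_norm x)"
  define G where "G t = enn2real (jump_sum sq_norm g 0 t)" for t
  have S': "jump_sum sq_norm g s t < \<infinity>" if "0 \<le> s" for s t
    using jump_sum_interval_mono[OF that order.refl] S by (rule order.strict_trans1)
  have Gd: "G t - G s = enn2real (jump_sum sq_norm g s t)" if "0 \<le> s" "s \<le> t" for s t
    unfolding G_def using enn2real_jump_sum_add[OF that S] by simp
  define f where "f t = b * t + a * G t" for t
  have "cadlag G" unfolding G_def by (rule mono_cadlag_jump_sum[OF S])
  have f: "cadlag f" unfolding cadlag_def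
  proof (intro conjI allI impI)
    show "(f \<longlongrightarrow> f t) (at_right t)" if "0 \<le> t" for t
      unfolding f_def by (intro tendsto_intros cadlag_right[OF \<open>cadlag G\<close>] that)
    show "\<exists>l. (f \<longlongrightarrow> l) (at_left t)" if "0 < t" for t
    proof
      show "(f \<longlongrightarrow> b * t + a * left_limit G t) (at_left t)"
        unfolding f_def by (intro tendsto_intros cadlag_left[OF \<open>cadlag G\<close>] that)
    qed
  qed
  have fd: "f t - f s = b * (t - s) + a * enn2real (jump_sum sq_norm g s t)" if "0 \<le> s" "s \<le> t" for s t
    using Gd[OF that] by (simp add: f_def algebra_simps)
  have fmono: "f s \<le> f t" if "0 \<le> s" "s \<le> t" for s t
  proof -
    have "0 \<le> b * (t - s)" "0 \<le> a * enn2real (jump_sum sq_norm g s t)" using ab that by auto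
    then show ?thesis using fd[OF that] by linarith
  qed
  \<comment> \<open>A bound \<open>K\<close> on left limits suffices, because both integrals see
    \<open>v\<close> only through its left limits.\<close>
  have grow: "v w \<le> v y + K * (f w - f y)"
    if yw: "0 \<le> y" "y \<le> w" and K: "\<And>r. y < r \<Longrightarrow> r \<le> w \<Longrightarrow> left_limit v r \<le> K" for y w K
  proof -
    have l0: "0 \<le> left_limit v r" if "y < r" for r
      using left_limit_in_closed[OF v(1) closed_atLeast[of 0], of r] v(2) that yw by auto
    note ic = integrable_count_space_iff_jump_sum[OF S'[OF yw(1)], of w]
    have "(\<integral>r. left_limit v r * indicator {y<..w} r \<partial>lborel) \<le> (\<integral>r. K * indicator {y<..w} r \<partial>lborel)"
    proof (rule integral_mono'[OF integrable_indicator_Ioc])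
      show "0 \<le> K * indicator {y<..w} r" for r using K[of r] l0[of r] by (auto simp: indicator_def)
    qed (use K in \<open>auto simp: indicator_def\<close>)
    also have "\<dots> = K * (w - y)" using yw by simp
    finally have 1: "(\<integral>r. left_limit v r * indicator {y<..w} r \<partial>lborel) \<le> K * (w - y)" .
    have "(\<integral>r. left_limit v r * (sq_norm (jump g r) * indicator {y<..w} r) \<partial>count_space UNIV)
      \<le> (\<integral>r. K * (sq_norm (jump g r) * indicator {y<..w} r) \<partial>count_space UNIV)"
    proof (rule integral_mono'[OF integrable_mult_right[OF ic]])
      show "0 \<le> K * (sq_norm (jump g r) * indicator {y<..w} r)" for r
        using K[of r] l0[of r] by (auto simp: indicator_def)
    qed (use K in \<open>auto simp: indicator_def intro!: mult_right_mono\<close>)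
    also have "\<dots> = K * enn2real (jump_sum sq_norm g y w)"
    proof -
      have "jump_sum sq_norm g y w = (\<integral>\<^sup>+r. ennreal (sq_norm (jump g r) * indicator {y<..w} r) \<partial>count_space UNIV)"
        unfolding jump_sum_def by (intro nn_integral_cong) (auto split: split_indicator)
      also have "\<dots> = ennreal (\<integral>r. sq_norm (jump g r) * indicator {y<..w} r \<partial>count_space UNIV)"
        by (rule nn_integral_eq_integral[OF ic]) auto
      finally show ?thesis by (simp add: Bochner_Integration.integral_nonneg)
    qed
    finally have 2: "(\<integral>r. left_limit v r * (sq_norm (jump g r) * indicator {y<..w} r) \<partial>count_space UNIV) \<le> K * enn2real (jump_sum sq_norm g y w)" .
    from ineq[OF yw] mult_left_mono[OF 1 ab(2)] mult_left_mono[OF 2 ab(1)] show ?thesis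
      unfolding fd[OF yw] by (simp add: algebra_simps)
  qed
  have short: "v z \<le> v y * (1 + 2 * (f z - f y))"
    if yz: "0 \<le> y" "y \<le> z" and half: "\<And>w. y \<le> w \<Longrightarrow> w < z \<Longrightarrow> f w - f y \<le> 1 / 2" for y z
  proof (cases "y = z")
    case False
    with yz have yz': "y < z" by simp
    obtain K where K: "\<And>s. 0 \<le> s \<Longrightarrow> s \<le> z \<Longrightarrow> norm (v s) \<le> K" using cadlag_bounded[OF v(1)] by metis
    \<comment> \<open>The right endpoint \<open>z\<close> is left out: a large jump may occur there,
      whereas the left limits on \<open>{y<..z}\<close> are still bounded by
      \<open>s\<close>.\<close>
    define s where "s = (SUP r\<in>{y..<z}. v r)"
    have bdd: "bdd_above (v ` {y..<z})"
    proof (rule bdd_aboveI2)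
      show "v r \<le> K" if "r \<in> {y..<z}" for r using K[of r] that yz by auto
    qed
    have vs: "v r \<le> s" if "y \<le> r" "r < z" for r
      unfolding s_def using that by (intro cSUP_upper bdd) auto
    have s0: "0 \<le> s" using vs[of y] v(2)[of y] yz yz' by auto
    have ls: "left_limit v r \<le> s" if r: "y < r" "r \<le> z" for r
    proof (rule tendsto_upperbound[OF cadlag_left[OF v(1)]])
      show "\<forall>\<^sub>F x in at_left r. v x \<le> s"
        using eventually_at_left_real[OF r(1)] by eventually_elim (use r in \<open>auto intro!: vs\<close>)
    qed (use r yz in auto)
    have "v w \<le> v y + s / 2" if "y \<le> w" "w < z" for w
    proof -
      have "v w \<le> v y + s * (f w - f y)" using that by (intro grow yz ls) auto
      also have "s * (f w - f y) \<le> s * (1 / 2)" using half[OF that] s0 by (intro mult_left_mono) auto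
      finally show ?thesis by simp
    qed
    then have "s \<le> v y + s / 2" unfolding s_def using yz' by (intro cSUP_least) (auto simp: s_def)
    then have s2: "s \<le> 2 * v y" by simp
    have "v z \<le> v y + s * (f z - f y)" by (intro grow yz ls)
    also have "s * (f z - f y) \<le> 2 * v y * (f z - f y)" using fmono[OF yz] s2 by (intro mult_right_mono) auto
    finally show ?thesis by (simp add: algebra_simps)
  qed simp
  \<comment> \<open>The growth factor of a single interval. Additivity of jump sums makes it
    multiplicative, as gluing of intervals requires.\<close>
  define E where "E y z = exp (2 * b * (z - y) + enn2real (jump_sum ?\<psi> g y z))" for y z
  have \<psi>f: "jump_sum ?\<psi> g y z < \<infinity>" if "0 \<le> y" for y z
    using one_plus_jump_sum_le_exp(2)[OF S'[OF that], of "2 * a"] ab by simp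
  have E_mult: "E x z = E x y * E y z" if "0 \<le> x" "x \<le> y" "y \<le> z" for x y z
    unfolding E_def exp_add[symmetric] using enn2real_jump_sum_add[OF that(2,3) \<psi>f[OF that(1)]]
    by (simp add: algebra_simps)
  have E_ge: "1 + 2 * (f z - f y) \<le> E y z" if yz: "0 \<le> y" "y \<le> z" for y z
  proof -
    let ?J = "enn2real (jump_sum sq_norm g y z)"
    have "1 + 2 * (f z - f y) \<le> (1 + 2 * b * (z - y)) * (1 + 2 * a * ?J)"
    proof -
      have "0 \<le> (2 * b * (z - y)) * (2 * a * ?J)" using yz ab by (intro mult_nonneg_nonneg) auto
      then show ?thesis unfolding fd[OF yz] by (simp add: algebra_simps)
    qed
    also have "\<dots> \<le> exp (2 * b * (z - y)) * exp (enn2real (jump_sum ?\<psi> g y z))"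
      using one_plus_jump_sum_le_exp(1)[OF S'[OF yz(1)], of "2 * a"] ab yz exp_ge_add_one_self[of "2 * b * (z - y)"]
      by (intro mult_mono) auto
    finally show ?thesis by (simp add: E_def exp_add)
  qed
  define P where "P y z \<longleftrightarrow> (0 \<le> y \<longrightarrow> v z \<le> v y * E y z)" for y z
  have step: "v z \<le> v y * E y z"
    if yz: "0 \<le> y" "y \<le> z" and half: "\<And>w. y \<le> w \<Longrightarrow> w < z \<Longrightarrow> f w - f y \<le> 1 / 2" for y z
    using short[OF yz half] mult_left_mono[OF E_ge[OF yz] v(2)[OF yz(1)]] by linarith
  have "P 0 t" using t
  proof (induction rule: Bolzano)
    case (trans x y z)
    show ?case unfolding P_def
    proof
      assume x: "0 \<le> x"
      have "v z \<le> v y * E y z" using trans x by (auto simp: P_def)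
      also have "\<dots> \<le> (v x * E x y) * E y z"
        using trans x by (intro mult_right_mono) (auto simp: P_def E_def)
      finally show "v z \<le> v x * E x z" using E_mult[OF x trans(3,4)] by (simp add: mult.assoc)
    qed
  next
    \<comment> \<open>Only the jump of \<open>f\<close> at \<open>x\<close> can be large, so the
      interval is split at \<open>x\<close>. In the left piece that jump sits at the right endpoint,
      where \<open>step\<close> permits it; in the right piece it has already taken place.\<close>
    case (local x)
    have "0 < (1 / 2 :: real)" by simp
    from cadlag_local[OF f local(1) this] obtain d where d: "d > 0"
      "\<And>y z. 0 \<le> y \<Longrightarrow> y \<le> z \<Longrightarrow> x - d < y \<Longrightarrow> z < x + d \<Longrightarrow> x \<notin> {y<..z} \<Longrightarrow> norm (f z - f y) < 1 / 2" by blast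
    have "P y z" if yz: "y \<le> x \<and> x \<le> z \<and> z - y < d" for y z
      unfolding P_def
    proof
      assume y: "0 \<le> y"
      have h1: "f w - f y \<le> 1 / 2" if "y \<le> w" "w < x" for w
      proof -
        have "norm (f w - f y) < 1 / 2" by (rule d(2)) (use that yz y in auto)
        then show ?thesis using abs_ge_self[of "f w - f y"] unfolding real_norm_def by linarith
      qed
      have h2: "f w - f x \<le> 1 / 2" if "x \<le> w" "w < z" for w
      proof -
        have "norm (f w - f x) < 1 / 2" by (rule d(2)) (use that yz y in auto)
        then show ?thesis using abs_ge_self[of "f w - f x"] unfolding real_norm_def by linarith
      qed
      have "v z \<le> v x * E x z" using yz y by (intro step h2) auto
      also have "\<dots> \<le> (v y * E y x) * E x z"
        using yz y by (intro mult_right_mono step h1) (auto simp: E_def)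
      finally show "v z \<le> v y * E y z" using E_mult[OF y, of x z] yz by (simp add: mult.assoc)
    qed
    with d(1) show ?case by blast
  qed
  then show ?thesis by (simp add: P_def E_def)
qed

section \<open>Moments of increments over short time intervals\<close>

lemma measurable_component: "(\<lambda>x :: real^'n. x $ i) \<in> borel_measurable borel"
  by (intro borel_measurable_continuous_onI continuous_intros)

lemma power4_add_le: "(x + y) ^ 4 \<le> 8 * (x ^ 4 + y ^ 4)" for x y :: real
proof -
  have sq: "(a + b)\<^sup>2 \<le> 2 * (a\<^sup>2 + b\<^sup>2)" for a b :: real
    using sum_squares_bound[of a b] by (simp add: power2_sum)
  have "(x + y) ^ 4 = ((x + y)\<^sup>2)\<^sup>2" by simp
  also have "\<dots> \<le> (2 * (x\<^sup>2 + y\<^sup>2))\<^sup>2" by (intro power_mono sq) simp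
  also have "\<dots> = 4 * (x\<^sup>2 + y\<^sup>2)\<^sup>2" by (simp only: power_mult_distrib) simp
  also have "\<dots> \<le> 4 * (2 * ((x\<^sup>2)\<^sup>2 + (y\<^sup>2)\<^sup>2))" using sq[of "x\<^sup>2" "y\<^sup>2"] by simp
  finally show ?thesis by simp
qed

lemma abs_power_le_power4: "p \<le> 4 \<Longrightarrow> \<bar>x ^ p\<bar> \<le> 1 + x ^ 4" for x :: real
proof -
  assume p: "p \<le> 4"
  have "\<bar>x\<bar> ^ p \<le> 1 + \<bar>x\<bar> ^ 4"
  proof (cases "\<bar>x\<bar> \<le> 1")
    case True
    then show ?thesis using power_le_one[of "\<bar>x\<bar>" p] by (smt (verit) abs_ge_zero zero_le_power)
  next
    case False
    then have "\<bar>x\<bar> ^ p \<le> \<bar>x\<bar> ^ 4" using p by (intro power_increasing) auto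
    then show ?thesis by simp
  qed
  then show ?thesis by (simp add: power_abs)
qed

lemma (in prob_space) integrable_power_le_4:
  fixes X :: "'a \<Rightarrow> real"
  assumes "X \<in> borel_measurable M" "integrable M (\<lambda>\<omega>. X \<omega> ^ 4)" "p \<le> 4"
  shows "integrable M (\<lambda>\<omega>. X \<omega> ^ p)"
proof (rule Bochner_Integration.integrable_bound)
  show "integrable M (\<lambda>\<omega>. 1 + X \<omega> ^ 4)" using assms(2) by simp
  have "norm (X \<omega> ^ p) \<le> norm (1 + X \<omega> ^ 4)" for \<omega>
    using abs_power_le_power4[OF assms(3), of "X \<omega>"] unfolding real_norm_def by linarith
  then show "AE \<omega> in M. norm (X \<omega> ^ p) \<le> norm (1 + X \<omega> ^ 4)" by simp
qed (use assms(1) in measurable)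

lemma (in prob_space) integrable_power4_add:
  fixes X Y :: "'a \<Rightarrow> real"
  assumes "X \<in> borel_measurable M" "integrable M (\<lambda>\<omega>. X \<omega> ^ 4)" "Y \<in> borel_measurable M" "integrable M (\<lambda>\<omega>. Y \<omega> ^ 4)"
  shows "integrable M (\<lambda>\<omega>. (X \<omega> + Y \<omega>) ^ 4)"
proof (rule Bochner_Integration.integrable_bound)
  show "integrable M (\<lambda>\<omega>. 8 * (X \<omega> ^ 4 + Y \<omega> ^ 4))" using assms by simp
  show "AE \<omega> in M. norm ((X \<omega> + Y \<omega>) ^ 4) \<le> norm (8 * (X \<omega> ^ 4 + Y \<omega> ^ 4))"
    using power4_add_le by (intro AE_I2) simp
qed (use assms in measurable)

context levy_path
begin

text \<open>Positive and negative parts of \<open>H\<close> and \<open>g\<close> give four products,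
  each covered by the identity for extended nonnegative functions.\<close>

lemma increments_real:
  fixes g :: "real^'d \<Rightarrow> real"
  assumes st: "0 \<le> s" "s \<le> t" and H: "H \<in> borel_measurable (F s)" "integrable M H"
    and g: "g \<in> borel_measurable borel" "integrable M (\<lambda>\<omega>. g (L (t - s) \<omega>))"
  shows "has_bochner_integral M (\<lambda>\<omega>. H \<omega> * g (L t \<omega> - L s \<omega>)) ((\<integral>\<omega>. H \<omega> \<partial>M) * (\<integral>\<omega>. g (L (t - s) \<omega>) \<partial>M))"
proof -
  have Lm: "(\<lambda>\<omega>. L t \<omega> - L s \<omega>) \<in> borel_measurable M"
    using st by (intro borel_measurable_diff L_measurable) auto
  have pos: "has_bochner_integral M (\<lambda>\<omega>. G \<omega> * k (L t \<omega> - L s \<omega>)) ((\<integral>\<omega>. G \<omega> \<partial>M) * (\<integral>\<omega>. k (L (t - s) \<omega>) \<partial>M))"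
    if G: "G \<in> borel_measurable (F s)" "integrable M G" "\<And>\<omega>. 0 \<le> G \<omega>"
      and k: "k \<in> borel_measurable borel" "integrable M (\<lambda>\<omega>. k (L (t - s) \<omega>))" "\<And>x. 0 \<le> k x" for G :: "'a \<Rightarrow> real" and k :: "real^'d \<Rightarrow> real"
  proof (rule has_bochner_integral_nn_integral)
    have "(\<integral>\<^sup>+\<omega>. ennreal (G \<omega> * k (L t \<omega> - L s \<omega>)) \<partial>M) = (\<integral>\<^sup>+\<omega>. ennreal (G \<omega>) * ennreal (k (L t \<omega> - L s \<omega>)) \<partial>M)"
      using G k by (simp add: ennreal_mult)
    also have "\<dots> = (\<integral>\<^sup>+\<omega>. ennreal (G \<omega>) \<partial>M) * (\<integral>\<^sup>+\<omega>. ennreal (k (L (t - s) \<omega>)) \<partial>M)"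
      using G k by (intro increments st) auto
    also have "\<dots> = ennreal (\<integral>\<omega>. G \<omega> \<partial>M) * ennreal (\<integral>\<omega>. k (L (t - s) \<omega>) \<partial>M)"
      using G k by (simp add: nn_integral_eq_integral)
    also have "\<dots> = ennreal ((\<integral>\<omega>. G \<omega> \<partial>M) * (\<integral>\<omega>. k (L (t - s) \<omega>) \<partial>M))"
      using G k by (intro ennreal_mult[symmetric] Bochner_Integration.integral_nonneg) auto
    finally show "(\<integral>\<^sup>+\<omega>. ennreal (G \<omega> * k (L t \<omega> - L s \<omega>)) \<partial>M) = ennreal ((\<integral>\<omega>. G \<omega> \<partial>M) * (\<integral>\<omega>. k (L (t - s) \<omega>) \<partial>M))" .
    show "0 \<le> (\<integral>\<omega>. G \<omega> \<partial>M) * (\<integral>\<omega>. k (L (t - s) \<omega>) \<partial>M)"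
      using G k by (intro mult_nonneg_nonneg Bochner_Integration.integral_nonneg) auto
    show "(\<lambda>\<omega>. G \<omega> * k (L t \<omega> - L s \<omega>)) \<in> borel_measurable M"
      using borel_measurable_integrable[OF G(2)] measurable_compose[OF Lm k(1)] by measurable
  qed (use G k in auto)
  let ?p = "\<lambda>x :: real. max 0 x" and ?n = "\<lambda>x :: real. max 0 (- x)"
  have m: "(\<lambda>\<omega>. ?p (H \<omega>)) \<in> borel_measurable (F s)" "(\<lambda>\<omega>. ?n (H \<omega>)) \<in> borel_measurable (F s)"
    "(\<lambda>x. ?p (g x)) \<in> borel_measurable borel" "(\<lambda>x. ?n (g x)) \<in> borel_measurable borel"
    using H(1) g(1) by measurable
  have i: "integrable M (\<lambda>\<omega>. ?p (H \<omega>))" "integrable M (\<lambda>\<omega>. ?n (H \<omega>))"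
    "integrable M (\<lambda>\<omega>. ?p (g (L (t - s) \<omega>)))" "integrable M (\<lambda>\<omega>. ?n (g (L (t - s) \<omega>)))" using H(2) g(2) by auto
  have split: "(\<integral>\<omega>. f \<omega> \<partial>M) = (\<integral>\<omega>. ?p (f \<omega>) \<partial>M) - (\<integral>\<omega>. ?n (f \<omega>) \<partial>M)" if "integrable M f" for f
  proof -
    have "(\<integral>\<omega>. f \<omega> \<partial>M) = (\<integral>\<omega>. ?p (f \<omega>) - ?n (f \<omega>) \<partial>M)" by (intro Bochner_Integration.integral_cong) auto
    then show ?thesis using that by simp
  qed
  have "has_bochner_integral M (\<lambda>\<omega>.
      (?p (H \<omega>) * ?p (g (L t \<omega> - L s \<omega>)) - ?p (H \<omega>) * ?n (g (L t \<omega> - L s \<omega>))) -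
      (?n (H \<omega>) * ?p (g (L t \<omega> - L s \<omega>)) - ?n (H \<omega>) * ?n (g (L t \<omega> - L s \<omega>))))
    (((\<integral>\<omega>. ?p (H \<omega>) \<partial>M) * (\<integral>\<omega>. ?p (g (L (t - s) \<omega>)) \<partial>M) - (\<integral>\<omega>. ?p (H \<omega>) \<partial>M) * (\<integral>\<omega>. ?n (g (L (t - s) \<omega>)) \<partial>M)) -
     ((\<integral>\<omega>. ?n (H \<omega>) \<partial>M) * (\<integral>\<omega>. ?p (g (L (t - s) \<omega>)) \<partial>M) - (\<integral>\<omega>. ?n (H \<omega>) \<partial>M) * (\<integral>\<omega>. ?n (g (L (t - s) \<omega>)) \<partial>M)))"
    by (intro has_bochner_integral_diff pos m i) auto
  moreover have "(\<lambda>\<omega>. (?p (H \<omega>) * ?p (g (L t \<omega> - L s \<omega>)) - ?p (H \<omega>) * ?n (g (L t \<omega> - L s \<omega>))) -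
      (?n (H \<omega>) * ?p (g (L t \<omega> - L s \<omega>)) - ?n (H \<omega>) * ?n (g (L t \<omega> - L s \<omega>)))) = (\<lambda>\<omega>. H \<omega> * g (L t \<omega> - L s \<omega>))"
  proof
    fix \<omega>
    have "(?p x * ?p y - ?p x * ?n y) - (?n x * ?p y - ?n x * ?n y) = (?p x - ?n x) * (?p y - ?n y)" for x y
      by (simp only: left_diff_distrib right_diff_distrib)
    moreover have "?p x - ?n x = x" for x by auto
    ultimately show "(?p (H \<omega>) * ?p (g (L t \<omega> - L s \<omega>)) - ?p (H \<omega>) * ?n (g (L t \<omega> - L s \<omega>))) -
      (?n (H \<omega>) * ?p (g (L t \<omega> - L s \<omega>)) - ?n (H \<omega>) * ?n (g (L t \<omega> - L s \<omega>))) = H \<omega> * g (L t \<omega> - L s \<omega>)" by simp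
  qed
  moreover have "(a * c - a * d) - (b * c - b * d) = (a - b) * (c - d)" for a b c d :: real
    by (simp add: algebra_simps)
  ultimately show ?thesis unfolding split[OF H(2)] split[OF g(2)] by (simp only:)
qed

text \<open>On the event that the later increment has norm at most \<open>n\<close>, the norm of
  \<open>L s\<close> is at most that of \<open>L t\<close> plus \<open>n\<close>. By independence
  the fourth moment of \<open>L s\<close> times the probability of this event is finite, and for
  some \<open>n\<close> the probability is positive.\<close>

lemma fourth_moment_mono:
  assumes st: "0 \<le> s" "s \<le> t" and fin: "(\<integral>\<^sup>+\<omega>. ennreal (norm (L t \<omega>) ^ 4) \<partial>M) < \<infinity>"
  shows "(\<integral>\<^sup>+\<omega>. ennreal (norm (L s \<omega>) ^ 4) \<partial>M) < \<infinity>"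
proof -
  define I where "I n x = (indicator {x. norm x \<le> real n} x :: ennreal)" for n and x :: "real^'d"
  have Im [measurable]: "I n \<in> borel_measurable borel" for n unfolding I_def by measurable
  have Ls [measurable]: "L r \<in> borel_measurable M" if "0 \<le> r" for r by (rule L_measurable[OF that])
  obtain n where n: "(\<integral>\<^sup>+\<omega>. I n (L (t - s) \<omega>) \<partial>M) \<noteq> 0"
  proof (rule ccontr)
    assume "\<not> thesis"
    with that have "(\<integral>\<^sup>+\<omega>. I n (L (t - s) \<omega>) \<partial>M) = 0" for n by blast
    then have "AE \<omega> in M. I n (L (t - s) \<omega>) = 0" for n
      using st by (subst (asm) nn_integral_0_iff_AE) auto
    then have "AE \<omega> in M. \<forall>n. I n (L (t - s) \<omega>) = 0" by (simp add: AE_all_countable)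
    then have "AE \<omega> in M. False"
    proof eventually_elim
      case (elim \<omega>)
      obtain n where "norm (L (t - s) \<omega>) \<le> real n" using real_arch_simple by blast
      with elim[rule_format, of n] show ?case by (simp add: I_def)
    qed
    then show False by simp
  qed
  have Hm: "(\<lambda>\<omega>. ennreal (norm (L s \<omega>) ^ 4)) \<in> borel_measurable (F s)"
    using L_adapted[OF st(1)] by measurable
  have "(\<integral>\<^sup>+\<omega>. ennreal (norm (L s \<omega>) ^ 4) \<partial>M) * (\<integral>\<^sup>+\<omega>. I n (L (t - s) \<omega>) \<partial>M)
    = (\<integral>\<^sup>+\<omega>. ennreal (norm (L s \<omega>) ^ 4) * I n (L t \<omega> - L s \<omega>) \<partial>M)"
    by (rule increments[OF st Hm Im, symmetric])
  also have "\<dots> \<le> (\<integral>\<^sup>+\<omega>. 8 * ennreal (norm (L t \<omega>) ^ 4) + ennreal (8 * real n ^ 4) \<partial>M)"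
  proof (rule nn_integral_mono)
    fix \<omega>
    show "ennreal (norm (L s \<omega>) ^ 4) * I n (L t \<omega> - L s \<omega>) \<le> 8 * ennreal (norm (L t \<omega>) ^ 4) + ennreal (8 * real n ^ 4)"
    proof (cases "norm (L t \<omega> - L s \<omega>) \<le> real n")
      case True
      have "norm (L s \<omega>) \<le> norm (L t \<omega>) + norm (L t \<omega> - L s \<omega>)"
        using norm_triangle_ineq4[of "L t \<omega>" "L t \<omega> - L s \<omega>"] by simp
      with True have "norm (L s \<omega>) \<le> norm (L t \<omega>) + real n" by linarith
      then have "norm (L s \<omega>) ^ 4 \<le> (norm (L t \<omega>) + real n) ^ 4" by (intro power_mono) auto
      also have "\<dots> \<le> 8 * (norm (L t \<omega>) ^ 4 + real n ^ 4)" by (rule power4_add_le)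
      finally have "ennreal (norm (L s \<omega>) ^ 4) \<le> ennreal (8 * norm (L t \<omega>) ^ 4 + 8 * real n ^ 4)"
        by (intro ennreal_leI) simp
      also have "\<dots> = 8 * ennreal (norm (L t \<omega>) ^ 4) + ennreal (8 * real n ^ 4)"
        by (simp add: ennreal_plus ennreal_mult'[of 8])
      finally show ?thesis using True by (simp add: I_def)
    qed (simp add: I_def)
  qed
  also have "\<dots> < \<infinity>"
    using fin st by (simp add: nn_integral_add nn_integral_cmult ennreal_mult_less_top emeasure_space_1)
  finally show ?thesis using n by (auto simp: ennreal_mult_less_top)
qed

text \<open>The centred increment over [0, 1] is a sum of \<open>N\<close> independent copies of the
  centred increment over a step of length 1 / N. The cross terms with an odd power have mean 0 and
  the others are nonnegative, so \<open>N\<close> times the second moment of one copy equals that of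
  the sum, and for the fourth moment there is an inequality in the required direction. The mean of a
  step is the N-th part of the total mean.\<close>

lemma component_moments:
  assumes fin: "(\<integral>\<^sup>+\<omega>. ennreal (norm (L 1 \<omega>) ^ 4) \<partial>M) < \<infinity>"
  shows "\<exists>C. \<forall>N>0. integrable M (\<lambda>\<omega>. (L (1 / real N) \<omega> $ i) ^ 4) \<and>
    (\<integral>\<omega>. (L (1 / real N) \<omega> $ i)\<^sup>2 \<partial>M) \<le> C / real N \<and> (\<integral>\<omega>. (L (1 / real N) \<omega> $ i) ^ 4 \<partial>M) \<le> C / real N"
proof -
  define l where "l t \<omega> = L t \<omega> $ i" for t \<omega>
  have lm [measurable]: "l t \<in> borel_measurable M" if "0 \<le> t" for t
    unfolding l_def
    by (rule measurable_compose[OF L_measurable[OF that] measurable_component])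
  have l4: "integrable M (\<lambda>\<omega>. l t \<omega> ^ 4)" if t: "0 \<le> t" "t \<le> 1" for t
  proof (rule integrableI_bounded)
    have "\<bar>l t \<omega>\<bar> ^ 4 \<le> norm (L t \<omega>) ^ 4" for \<omega>
      unfolding l_def by (intro power_mono component_le_norm_cart) simp
    then have "(\<integral>\<^sup>+\<omega>. ennreal (norm (l t \<omega> ^ 4)) \<partial>M) \<le> (\<integral>\<^sup>+\<omega>. ennreal (norm (L t \<omega>) ^ 4) \<partial>M)"
      by (intro nn_integral_mono ennreal_leI) (simp add: power_abs)
    also have "\<dots> < \<infinity>" by (rule fourth_moment_mono[OF t fin])
    finally show "(\<integral>\<^sup>+\<omega>. ennreal (norm (l t \<omega> ^ 4)) \<partial>M) < \<infinity>" .
  qed (use lm[OF t(1)] in measurable)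
  have l1: "integrable M (l t)" if "0 \<le> t" "t \<le> 1" for t
    using integrable_power_le_4[OF lm l4, of t 1] that by simp
  \<comment> \<open>\<open>L 0\<close> is subtracted, as \<open>L 0 = 0\<close> is not among the
    locale assumptions.\<close>
  define m where "m = (\<integral>\<omega>. l 1 \<omega> \<partial>M) - (\<integral>\<omega>. l 0 \<omega> \<partial>M)"
  define c2 where "c2 = (\<integral>\<omega>. (l 1 \<omega> - l 0 \<omega> - m)\<^sup>2 \<partial>M)"
  define c4 where "c4 = (\<integral>\<omega>. (l 1 \<omega> - l 0 \<omega> - m) ^ 4 \<partial>M)"
  \<comment> \<open>The factors 2 and 8 undo the centring, by (x + y)^2 <= 2 (x^2 + y^2) and (x +
    y)^4 <= 8 (x^4 + y^4). The two bounds are added to have one constant for both moments.\<close>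
  define C where "C = 2 * (c2 + m\<^sup>2) + 8 * (c4 + m ^ 4)"
  have c: "0 \<le> c2" "0 \<le> c4" unfolding c2_def c4_def by (auto intro!: Bochner_Integration.integral_nonneg)
  have "(\<integral>\<omega>. (l (1 / real N) \<omega>)\<^sup>2 \<partial>M) \<le> C / real N \<and> (\<integral>\<omega>. (l (1 / real N) \<omega>) ^ 4 \<partial>M) \<le> C / real N" if N: "N > 0" for N
  proof -
    define \<delta> where "\<delta> = 1 / real N"
    have \<delta>: "0 \<le> \<delta>" "\<delta> \<le> 1" "real N * \<delta> = 1" using N by (auto simp: \<delta>_def)
    define \<mu> where "\<mu> = (\<integral>\<omega>. l \<delta> \<omega> \<partial>M)"
    define g where "g q x = (x $ i - \<mu>) ^ q" for q and x :: "real^'d"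
    have gm: "g q \<in> borel_measurable borel" for q unfolding g_def by measurable
    have g4: "integrable M (\<lambda>\<omega>. (l \<delta> \<omega> - \<mu>) ^ 4)"
      using integrable_power4_add[OF lm l4, of \<delta> "\<lambda>_. - \<mu>"] \<delta> by simp
    have gi: "integrable M (\<lambda>\<omega>. g q (L \<delta> \<omega>))" if "q \<le> 4" for q
      using integrable_power_le_4[OF _ g4 that] lm[OF \<delta>(1)] unfolding g_def l_def[symmetric] by simp
    define e where "e q = (\<integral>\<omega>. g q (L \<delta> \<omega>) \<partial>M)" for q
    have e1: "e 1 = 0" unfolding e_def g_def l_def[symmetric] using l1[OF \<delta>(1,2)] by (simp add: \<mu>_def prob_space)
    have e24: "0 \<le> e 2" "0 \<le> e 4" unfolding e_def g_def by (auto intro!: Bochner_Integration.integral_nonneg)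
    define S where "S k \<omega> = l (real k * \<delta>) \<omega> - l 0 \<omega> - real k * \<mu>" for k \<omega>
    have kd: "0 \<le> real k * \<delta>" "real k * \<delta> \<le> 1" if "k \<le> N" for k
      using that N \<delta> by (auto simp: \<delta>_def)
    have S4: "integrable M (\<lambda>\<omega>. S k \<omega> ^ 4)" and Sm: "S k \<in> borel_measurable M" if "k \<le> N" for k
    proof -
      have i1: "integrable M (\<lambda>\<omega>. (l (real k * \<delta>) \<omega> + (- l 0 \<omega>)) ^ 4)"
        by (intro integrable_power4_add lm l4 kd that borel_measurable_uminus) (simp_all add: l4)
      have "integrable M (\<lambda>\<omega>. ((l (real k * \<delta>) \<omega> + (- l 0 \<omega>)) + (- (real k * \<mu>))) ^ 4)"
        by (rule integrable_power4_add[OF _ i1]) (auto intro!: borel_measurable_diff lm kd that)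
      then show "integrable M (\<lambda>\<omega>. S k \<omega> ^ 4)" by (simp add: S_def)
      show "S k \<in> borel_measurable M" unfolding S_def using kd[OF that] by measurable
    qed
    have Sp: "integrable M (\<lambda>\<omega>. S k \<omega> ^ p)" if "k \<le> N" "p \<le> 4" for k p
      by (rule integrable_power_le_4[OF Sm S4]) (use that in auto)
    have SF: "(\<lambda>\<omega>. S k \<omega> ^ p) \<in> borel_measurable (F (real k * \<delta>))" if "k \<le> N" for k p
    proof -
      have "L 0 \<in> borel_measurable (F (real k * \<delta>))" "L (real k * \<delta>) \<in> borel_measurable (F (real k * \<delta>))"
        using measurable_F_mono[OF L_adapted, of 0 "real k * \<delta>"] L_adapted kd[OF that] by auto
      then show ?thesis unfolding S_def l_def
        by (intro borel_measurable_power borel_measurable_diff borel_measurable_const measurable_compose[OF _ measurable_component])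
    qed
    have B: "has_bochner_integral M (\<lambda>\<omega>. S k \<omega> ^ p * g q (L (real (Suc k) * \<delta>) \<omega> - L (real k * \<delta>) \<omega>)) ((\<integral>\<omega>. S k \<omega> ^ p \<partial>M) * e q)"
      if k: "Suc k \<le> N" "p \<le> 4" "q \<le> 4" for k p q
    proof -
      have "real (Suc k) * \<delta> - real k * \<delta> = \<delta>" by (simp add: algebra_simps)
      with increments_real[of "real k * \<delta>" "real (Suc k) * \<delta>" "\<lambda>\<omega>. S k \<omega> ^ p" "g q"] show ?thesis
        using k kd[of k] SF[of k p] Sp[of k p] gm gi[of q] \<delta>(1) unfolding e_def by (simp add: algebra_simps)
    qed
    have SS: "S (Suc k) \<omega> = S k \<omega> + g 1 (L (real (Suc k) * \<delta>) \<omega> - L (real k * \<delta>) \<omega>)" for k \<omega>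
      by (simp add: S_def g_def l_def algebra_simps)
    have gq: "g q x = g 1 x ^ q" for q x by (simp add: g_def)
    \<comment> \<open>The first two moments are carried along because they determine the cross terms
      in the fourth.\<close>
    have ind: "(\<integral>\<omega>. S k \<omega> \<partial>M) = 0 \<and> (\<integral>\<omega>. (S k \<omega>)\<^sup>2 \<partial>M) = real k * e 2 \<and> real k * e 4 \<le> (\<integral>\<omega>. S k \<omega> ^ 4 \<partial>M)" if "k \<le> N" for k
      using that
    proof (induction k)
      case 0
      then show ?case by (simp add: S_def)
    next
      case (Suc k)
      define G where "G q \<omega> = g q (L (real (Suc k) * \<delta>) \<omega> - L (real k * \<delta>) \<omega>)" for q \<omega>
      note B' = B[OF Suc.prems, folded G_def]
      have S1: "S (Suc k) \<omega> = S k \<omega> ^ 1 * G 0 \<omega> + S k \<omega> ^ 0 * G 1 \<omega>" for \<omega>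
        unfolding SS G_def by (simp add: g_def)
      have GG: "G q \<omega> = G 1 \<omega> ^ q" for q \<omega> unfolding G_def by (rule gq)
      have S2: "(S (Suc k) \<omega>)\<^sup>2 = S k \<omega> ^ 2 * G 0 \<omega> + 2 * (S k \<omega> ^ 1 * G 1 \<omega>) + S k \<omega> ^ 0 * G 2 \<omega>" for \<omega>
        unfolding S1 GG[of 0] GG[of 2] by (simp add: power2_eq_square algebra_simps)
      have S4': "(S (Suc k) \<omega>) ^ 4 = S k \<omega> ^ 4 * G 0 \<omega> + 4 * (S k \<omega> ^ 3 * G 1 \<omega>) + 6 * (S k \<omega> ^ 2 * G 2 \<omega>) + 4 * (S k \<omega> ^ 1 * G 3 \<omega>) + S k \<omega> ^ 0 * G 4 \<omega>" for \<omega>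
        unfolding S1 GG[of 0] GG[of 2] GG[of 3] GG[of 4] by (simp add: power4_eq_xxxx power3_eq_cube power2_eq_square algebra_simps)
      have e0: "e 0 = 1" by (simp add: e_def g_def prob_space)
      have IH: "(\<integral>\<omega>. S k \<omega> \<partial>M) = 0" "(\<integral>\<omega>. (S k \<omega>)\<^sup>2 \<partial>M) = real k * e 2" "real k * e 4 \<le> (\<integral>\<omega>. S k \<omega> ^ 4 \<partial>M)"
        using Suc by auto
      have 1: "(\<integral>\<omega>. S (Suc k) \<omega> \<partial>M) = 0"
      proof -
        have "has_bochner_integral M (S (Suc k)) ((\<integral>\<omega>. S k \<omega> ^ 1 \<partial>M) * e 0 + (\<integral>\<omega>. S k \<omega> ^ 0 \<partial>M) * e 1)"
          unfolding S1 by (intro has_bochner_integral_add B') auto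
        then show ?thesis using IH e1 by (auto dest!: has_bochner_integral_integral_eq)
      qed
      have 2: "(\<integral>\<omega>. (S (Suc k) \<omega>)\<^sup>2 \<partial>M) = real (Suc k) * e 2"
      proof -
        have "has_bochner_integral M (\<lambda>\<omega>. (S (Suc k) \<omega>)\<^sup>2) ((\<integral>\<omega>. S k \<omega> ^ 2 \<partial>M) * e 0 + 2 * ((\<integral>\<omega>. S k \<omega> ^ 1 \<partial>M) * e 1) + (\<integral>\<omega>. S k \<omega> ^ 0 \<partial>M) * e 2)"
          unfolding S2 by (intro has_bochner_integral_add has_bochner_integral_mult_right B') auto
        then show ?thesis using IH e1 e0 by (auto dest!: has_bochner_integral_integral_eq simp: prob_space algebra_simps)
      qed
      have 4: "real (Suc k) * e 4 \<le> (\<integral>\<omega>. S (Suc k) \<omega> ^ 4 \<partial>M)"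
      proof -
        have "has_bochner_integral M (\<lambda>\<omega>. S (Suc k) \<omega> ^ 4) ((\<integral>\<omega>. S k \<omega> ^ 4 \<partial>M) * e 0 + 4 * ((\<integral>\<omega>. S k \<omega> ^ 3 \<partial>M) * e 1)
            + 6 * ((\<integral>\<omega>. S k \<omega> ^ 2 \<partial>M) * e 2) + 4 * ((\<integral>\<omega>. S k \<omega> ^ 1 \<partial>M) * e 3) + (\<integral>\<omega>. S k \<omega> ^ 0 \<partial>M) * e 4)"
          unfolding S4' by (intro has_bochner_integral_add has_bochner_integral_mult_right B') auto
        from has_bochner_integral_integral_eq[OF this]
        have "(\<integral>\<omega>. S (Suc k) \<omega> ^ 4 \<partial>M) = (\<integral>\<omega>. S k \<omega> ^ 4 \<partial>M) + 6 * (real k * e 2 * e 2) + e 4"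
          using IH(1,2) e1 e0 by (simp add: prob_space)
        moreover have "0 \<le> real k * e 2 * e 2" using e24 by simp
        moreover have "real (Suc k) * e 4 = real k * e 4 + e 4" by (simp add: algebra_simps)
        ultimately show ?thesis using IH(3) by linarith
      qed
      show ?case using 1 2 4 by blast
    qed
    have SN: "S N \<omega> = l 1 \<omega> - l 0 \<omega> - real N * \<mu>" for \<omega> by (simp add: S_def \<delta>(3))
    have Nm: "real N * \<mu> = m"
      using ind[OF order.refl] l1[of 1] l1[of 0] unfolding SN by (simp add: m_def prob_space)
    have e2: "e 2 = c2 / real N" using ind[OF order.refl] N unfolding SN Nm c2_def by (simp add: field_simps)
    have e4: "e 4 \<le> c4 / real N" using ind[OF order.refl] N unfolding SN Nm c4_def by (simp add: field_simps)
    have \<mu>N: "\<mu> = m / real N" using Nm N by (simp add: field_simps)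
    have N1: "1 \<le> real N" using N by simp
    \<comment> \<open>Positive powers of the mean \<open>m / N\<close> of one step decay at least
      like 1 / N.\<close>
    have pw: "(x / real N) ^ q \<le> x ^ q / real N" if "0 \<le> x ^ q" "0 < q" for x q
    proof -
      have "real N \<le> real N ^ q" using N1 that(2) by (rule self_le_power)
      then show ?thesis unfolding power_divide using that N1 by (intro divide_left_mono) auto
    qed
    have le2: "(l \<delta> \<omega>)\<^sup>2 \<le> 2 * (g 2 (L \<delta> \<omega>) + \<mu>\<^sup>2)" for \<omega>
      using sum_squares_bound[of "l \<delta> \<omega> - \<mu>" \<mu>] by (simp add: g_def l_def power2_eq_square algebra_simps)
    have le4: "(l \<delta> \<omega>) ^ 4 \<le> 8 * (g 4 (L \<delta> \<omega>) + \<mu> ^ 4)" for \<omega>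
      using power4_add_le[of "l \<delta> \<omega> - \<mu>" \<mu>] by (simp add: g_def l_def)
    have "(\<integral>\<omega>. (l \<delta> \<omega>)\<^sup>2 \<partial>M) \<le> (\<integral>\<omega>. 2 * (g 2 (L \<delta> \<omega>) + \<mu>\<^sup>2) \<partial>M)"
      using integrable_power_le_4[OF lm l4, of \<delta> 2] \<delta> gi[of 2] by (intro Bochner_Integration.integral_mono le2) auto
    also have "\<dots> = 2 * (e 2 + \<mu>\<^sup>2)" using gi[of 2] by (simp add: e_def prob_space)
    also have "\<dots> \<le> 2 * (c2 / real N + m\<^sup>2 / real N)"
      unfolding e2 \<mu>N using pw[of m 2] by simp
    also have "\<dots> \<le> C / real N" using c N by (simp add: C_def field_simps)
    finally have 2: "(\<integral>\<omega>. (l \<delta> \<omega>)\<^sup>2 \<partial>M) \<le> C / real N" .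
    have "(\<integral>\<omega>. (l \<delta> \<omega>) ^ 4 \<partial>M) \<le> (\<integral>\<omega>. 8 * (g 4 (L \<delta> \<omega>) + \<mu> ^ 4) \<partial>M)"
      using l4[OF \<delta>(1,2)] gi[of 4] by (intro Bochner_Integration.integral_mono le4) auto
    also have "\<dots> = 8 * (e 4 + \<mu> ^ 4)" using gi[of 4] by (simp add: e_def prob_space)
    also have "\<dots> \<le> 8 * (c4 / real N + m ^ 4 / real N)"
    proof -
      have "\<mu> ^ 4 \<le> m ^ 4 / real N" unfolding \<mu>N using pw[of m 4] by simp
      with e4 show ?thesis by (intro mult_left_mono add_mono) auto
    qed
    also have "\<dots> \<le> C / real N" using c N by (simp add: C_def field_simps)
    finally show ?thesis using 2 unfolding \<delta>_def by simp
  qed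
  then show ?thesis using l4 unfolding l_def by (intro exI[of _ C]) auto
qed

text \<open>With a = 4 c and b = 4 c^2 the integrand is (1 + 2 c |x|^2)^2 - 1, the excess over 1 of
  the squared Gronwall factor. The fourth power of the norm is distributed over the coordinates by
  Cauchy-Schwarz at the cost of the dimension \<open>d\<close>.\<close>

lemma norm_moments:
  assumes fin: "(\<integral>\<^sup>+\<omega>. ennreal (norm (L 1 \<omega>) ^ 4) \<partial>M) < \<infinity>" and ab: "0 \<le> a" "0 \<le> b"
  shows "\<exists>C\<ge>0. \<forall>N>0. (\<integral>\<^sup>+\<omega>. ennreal (a * sq_norm (L (1 / real N) \<omega>) + b * norm (L (1 / real N) \<omega>) ^ 4) \<partial>M) \<le> ennreal (C / real N)"
proof -
  have "\<forall>i. \<exists>C. \<forall>N>0. integrable M (\<lambda>\<omega>. (L (1 / real N) \<omega> $ i) ^ 4) \<and>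
    (\<integral>\<omega>. (L (1 / real N) \<omega> $ i)\<^sup>2 \<partial>M) \<le> C / real N \<and> (\<integral>\<omega>. (L (1 / real N) \<omega> $ i) ^ 4 \<partial>M) \<le> C / real N"
    using component_moments[OF fin] by blast
  from choice[OF this] obtain C where C: "\<And>i N. N > 0 \<Longrightarrow> integrable M (\<lambda>\<omega>. (L (1 / real N) \<omega> $ i) ^ 4)"
    "\<And>i N. N > 0 \<Longrightarrow> (\<integral>\<omega>. (L (1 / real N) \<omega> $ i)\<^sup>2 \<partial>M) \<le> C i / real N"
    "\<And>i N. N > 0 \<Longrightarrow> (\<integral>\<omega>. (L (1 / real N) \<omega> $ i) ^ 4 \<partial>M) \<le> C i / real N" by blast
  have C0: "0 \<le> C i" for i
  proof -
    have "0 \<le> (\<integral>\<omega>. (L (1 / real 1) \<omega> $ i)\<^sup>2 \<partial>M)" by (intro Bochner_Integration.integral_nonneg) simp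
    from order_trans[OF this C(2)[of 1 i]] show ?thesis by simp
  qed
  define d where "d = real CARD('d)"
  define K where "K = (\<Sum>i\<in>UNIV. a * C i + b * d * C i)"
  have d0: "0 \<le> d" by (simp add: d_def)
  have "(\<integral>\<^sup>+\<omega>. ennreal (a * sq_norm (L (1 / real N) \<omega>) + b * norm (L (1 / real N) \<omega>) ^ 4) \<partial>M) \<le> ennreal (K / real N)"
    if N: "N > 0" for N
  proof -
    let ?x = "\<lambda>\<omega>. L (1 / real N) \<omega>"
    have xm: "(\<lambda>\<omega>. ?x \<omega> $ i) \<in> borel_measurable M" for i
      by (rule measurable_compose[OF L_measurable measurable_component]) simp
    have i2: "integrable M (\<lambda>\<omega>. (?x \<omega> $ i)\<^sup>2)" for i
      by (rule integrable_power_le_4[OF xm C(1)[OF N]]) simp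
    have n2: "sq_norm x = (\<Sum>i\<in>UNIV. (x $ i)\<^sup>2)" for x :: "real^'d"
      unfolding power2_norm_eq_inner inner_vec_def by (simp add: power2_eq_square)
    have n4: "norm x ^ 4 \<le> (\<Sum>i\<in>UNIV. d * (x $ i) ^ 4)" for x :: "real^'d"
    proof -
      have "norm x ^ 4 = (\<Sum>i\<in>UNIV. (x $ i)\<^sup>2)\<^sup>2" unfolding n2[symmetric] by simp
      also have "\<dots> \<le> (\<Sum>i\<in>UNIV. ((x $ i)\<^sup>2)\<^sup>2) * d" unfolding d_def by (rule sum_squared_le_sum_of_squares)
      also have "\<dots> = (\<Sum>i\<in>UNIV. d * (x $ i) ^ 4)" by (simp add: sum_distrib_left mult.commute)
      finally show ?thesis .
    qed
    have "(\<integral>\<^sup>+\<omega>. ennreal (a * sq_norm (?x \<omega>) + b * norm (?x \<omega>) ^ 4) \<partial>M)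
      \<le> (\<integral>\<^sup>+\<omega>. ennreal (\<Sum>i\<in>UNIV. a * (?x \<omega> $ i)\<^sup>2 + b * (d * (?x \<omega> $ i) ^ 4)) \<partial>M)"
    proof (intro nn_integral_mono ennreal_leI)
      fix \<omega>
      show "a * sq_norm (?x \<omega>) + b * norm (?x \<omega>) ^ 4 \<le> (\<Sum>i\<in>UNIV. a * (?x \<omega> $ i)\<^sup>2 + b * (d * (?x \<omega> $ i) ^ 4))"
        using mult_left_mono[OF n4[of "?x \<omega>"] ab(2)]
        unfolding sum.distrib sum_distrib_left[symmetric] n2 by simp
    qed
    also have "\<dots> = ennreal (\<integral>\<omega>. (\<Sum>i\<in>UNIV. a * (?x \<omega> $ i)\<^sup>2 + b * (d * (?x \<omega> $ i) ^ 4)) \<partial>M)"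
      by (intro nn_integral_eq_integral Bochner_Integration.integrable_sum Bochner_Integration.integrable_add integrable_mult_right i2 C(1)[OF N])
         (auto intro!: sum_nonneg add_nonneg_nonneg mult_nonneg_nonneg ab d0)
    also have "(\<integral>\<omega>. (\<Sum>i\<in>UNIV. a * (?x \<omega> $ i)\<^sup>2 + b * (d * (?x \<omega> $ i) ^ 4)) \<partial>M)
      = (\<Sum>i\<in>UNIV. a * (\<integral>\<omega>. (?x \<omega> $ i)\<^sup>2 \<partial>M) + b * (d * (\<integral>\<omega>. (?x \<omega> $ i) ^ 4 \<partial>M)))"
      using i2 C(1)[OF N] by (simp add: Bochner_Integration.integral_sum)
    also have "\<dots> \<le> (\<Sum>i\<in>UNIV. a * (C i / real N) + b * (d * (C i / real N)))"
      by (intro sum_mono add_mono mult_left_mono C N ab d0)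
    also have "\<dots> = K / real N" by (simp add: K_def sum_divide_distrib add_divide_distrib mult.assoc)
    finally show ?thesis by (simp add: ennreal_leI)
  qed
  moreover have "0 \<le> K" unfolding K_def by (intro sum_nonneg add_nonneg_nonneg mult_nonneg_nonneg ab d0 C0)
  ultimately show ?thesis by blast
qed

text \<open>Over \<open>[0, m]\<close>, with \<open>m (n + 1)\<close> grid cells, independence bounds the expectation by
  \<open>(1 + C / (n + 1))\<^bsup>m (n + 1)\<^esup> \<le> e\<^bsup>m C\<^esup>\<close>.\<close>

lemma exp_jump_sum_le:
  fixes \<psi> :: "real^'d \<Rightarrow> real"
  assumes \<psi>: "continuous_on UNIV \<psi>" "\<psi> 0 = 0" "\<And>x. 0 \<le> \<psi> x" and H: "H \<in> borel_measurable (F 0)"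
    and C: "0 \<le> C" "\<And>N. N > 0 \<Longrightarrow> (\<integral>\<^sup>+\<omega>. ennreal (exp (\<psi> (L (1 / real N) \<omega>)) - 1) \<partial>M) \<le> ennreal (C / real N)"
    and m: "0 < m" and fin: "AE \<omega> in M. jump_sum \<psi> (\<lambda>t. L t \<omega>) 0 (real m) < \<infinity>"
  shows "(\<integral>\<^sup>+\<omega>. H \<omega> * ennreal (exp (enn2real (jump_sum \<psi> (\<lambda>t. L t \<omega>) 0 (real m)))) \<partial>M) \<le> (\<integral>\<^sup>+\<omega>. H \<omega> \<partial>M) * ennreal (exp (real m * C))"
proof -
  \<comment> \<open>Without small jumps the grid sums converge path by path. As the truncations stay
    below \<open>\<psi>\<close>, the resulting bound is the same for all \<open>k\<close>.\<close>
  define \<phi> where "\<phi> k x = max 0 (\<psi> x - 1 / real (Suc k))" for k x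
  have \<phi>v: "vanishes_near_0 (\<phi> k)" for k
    unfolding \<phi>_def by (rule vanishes_near_0_truncate[OF \<psi>(1,2), of "1 / real (Suc k)"]) (auto intro!: continuous_intros)
  have \<phi>c: "continuous_on UNIV (\<phi> k)" for k using \<phi>v[of k] by (simp add: vanishes_near_0_def)
  have \<phi>le: "\<phi> k x \<le> \<psi> x" for k x using \<psi>(3)[of x] by (simp add: \<phi>_def)
  have \<phi>lim: "(\<lambda>k. \<phi> k x) \<longlonglongrightarrow> \<psi> x" for x
  proof -
    have "(\<lambda>n. max 0 (\<psi> x - 1 / real (Suc n))) \<longlonglongrightarrow> max 0 (\<psi> x - 0)"
      by (intro tendsto_intros LIMSEQ_Suc[OF lim_const_over_n])
    then show ?thesis by (simp only: \<phi>_def diff_0_right max_absorb2[OF \<psi>(3)])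
  qed
  have HM [measurable]: "H \<in> borel_measurable M" by (rule measurable_F_M[OF H]) simp
  let ?B = "(\<integral>\<^sup>+\<omega>. H \<omega> \<partial>M) * ennreal (exp (real m * C))"
  let ?J = "\<lambda>\<phi> \<omega>. enn2real (jump_sum \<phi> (\<lambda>t. L t \<omega>) 0 (real m))"
  \<comment> \<open>\<open>H\<close> may take the value infinity. A limit \<open>g\<close> that is
    finite and nonzero keeps multiplication by \<open>H\<close> continuous in the extended
    reals.\<close>
  have fatou: "(\<integral>\<^sup>+\<omega>. H \<omega> * g \<omega> \<partial>M) \<le> B"
    if "\<And>n. f n \<in> borel_measurable M" "AE \<omega> in M. (\<lambda>n. f n \<omega>) \<longlonglongrightarrow> g \<omega>" "AE \<omega> in M. g \<omega> \<noteq> 0 \<and> g \<omega> < \<infinity>"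
      "\<And>n. (\<integral>\<^sup>+\<omega>. H \<omega> * f n \<omega> \<partial>M) \<le> B" for f :: "nat \<Rightarrow> 'a \<Rightarrow> ennreal" and g B
  proof -
    have "AE \<omega> in M. (\<lambda>n. H \<omega> * f n \<omega>) \<longlonglongrightarrow> H \<omega> * g \<omega>"
      using that(2,3) by eventually_elim (auto intro!: tendsto_mult_ennreal tendsto_const)
    then have "(\<integral>\<^sup>+\<omega>. H \<omega> * g \<omega> \<partial>M) = (\<integral>\<^sup>+\<omega>. liminf (\<lambda>n. H \<omega> * f n \<omega>) \<partial>M)"
      by (intro nn_integral_cong_AE) (auto simp: tendsto_iff_Liminf_eq_Limsup)
    also have "\<dots> \<le> liminf (\<lambda>n. \<integral>\<^sup>+\<omega>. H \<omega> * f n \<omega> \<partial>M)"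
      using that(1) by (intro nn_integral_liminf) auto
    also have "\<dots> \<le> B"
      using that(4) by (intro Liminf_le) auto
    finally show ?thesis .
  qed
  have k: "(\<integral>\<^sup>+\<omega>. H \<omega> * ennreal (exp (?J (\<phi> k) \<omega>)) \<partial>M) \<le> ?B" for k
  proof -
    let ?S = "\<lambda>N \<omega>. \<Sum>i<N. \<phi> k (L (grid 0 (real m) N (Suc i)) \<omega> - L (grid 0 (real m) N i) \<omega>)"
    define N where "N n = m * Suc n" for n
    have c: "\<phi> k \<in> borel_measurable borel" using \<phi>c by (rule borel_measurable_continuous_onI)
    have Sm: "?S N \<in> borel_measurable M" for N
    proof -
      have "0 \<le> grid 0 (real m) N i" for i by (simp add: grid_def)
      then show ?thesis by (intro borel_measurable_sum measurable_compose[OF _ c] borel_measurable_diff L_measurable) auto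
    qed
    show ?thesis
    proof (rule fatou[of "\<lambda>n \<omega>. ennreal (exp (?S (N n) \<omega>))"])
      show "(\<lambda>\<omega>. ennreal (exp (?S (N n) \<omega>))) \<in> borel_measurable M" for n using Sm by measurable
      have N: "strict_mono N" unfolding N_def using m by (intro strict_monoI) auto
      have "(\<lambda>n. ?S n \<omega>) \<longlonglongrightarrow> ?J (\<phi> k) \<omega>" for \<omega>
        by (rule jump_sum_tendsto[OF L_cadlag]) (auto simp: \<phi>v)
      from LIMSEQ_subseq_LIMSEQ[OF this N]
      show "AE \<omega> in M. (\<lambda>n. ennreal (exp (?S (N n) \<omega>))) \<longlonglongrightarrow> ennreal (exp (?J (\<phi> k) \<omega>))"
        unfolding comp_def by (intro AE_I2 tendsto_ennrealI tendsto_exp)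
      show "(\<integral>\<^sup>+\<omega>. H \<omega> * ennreal (exp (?S (N n) \<omega>)) \<partial>M) \<le> ?B" for n
      proof -
        have gle: "(\<integral>\<^sup>+\<omega>. ennreal (exp (\<phi> k (L (1 / real (Suc n)) \<omega>))) \<partial>M) \<le> ennreal (exp (C / real (Suc n)))"
        proof -
          have Lm: "L (1 / real (Suc n)) \<in> borel_measurable M" by (rule L_measurable) simp
          have \<psi>m: "\<psi> \<in> borel_measurable borel" using \<psi>(1) by (rule borel_measurable_continuous_onI)
          have "(\<integral>\<^sup>+\<omega>. ennreal (exp (\<phi> k (L (1 / real (Suc n)) \<omega>))) \<partial>M) \<le> (\<integral>\<^sup>+\<omega>. 1 + ennreal (exp (\<psi> (L (1 / real (Suc n)) \<omega>)) - 1) \<partial>M)"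
          proof (rule nn_integral_mono)
            fix \<omega>
            let ?x = "L (1 / real (Suc n)) \<omega>"
            have "ennreal (exp (\<phi> k ?x)) \<le> ennreal (1 + (exp (\<psi> ?x) - 1))" using \<phi>le[of k ?x] by (intro ennreal_leI) simp
            also have "\<dots> = 1 + ennreal (exp (\<psi> ?x) - 1)" using \<psi>(3)[of ?x] by (subst ennreal_plus) auto
            finally show "ennreal (exp (\<phi> k ?x)) \<le> 1 + ennreal (exp (\<psi> ?x) - 1)" .
          qed
          also have "\<dots> = 1 + (\<integral>\<^sup>+\<omega>. ennreal (exp (\<psi> (L (1 / real (Suc n)) \<omega>)) - 1) \<partial>M)"
            using measurable_compose[OF Lm \<psi>m] by (subst nn_integral_add) (auto simp: emeasure_space_1)
          also have "\<dots> \<le> 1 + ennreal (C / real (Suc n))" by (intro add_left_mono C) simp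
          also have "\<dots> = ennreal (1 + C / real (Suc n))" using C(1) by (subst ennreal_plus) auto
          also have "\<dots> \<le> ennreal (exp (C / real (Suc n)))" by (intro ennreal_leI exp_ge_add_one_self)
          finally show ?thesis .
        qed
        have "(\<integral>\<^sup>+\<omega>. H \<omega> * ennreal (exp (?S (N n) \<omega>)) \<partial>M)
          = (\<integral>\<^sup>+\<omega>. H \<omega> \<partial>M) * (\<integral>\<^sup>+\<omega>. ennreal (exp (\<phi> k (L ((real m - 0) / real (N n)) \<omega>))) \<partial>M) ^ N n"
          by (rule exp_jump_sum_grid[OF _ _ H \<phi>c]) auto
        also have "(real m - 0) / real (N n) = 1 / real (Suc n)" using m by (simp add: N_def del: of_nat_Suc mult_Suc_right)
        also have "(\<integral>\<^sup>+\<omega>. H \<omega> \<partial>M) * (\<integral>\<^sup>+\<omega>. ennreal (exp (\<phi> k (L (1 / real (Suc n)) \<omega>))) \<partial>M) ^ N n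
          \<le> (\<integral>\<^sup>+\<omega>. H \<omega> \<partial>M) * ennreal (exp (C / real (Suc n))) ^ N n"
          by (intro mult_left_mono power_mono gle) auto
        also have "ennreal (exp (C / real (Suc n))) ^ N n = ennreal (exp (real m * C))"
        proof -
          have "real (N n) * (C / real (Suc n)) = real m * C" by (simp add: N_def field_simps)
          then show ?thesis by (simp add: ennreal_power flip: exp_of_nat_mult)
        qed
        finally show ?thesis .
      qed
    qed auto
  qed
  show ?thesis
  proof (rule fatou[of "\<lambda>k \<omega>. ennreal (exp (?J (\<phi> k) \<omega>))"])
    show "(\<lambda>\<omega>. ennreal (exp (?J (\<phi> k) \<omega>))) \<in> borel_measurable M" for k
      using jump_sum_measurable_vanish[OF _ _ \<phi>v, of 0 "real m" k] by measurable
    show "AE \<omega> in M. (\<lambda>k. ennreal (exp (?J (\<phi> k) \<omega>))) \<longlonglongrightarrow> ennreal (exp (?J \<psi> \<omega>))"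
      using fin
    proof eventually_elim
      case (elim \<omega>)
      have "(\<lambda>k. jump_sum (\<phi> k) (\<lambda>t. L t \<omega>) 0 (real m)) \<longlonglongrightarrow> jump_sum \<psi> (\<lambda>t. L t \<omega>) 0 (real m)"
        by (rule jump_sum_tendsto_below[OF \<phi>le \<phi>lim])
      then have "(\<lambda>k. ?J (\<phi> k) \<omega>) \<longlonglongrightarrow> ?J \<psi> \<omega>"
        using elim by (intro tendsto_enn2real) (auto simp: less_top)
      then show ?case by (intro tendsto_ennrealI tendsto_exp)
    qed
  qed (use k in auto)
qed

end

section \<open>The matrix exponential and linear equations\<close>

lemma has_vector_derivative_matrixI:
  fixes f :: "real \<Rightarrow> real^'n^'m"
  assumes "\<And>i j. ((\<lambda>t. f t $ i $ j) has_vector_derivative f' $ i $ j) (at t within S)"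
  shows "(f has_vector_derivative f') (at t within S)"
  unfolding has_vector_derivative_def
proof (subst has_derivative_componentwise_within, rule ballI)
  fix b :: "real^'n^'m" assume "b \<in> Basis"
  then obtain i j where b: "b = axis i (axis j 1)" by (auto simp: Basis_vec_def)
  show "((\<lambda>x. f x \<bullet> b) has_derivative (\<lambda>x. x *\<^sub>R f' \<bullet> b)) (at t within S)"
    using assms[of i j] by (simp add: b inner_axis has_vector_derivative_def)
qed

definition matrix_power :: "real^'n^'n \<Rightarrow> nat \<Rightarrow> real^'n^'n" where
  "matrix_power K k = ((**) K ^^ k) (mat 1)"

lemma matrix_power_0: "matrix_power K 0 = mat 1"
  and matrix_power_Suc: "matrix_power K (Suc k) = K ** matrix_power K k"
  by (simp_all add: matrix_power_def)

lemma matrix_power_scaleR: "matrix_power (c *\<^sub>R K) k = c ^ k *\<^sub>R matrix_power K k"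
proof (induction k)
  case (Suc k)
  have "(c *\<^sub>R K) ** (d *\<^sub>R X) = (c * d) *\<^sub>R (K ** X)" for d and X :: "real^'a^'a"
    by (simp add: vec_eq_iff matrix_matrix_mult_def sum_distrib_left mult_ac)
  then show ?case by (simp add: matrix_power_Suc Suc)
qed (simp add: matrix_power_0)

lemma norm_matrix_power_le: "norm (matrix_power K k) \<le> norm K ^ k * norm (mat 1 :: real^'n^'n)"
  for K :: "real^'n^'n"
proof (induction k)
  case (Suc k)
  have "norm (matrix_power K (Suc k)) \<le> norm K * norm (matrix_power K k)"
    unfolding matrix_power_Suc by (rule norm_matrix_mult_le)
  also have "\<dots> \<le> norm K * (norm K ^ k * norm (mat 1 :: real^'n^'n))" by (intro mult_left_mono Suc) simp
  finally show ?case by (simp add: mult.assoc)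
qed (simp add: matrix_power_0)

lemma summable_matrix_exp: "summable (\<lambda>k. (1 / fact k) *\<^sub>R matrix_power K k)" for K :: "real^'n^'n"
proof (rule summable_norm_cancel, rule summable_comparison_test')
  show "summable (\<lambda>k. (norm K ^ k /\<^sub>R fact k) * norm (mat 1 :: real^'n^'n))"
    by (intro summable_mult2 summable_exp_generic)
  show "norm (norm ((1 / fact k) *\<^sub>R matrix_power K k)) \<le> (norm K ^ k /\<^sub>R fact k) * norm (mat 1 :: real^'n^'n)" for k
    using mult_left_mono[OF norm_matrix_power_le[of K k], of "1 / fact k"] by (simp add: divide_inverse mult.assoc)
qed

text \<open>The entries become real power series in \<open>h\<close>, for which term-by-term
  differentiation is available.\<close>

lemma matrix_exp_nth:
  fixes K :: "real^'n^'n"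
  shows "(\<lambda>k. (matrix_power K k $ i $ j / fact k) * h ^ k) sums (matrix_exp (h *\<^sub>R K) $ i $ j)"
proof -
  have l: "bounded_linear (\<lambda>X :: real^'n^'n. X $ i $ j)"
    by (intro bounded_linear_compose[OF bounded_linear_vec_nth bounded_linear_vec_nth])
  have "(\<lambda>k. (1 / fact k) *\<^sub>R matrix_power (h *\<^sub>R K) k) sums matrix_exp (h *\<^sub>R K)"
    unfolding matrix_exp_def matrix_power_def[symmetric] by (rule summable_sums[OF summable_matrix_exp])
  from bounded_linear.sums[OF l this] show ?thesis
    by (simp add: matrix_power_scaleR mult_ac)
qed

lemma matrix_exp_0: "matrix_exp (0 *\<^sub>R K) = mat 1" for K :: "real^'n^'n"
proof -
  have "matrix_exp (0 *\<^sub>R K) $ i $ j = mat 1 $ i $ j" for i j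
  proof -
    have "(\<lambda>k. (matrix_power K k $ i $ j / fact k) * 0 ^ k) sums (matrix_power K 0 $ i $ j / fact 0)"
      by (rule powser_sums_zero)
    from sums_unique2[OF matrix_exp_nth[of K i j 0] this] show ?thesis by (simp add: matrix_power_0)
  qed
  then show ?thesis by (simp add: vec_eq_iff)
qed

text \<open>In the differentiated series the factor \<open>k + 1\<close> cancels against the
  factorial, and since \<open>matrix_power K (Suc k)\<close> is \<open>K\<close> times
  \<open>matrix_power K k\<close>, one factor \<open>K\<close> comes out on the left.\<close>

lemma matrix_exp_has_vector_derivative:
  fixes K :: "real^'n^'n"
  shows "((\<lambda>h. matrix_exp (h *\<^sub>R K)) has_vector_derivative K ** matrix_exp (h *\<^sub>R K)) (at h within S)"
proof (rule has_vector_derivative_matrixI)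
  fix i j
  define c where "c i k = matrix_power K k $ i $ j / fact k" for i k
  have s: "(\<lambda>k. c i k * h ^ k) sums (matrix_exp (h *\<^sub>R K) $ i $ j)" for h i
    unfolding c_def by (rule matrix_exp_nth)
  have e: "matrix_exp (h *\<^sub>R K) $ i $ j = (\<Sum>k. c i k * h ^ k)" for h i using s by (rule sums_unique)
  have "((\<lambda>h. \<Sum>k. c i k * h ^ k) has_field_derivative (\<Sum>k. diffs (c i) k * h ^ k)) (at h)"
    by (rule termdiffs_strong_converges_everywhere) (rule sums_summable[OF s])
  moreover have "(\<lambda>k. diffs (c i) k * h ^ k) sums ((K ** matrix_exp (h *\<^sub>R K)) $ i $ j)"
  proof -
    have "(\<lambda>k. \<Sum>l\<in>UNIV. K $ i $ l * (c l k * h ^ k)) sums (\<Sum>l\<in>UNIV. K $ i $ l * matrix_exp (h *\<^sub>R K) $ l $ j)"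
      by (intro sums_sum sums_mult s)
    moreover have "diffs (c i) k * h ^ k = (\<Sum>l\<in>UNIV. K $ i $ l * (c l k * h ^ k))" for k
    proof -
      have "diffs (c i) k = (K ** matrix_power K k) $ i $ j / fact k"
        by (simp add: diffs_def c_def matrix_power_Suc field_simps del: of_nat_Suc)
      then show ?thesis
        by (simp add: matrix_matrix_mult_def c_def sum_divide_distrib sum_distrib_right mult.assoc)
    qed
    ultimately show ?thesis by (simp add: matrix_matrix_mult_def)
  qed
  ultimately have "((\<lambda>h. matrix_exp (h *\<^sub>R K) $ i $ j) has_field_derivative ((K ** matrix_exp (h *\<^sub>R K)) $ i $ j)) (at h)"
    unfolding e by (simp add: sums_iff)
  then show "((\<lambda>h. matrix_exp (h *\<^sub>R K) $ i $ j) has_vector_derivative ((K ** matrix_exp (h *\<^sub>R K)) $ i $ j)) (at h within S)"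
    unfolding has_real_derivative_iff_has_vector_derivative by (rule has_vector_derivative_at_within)
qed

lemma matrix_mult_right_has_vector_derivative:
  fixes X :: "real^'n^'n" and f :: "real \<Rightarrow> real^'n^'m"
  assumes "(f has_vector_derivative f') (at t within S)"
  shows "((\<lambda>t. f t ** X) has_vector_derivative f' ** X) (at t within S)"
proof (rule bounded_linear.has_vector_derivative[OF _ assms])
  show "bounded_linear (\<lambda>A :: real^'n^'m. A ** X)"
    by (rule linear_conv_bounded_linear[THEN iffD1], rule linearI)
       (simp_all add: vec_eq_iff matrix_matrix_mult_def sum.distrib distrib_right sum_distrib_left mult.assoc)
qed

section \<open>Linear differential and integral equations\<close>

text \<open>The squared norm of \<open>W\<close>, damped by \<open>exp (- (2 * norm K) * t)\<close>,
  has a nonpositive derivative by Cauchy-Schwarz and starts at 0.\<close>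

lemma linear_ode_zero:
  fixes W :: "real \<Rightarrow> real^'n^'m"
  assumes W: "\<And>t. 0 \<le> t \<Longrightarrow> (W has_vector_derivative K ** W t) (at t within {0..})"
    and W0: "W 0 = 0" and t: "0 \<le> t"
  shows "W t = 0"
proof -
  define f where "f t = exp (- (2 * norm K) * t) * (W t \<bullet> W t)" for t
  have d: "(f has_vector_derivative (exp (- (2 * norm K) * s) * (2 * (W s \<bullet> (K ** W s)) - 2 * norm K * (W s \<bullet> W s)))) (at s within {0..})"
    if "0 \<le> s" for s
  proof -
    have "((\<lambda>s. W s \<bullet> W s) has_vector_derivative (2 * (W s \<bullet> (K ** W s)))) (at s within {0..})"
      using bounded_bilinear.has_vector_derivative[OF bounded_bilinear_inner W[OF that] W[OF that]]
      by (simp add: inner_commute)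
    moreover have "((\<lambda>s. exp (- (2 * norm K) * s)) has_vector_derivative (exp (- (2 * norm K) * s) * (- (2 * norm K)))) (at s within {0..})"
      unfolding has_real_derivative_iff_has_vector_derivative[symmetric]
      by (auto intro!: derivative_eq_intros)
    ultimately have "(f has_vector_derivative (exp (- (2 * norm K) * s) * (2 * (W s \<bullet> (K ** W s))) + exp (- (2 * norm K) * s) * (- (2 * norm K)) * (W s \<bullet> W s))) (at s within {0..})"
      unfolding f_def by (rule has_vector_derivative_mult[rotated])
    then show ?thesis by (simp add: algebra_simps)
  qed
  have "f t \<le> f 0"
  proof (rule DERIV_nonpos_imp_decreasing_open[OF t])
    show "continuous_on {0..t} f"
      unfolding continuous_on_eq_continuous_within
    proof
      fix s assume s: "s \<in> {0..t}"
      then have "continuous (at s within {0..}) f" by (intro has_vector_derivative_continuous[OF d]) auto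
      then show "continuous (at s within {0..t}) f" by (rule continuous_within_subset) auto
    qed
    fix s :: real assume s: "0 < s" "s < t"
    have "at s within {0..} = at s" using s by (intro at_within_interior) (simp add: interior_real_atLeast)
    then have "DERIV f s :> exp (- (2 * norm K) * s) * (2 * (W s \<bullet> (K ** W s)) - 2 * norm K * (W s \<bullet> W s))"
      using d[of s] s by (simp add: has_real_derivative_iff_has_vector_derivative)
    moreover have "W s \<bullet> (K ** W s) \<le> norm K * (W s \<bullet> W s)"
    proof -
      have "W s \<bullet> (K ** W s) \<le> norm (W s) * norm (K ** W s)" by (rule norm_cauchy_schwarz)
      also have "\<dots> \<le> norm (W s) * (norm K * norm (W s))" by (intro mult_left_mono norm_matrix_mult_le) simp
      finally show ?thesis by (simp add: power2_norm_eq_inner[symmetric] power2_eq_square mult_ac)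
    qed
    ultimately show "\<exists>y. DERIV f s :> y \<and> y \<le> 0"
      by (intro exI conjI) (assumption, simp add: mult_le_0_iff)
  qed
  also have "f 0 = 0" by (simp add: f_def W0)
  finally have "W t \<bullet> W t \<le> 0" by (simp add: f_def mult_le_0_iff)
  then show ?thesis by (metis inner_gt_zero_iff not_less)
qed

lemma linear_ode_unique:
  fixes D :: "real \<Rightarrow> real^'n^'n"
  assumes D: "\<And>t. 0 \<le> t \<Longrightarrow> (D has_vector_derivative K ** D t) (at t within {0..})" and t: "0 \<le> t"
  shows "D t = matrix_exp (t *\<^sub>R K) ** D 0"
proof -
  define W where "W t = D t - matrix_exp (t *\<^sub>R K) ** D 0" for t
  have "W t = 0"
  proof (rule linear_ode_zero[OF _ _ t])
    show "(W has_vector_derivative K ** W s) (at s within {0..})" if "0 \<le> s" for s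
    proof -
      have "(W has_vector_derivative (K ** D s - (K ** matrix_exp (s *\<^sub>R K)) ** D 0)) (at s within {0..})"
        unfolding W_def
        by (intro has_vector_derivative_diff D that matrix_mult_right_has_vector_derivative matrix_exp_has_vector_derivative)
      also have "K ** D s - (K ** matrix_exp (s *\<^sub>R K)) ** D 0 = K ** W s"
      proof -
        have "K ** X - K ** Y = K ** (X - Y)" for X Y :: "real^'n^'n"
          by (simp add: vec_eq_iff matrix_matrix_mult_def sum_subtractf right_diff_distrib)
        then show ?thesis unfolding W_def matrix_mul_assoc[symmetric] by simp
      qed
      finally show ?thesis .
    qed
    show "W 0 = 0" using matrix_exp_0[of K] by (simp add: W_def)
  qed
  then show ?thesis by (simp add: W_def)
qed

text \<open>The fundamental theorem of calculus, once the half-open interval is replaced by the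
  closed one at the cost of a null set. At time 0 the derivative is one-sided.\<close>

lemma integral_equation_has_derivative:
  fixes g :: "real \<Rightarrow> real"
  assumes g: "continuous_on {0..} g" and f: "\<And>t. 0 \<le> t \<Longrightarrow> f t = f 0 + (\<integral>s. g s * indicator {0<..t} s \<partial>lborel)" and t: "0 \<le> t"
  shows "(f has_vector_derivative g t) (at t within {0..})"
proof -
  have eq: "f s = f 0 + integral {0..s} g" if "0 \<le> s" for s
  proof -
    have "continuous_on {0..s} g" using g by (rule continuous_on_subset) auto
    then have "set_integrable lborel {0..s} g" by (rule borel_integrable_atLeastAtMost')
    then have "(LINT r:{0..s}|lborel. g r) = integral {0..s} g" by (rule set_borel_integral_eq_integral)
    moreover have "(\<integral>r. g r * indicator {0<..s} r \<partial>lborel) = (LINT r:{0..s}|lborel. g r)"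
      unfolding set_lebesgue_integral_def
    proof (rule integral_cong_AE)
      have m: "(\<lambda>r. indicator {0..s} r *\<^sub>R g r) \<in> borel_measurable lborel"
        using \<open>set_integrable lborel {0..s} g\<close> unfolding set_integrable_def by (rule borel_measurable_integrable)
      then have "(\<lambda>r. indicator {0<..s} r * (indicator {0..s} r *\<^sub>R g r)) \<in> borel_measurable lborel" by measurable
      also have "(\<lambda>r. indicator {0<..s} r * (indicator {0..s} r *\<^sub>R g r)) = (\<lambda>r. g r * indicator {0<..s} r)"
        by (auto simp: fun_eq_iff indicator_def)
      finally show "(\<lambda>r. g r * indicator {0<..s} r) \<in> borel_measurable lborel" .
      show "AE r in lborel. g r * indicator {0<..s} r = indicator {0..s} r *\<^sub>R g r"
        using AE_lborel_singleton[of 0] by eventually_elim (auto simp: indicator_def)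
      show "(\<lambda>r. indicator {0..s} r *\<^sub>R g r) \<in> borel_measurable lborel" by (rule m)
    qed
    ultimately show ?thesis using f[OF that] by simp
  qed
  have "continuous_on {0..t + 1} g" using g by (rule continuous_on_subset) auto
  from integral_has_vector_derivative[OF this, of t] t
  have d: "((\<lambda>s. f 0 + integral {0..s} g) has_vector_derivative (0 + g t)) (at t within {0..t + 1})"
    by (intro has_vector_derivative_add has_vector_derivative_const) auto
  have "(f has_vector_derivative g t) (at t within {0..t + 1})"
  proof (rule has_vector_derivative_transform[OF _ _ d[unfolded add_0]])
    show "f s = f 0 + integral {0..s} g" if "s \<in> {0..t + 1}" for s by (rule eq) (use that in simp)
  qed (use t in simp)
  moreover have "at t within {0..t + 1} = at t within {0..}"
    by (rule at_within_nhd[where S = "{..<t + 1}"]) auto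
  ultimately show ?thesis by simp
qed

text \<open>A bootstrap: boundedness makes \<open>D\<close> locally Lipschitz through the integral
  equation, hence the integrand is continuous, hence \<open>D\<close> is differentiable.
  Measurability of the integrand is among the assumptions because continuity of \<open>D\<close> is
  only an outcome.\<close>

lemma linear_integral_equation:
  fixes D :: "real \<Rightarrow> real^'n^'n"
  assumes bdd: "\<And>T. \<exists>B. \<forall>t. 0 \<le> t \<longrightarrow> t \<le> T \<longrightarrow> norm (D t) \<le> B"
    and D: "\<And>t i j. 0 \<le> t \<Longrightarrow> D t $ i $ j = D 0 $ i $ j + (\<integral>s. (K ** D s) $ i $ j * indicator {0<..t} s \<partial>lborel)"
    and m: "\<And>t i j. 0 \<le> t \<Longrightarrow> (\<lambda>s. (K ** D s) $ i $ j * indicator {0<..t} s) \<in> borel_measurable lborel"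
    and t: "0 \<le> t"
  shows "(D has_vector_derivative K ** D t) (at t within {0..})" and "D t = matrix_exp (t *\<^sub>R K) ** D 0"
proof -
  have cont: "continuous_on {0..} (\<lambda>t. D t $ i $ j)" for i j
    unfolding continuous_on_eq_continuous_within
  proof
    fix x :: real assume "x \<in> {0..}"
    then have x: "0 \<le> x" by simp
    obtain B where B: "\<And>t. 0 \<le> t \<Longrightarrow> t \<le> x + 1 \<Longrightarrow> norm (D t) \<le> B" using bdd by blast
    have B0: "0 \<le> B" using B[of 0] x by (auto intro: order_trans[OF norm_ge_zero])
    have KB: "\<bar>(K ** D s) $ i $ j\<bar> \<le> norm K * B" if "0 \<le> s" "s \<le> x + 1" for s
    proof -
      have "\<bar>(K ** D s) $ i $ j\<bar> \<le> norm (K ** D s)"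
        by (rule order_trans[OF component_le_norm_cart Finite_Cartesian_Product.norm_nth_le])
      also have "\<dots> \<le> norm K * norm (D s)" by (rule norm_matrix_mult_le)
      also have "\<dots> \<le> norm K * B" by (intro mult_left_mono B that) simp
      finally show ?thesis .
    qed
    have int: "integrable lborel (\<lambda>s. (K ** D s) $ i $ j * indicator {0<..t} s)" if "0 \<le> t" "t \<le> x + 1" for t
    proof (rule Bochner_Integration.integrable_bound[OF integrable_indicator_Ioc[of "norm K * B" 0 t] m[OF that(1)]])
      show "AE s in lborel. norm ((K ** D s) $ i $ j * indicator {0<..t} s) \<le> norm (norm K * B * indicator {0<..t} s)"
        using KB that B0 by (intro AE_I2) (auto simp: indicator_def)
    qed
    have lip: "\<bar>D b $ i $ j - D a $ i $ j\<bar> \<le> norm K * B * (b - a)" if "0 \<le> a" "a \<le> b" "b \<le> x + 1" for a b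
    proof -
      have "D b $ i $ j - D a $ i $ j = (\<integral>s. (K ** D s) $ i $ j * indicator {0<..b} s - (K ** D s) $ i $ j * indicator {0<..a} s \<partial>lborel)"
        using that D[of a i j] D[of b i j] by (subst Bochner_Integration.integral_diff[OF int int]) auto
      also have "\<dots> = (\<integral>s. (K ** D s) $ i $ j * indicator {a<..b} s \<partial>lborel)"
        using that by (intro Bochner_Integration.integral_cong) (auto simp: indicator_def)
      finally have e: "D b $ i $ j - D a $ i $ j = (\<integral>s. (K ** D s) $ i $ j * indicator {a<..b} s \<partial>lborel)" .
      have "\<bar>D b $ i $ j - D a $ i $ j\<bar> \<le> (\<integral>s. \<bar>(K ** D s) $ i $ j * indicator {a<..b} s\<bar> \<partial>lborel)"
        unfolding e by (rule integral_abs_bound)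
      also have "\<dots> \<le> (\<integral>s. norm K * B * indicator {a<..b} s \<partial>lborel)"
      proof (rule integral_mono')
        show "integrable lborel (\<lambda>s. norm K * B * indicator {a<..b} s)" by (rule integrable_indicator_Ioc)
      qed (use KB that B0 in \<open>auto simp: indicator_def\<close>)
      also have "\<dots> = norm K * B * (b - a)" using that by simp
      finally show ?thesis .
    qed
    have "((\<lambda>t. D t $ i $ j - D x $ i $ j) \<longlongrightarrow> 0) (at x within {0..})"
    proof (rule Lim_null_comparison)
      have "((\<lambda>t. norm K * B * \<bar>t - x\<bar>) \<longlongrightarrow> norm K * B * \<bar>x - x\<bar>) (at x within {0..})" by (intro tendsto_intros)
      then show "((\<lambda>t. norm K * B * \<bar>t - x\<bar>) \<longlongrightarrow> 0) (at x within {0..})" by simp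
      have "\<forall>\<^sub>F t in at x within {0..}. t < x + 1"
        by (rule order_tendstoD(2)[OF tendsto_ident_at]) simp
      moreover have "\<forall>\<^sub>F t in at x within {0..}. 0 \<le> t" by (simp add: eventually_at_filter)
      ultimately show "\<forall>\<^sub>F t in at x within {0..}. norm (D t $ i $ j - D x $ i $ j) \<le> norm K * B * \<bar>t - x\<bar>"
      proof eventually_elim
        case (elim t)
        then show ?case using lip[of t x] lip[of x t] x by (cases "t \<le> x") (auto simp: abs_minus_commute)
      qed
    qed
    then show "continuous (at x within {0..}) (\<lambda>t. D t $ i $ j)"
      unfolding continuous_within by (subst (asm) Lim_null[symmetric])
  qed
  have KDc: "continuous_on {0..} (\<lambda>t. (K ** D t) $ i $ j)" for i j
    unfolding matrix_matrix_mult_def by (simp, intro continuous_intros cont)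
  have der: "(D has_vector_derivative K ** D t) (at t within {0..})" if "0 \<le> t" for t
    by (rule has_vector_derivative_matrixI, rule integral_equation_has_derivative[OF KDc D that])
  then show "(D has_vector_derivative K ** D t) (at t within {0..})" using t by blast
  show "D t = matrix_exp (t *\<^sub>R K) ** D 0" by (rule linear_ode_unique[OF der t])
qed

section \<open>The volatility equation along paths\<close>

text \<open>As the blocks are columns, left multiplication by \<open>B\<close> acts inside each
  block and becomes \<open>mat 1 \<otimes>\<^sub>K B\<close>, whereas right multiplication by
  \<open>transpose B\<close> mixes the blocks and becomes
  \<open>B \<otimes>\<^sub>K mat 1\<close>.\<close>

lemma kronecker_vectorize:
  fixes A B X :: "real^'n^'n" and c :: real
  defines "K \<equiv> B \<otimes>\<^sub>K mat 1 + mat 1 \<otimes>\<^sub>K B + c *\<^sub>R (A \<otimes>\<^sub>K A)"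
  shows "K *v vectorize X = vectorize (B ** X + X ** transpose B + c *\<^sub>R (A ** X ** transpose A))"
proof -
  have delta: "(\<Sum>k\<in>UNIV. \<Sum>l\<in>UNIV. (if l = i then f k l else 0)) = (\<Sum>k\<in>UNIV. f k i)"
    "(\<Sum>k\<in>UNIV. \<Sum>l\<in>UNIV. (if k = i then f k l else 0)) = (\<Sum>l\<in>UNIV. f i l)"
    for f :: "'n \<Rightarrow> 'n \<Rightarrow> real" and i
    by (simp, subst sum.swap, simp)
  have "(K *v vectorize X) $ p = vectorize (B ** X + X ** transpose B + c *\<^sub>R (A ** X ** transpose A)) $ p" for p
  proof -
    \<comment> \<open>The first index names the block, that is the column, and the second one the
      row.\<close>
    obtain j i where p: "p = (j, i)" by (cases p)
    have "(K *v vectorize X) $ p = (\<Sum>l\<in>UNIV. \<Sum>k\<in>UNIV.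
        B $ j $ l * mat 1 $ i $ k * X $ k $ l + mat 1 $ j $ l * B $ i $ k * X $ k $ l + c * (A $ j $ l * A $ i $ k * X $ k $ l))"
      by (simp add: p K_def matrix_vector_mult_def kronecker_def vectorize_def distrib_right sum.cartesian_product UNIV_Times_UNIV[symmetric] case_prod_beta mult.assoc del: UNIV_Times_UNIV)
    also have "\<dots> = (\<Sum>l\<in>UNIV. B $ j $ l * X $ i $ l) + (\<Sum>k\<in>UNIV. B $ i $ k * X $ k $ j)
        + c * (\<Sum>l\<in>UNIV. \<Sum>k\<in>UNIV. A $ j $ l * A $ i $ k * X $ k $ l)"
    proof -
      have 1: "B $ j $ l * mat 1 $ i $ k * X $ k $ l = (if k = i then B $ j $ l * X $ k $ l else 0)" for l k
        by (simp add: mat_def)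
      have 2: "mat 1 $ j $ l * B $ i $ k * X $ k $ l = (if l = j then B $ i $ k * X $ k $ l else 0)" for l k
        by (simp add: mat_def)
      show ?thesis unfolding sum.distrib 1 2 delta sum_distrib_left[symmetric] ..
    qed
    also have "\<dots> = vectorize (B ** X + X ** transpose B + c *\<^sub>R (A ** X ** transpose A)) $ p"
    proof -
      have "(\<Sum>l\<in>UNIV. \<Sum>k\<in>UNIV. A $ j $ l * A $ i $ k * X $ k $ l) = (A ** X ** transpose A) $ i $ j"
        by (simp add: matrix_matrix_mult_def transpose_def sum_distrib_left sum_distrib_right mult_ac)
      then show ?thesis
        by (simp add: p vectorize_def matrix_matrix_mult_def transpose_def mult.commute)
    qed
    finally show ?thesis .
  qed
  then show ?thesis by (simp add: vec_eq_iff)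
qed

lemma integrable_vecI:
  fixes f :: "'a \<Rightarrow> real^'n"
  assumes "\<And>i. integrable M (\<lambda>x. f x $ i)"
  shows "integrable M f"
proof -
  have "integrable M (\<lambda>x. f x \<bullet> b)" if "b \<in> Basis" for b
    using that assms by (auto simp: Basis_vec_def inner_axis)
  then have "integrable M (\<lambda>x. \<Sum>b\<in>Basis. (f x \<bullet> b) *\<^sub>R b)"
    by (intro Bochner_Integration.integrable_sum integrable_scaleR_left)
  then show ?thesis by (simp add: euclidean_representation)
qed

lemma integrable_matrixI:
  fixes f :: "'a \<Rightarrow> real^'n^'m"
  assumes "\<And>i j. integrable M (\<lambda>x. f x $ i $ j)"
  shows "integrable M f"
proof -
  have "integrable M (\<lambda>x. f x \<bullet> b)" if "b \<in> Basis" for b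
    using that assms by (auto simp: Basis_vec_def inner_axis)
  then have "integrable M (\<lambda>x. \<Sum>b\<in>Basis. (f x \<bullet> b) *\<^sub>R b)"
    by (intro Bochner_Integration.integrable_sum integrable_scaleR_left)
  then show ?thesis by (simp add: euclidean_representation)
qed

lemma integral_nth:
  fixes f :: "'a \<Rightarrow> 'b::euclidean_space^'n"
  assumes "integrable M f"
  shows "(\<integral>x. f x \<partial>M) $ i = (\<integral>x. f x $ i \<partial>M)"
  using integral_bounded_linear[OF bounded_linear_vec_nth assms] by simp

lemma integral_matrix_nth:
  fixes f :: "'a \<Rightarrow> real^'n^'m"
  assumes "integrable M f"
  shows "(\<integral>x. f x \<partial>M) $ i $ j = (\<integral>x. f x $ i $ j \<partial>M)"
  using integral_nth[OF integrable_bounded_linear[OF bounded_linear_vec_nth assms]] by (simp add: integral_nth[OF assms])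

text \<open>An unordered sum that converges absolutely is an integral against counting measure, and
  summability of the squared jumps gives absolute convergence. Time 0 drops out because no jump
  takes place there by convention.\<close>

lemma disc_qv_nth:
  fixes f :: "real \<Rightarrow> real^'n"
  assumes S: "jump_sum sq_norm f 0 t < \<infinity>"
  shows "disc_qv f t $ k $ l = (\<integral>r. jump_prod f k l r * indicator {0<..t} r \<partial>count_space UNIV)"
proof -
  let ?g = "\<lambda>r. outer (jump f r) (jump f r)"
  have ind: "indicator {0..t} r *\<^sub>R ?g r = indicator {0<..t} r *\<^sub>R ?g r" for r
    by (cases "r = 0") (auto simp: indicator_def outer_def vec_eq_iff)
  have comp: "(indicator {0<..t} r *\<^sub>R ?g r) $ k $ l = 1 * jump_prod f k l r * indicator {0<..t} r" for r k l
    by (simp add: outer_def jump_prod_def)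
  have "integrable (count_space UNIV) (\<lambda>r. indicator {0<..t} r *\<^sub>R ?g r)"
  proof (rule integrable_matrixI)
    show "integrable (count_space UNIV) (\<lambda>r. (indicator {0<..t} r *\<^sub>R ?g r) $ i $ j)" for i j
      unfolding comp by (rule integrable_jump_prod[OF S, of _ 1]) simp
  qed
  then have i: "integrable (count_space UNIV) (\<lambda>r. indicator {0..t} r *\<^sub>R ?g r)" by (simp only: ind)
  then have "Infinite_Set_Sum.abs_summable_on ?g {0..t}"
    unfolding abs_summable_on_altdef set_integrable_def .
  then have "disc_qv f t = infsetsum ?g {0..t}"
    unfolding disc_qv_def by (rule infsetsum_infsum[symmetric])
  also have "\<dots> = (\<integral>r. indicator {0..t} r *\<^sub>R ?g r \<partial>count_space UNIV)"
    unfolding infsetsum_altdef set_lebesgue_integral_def ..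
  finally show ?thesis
    by (simp only: integral_matrix_nth[OF i]) (simp only: ind comp, simp)
qed

lemma jump_integral_of_has_LS_integral:
  fixes g :: "real \<Rightarrow> real^'n"
  assumes LS: "has_LS_integral f (\<lambda>s. disc_qv g s $ k $ l) 0 t I" and t: "0 \<le> t"
    and S: "\<And>t. jump_sum sq_norm g 0 t < \<infinity>" and f: "\<And>r. 0 < r \<Longrightarrow> r \<le> t \<Longrightarrow> \<bar>f r\<bar> \<le> K"
  shows "I = (\<integral>r. f r * jump_prod g k l r * indicator {0<..t} r \<partial>count_space UNIV)"
proof (rule has_LS_integral_pure_jump[OF LS t])
  show "integrable (count_space UNIV) (\<lambda>r. jump_prod g k l r * indicator {0<..t} r)"
    using integrable_jump_prod[OF S, of _ "\<lambda>_. 1" 1] by simp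
  show "disc_qv g y $ k $ l = disc_qv g 0 $ k $ l + (\<integral>r. jump_prod g k l r * indicator {0<..y} r \<partial>count_space UNIV)" for y
    by (simp add: disc_qv_nth[OF S])
qed (rule f)

lemma measurable_continuous_on_closed:
  assumes "f \<in> measurable M borel" "\<And>x. x \<in> space M \<Longrightarrow> f x \<in> S" "continuous_on S g"
  shows "(\<lambda>x. g (f x)) \<in> borel_measurable M"
  by (rule measurable_compose[OF measurable_restrict_space2[OF _ assms(1)] borel_measurable_continuous_on_restrict[OF assms(3)]])
     (use assms(2) in auto)

context prob_space
begin

text \<open>Fubini's theorem needs joint measurability in time and \<open>\<omega>\<close>, which
  comes from right-endpoint step functions converging everywhere to the path. Integrability on the
  product follows from the bound \<open>K\<close> on the first absolute moments at each time, since
  the time interval is finite.\<close>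

lemma path_fubini:
  fixes X :: "real \<Rightarrow> 'a \<Rightarrow> real"
  assumes u: "0 \<le> u" "u \<le> t" and X: "\<And>s. 0 \<le> s \<Longrightarrow> X s \<in> borel_measurable M" and cad: "\<And>\<omega>. cadlag (\<lambda>s. X s \<omega>)"
    and Z: "Z \<in> borel_measurable M"
    and i: "\<And>r. u < r \<Longrightarrow> r \<le> t \<Longrightarrow> integrable M (\<lambda>\<omega>. Z \<omega> * X r \<omega>)"
    and K: "\<And>r. u < r \<Longrightarrow> r \<le> t \<Longrightarrow> (\<integral>\<omega>. \<bar>Z \<omega> * X r \<omega>\<bar> \<partial>M) \<le> K"
  shows "(\<integral>\<^sup>+\<omega>. ennreal (\<bar>Z \<omega>\<bar> * (\<integral>r. \<bar>X r \<omega>\<bar> * indicator {u<..t} r \<partial>lborel)) \<partial>M) < \<infinity>"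
    and "integrable M (\<lambda>\<omega>. Z \<omega> * (\<integral>r. X r \<omega> * indicator {u<..t} r \<partial>lborel))"
    and "(\<integral>\<omega>. Z \<omega> * (\<integral>r. X r \<omega> * indicator {u<..t} r \<partial>lborel) \<partial>M) = (\<integral>r. (\<integral>\<omega>. Z \<omega> * X r \<omega> \<partial>M) * indicator {u<..t} r \<partial>lborel)"
    and "integrable lborel (\<lambda>r. (\<integral>\<omega>. Z \<omega> * X r \<omega> \<partial>M) * indicator {u<..t} r)"
proof -
  interpret pair_sigma_finite M "lborel :: real measure" ..
  define f where "f \<omega> r = Z \<omega> * (X r \<omega> * indicator {u<..t} r)" for \<omega> r
  have fm [measurable]: "case_prod f \<in> borel_measurable (M \<Otimes>\<^sub>M lborel)"
  proof (rule borel_measurable_LIMSEQ_real)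
    fix p :: "'a \<times> real"
    show "(\<lambda>N. Z (fst p) * step_fun (\<lambda>s. X (s + (t - u) / real N) (fst p)) u t N (snd p)) \<longlonglongrightarrow> case_prod f p"
      unfolding f_def case_prod_beta by (intro tendsto_mult tendsto_const right_step_tendsto cad u)
  next
    fix N
    have "(\<lambda>p. X (grid u t N i + (t - u) / real N) (fst p)) \<in> borel_measurable (M \<Otimes>\<^sub>M lborel)" for i
      using X[of "grid u t N i + (t - u) / real N"] grid_ge[OF u(2), of N i] u by (intro measurable_compose[OF measurable_fst]) simp
    moreover have "(\<lambda>p. indicator {grid u t N i<..grid u t N (Suc i)} (snd p) :: real) \<in> borel_measurable (M \<Otimes>\<^sub>M lborel)" for i
      by measurable
    ultimately show "(\<lambda>p. Z (fst p) * step_fun (\<lambda>s. X (s + (t - u) / real N) (fst p)) u t N (snd p)) \<in> borel_measurable (M \<Otimes>\<^sub>M lborel)"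
      unfolding step_fun_def using Z by (intro borel_measurable_times borel_measurable_sum) auto
  qed
  have eqf: "(\<integral>r. f \<omega> r \<partial>lborel) = Z \<omega> * (\<integral>r. X r \<omega> * indicator {u<..t} r \<partial>lborel)" for \<omega>
    unfolding f_def by simp
  have nn: "(\<integral>\<^sup>+r. ennreal \<bar>f \<omega> r\<bar> \<partial>lborel) = ennreal (\<bar>Z \<omega>\<bar> * (\<integral>r. \<bar>X r \<omega>\<bar> * indicator {u<..t} r \<partial>lborel))" for \<omega>
  proof -
    have ic: "integrable lborel (\<lambda>r. \<bar>X r \<omega>\<bar> * indicator {u<..t} r)"
      by (intro integrable_cadlag cadlag_abs(1) cad u)
    have "(\<integral>\<^sup>+r. ennreal \<bar>f \<omega> r\<bar> \<partial>lborel) = ennreal (\<integral>r. \<bar>Z \<omega>\<bar> * (\<bar>X r \<omega>\<bar> * indicator {u<..t} r) \<partial>lborel)"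
      unfolding f_def abs_mult abs_indicator by (intro nn_integral_eq_integral integrable_mult_right ic) auto
    then show ?thesis by simp
  qed
  have sw: "(\<integral>\<^sup>+\<omega>. (\<integral>\<^sup>+r. ennreal \<bar>f \<omega> r\<bar> \<partial>lborel) \<partial>M) = (\<integral>\<^sup>+r. (\<integral>\<^sup>+\<omega>. ennreal \<bar>f \<omega> r\<bar> \<partial>M) \<partial>lborel)"
    by (rule Fubini'[symmetric]) measurable
  also have "\<dots> \<le> (\<integral>\<^sup>+r. ennreal \<bar>K\<bar> * indicator {u<..t} r \<partial>lborel)"
  proof (rule nn_integral_mono)
    fix r
    show "(\<integral>\<^sup>+\<omega>. ennreal \<bar>f \<omega> r\<bar> \<partial>M) \<le> ennreal \<bar>K\<bar> * indicator {u<..t} r"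
    proof (cases "r \<in> {u<..t}")
      case True
      then have "(\<integral>\<^sup>+\<omega>. ennreal \<bar>f \<omega> r\<bar> \<partial>M) = ennreal (\<integral>\<omega>. \<bar>Z \<omega> * X r \<omega>\<bar> \<partial>M)"
        using i[of r] by (subst nn_integral_eq_integral[symmetric]) (auto simp: f_def)
      also have "\<dots> \<le> ennreal \<bar>K\<bar>" using K[of r] True by (intro ennreal_leI) auto
      finally show ?thesis using True by simp
    qed (simp add: f_def)
  qed
  also have "\<dots> < \<infinity>" using u by (simp add: nn_integral_cmult_indicator ennreal_mult_less_top)
  finally have fin: "(\<integral>\<^sup>+\<omega>. (\<integral>\<^sup>+r. ennreal \<bar>f \<omega> r\<bar> \<partial>lborel) \<partial>M) < \<infinity>" .
  then show "(\<integral>\<^sup>+\<omega>. ennreal (\<bar>Z \<omega>\<bar> * (\<integral>r. \<bar>X r \<omega>\<bar> * indicator {u<..t} r \<partial>lborel)) \<partial>M) < \<infinity>"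
    unfolding nn .
  have int: "integrable (M \<Otimes>\<^sub>M lborel) (case_prod f)"
  proof (rule integrableI_bounded)
    have "(\<integral>\<^sup>+p. ennreal (norm (case_prod f p)) \<partial>(M \<Otimes>\<^sub>M lborel)) = (\<integral>\<^sup>+\<omega>. (\<integral>\<^sup>+r. ennreal \<bar>f \<omega> r\<bar> \<partial>lborel) \<partial>M)"
      by (subst lborel.nn_integral_fst[symmetric]) auto
    with fin show "(\<integral>\<^sup>+p. ennreal (norm (case_prod f p)) \<partial>(M \<Otimes>\<^sub>M lborel)) < \<infinity>" by simp
  qed measurable
  show "integrable M (\<lambda>\<omega>. Z \<omega> * (\<integral>r. X r \<omega> * indicator {u<..t} r \<partial>lborel))"
    using integrable_fst[OF int] unfolding eqf .
  have fr: "(\<integral>\<omega>. f \<omega> r \<partial>M) = (\<integral>\<omega>. Z \<omega> * X r \<omega> \<partial>M) * indicator {u<..t} r" for r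
    unfolding f_def mult.assoc[symmetric] by simp
  show "(\<integral>\<omega>. Z \<omega> * (\<integral>r. X r \<omega> * indicator {u<..t} r \<partial>lborel) \<partial>M) = (\<integral>r. (\<integral>\<omega>. Z \<omega> * X r \<omega> \<partial>M) * indicator {u<..t} r \<partial>lborel)"
    using Fubini_integral[OF int] unfolding eqf fr by simp
  show "integrable lborel (\<lambda>r. (\<integral>\<omega>. Z \<omega> * X r \<omega> \<partial>M) * indicator {u<..t} r)"
    using integrable_snd[OF int] unfolding fr .
qed

end

text \<open>As for the Levy paths, cadlag and positive semidefinite paths of \<open>Y\<close> are
  required for every \<open>\<omega>\<close>; the equation alone is kept as an almost sure
  statement.\<close>

locale mucogarch_path = second_moment_levy_path M F L \<nu> \<sigma>
  for M :: "'a measure" and F and L :: "real \<Rightarrow> 'a \<Rightarrow> real^'d::finite" and \<nu> \<sigma> +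
  fixes A B C :: "real^'d^'d" and Y :: "real \<Rightarrow> 'a \<Rightarrow> real^'d^'d"
  assumes C_psd: "psd C"
    and Y_adapted: "\<And>t. 0 \<le> t \<Longrightarrow> Y t \<in> borel_measurable (F t)"
    and Y_cadlag: "\<And>\<omega>. cadlag (\<lambda>t. Y t \<omega>)"
    and Y_psd: "\<And>t \<omega>. 0 \<le> t \<Longrightarrow> psd (Y t \<omega>)"
    and Y_sde: "AE \<omega> in M. \<forall>t\<ge>0.
        let Ym = left_limit (\<lambda>r. Y r \<omega>) in
        \<exists>J. has_matrix_LS_integral (\<lambda>s. A ** psd_sqrt (C + Ym s)) (disc_qv (\<lambda>r. L r \<omega>))
              (\<lambda>s. psd_sqrt (C + Ym s) ** transpose A) 0 t J \<and>
            Y t \<omega> = Y 0 \<omega> + (LINT s:{0..t}|lborel. B ** Ym s + Ym s ** transpose B) + J"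
begin

text \<open>The integrand of entry (i, j) of the jump part against entry (k, l) of the quadratic
  variation, with one square root from each side.\<close>

definition coeff :: "'d \<Rightarrow> 'd \<Rightarrow> 'd \<Rightarrow> 'd \<Rightarrow> real^'d^'d \<Rightarrow> real" where
  "coeff i j k l X = (A ** psd_sqrt (C + X)) $ i $ k * (psd_sqrt (C + X) ** transpose A) $ l $ j"

definition drift :: "real^'d^'d \<Rightarrow> real^'d^'d" where
  "drift X = B ** X + X ** transpose B"

lemma continuous_coeff: "continuous_on {X. psd X} (coeff i j k l)"
proof -
  have r: "continuous_on {X. psd X} (\<lambda>X. psd_sqrt (C + X))"
    by (rule continuous_on_compose2[OF continuous_on_psd_sqrt]) (auto intro!: continuous_intros psd_add C_psd)
  show ?thesis unfolding coeff_def matrix_matrix_mult_def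
    by (simp, intro continuous_intros r)
qed

lemma continuous_drift: "continuous_on S drift"
  unfolding drift_def matrix_matrix_mult_def by (intro continuous_intros continuous_on_vec_lambda)

lemma coeff_process:
  shows coeff_adapted: "0 \<le> t \<Longrightarrow> (\<lambda>\<omega>. coeff i j k l (Y t \<omega>)) \<in> borel_measurable (F t)"
    and coeff_cadlag: "cadlag (\<lambda>t. coeff i j k l (Y t \<omega>))"
    and coeff_left_limit: "0 \<le> t \<Longrightarrow> left_limit (\<lambda>t. coeff i j k l (Y t \<omega>)) t = coeff i j k l (left_limit (\<lambda>t. Y t \<omega>) t)"
proof -
  show "(\<lambda>\<omega>. coeff i j k l (Y t \<omega>)) \<in> borel_measurable (F t)" if "0 \<le> t"
    by (rule measurable_continuous_on_closed[OF Y_adapted[OF that] _ continuous_coeff]) (simp add: Y_psd that)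
  have c: "closed {X :: real^'d^'d. psd X}" by (rule closed_psd)
  have Y: "Y s \<omega> \<in> {X. psd X}" if "0 \<le> s" for s using Y_psd[OF that] by simp
  show "cadlag (\<lambda>t. coeff i j k l (Y t \<omega>))" by (rule cadlag_comp[OF Y_cadlag c Y continuous_coeff])
  show "left_limit (\<lambda>t. coeff i j k l (Y t \<omega>)) t = coeff i j k l (left_limit (\<lambda>t. Y t \<omega>) t)" if "0 \<le> t"
    by (rule left_limit_comp[OF Y_cadlag c Y continuous_coeff that])
qed

lemma continuous_process:
  fixes g :: "real^'d^'d \<Rightarrow> 'b::{second_countable_topology, t2_space}"
  assumes g: "continuous_on UNIV g"
  shows continuous_adapted: "0 \<le> t \<Longrightarrow> (\<lambda>\<omega>. g (Y t \<omega>)) \<in> borel_measurable (F t)"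
    and continuous_cadlag: "cadlag (\<lambda>t. g (Y t \<omega>))"
    and continuous_left_limit: "0 \<le> t \<Longrightarrow> left_limit (\<lambda>t. g (Y t \<omega>)) t = g (left_limit (\<lambda>t. Y t \<omega>) t)"
  using measurable_continuous_on_closed[OF Y_adapted _ g] cadlag_comp[OF Y_cadlag closed_UNIV _ g]
    left_limit_comp[OF Y_cadlag closed_UNIV _ g] by auto

text \<open>The Stieltjes integrals become sums over jumps, and subtracting the equation at
  \<open>u\<close> from the one at \<open>t\<close> leaves \<open>{u<..t}\<close>. The null set
  depends neither on times nor on indices.\<close>

lemma path_equation:
  "AE \<omega> in M. \<forall>u t i j. 0 \<le> u \<longrightarrow> u \<le> t \<longrightarrow>
     Y t \<omega> $ i $ j = Y u \<omega> $ i $ j + (\<integral>r. drift (Y r \<omega>) $ i $ j * indicator {u<..t} r \<partial>lborel)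
       + (\<Sum>k\<in>UNIV. \<Sum>l\<in>UNIV. jump_integral (\<lambda>s \<omega>. coeff i j k l (Y s \<omega>)) k l u t \<omega>)"
  using Y_sde AE_jump_sum_finite
proof eventually_elim
  case (elim \<omega>)
  define Ym where "Ym = left_limit (\<lambda>r. Y r \<omega>)"
  let ?f = "\<lambda>r. L r \<omega>"
  have S: "jump_sum sq_norm ?f s t < \<infinity>" if "0 \<le> s" for s t using elim(2) that by blast
  have dc: "continuous_on UNIV (\<lambda>X. drift X $ i $ j)" for i j by (intro continuous_intros continuous_drift)
  have dcad: "cadlag (\<lambda>r. drift (Y r \<omega>) $ i $ j)" for i j by (rule continuous_cadlag[OF dc])
  have dm: "drift (Ym r) $ i $ j = left_limit (\<lambda>r. drift (Y r \<omega>) $ i $ j) r" if "0 \<le> r" for r i j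
    unfolding Ym_def by (rule continuous_left_limit[OF dc that, symmetric])
  have dint: "integrable lborel (\<lambda>r. drift (Y r \<omega>) $ i $ j * indicator {u<..t} r)" if "0 \<le> u" "u \<le> t" for u t i j
    by (rule integrable_cadlag[OF dcad that])
  \<comment> \<open>Replacing left limits by values and dropping time 0 changes the integrand on a
    null set of times only.\<close>
  have D: "(LINT s:{0..t}|lborel. B ** Ym s + Ym s ** transpose B) $ i $ j
      = (\<integral>r. drift (Y r \<omega>) $ i $ j * indicator {0<..t} r \<partial>lborel)" if t: "0 \<le> t" for t i j
  proof -
    have m: "(\<lambda>r. drift (Ym r) $ i $ j * indicator {0<..t} r) \<in> borel_measurable lborel" for i j
    proof -
      have "(\<lambda>r. drift (Ym r) $ i $ j * indicator {0<..t} r) = (\<lambda>r. left_limit (\<lambda>r. drift (Y r \<omega>) $ i $ j) r * indicator {0<..t} r)"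
        by (auto simp: fun_eq_iff dm indicator_def)
      then show ?thesis using cadlag_measurable(2)[OF dcad[of i j] order.refl t] by simp
    qed
    have a: "AE r in lborel. (indicator {0..t} r *\<^sub>R drift (Ym r)) $ i $ j = drift (Y r \<omega>) $ i $ j * indicator {0<..t} r" for i j
      using AE_lborel_singleton[of 0] AE_lborel_left_limit[OF dcad[of i j] order.refl, of t]
      by eventually_elim (auto simp: indicator_def dm)
    have zero: "(indicator {0..t} r *\<^sub>R drift (Ym r)) $ i $ j = drift (Ym r) $ i $ j * indicator {0<..t} r + drift (Ym 0) $ i $ j * indicator {0} r" for i j r
      using t by (cases "r = 0") (auto simp: indicator_def)
    have m2: "(\<lambda>r. (indicator {0..t} r *\<^sub>R drift (Ym r)) $ i $ j) \<in> borel_measurable lborel" for i j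
      unfolding zero using m[of i j] by measurable
    have "integrable lborel (\<lambda>r. (indicator {0..t} r *\<^sub>R drift (Ym r)) $ i $ j)" for i j
    proof (rule integrable_cong_AE_imp[OF dint[OF order.refl t] m2])
      show "AE r in lborel. drift (Y r \<omega>) $ i $ j * indicator {0<..t} r = (indicator {0..t} r *\<^sub>R drift (Ym r)) $ i $ j"
        using a[of i j] by eventually_elim (rule sym)
    qed
    then have "integrable lborel (\<lambda>r. indicator {0..t} r *\<^sub>R drift (Ym r))" by (rule integrable_matrixI)
    then have "(LINT s:{0..t}|lborel. B ** Ym s + Ym s ** transpose B) $ i $ j = (\<integral>r. (indicator {0..t} r *\<^sub>R drift (Ym r)) $ i $ j \<partial>lborel)"
      unfolding set_lebesgue_integral_def drift_def[symmetric] by (rule integral_matrix_nth)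
    also have "\<dots> = (\<integral>r. drift (Y r \<omega>) $ i $ j * indicator {0<..t} r \<partial>lborel)"
      by (rule integral_cong_AE[OF m2 borel_measurable_integrable[OF dint[OF order.refl t]] a])
    finally show ?thesis .
  qed
  have bdd: "\<exists>K. \<forall>r. 0 \<le> r \<longrightarrow> r \<le> t \<longrightarrow> \<bar>left_limit (\<lambda>s. coeff i j k l (Y s \<omega>)) r\<bar> \<le> K" for i j k l t
    using cadlag_bounded[OF coeff_cadlag[of i j k l \<omega>], of t] unfolding real_norm_def by metis
  have base: "Y t \<omega> $ i $ j = Y 0 \<omega> $ i $ j + (\<integral>r. drift (Y r \<omega>) $ i $ j * indicator {0<..t} r \<partial>lborel)
       + (\<Sum>k\<in>UNIV. \<Sum>l\<in>UNIV. jump_integral (\<lambda>s \<omega>. coeff i j k l (Y s \<omega>)) k l 0 t \<omega>)" if t: "0 \<le> t" for t i j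
  proof -
    obtain J where J: "has_matrix_LS_integral (\<lambda>s. A ** psd_sqrt (C + Ym s)) (disc_qv ?f)
              (\<lambda>s. psd_sqrt (C + Ym s) ** transpose A) 0 t J"
      and Yt: "Y t \<omega> = Y 0 \<omega> + (LINT s:{0..t}|lborel. B ** Ym s + Ym s ** transpose B) + J"
      using elim(1) t unfolding Let_def Ym_def by blast
    from J obtain I where I: "\<And>i j k l. has_LS_integral (\<lambda>s. coeff i j k l (Ym s)) (\<lambda>s. disc_qv ?f s $ k $ l) 0 t (I i j k l)"
      and Jij: "\<And>i j. J $ i $ j = (\<Sum>k\<in>UNIV. \<Sum>l\<in>UNIV. I i j k l)"
      unfolding has_matrix_LS_integral_def coeff_def by blast
    have "I i j k l = jump_integral (\<lambda>s \<omega>. coeff i j k l (Y s \<omega>)) k l 0 t \<omega>" for k l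
    proof -
      obtain K where K: "\<And>r. 0 \<le> r \<Longrightarrow> r \<le> t \<Longrightarrow> \<bar>left_limit (\<lambda>s. coeff i j k l (Y s \<omega>)) r\<bar> \<le> K" using bdd by blast
      have "I i j k l = (\<integral>r. coeff i j k l (Ym r) * jump_prod ?f k l r * indicator {0<..t} r \<partial>count_space UNIV)"
      proof (rule jump_integral_of_has_LS_integral[OF I t S])
        show "\<bar>coeff i j k l (Ym r)\<bar> \<le> K" if "0 < r" "r \<le> t" for r
          using K[of r] that unfolding Ym_def by (simp add: coeff_left_limit)
      qed simp
      also have "\<dots> = jump_integral (\<lambda>s \<omega>. coeff i j k l (Y s \<omega>)) k l 0 t \<omega>"
        unfolding jump_integral_def Ym_def
        by (intro Bochner_Integration.integral_cong) (auto simp: indicator_def coeff_left_limit)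
      finally show ?thesis .
    qed
    then show ?thesis unfolding Yt by (simp add: D[OF t] Jij)
  qed
  show ?case
  proof (intro allI impI)
    fix u t :: real and i j assume u: "0 \<le> u" "u \<le> t"
    have ind: "indicator {0<..t} r = indicator {0<..u} r + (indicator {u<..t} r :: real)" for r :: real
      using u by (auto simp: indicator_def)
    have "(\<integral>r. drift (Y r \<omega>) $ i $ j * indicator {0<..t} r \<partial>lborel)
      = (\<integral>r. drift (Y r \<omega>) $ i $ j * indicator {0<..u} r \<partial>lborel) + (\<integral>r. drift (Y r \<omega>) $ i $ j * indicator {u<..t} r \<partial>lborel)"
      unfolding ind distrib_left using u by (intro Bochner_Integration.integral_add dint) auto
    moreover have "jump_integral (\<lambda>s \<omega>. coeff i j k l (Y s \<omega>)) k l 0 t \<omega> =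
      jump_integral (\<lambda>s \<omega>. coeff i j k l (Y s \<omega>)) k l 0 u \<omega> + jump_integral (\<lambda>s \<omega>. coeff i j k l (Y s \<omega>)) k l u t \<omega>" for k l
    proof -
      obtain K where K: "\<And>r. 0 \<le> r \<Longrightarrow> r \<le> t \<Longrightarrow> \<bar>left_limit (\<lambda>s. coeff i j k l (Y s \<omega>)) r\<bar> \<le> K" using bdd by blast
      show ?thesis unfolding jump_integral_def ind distrib_left
        by (intro Bochner_Integration.integral_add integrable_jump_prod[OF S, of _ _ _ K]) (use u K in auto)
    qed
    ultimately show "Y t \<omega> $ i $ j = Y u \<omega> $ i $ j + (\<integral>r. drift (Y r \<omega>) $ i $ j * indicator {u<..t} r \<partial>lborel)
       + (\<Sum>k\<in>UNIV. \<Sum>l\<in>UNIV. jump_integral (\<lambda>s \<omega>. coeff i j k l (Y s \<omega>)) k l u t \<omega>)"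
      using base[of t i j] base[OF u(1), of i j] u by (simp add: sum.distrib)
  qed
qed

end

section \<open>The covariance equation\<close>

lemma abs_trace_le: "\<bar>trace X\<bar> \<le> real CARD('n) * norm X" for X :: "real^'n^'n"
proof -
  have "\<bar>trace X\<bar> \<le> (\<Sum>i\<in>UNIV. \<bar>X $ i $ i\<bar>)" unfolding trace_def by (rule sum_abs)
  also have "\<dots> \<le> (\<Sum>i\<in>(UNIV :: 'n set). norm X)"
    by (intro sum_mono order_trans[OF component_le_norm_cart Finite_Cartesian_Product.norm_nth_le])
  finally show ?thesis by simp
qed

lemma trace_mult_le: "trace (B ** X) \<le> norm B * norm X" for B X :: "real^'n^'n"
proof -
  have "trace (B ** X) = B \<bullet> transpose X"
    by (simp add: trace_def matrix_matrix_mult_def transpose_def inner_vec_def)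
  also have "\<dots> \<le> norm B * norm (transpose X)" by (rule norm_cauchy_schwarz)
  finally show ?thesis by (simp add: norm_transpose)
qed

lemma matrix_component_le_norm: "\<bar>X $ i $ j\<bar> \<le> norm X" for X :: "real^'n^'m"
  by (rule order_trans[OF component_le_norm_cart Finite_Cartesian_Product.norm_nth_le])

lemma psd_trace_nonneg: "psd X \<Longrightarrow> 0 \<le> trace X"
  using norm_psd_sqrt[of X] by (metis zero_le_power2)

lemma cov_nth:
  fixes X :: "'a \<Rightarrow> real^'m" and W :: "'a \<Rightarrow> real^'n"
  assumes "\<And>i. integrable M (\<lambda>\<omega>. X \<omega> $ i)" "\<And>j. integrable M (\<lambda>\<omega>. W \<omega> $ j)" "\<And>i j. integrable M (\<lambda>\<omega>. X \<omega> $ i * W \<omega> $ j)"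
  shows "cov M X W $ i $ j = (\<integral>\<omega>. X \<omega> $ i * W \<omega> $ j \<partial>M) - (\<integral>\<omega>. X \<omega> $ i \<partial>M) * (\<integral>\<omega>. W \<omega> $ j \<partial>M)"
proof -
  have "integrable M (\<lambda>\<omega>. outer (X \<omega>) (W \<omega>))" by (rule integrable_matrixI) (simp add: outer_def assms)
  then have "(\<integral>\<omega>. outer (X \<omega>) (W \<omega>) \<partial>M) $ i $ j = (\<integral>\<omega>. X \<omega> $ i * W \<omega> $ j \<partial>M)"
    by (subst integral_matrix_nth) (simp_all add: outer_def)
  then show ?thesis
    by (simp add: cov_def outer_def integral_nth[OF integrable_vecI[OF assms(1)]] integral_nth[OF integrable_vecI[OF assms(2)]])
qed

text \<open>From 2 |z x| <= z^2 + x^2 and linear growth of \<open>X\<close> in \<open>V\<close>. The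
  explicit right-hand side is uniform in time as soon as the second moments of \<open>V\<close> are,
  which is what Fubini asks for.\<close>

lemma (in prob_space) integrable_mult_L2:
  fixes Z X V :: "'a \<Rightarrow> real"
  assumes Z: "Z \<in> borel_measurable M" "integrable M (\<lambda>\<omega>. (Z \<omega>)\<^sup>2)" and X: "X \<in> borel_measurable M"
    and V: "integrable M (\<lambda>\<omega>. (V \<omega>)\<^sup>2)" and le: "\<And>\<omega>. \<bar>X \<omega>\<bar> \<le> a + b * V \<omega>"
  shows "integrable M (\<lambda>\<omega>. Z \<omega> * X \<omega>)"
    and "(\<integral>\<omega>. \<bar>Z \<omega> * X \<omega>\<bar> \<partial>M) \<le> (\<integral>\<omega>. (Z \<omega>)\<^sup>2 \<partial>M) + 2 * a\<^sup>2 + 2 * b\<^sup>2 * (\<integral>\<omega>. (V \<omega>)\<^sup>2 \<partial>M)"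
proof -
  have bd: "\<bar>Z \<omega> * X \<omega>\<bar> \<le> (Z \<omega>)\<^sup>2 + 2 * a\<^sup>2 + 2 * b\<^sup>2 * (V \<omega>)\<^sup>2" for \<omega>
  proof -
    have "2 * (\<bar>Z \<omega>\<bar> * \<bar>X \<omega>\<bar>) \<le> (Z \<omega>)\<^sup>2 + (X \<omega>)\<^sup>2" "0 \<le> \<bar>Z \<omega>\<bar> * \<bar>X \<omega>\<bar>"
      using sum_squares_bound[of "\<bar>Z \<omega>\<bar>" "\<bar>X \<omega>\<bar>"] by (simp_all add: mult.assoc)
    then have 1: "\<bar>Z \<omega> * X \<omega>\<bar> \<le> (Z \<omega>)\<^sup>2 + (X \<omega>)\<^sup>2" unfolding abs_mult by linarith
    have "(X \<omega>)\<^sup>2 \<le> (a + b * V \<omega>)\<^sup>2" using le[of \<omega>] by (intro abs_le_square_iff[THEN iffD1]) auto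
    also have "\<dots> \<le> 2 * a\<^sup>2 + 2 * (b * V \<omega>)\<^sup>2" using sum_squares_bound[of a "b * V \<omega>"] by (simp add: power2_sum)
    finally show ?thesis using 1 by (simp add: power_mult_distrib)
  qed
  have i: "integrable M (\<lambda>\<omega>. (Z \<omega>)\<^sup>2 + 2 * a\<^sup>2 + 2 * b\<^sup>2 * (V \<omega>)\<^sup>2)" using Z(2) V by simp
  show int: "integrable M (\<lambda>\<omega>. Z \<omega> * X \<omega>)"
  proof (rule Bochner_Integration.integrable_bound[OF i])
    show "AE \<omega> in M. norm (Z \<omega> * X \<omega>) \<le> norm ((Z \<omega>)\<^sup>2 + 2 * a\<^sup>2 + 2 * b\<^sup>2 * (V \<omega>)\<^sup>2)"
      by (intro AE_I2 order_trans[OF bd[folded real_norm_def]]) simp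
  qed (use Z(1) X in measurable)
  have "(\<integral>\<omega>. \<bar>Z \<omega> * X \<omega>\<bar> \<partial>M) \<le> (\<integral>\<omega>. (Z \<omega>)\<^sup>2 + 2 * a\<^sup>2 + 2 * b\<^sup>2 * (V \<omega>)\<^sup>2 \<partial>M)"
    by (intro Bochner_Integration.integral_mono integrable_abs int i bd)
  also have "\<dots> = (\<integral>\<omega>. (Z \<omega>)\<^sup>2 \<partial>M) + 2 * a\<^sup>2 + 2 * b\<^sup>2 * (\<integral>\<omega>. (V \<omega>)\<^sup>2 \<partial>M)"
    using Z(2) V by (simp add: prob_space)
  finally show "(\<integral>\<omega>. \<bar>Z \<omega> * X \<omega>\<bar> \<partial>M) \<le> (\<integral>\<omega>. (Z \<omega>)\<^sup>2 \<partial>M) + 2 * a\<^sup>2 + 2 * b\<^sup>2 * (\<integral>\<omega>. (V \<omega>)\<^sup>2 \<partial>M)" .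
qed

context mucogarch_path
begin

lemma psd_V: "psd X \<Longrightarrow> psd (C + X)"
  by (rule psd_add[OF C_psd])

text \<open>The same square root occurs in both factors, so the product of their norms is at most
  |A|^2 tr (C + X).\<close>

lemma abs_coeff_le: "psd X \<Longrightarrow> \<bar>coeff i j k l X\<bar> \<le> sq_norm A * trace C + (sq_norm A * real CARD('d)) * norm X"
proof -
  assume X: "psd X"
  let ?R = "psd_sqrt (C + X)"
  have "\<bar>coeff i j k l X\<bar> \<le> norm (A ** ?R) * norm (?R ** transpose A)"
    unfolding coeff_def abs_mult by (intro mult_mono matrix_component_le_norm) auto
  also have "\<dots> \<le> (norm A * norm ?R) * (norm ?R * norm (transpose A))"
    by (intro mult_mono norm_matrix_mult_le) auto
  also have "\<dots> = sq_norm A * trace (C + X)"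
    unfolding norm_psd_sqrt[OF psd_V[OF X], symmetric] norm_transpose by (simp add: power2_eq_square mult_ac)
  also have "trace (C + X) \<le> trace C + real CARD('d) * norm X"
    using abs_trace_le[of X] by (simp add: trace_add)
  finally show ?thesis by (simp add: distrib_left mult.assoc mult_left_mono)
qed

lemma norm_drift_le: "norm (drift X) \<le> 2 * norm B * norm X"
proof -
  have "norm (drift X) \<le> norm (B ** X) + norm (X ** transpose B)" unfolding drift_def by (rule norm_triangle_ineq)
  also have "\<dots> \<le> norm B * norm X + norm X * norm (transpose B)" by (intro add_mono norm_matrix_mult_le)
  finally show ?thesis by (simp add: norm_transpose)
qed

lemma sum_coeff: "psd X \<Longrightarrow> (\<Sum>k\<in>UNIV. coeff i j k k X) = (A ** (C + X) ** transpose A) $ i $ j"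
proof -
  assume X: "psd X"
  let ?R = "psd_sqrt (C + X)"
  have "(\<Sum>k\<in>UNIV. coeff i j k k X) = ((A ** ?R) ** (?R ** transpose A)) $ i $ j"
    by (simp add: coeff_def matrix_matrix_mult_def[of "A ** ?R"])
  also have "(A ** ?R) ** (?R ** transpose A) = A ** (?R ** ?R) ** transpose A"
    by (simp add: matrix_mul_assoc)
  finally show ?thesis by (simp add: psd_sqrt_mult psd_V X)
qed

text \<open>The compensated drift: the rate at which the entries of \<open>Y\<close> change in the
  mean when the present state is \<open>X\<close>.\<close>

definition generator :: "real^'d^'d \<Rightarrow> real^'d^'d" where
  "generator X = drift X + \<sigma> *\<^sub>R (A ** (C + X) ** transpose A)"

lemma Y_measurable: "0 \<le> t \<Longrightarrow> Y t \<in> borel_measurable M"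
  by (rule measurable_F_M[OF Y_adapted])

text \<open>The path equation is multiplied by \<open>Z\<close> and integrated, with Fubini for the
  drift and compensation for the jumps. Testing against all \<open>Z\<close> known at time
  \<open>u\<close> takes the place of a conditional expectation.\<close>

lemma mean_equation:
  assumes sm: "\<And>t. 0 \<le> t \<Longrightarrow> integrable M (\<lambda>\<omega>. sq_norm (Y t \<omega>))"
    and bd: "\<And>T. \<exists>K. \<forall>t. 0 \<le> t \<longrightarrow> t \<le> T \<longrightarrow> (\<integral>\<omega>. sq_norm (Y t \<omega>) \<partial>M) \<le> K"
    and u: "0 \<le> u" "u \<le> t" and Z: "Z \<in> borel_measurable (F u)" "integrable M (\<lambda>\<omega>. (Z \<omega>)\<^sup>2)"
  shows "(\<integral>\<omega>. Z \<omega> * Y t \<omega> $ i $ j \<partial>M) = (\<integral>\<omega>. Z \<omega> * Y u \<omega> $ i $ j \<partial>M) +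
      (\<integral>r. (\<integral>\<omega>. Z \<omega> * generator (Y r \<omega>) $ i $ j \<partial>M) * indicator {u<..t} r \<partial>lborel)"
    and "integrable lborel (\<lambda>r. (\<integral>\<omega>. Z \<omega> * generator (Y r \<omega>) $ i $ j \<partial>M) * indicator {u<..t} r)"
proof -
  have ZM: "Z \<in> borel_measurable M" by (rule measurable_F_M[OF Z(1) u(1)])
  obtain K where K: "\<And>s. 0 \<le> s \<Longrightarrow> s \<le> t \<Longrightarrow> (\<integral>\<omega>. sq_norm (Y s \<omega>) \<partial>M) \<le> K" using bd by blast
  let ?d = "\<lambda>r \<omega>. drift (Y r \<omega>) $ i $ j"
  let ?c = "\<lambda>k l r \<omega>. coeff i j k l (Y r \<omega>)"
  let ?I = "\<lambda>X \<omega>. \<integral>r. X r \<omega> * indicator {u<..t} r \<partial>lborel"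
  let ?J = "\<lambda>X r. (\<integral>\<omega>. Z \<omega> * X r \<omega> \<partial>M) * indicator {u<..t} r"
  have L2: "integrable M (\<lambda>\<omega>. Z \<omega> * X \<omega>)"
    "(\<integral>\<omega>. \<bar>Z \<omega> * X \<omega>\<bar> \<partial>M) \<le> (\<integral>\<omega>. (Z \<omega>)\<^sup>2 \<partial>M) + 2 * a\<^sup>2 + 2 * b\<^sup>2 * K"
    if X: "X \<in> borel_measurable M" "0 \<le> r" "r \<le> t" "\<And>\<omega>. \<bar>X \<omega>\<bar> \<le> a + b * norm (Y r \<omega>)" for X a b r
  proof -
    note L = integrable_mult_L2[OF ZM Z(2) X(1) sm[OF X(2)] X(4)]
    show "integrable M (\<lambda>\<omega>. Z \<omega> * X \<omega>)" by (rule L(1))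
    have "2 * b\<^sup>2 * (\<integral>\<omega>. sq_norm (Y r \<omega>) \<partial>M) \<le> 2 * b\<^sup>2 * K" using K[OF X(2,3)] by (intro mult_left_mono) auto
    with L(2) show "(\<integral>\<omega>. \<bar>Z \<omega> * X \<omega>\<bar> \<partial>M) \<le> (\<integral>\<omega>. (Z \<omega>)\<^sup>2 \<partial>M) + 2 * a\<^sup>2 + 2 * b\<^sup>2 * K" by linarith
  qed
  have dc: "continuous_on UNIV (\<lambda>X. drift X $ i $ j)" by (intro continuous_intros continuous_drift)
  have dm: "?d r \<in> borel_measurable M" if "0 \<le> r" for r
    by (rule measurable_F_M[OF continuous_adapted[OF dc that] that])
  have dle: "\<bar>?d r \<omega>\<bar> \<le> 0 + (2 * norm B) * norm (Y r \<omega>)" for r \<omega>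
    using order_trans[OF matrix_component_le_norm norm_drift_le] by simp
  have cm: "?c k l r \<in> borel_measurable M" if "0 \<le> r" for k l r
    by (rule measurable_F_M[OF coeff_adapted[OF that] that])
  have cle: "\<bar>?c k l r \<omega>\<bar> \<le> sq_norm A * trace C + (sq_norm A * real CARD('d)) * norm (Y r \<omega>)" if "0 \<le> r" for k l r \<omega>
    by (rule abs_coeff_le[OF Y_psd[OF that]])
  have dZ: "integrable M (\<lambda>\<omega>. Z \<omega> * ?d r \<omega>)" if "0 \<le> r" "r \<le> t" for r
    using that by (intro L2(1)[OF dm _ _ dle]) auto
  have cZ: "integrable M (\<lambda>\<omega>. Z \<omega> * ?c k l r \<omega>)" if "0 \<le> r" "r \<le> t" for k l r
    using that by (intro L2(1)[OF cm _ _ cle]) auto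
  \<comment> \<open>Linear growth of drift and coefficients bounds their products with
    \<open>Z\<close> in mean, uniformly on the time interval.\<close>
  note fd = path_fubini[OF u dm continuous_cadlag[OF dc] ZM dZ L2(2)[OF dm _ _ dle]]
  note fc = path_fubini[OF u cm coeff_cadlag ZM cZ L2(2)[OF cm _ _ cle]]
  have d2: "integrable M (\<lambda>\<omega>. Z \<omega> * ?I ?d \<omega>)" "(\<integral>\<omega>. Z \<omega> * ?I ?d \<omega> \<partial>M) = (\<integral>r. ?J ?d r \<partial>lborel)" "integrable lborel (?J ?d)"
    by (rule fd(2-4); use u in simp)+
  have c2: "(\<integral>\<^sup>+\<omega>. ennreal (\<bar>Z \<omega>\<bar> * ?I (\<lambda>r \<omega>. \<bar>?c k l r \<omega>\<bar>) \<omega>) \<partial>M) < \<infinity>"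
    "(\<integral>\<omega>. Z \<omega> * ?I (?c k l) \<omega> \<partial>M) = (\<integral>r. ?J (?c k l) r \<partial>lborel)" "integrable lborel (?J (?c k l))" for k l
    by (rule fc(1) fc(3) fc(4); use u in simp)+
  have comp: "has_bochner_integral M (\<lambda>\<omega>. Z \<omega> * jump_integral (?c k l) k l u t \<omega>) ((if k = l then \<sigma> else 0) * (\<integral>r. ?J (?c k l) r \<partial>lborel))" for k l
    using compensation[OF u coeff_adapted coeff_cadlag Z(1) c2(1), of k l k l] unfolding c2(2) .
  have Yc: "\<bar>Y r \<omega> $ i $ j\<bar> \<le> 0 + 1 * norm (Y r \<omega>)" for r \<omega> using matrix_component_le_norm by simp
  have Ym: "(\<lambda>\<omega>. Y r \<omega> $ i $ j) \<in> borel_measurable M" if "0 \<le> r" for r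
    by (rule measurable_compose[OF Y_measurable[OF that] borel_measurable_continuous_onI]) (intro continuous_intros)
  have YZ: "integrable M (\<lambda>\<omega>. Z \<omega> * Y r \<omega> $ i $ j)" if "0 \<le> r" "r \<le> t" for r
    using that by (intro L2(1)[OF Ym _ _ Yc]) auto
  have "has_bochner_integral M (\<lambda>\<omega>. Z \<omega> * Y u \<omega> $ i $ j + Z \<omega> * ?I ?d \<omega> + (\<Sum>k\<in>UNIV. \<Sum>l\<in>UNIV. Z \<omega> * jump_integral (?c k l) k l u t \<omega>))
     ((\<integral>\<omega>. Z \<omega> * Y u \<omega> $ i $ j \<partial>M) + (\<integral>r. ?J ?d r \<partial>lborel) + (\<Sum>k\<in>UNIV. \<Sum>l\<in>UNIV. (if k = l then \<sigma> else 0) * (\<integral>r. ?J (?c k l) r \<partial>lborel)))"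
    unfolding d2(2)[symmetric]
    by (intro has_bochner_integral_add has_bochner_integral_sum comp has_bochner_integral_integrable YZ d2(1) u)
  then have "(\<integral>\<omega>. Z \<omega> * Y u \<omega> $ i $ j + Z \<omega> * ?I ?d \<omega> + (\<Sum>k\<in>UNIV. \<Sum>l\<in>UNIV. Z \<omega> * jump_integral (?c k l) k l u t \<omega>) \<partial>M)
     = (\<integral>\<omega>. Z \<omega> * Y u \<omega> $ i $ j \<partial>M) + (\<integral>r. ?J ?d r \<partial>lborel) + (\<Sum>k\<in>UNIV. \<Sum>l\<in>UNIV. (if k = l then \<sigma> else 0) * (\<integral>r. ?J (?c k l) r \<partial>lborel))"
    by (rule has_bochner_integral_integral_eq)
  moreover have "(\<integral>\<omega>. Z \<omega> * Y t \<omega> $ i $ j \<partial>M) = (\<integral>\<omega>. Z \<omega> * Y u \<omega> $ i $ j + Z \<omega> * ?I ?d \<omega> + (\<Sum>k\<in>UNIV. \<Sum>l\<in>UNIV. Z \<omega> * jump_integral (?c k l) k l u t \<omega>) \<partial>M)"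
  proof (rule integral_cong_AE)
    show "AE \<omega> in M. Z \<omega> * Y t \<omega> $ i $ j = Z \<omega> * Y u \<omega> $ i $ j + Z \<omega> * ?I ?d \<omega> + (\<Sum>k\<in>UNIV. \<Sum>l\<in>UNIV. Z \<omega> * jump_integral (?c k l) k l u t \<omega>)"
      using path_equation
    proof eventually_elim
      case (elim \<omega>)
      then have "Y t \<omega> $ i $ j = Y u \<omega> $ i $ j + ?I ?d \<omega> + (\<Sum>k\<in>UNIV. \<Sum>l\<in>UNIV. jump_integral (?c k l) k l u t \<omega>)"
        using u by blast
      then show ?case by (simp only: distrib_left sum_distrib_left)
    qed
    show "(\<lambda>\<omega>. Z \<omega> * Y t \<omega> $ i $ j) \<in> borel_measurable M" using ZM Ym[of t] u by (intro borel_measurable_times) auto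
    have "(\<lambda>\<omega>. Z \<omega> * jump_integral (?c k l) k l u t \<omega>) \<in> borel_measurable M" for k l
      using comp[of k l] by (simp add: has_bochner_integral_iff borel_measurable_integrable)
    then show "(\<lambda>\<omega>. Z \<omega> * Y u \<omega> $ i $ j + Z \<omega> * ?I ?d \<omega> + (\<Sum>k\<in>UNIV. \<Sum>l\<in>UNIV. Z \<omega> * jump_integral (?c k l) k l u t \<omega>)) \<in> borel_measurable M"
      using borel_measurable_times[OF ZM Ym[OF u(1)]] borel_measurable_integrable[OF d2(1)]
      by (intro borel_measurable_add borel_measurable_sum)
  qed
  \<comment> \<open>The off-diagonal coefficients drop out, and in the remaining sum the two square
    roots meet.\<close>
  moreover have "(\<Sum>k\<in>UNIV. \<Sum>l\<in>UNIV. (if k = l then \<sigma> else 0) * (\<integral>r. ?J (?c k l) r \<partial>lborel)) = (\<Sum>k\<in>UNIV. \<sigma> * (\<integral>r. ?J (?c k k) r \<partial>lborel))"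
    by (simp add: if_distrib[of "\<lambda>x. x * _"] cong: if_cong)
  moreover have g: "(\<integral>\<omega>. Z \<omega> * generator (Y r \<omega>) $ i $ j \<partial>M) * indicator {u<..t} r = ?J ?d r + (\<Sum>k\<in>UNIV. \<sigma> * ?J (?c k k) r)" for r
  proof (cases "r \<in> {u<..t}")
    case True
    then have r: "0 \<le> r" "r \<le> t" using u by auto
    have "(\<integral>\<omega>. Z \<omega> * generator (Y r \<omega>) $ i $ j \<partial>M) = (\<integral>\<omega>. Z \<omega> * ?d r \<omega> + (\<Sum>k\<in>UNIV. \<sigma> * (Z \<omega> * ?c k k r \<omega>)) \<partial>M)"
    proof (intro Bochner_Integration.integral_cong refl)
      fix \<omega>
      show "Z \<omega> * generator (Y r \<omega>) $ i $ j = Z \<omega> * ?d r \<omega> + (\<Sum>k\<in>UNIV. \<sigma> * (Z \<omega> * ?c k k r \<omega>))"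
        unfolding sum_distrib_left[symmetric] sum_coeff[OF Y_psd[OF r(1)]] by (simp add: generator_def algebra_simps)
    qed
    also have "\<dots> = (\<integral>\<omega>. Z \<omega> * ?d r \<omega> \<partial>M) + (\<Sum>k\<in>UNIV. \<sigma> * (\<integral>\<omega>. Z \<omega> * ?c k k r \<omega> \<partial>M))"
      using dZ[OF r] cZ[OF r] by (simp add: Bochner_Integration.integral_sum)
    finally show ?thesis using True by simp
  qed simp
  ultimately show "(\<integral>\<omega>. Z \<omega> * Y t \<omega> $ i $ j \<partial>M) = (\<integral>\<omega>. Z \<omega> * Y u \<omega> $ i $ j \<partial>M) +
      (\<integral>r. (\<integral>\<omega>. Z \<omega> * generator (Y r \<omega>) $ i $ j \<partial>M) * indicator {u<..t} r \<partial>lborel)"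
    unfolding g using d2(3) c2(3) by (simp add: Bochner_Integration.integral_sum)
  show "integrable lborel (\<lambda>r. (\<integral>\<omega>. Z \<omega> * generator (Y r \<omega>) $ i $ j \<partial>M) * indicator {u<..t} r)"
    unfolding g by (intro Bochner_Integration.integrable_add Bochner_Integration.integrable_sum integrable_mult_right d2(3) c2(3))
qed

text \<open>Centring one factor suffices for a covariance, so only the value at the fixed time
  \<open>u\<close> is centred and the later one enters the mean equation as it is. The second
  moments give the boundedness from which regularity in \<open>h\<close> is derived.\<close>

theorem covariance_equation:
  defines "K \<equiv> B \<otimes>\<^sub>K mat 1 + mat 1 \<otimes>\<^sub>K B + \<sigma> *\<^sub>R (A \<otimes>\<^sub>K A)"
  assumes sm: "\<And>t. 0 \<le> t \<Longrightarrow> integrable M (\<lambda>\<omega>. sq_norm (Y t \<omega>))"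
    and bd: "\<And>T. \<exists>K. \<forall>t. 0 \<le> t \<longrightarrow> t \<le> T \<longrightarrow> (\<integral>\<omega>. sq_norm (Y t \<omega>) \<partial>M) \<le> K"
    and u: "0 \<le> u" and h: "0 \<le> h"
  defines "D \<equiv> \<lambda>h. cov M (\<lambda>\<omega>. vectorize (Y (u + h) \<omega>)) (\<lambda>\<omega>. vectorize (Y u \<omega>))"
  shows "(D has_vector_derivative K ** D h) (at h within {0..})" and "D h = matrix_exp (h *\<^sub>R K) ** D 0"
proof -
  define y where "y p t \<omega> = vectorize (Y t \<omega>) $ p" for p t \<omega>
  have y: "y p t \<omega> = Y t \<omega> $ snd p $ fst p" for p t \<omega> by (simp add: y_def vectorize_def)
  have yle: "\<bar>y p t \<omega>\<bar> \<le> 0 + 1 * norm (Y t \<omega>)" for p t \<omega> unfolding y using matrix_component_le_norm by simp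
  have yc: "continuous_on UNIV (\<lambda>X :: real^'d^'d. X $ snd p $ fst p)" for p by (intro continuous_intros)
  have yF: "y p t \<in> borel_measurable (F t)" if "0 \<le> t" for p t
    unfolding y using continuous_adapted[OF yc that] .
  have ym: "y p t \<in> borel_measurable M" if "0 \<le> t" for p t by (rule measurable_F_M[OF yF[OF that] that])
  have y2: "integrable M (\<lambda>\<omega>. (y p t \<omega>)\<^sup>2)" if "0 \<le> t" for p t
  proof (rule Bochner_Integration.integrable_bound[OF sm[OF that]])
    show "AE \<omega> in M. norm ((y p t \<omega>)\<^sup>2) \<le> norm (sq_norm (Y t \<omega>))"
      using yle[of p t] by (intro AE_I2) (simp add: abs_le_square_iff[symmetric])
  qed (use ym[OF that] in measurable)
  have yy: "integrable M (\<lambda>\<omega>. y q s \<omega> * y p t \<omega>)" if "0 \<le> s" "0 \<le> t" for p q s t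
    by (rule integrable_mult_L2(1)[OF ym[OF that(1)] y2[OF that(1)] ym[OF that(2)] sm[OF that(2)] yle])
  have y1: "integrable M (y p t)" if "0 \<le> t" for p t
    using integrable_mult_L2(1)[of "\<lambda>_. 1", OF _ _ ym[OF that] sm[OF that] yle] by simp
  define m where "m q = (\<integral>\<omega>. y q u \<omega> \<partial>M)" for q
  define Z where "Z q \<omega> = y q u \<omega> - m q" for q \<omega>
  have ZF: "Z q \<in> borel_measurable (F u)" for q unfolding Z_def using yF[OF u] by measurable
  have ZM: "Z q \<in> borel_measurable M" for q by (rule measurable_F_M[OF ZF u])
  have Z2: "integrable M (\<lambda>\<omega>. (Z q \<omega>)\<^sup>2)" for q
    unfolding Z_def power2_diff using y2[OF u] y1[OF u] by simp
  have Z1: "(\<integral>\<omega>. Z q \<omega> \<partial>M) = 0" "integrable M (Z q)" for q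
    unfolding Z_def m_def using y1[OF u] by (simp_all add: prob_space)
  have Zy: "integrable M (\<lambda>\<omega>. Z q \<omega> * y p t \<omega>)" if "0 \<le> t" for p q t
    by (rule integrable_mult_L2(1)[OF ZM Z2 ym[OF that] sm[OF that] yle])
  have D: "D h $ p $ q = (\<integral>\<omega>. Z q \<omega> * y p (u + h) \<omega> \<partial>M)" if h: "0 \<le> h" for h p q
  proof -
    have uh: "0 \<le> u + h" using u h by simp
    have "D h $ p $ q = (\<integral>\<omega>. y p (u + h) \<omega> * y q u \<omega> \<partial>M) - (\<integral>\<omega>. y p (u + h) \<omega> \<partial>M) * m q"
      unfolding D_def m_def y_def
      by (rule cov_nth) (fact y1[OF uh, unfolded y_def[abs_def]] y1[OF u, unfolded y_def[abs_def]] yy[OF uh u, unfolded y_def])+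
    also have "\<dots> = (\<integral>\<omega>. y p (u + h) \<omega> * y q u \<omega> - y p (u + h) \<omega> * m q \<partial>M)"
      using yy[OF uh u, of p q] y1[OF uh, of p] by simp
    also have "\<dots> = (\<integral>\<omega>. Z q \<omega> * y p (u + h) \<omega> \<partial>M)"
      by (intro Bochner_Integration.integral_cong) (auto simp: Z_def algebra_simps)
    finally show ?thesis .
  qed
  have KD: "(K ** D h) $ p $ q = (\<integral>\<omega>. Z q \<omega> * generator (Y (u + h) \<omega>) $ snd p $ fst p \<partial>M)" if h: "0 \<le> h" for h p q
  proof -
    have uh: "0 \<le> u + h" using u h by simp
    define c where "c = (\<sigma> *\<^sub>R (A ** C ** transpose A)) $ snd p $ fst p"
    have gen: "generator X $ snd p $ fst p = (\<Sum>r\<in>UNIV. K $ p $ r * vectorize X $ r) + c" for X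
    proof -
      have "(\<Sum>r\<in>UNIV. K $ p $ r * vectorize X $ r) = (K *v vectorize X) $ p" by (simp add: matrix_vector_mult_def)
      also have "\<dots> = (drift X + \<sigma> *\<^sub>R (A ** X ** transpose A)) $ snd p $ fst p"
        unfolding K_def kronecker_vectorize by (simp add: vectorize_def drift_def)
      finally have 1: "(\<Sum>r\<in>UNIV. K $ p $ r * vectorize X $ r) = (drift X + \<sigma> *\<^sub>R (A ** X ** transpose A)) $ snd p $ fst p" .
      have "A ** (C + X) ** transpose A = A ** C ** transpose A + A ** X ** transpose A"
        by (simp add: vec_eq_iff matrix_matrix_mult_def distrib_left distrib_right sum.distrib)
      then show ?thesis unfolding 1 c_def generator_def by (simp add: algebra_simps)
    qed
    have "(\<integral>\<omega>. Z q \<omega> * generator (Y (u + h) \<omega>) $ snd p $ fst p \<partial>M) = (\<integral>\<omega>. (\<Sum>r\<in>UNIV. K $ p $ r * (Z q \<omega> * y r (u + h) \<omega>)) + c * Z q \<omega> \<partial>M)"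
      unfolding gen by (intro Bochner_Integration.integral_cong refl) (simp add: y_def algebra_simps sum_distrib_left)
    also have "\<dots> = (\<Sum>r\<in>UNIV. K $ p $ r * (\<integral>\<omega>. Z q \<omega> * y r (u + h) \<omega> \<partial>M))"
      using Zy[OF uh] Z1 by (simp add: Bochner_Integration.integral_sum)
    also have "\<dots> = (K ** D h) $ p $ q" by (simp add: matrix_matrix_mult_def D[OF h])
    finally show ?thesis ..
  qed
  \<comment> \<open>Time is measured from \<open>u\<close>. The factor 1 gives the argument the
    affine form of the substitution rule for Lebesgue measure.\<close>
  have shift: "(\<lambda>s. (K ** D s) $ p $ q * indicator {0<..t} s)
     = (\<lambda>s. (\<integral>\<omega>. Z q \<omega> * generator (Y (u + 1 * s) \<omega>) $ snd p $ fst p \<partial>M) * indicator {u<..u + t} (u + 1 * s))" for p q t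
    by (auto simp: fun_eq_iff KD indicator_def)
  have me: "(\<integral>\<omega>. Z q \<omega> * Y t \<omega> $ i $ j \<partial>M) = (\<integral>\<omega>. Z q \<omega> * Y u \<omega> $ i $ j \<partial>M) +
      (\<integral>r. (\<integral>\<omega>. Z q \<omega> * generator (Y r \<omega>) $ i $ j \<partial>M) * indicator {u<..t} r \<partial>lborel)"
    "integrable lborel (\<lambda>r. (\<integral>\<omega>. Z q \<omega> * generator (Y r \<omega>) $ i $ j \<partial>M) * indicator {u<..t} r)" if "u \<le> t" for t q i j
    by (rule mean_equation[OF sm bd u that ZF Z2]; assumption)+
  have bounded: "\<exists>B. \<forall>t. 0 \<le> t \<longrightarrow> t \<le> T \<longrightarrow> norm (D t) \<le> B" for T
  proof -
    obtain K where K: "\<And>s. 0 \<le> s \<Longrightarrow> s \<le> u + T \<Longrightarrow> (\<integral>\<omega>. sq_norm (Y s \<omega>) \<partial>M) \<le> K" using bd by blast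
    have "norm (D t) \<le> (\<Sum>p\<in>(UNIV :: ('d \<times> 'd) set). \<Sum>q\<in>UNIV. (\<integral>\<omega>. (Z q \<omega>)\<^sup>2 \<partial>M) + 2 * K)" if t: "0 \<le> t" "t \<le> T" for t
    proof -
      have ut: "0 \<le> u + t" "u + t \<le> u + T" using u t by auto
      have "norm (D t) \<le> (\<Sum>p\<in>UNIV. norm (D t $ p))" unfolding norm_vec_def[of "D t"] by (rule L2_set_le_sum) auto
      also have "\<dots> \<le> (\<Sum>p\<in>UNIV. \<Sum>q\<in>UNIV. \<bar>D t $ p $ q\<bar>)" by (intro sum_mono norm_le_l1_cart)
      also have "\<dots> \<le> (\<Sum>p\<in>(UNIV :: ('d \<times> 'd) set). \<Sum>q\<in>UNIV. (\<integral>\<omega>. (Z q \<omega>)\<^sup>2 \<partial>M) + 2 * K)"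
      proof (intro sum_mono)
        fix p q
        have "\<bar>D t $ p $ q\<bar> \<le> (\<integral>\<omega>. \<bar>Z q \<omega> * y p (u + t) \<omega>\<bar> \<partial>M)" unfolding D[OF t(1)] by (rule integral_abs_bound)
        also have "\<dots> \<le> (\<integral>\<omega>. (Z q \<omega>)\<^sup>2 \<partial>M) + 2 * 0\<^sup>2 + 2 * 1\<^sup>2 * (\<integral>\<omega>. sq_norm (Y (u + t) \<omega>) \<partial>M)"
          by (rule integrable_mult_L2(2)[OF ZM Z2 ym[OF ut(1)] sm[OF ut(1)] yle])
        finally show "\<bar>D t $ p $ q\<bar> \<le> (\<integral>\<omega>. (Z q \<omega>)\<^sup>2 \<partial>M) + 2 * K" using K[OF ut] by simp
      qed
      finally show ?thesis .
    qed
    then show ?thesis by blast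
  qed
  have eq: "D t $ p $ q = D 0 $ p $ q + (\<integral>s. (K ** D s) $ p $ q * indicator {0<..t} s \<partial>lborel)" if t: "0 \<le> t" for t p q
  proof -
    have ut: "u \<le> u + t" using t by simp
    have "D t $ p $ q = D 0 $ p $ q + (\<integral>r. (\<integral>\<omega>. Z q \<omega> * generator (Y r \<omega>) $ snd p $ fst p \<partial>M) * indicator {u<..u + t} r \<partial>lborel)"
      using me(1)[OF ut, of q "snd p" "fst p"] unfolding D[OF t] D[OF order.refl] y by simp
    also have "(\<integral>r. (\<integral>\<omega>. Z q \<omega> * generator (Y r \<omega>) $ snd p $ fst p \<partial>M) * indicator {u<..u + t} r \<partial>lborel)
       = (\<integral>s. (K ** D s) $ p $ q * indicator {0<..t} s \<partial>lborel)"
      unfolding shift by (subst lborel_integral_real_affine[where c = 1 and t = u]) simp_all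
    finally show ?thesis .
  qed
  have meas: "(\<lambda>s. (K ** D s) $ p $ q * indicator {0<..t} s) \<in> borel_measurable lborel" if t: "0 \<le> t" for t p q
  proof -
    have ut: "u \<le> u + t" using t by simp
    show ?thesis unfolding shift
      by (rule borel_measurable_integrable[OF lborel_integrable_real_affine[OF me(2)[OF ut, of q "snd p" "fst p"]]]) simp
  qed
  show "(D has_vector_derivative K ** D h) (at h within {0..})"
    by (rule linear_integral_equation(1)[OF bounded eq meas h])
  show "D h = matrix_exp (h *\<^sub>R K) ** D 0"
    by (rule linear_integral_equation(2)[OF bounded eq meas h])
qed

section \<open>Finiteness of second moments\<close>

text \<open>Symmetry of \<open>X\<close> gives the two drift terms the same trace, and
  Cauchy-Schwarz for the Frobenius inner product bounds it. The bound is stated with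
  \<open>C + X\<close>, whose trace is the quantity for Gronwall.\<close>

lemma trace_drift_le: "psd X \<Longrightarrow> trace (drift X) \<le> 2 * norm B * trace (C + X)"
proof -
  assume X: "psd X"
  have "trace (X ** transpose B) = trace (B ** X)"
  proof -
    have "X ** transpose B = transpose (B ** X)" by (simp add: matrix_transpose_mul psd_symmetric[OF X])
    then show ?thesis by (simp add: trace_def transpose_def)
  qed
  then have "trace (drift X) = 2 * trace (B ** X)" by (simp add: drift_def trace_add)
  also have "\<dots> \<le> 2 * (norm B * norm X)" using trace_mult_le[of B X] by simp
  also have "norm X \<le> trace (C + X)"
    using norm_le_trace[OF X] psd_trace_nonneg[OF C_psd] by (simp add: trace_add)
  finally show ?thesis by (simp add: mult_left_mono mult.assoc)
qed

text \<open>A jump \<open>x\<close> of \<open>L\<close> raises the trace by |Q x|^2, where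
  \<open>Q\<close> is \<open>A\<close> times the root of \<open>C + X\<close>, and the squared norm
  of that root is again the trace of \<open>C + X\<close>.\<close>

lemma sum_coeff_le:
  assumes X: "psd X"
  shows "(\<Sum>i\<in>UNIV. \<Sum>k\<in>UNIV. \<Sum>l\<in>UNIV. coeff i i k l X * (x $ k * x $ l)) \<le> sq_norm A * trace (C + X) * sq_norm x"
proof -
  let ?R = "psd_sqrt (C + X)"
  let ?Q = "A ** ?R"
  have t: "(?R ** transpose A) $ l $ i = ?Q $ i $ l" for i l
  proof -
    have "?R ** transpose A = transpose ?Q"
      by (simp add: matrix_transpose_mul psd_symmetric[OF psd_psd_sqrt[OF psd_V[OF X]]])
    then show ?thesis by (simp add: transpose_def)
  qed
  have "(\<Sum>k\<in>UNIV. \<Sum>l\<in>UNIV. coeff i i k l X * (x $ k * x $ l)) = ((?Q *v x) $ i)\<^sup>2" for i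
    unfolding coeff_def t matrix_vector_mult_def power2_eq_square
    by (simp add: sum_product mult_ac)
  then have "(\<Sum>i\<in>UNIV. \<Sum>k\<in>UNIV. \<Sum>l\<in>UNIV. coeff i i k l X * (x $ k * x $ l)) = sq_norm (?Q *v x)"
    unfolding power2_norm_eq_inner inner_vec_def by (simp add: power2_eq_square)
  also have "norm (?Q *v x) \<le> norm A * norm ?R * norm x"
    using order_trans[OF norm_matrix_vector_le mult_right_mono[OF norm_matrix_mult_le norm_ge_zero]] .
  then have "sq_norm (?Q *v x) \<le> (norm A * norm ?R * norm x)\<^sup>2" by (intro power_mono) auto
  also have "\<dots> = sq_norm A * trace (C + X) * sq_norm x"
    by (simp add: power_mult_distrib norm_psd_sqrt[OF psd_V[OF X]])
  finally show ?thesis .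
qed

lemma continuous_trace_V: "continuous_on UNIV (\<lambda>X. trace (C + X))"
  unfolding trace_def by (intro continuous_intros)

lemma trace_V_nonneg: "0 \<le> t \<Longrightarrow> 0 \<le> trace (C + Y t \<omega>)"
  by (rule psd_trace_nonneg[OF psd_V[OF Y_psd]])

text \<open>Taking traces in the path equation leads to the scalar inequality of
  \<open>jump_gronwall\<close>, with constant \<open>2 * norm B\<close> for the drift and the
  squared norm of \<open>A\<close> for the jumps.\<close>

lemma trace_V_le:
  "AE \<omega> in M. \<forall>t\<ge>0. trace (C + Y t \<omega>) \<le> trace (C + Y 0 \<omega>) *
     exp (2 * (2 * norm B) * t + enn2real (jump_sum (\<lambda>x. ln (1 + 2 * sq_norm A * sq_norm x)) (\<lambda>t. L t \<omega>) 0 t))"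
  using path_equation AE_jump_sum_finite
proof eventually_elim
  case (elim \<omega>)
  let ?g = "\<lambda>t. L t \<omega>" and ?v = "\<lambda>t. trace (C + Y t \<omega>)"
  have S: "jump_sum sq_norm ?g s t < \<infinity>" if "0 \<le> s" for s t using elim(2) that by blast
  have vcad: "cadlag ?v" by (rule continuous_cadlag[OF continuous_trace_V])
  have vl: "left_limit ?v r = trace (C + left_limit (\<lambda>t. Y t \<omega>) r)" if "0 \<le> r" for r
    by (rule continuous_left_limit[OF continuous_trace_V that])
  show ?case
  proof (intro allI impI)
    fix t :: real assume t: "0 \<le> t"
    show "?v t \<le> ?v 0 * exp (2 * (2 * norm B) * t + enn2real (jump_sum (\<lambda>x. ln (1 + 2 * sq_norm A * sq_norm x)) ?g 0 t))"
    proof (rule jump_gronwall[OF vcad trace_V_nonneg S[OF order.refl] _ _ _ t])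
      fix s t :: real assume st: "0 \<le> s" "s \<le> t"
      have dc: "continuous_on UNIV (\<lambda>X. drift X $ i $ j)" for i j by (intro continuous_intros continuous_drift)
      have di: "integrable lborel (\<lambda>r. drift (Y r \<omega>) $ i $ i * indicator {s<..t} r)" for i
        by (rule integrable_cadlag[OF continuous_cadlag[OF dc] st])
      have vi: "integrable lborel (\<lambda>r. ?v r * indicator {s<..t} r)" by (rule integrable_cadlag[OF vcad st])
      have "(\<Sum>i\<in>UNIV. \<integral>r. drift (Y r \<omega>) $ i $ i * indicator {s<..t} r \<partial>lborel)
          = (\<integral>r. trace (drift (Y r \<omega>)) * indicator {s<..t} r \<partial>lborel)"
        unfolding trace_def sum_distrib_right by (rule Bochner_Integration.integral_sum[symmetric]) (rule di)
      also have "\<dots> \<le> (\<integral>r. 2 * norm B * (?v r * indicator {s<..t} r) \<partial>lborel)"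
      proof (rule Bochner_Integration.integral_mono)
        show "integrable lborel (\<lambda>r. trace (drift (Y r \<omega>)) * indicator {s<..t} r)"
          unfolding trace_def sum_distrib_right by (intro Bochner_Integration.integrable_sum di)
        show "integrable lborel (\<lambda>r. 2 * norm B * (?v r * indicator {s<..t} r))" by (rule integrable_mult_right[OF vi])
        show "trace (drift (Y r \<omega>)) * indicator {s<..t} r \<le> 2 * norm B * (?v r * indicator {s<..t} r)" for r
          using trace_drift_le[OF Y_psd, of r] st by (auto simp: indicator_def)
      qed
      also have "\<dots> = 2 * norm B * (\<integral>r. left_limit ?v r * indicator {s<..t} r \<partial>lborel)"
      proof -
        have "(\<integral>r. ?v r * indicator {s<..t} r \<partial>lborel) = (\<integral>r. left_limit ?v r * indicator {s<..t} r \<partial>lborel)"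
        proof (rule integral_cong_AE[OF borel_measurable_integrable[OF vi]])
          show "(\<lambda>r. left_limit ?v r * indicator {s<..t} r) \<in> borel_measurable lborel"
            using cadlag_measurable(2)[OF vcad st] by simp
          show "AE r in lborel. ?v r * indicator {s<..t} r = left_limit ?v r * indicator {s<..t} r"
            using AE_lborel_left_limit[OF vcad st(1), of t] by eventually_elim (auto simp: indicator_def)
        qed
        then show ?thesis by simp
      qed
      finally have drift: "(\<Sum>i\<in>UNIV. \<integral>r. drift (Y r \<omega>) $ i $ i * indicator {s<..t} r \<partial>lborel)
        \<le> 2 * norm B * (\<integral>r. left_limit ?v r * indicator {s<..t} r \<partial>lborel)" .
      let ?c = "\<lambda>i k l r. left_limit (\<lambda>s. coeff i i k l (Y s \<omega>)) r * jump_prod ?g k l r * indicator {s<..t} r"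
      have ci: "integrable (count_space UNIV) (?c i k l)" for i k l
      proof -
        obtain K where K: "\<And>r. 0 \<le> r \<Longrightarrow> r \<le> t \<Longrightarrow> norm (left_limit (\<lambda>s. coeff i i k l (Y s \<omega>)) r) \<le> K"
          using cadlag_bounded[OF coeff_cadlag[of i i k l \<omega>], of t] by metis
        show ?thesis by (rule integrable_jump_prod[OF S[OF st(1)], where K = K]) (use K st in auto)
      qed
      have ri: "integrable (count_space UNIV) (\<lambda>r. left_limit ?v r * (sq_norm (jump ?g r) * indicator {s<..t} r))"
      proof -
        obtain K where K: "\<And>r. 0 \<le> r \<Longrightarrow> r \<le> t \<Longrightarrow> norm (left_limit ?v r) \<le> K"
          using cadlag_bounded[OF vcad, of t] by metis
        have "integrable (count_space UNIV) (\<lambda>r. \<Sum>k\<in>UNIV. left_limit ?v r * jump_prod ?g k k r * indicator {s<..t} r)"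
          by (intro Bochner_Integration.integrable_sum integrable_jump_prod[OF S[OF st(1)], where K = K]) (use K st in auto)
        then show ?thesis unfolding sq_norm_jump by (simp only: sum_distrib_left sum_distrib_right mult.assoc)
      qed
      have "(\<Sum>i\<in>UNIV. \<Sum>k\<in>UNIV. \<Sum>l\<in>UNIV. jump_integral (\<lambda>s \<omega>. coeff i i k l (Y s \<omega>)) k l s t \<omega>)
        = (\<integral>r. (\<Sum>i\<in>UNIV. \<Sum>k\<in>UNIV. \<Sum>l\<in>UNIV. ?c i k l r) \<partial>count_space UNIV)"
        by (simp only: jump_integral_def Bochner_Integration.integral_sum Bochner_Integration.integrable_sum ci)
      also have "\<dots> \<le> (\<integral>r. sq_norm A * (left_limit ?v r * (sq_norm (jump ?g r) * indicator {s<..t} r)) \<partial>count_space UNIV)"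
      proof (rule Bochner_Integration.integral_mono)
        show "integrable (count_space UNIV) (\<lambda>r. \<Sum>i\<in>UNIV. \<Sum>k\<in>UNIV. \<Sum>l\<in>UNIV. ?c i k l r)"
          by (intro Bochner_Integration.integrable_sum ci)
        show "integrable (count_space UNIV) (\<lambda>r. sq_norm A * (left_limit ?v r * (sq_norm (jump ?g r) * indicator {s<..t} r)))"
          by (rule integrable_mult_right[OF ri])
        show "(\<Sum>i\<in>UNIV. \<Sum>k\<in>UNIV. \<Sum>l\<in>UNIV. ?c i k l r) \<le> sq_norm A * (left_limit ?v r * (sq_norm (jump ?g r) * indicator {s<..t} r))" for r
        proof (cases "r \<in> {s<..t}")
          case True
          then have r: "0 \<le> r" using st by auto
          have "left_limit (\<lambda>t. Y t \<omega>) r \<in> {X. psd X}"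
            by (rule left_limit_in_closed[OF Y_cadlag closed_psd]) (use Y_psd r in auto)
          then show ?thesis
            using sum_coeff_le[of "left_limit (\<lambda>t. Y t \<omega>) r" "jump ?g r"] True
            by (simp add: vl[OF r] coeff_left_limit[OF r] jump_prod_def mult.assoc)
        qed simp
      qed
      finally have jumps: "(\<Sum>i\<in>UNIV. \<Sum>k\<in>UNIV. \<Sum>l\<in>UNIV. jump_integral (\<lambda>s \<omega>. coeff i i k l (Y s \<omega>)) k l s t \<omega>)
        \<le> sq_norm A * (\<integral>r. left_limit ?v r * (sq_norm (jump ?g r) * indicator {s<..t} r) \<partial>count_space UNIV)" by simp
      have "?v t = trace C + (\<Sum>i\<in>UNIV. Y t \<omega> $ i $ i)" by (simp only: trace_add) (simp add: trace_def)
      also have "(\<Sum>i\<in>UNIV. Y t \<omega> $ i $ i) = (\<Sum>i\<in>UNIV. Y s \<omega> $ i $ i + (\<integral>r. drift (Y r \<omega>) $ i $ i * indicator {s<..t} r \<partial>lborel)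
         + (\<Sum>k\<in>UNIV. \<Sum>l\<in>UNIV. jump_integral (\<lambda>s \<omega>. coeff i i k l (Y s \<omega>)) k l s t \<omega>))"
        using elim(1) st by (intro sum.cong refl) blast
      also have "trace C + \<dots> = ?v s + (\<Sum>i\<in>UNIV. \<integral>r. drift (Y r \<omega>) $ i $ i * indicator {s<..t} r \<partial>lborel)
         + (\<Sum>i\<in>UNIV. \<Sum>k\<in>UNIV. \<Sum>l\<in>UNIV. jump_integral (\<lambda>s \<omega>. coeff i i k l (Y s \<omega>)) k l s t \<omega>)"
        by (simp only: trace_add sum.distrib) (simp add: trace_def)
      finally show "?v t \<le> ?v s + 2 * norm B * (\<integral>r. left_limit ?v r * indicator {s<..t} r \<partial>lborel)
        + sq_norm A * (\<integral>r. left_limit ?v r * (sq_norm (jump ?g r) * indicator {s<..t} r) \<partial>count_space UNIV)"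
        using drift jumps by linarith
    qed auto
  qed
qed

text \<open>Squaring the pathwise bound doubles the logarithm, and the exponential of the doubled
  logarithm minus 1 is a polynomial of degree 4 in |x|, whose mean over a step 1 / N is of order 1 /
  N. The initial value is known at time 0 and therefore factors off from the jumps.\<close>

theorem second_moments:
  assumes Y0: "integrable M (\<lambda>\<omega>. sq_norm (Y 0 \<omega>))"
    and L1: "(\<integral>\<^sup>+\<omega>. ennreal (norm (L 1 \<omega>) ^ 4) \<partial>M) < \<infinity>"
  shows "0 \<le> t \<Longrightarrow> integrable M (\<lambda>\<omega>. sq_norm (Y t \<omega>))"
    and "\<exists>K. \<forall>t. 0 \<le> t \<longrightarrow> t \<le> T \<longrightarrow> (\<integral>\<omega>. sq_norm (Y t \<omega>) \<partial>M) \<le> K"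
proof -
  define a b where "a = sq_norm A" and "b = 2 * norm B"
  have ab: "0 \<le> a" "0 \<le> b" by (simp_all add: a_def b_def)
  let ?\<phi> = "\<lambda>x :: real^'d. ln (1 + 2 * a * sq_norm x)"
  let ?\<psi> = "\<lambda>x :: real^'d. 2 * ln (1 + 2 * a * sq_norm x)"
  let ?v = "\<lambda>t \<omega>. trace (C + Y t \<omega>)"
  let ?J = "\<lambda>\<phi> t \<omega>. enn2real (jump_sum \<phi> (\<lambda>t. L t \<omega>) 0 t)"
  have pos: "0 < 1 + 2 * a * sq_norm x" for x :: "real^'d" using ab by (simp add: add_pos_nonneg)
  have exp_\<psi>: "exp (?\<psi> x) - 1 = 4 * a * sq_norm x + 4 * a\<^sup>2 * norm x ^ 4" for x :: "real^'d"
  proof -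
    have "exp (?\<psi> x) = (1 + 2 * a * sq_norm x)\<^sup>2"
      using pos[of x] by (simp only: exp_double exp_ln)
    also have "\<dots> = 1 + 4 * a * sq_norm x + 4 * a\<^sup>2 * norm x ^ 4"
      by (simp add: power2_sum power_mult_distrib flip: power_mult)
    finally show ?thesis by simp
  qed
  obtain K where K: "0 \<le> K" "\<And>N. N > 0 \<Longrightarrow>
      (\<integral>\<^sup>+\<omega>. ennreal (4 * a * sq_norm (L (1 / real N) \<omega>) + 4 * a\<^sup>2 * norm (L (1 / real N) \<omega>) ^ 4) \<partial>M) \<le> ennreal (K / real N)"
    using norm_moments[OF L1, of "4 * a" "4 * a\<^sup>2"] ab by auto
  have fin: "AE \<omega> in M. jump_sum ?\<phi> (\<lambda>t. L t \<omega>) 0 t < \<infinity>" for t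
    using AE_jump_sum_finite
  proof eventually_elim
    case (elim \<omega>)
    then have "jump_sum sq_norm (\<lambda>t. L t \<omega>) 0 t < \<infinity>" by blast
    from one_plus_jump_sum_le_exp(2)[OF this, of "2 * a"] ab show ?case by simp
  qed
  have dbl: "jump_sum ?\<psi> g 0 t = 2 * jump_sum ?\<phi> g 0 t" for g t
    unfolding jump_sum_def using pos
    by (subst nn_integral_cmult[symmetric]) (auto simp: ennreal_mult' mult.assoc intro!: nn_integral_cong)
  have vm: "(\<lambda>\<omega>. ?v 0 \<omega>) \<in> borel_measurable M"
    by (rule measurable_F_M[OF continuous_adapted[OF continuous_trace_V]]) auto
  have v0: "(\<integral>\<^sup>+\<omega>. ennreal ((?v 0 \<omega>)\<^sup>2) \<partial>M) < \<infinity>"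
  proof -
    have "integrable M (\<lambda>\<omega>. (?v 0 \<omega>)\<^sup>2)"
    proof (rule Bochner_Integration.integrable_bound)
      show "integrable M (\<lambda>\<omega>. 2 * (trace C)\<^sup>2 + 2 * (real CARD('d))\<^sup>2 * sq_norm (Y 0 \<omega>))" using Y0 by simp
      have "(?v 0 \<omega>)\<^sup>2 \<le> 2 * (trace C)\<^sup>2 + 2 * (real CARD('d))\<^sup>2 * sq_norm (Y 0 \<omega>)" for \<omega>
      proof -
        have "(?v 0 \<omega>)\<^sup>2 \<le> 2 * (trace C)\<^sup>2 + 2 * (trace (Y 0 \<omega>))\<^sup>2"
          unfolding trace_add power2_sum using sum_squares_bound[of "trace C" "trace (Y 0 \<omega>)"] by simp
        moreover have "(trace (Y 0 \<omega>))\<^sup>2 \<le> (real CARD('d) * norm (Y 0 \<omega>))\<^sup>2"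
          using abs_trace_le[of "Y 0 \<omega>"] by (intro abs_le_square_iff[THEN iffD1]) auto
        ultimately show ?thesis by (simp add: power_mult_distrib)
      qed
      then show "AE \<omega> in M. norm ((?v 0 \<omega>)\<^sup>2) \<le> norm (2 * (trace C)\<^sup>2 + 2 * (real CARD('d))\<^sup>2 * sq_norm (Y 0 \<omega>))"
        by (intro AE_I2) simp
    qed (use vm in measurable)
    then show ?thesis by (simp add: integrable_iff_bounded)
  qed
  have main: "\<exists>K. \<forall>t. 0 \<le> t \<longrightarrow> t \<le> T \<longrightarrow> integrable M (\<lambda>\<omega>. sq_norm (Y t \<omega>)) \<and> (\<integral>\<omega>. sq_norm (Y t \<omega>) \<partial>M) \<le> K" for T
  proof -
    \<comment> \<open>The exponential estimate is stated for positive integer horizons.\<close>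
    obtain m :: nat where m: "0 < m" "T \<le> real m"
      using reals_Archimedean2[of "max T 1"] by (metis max_less_iff_conj of_nat_0_less_iff less_le zero_less_one order.strict_trans)
    let ?e = "exp (2 * (2 * b * real m))"
    \<comment> \<open>Collects what is known at time 0: the deterministic growth up to
      \<open>m\<close> and the squared initial trace.\<close>
    let ?H = "\<lambda>\<omega>. ennreal (?e * (?v 0 \<omega>)\<^sup>2)"
    have HF: "?H \<in> borel_measurable (F 0)"
      using continuous_adapted[OF continuous_trace_V, of 0] by measurable
    have I: "(\<integral>\<^sup>+\<omega>. ?H \<omega> * ennreal (exp (?J ?\<psi> (real m) \<omega>)) \<partial>M) \<le> (\<integral>\<^sup>+\<omega>. ?H \<omega> \<partial>M) * ennreal (exp (real m * K))"
    proof (rule exp_jump_sum_le[OF _ _ _ HF K(1) _ m(1)])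
      show "continuous_on UNIV ?\<psi>" using pos by (intro continuous_intros) (simp add: less_imp_neq[symmetric])
      show "0 \<le> ?\<psi> x" for x using ab by simp
      show "AE \<omega> in M. jump_sum ?\<psi> (\<lambda>t. L t \<omega>) 0 (real m) < \<infinity>"
        using fin by eventually_elim (auto simp: dbl ennreal_mult_less_top)
      show "(\<integral>\<^sup>+\<omega>. ennreal (exp (?\<psi> (L (1 / real N) \<omega>)) - 1) \<partial>M) \<le> ennreal (K / real N)" if "0 < N" for N
        unfolding exp_\<psi> by (rule K(2)[OF that])
    qed simp
    define Q where "Q = (\<integral>\<^sup>+\<omega>. ?H \<omega> \<partial>M) * ennreal (exp (real m * K))"
    have "(\<integral>\<^sup>+\<omega>. ?H \<omega> \<partial>M) = ennreal ?e * (\<integral>\<^sup>+\<omega>. ennreal ((?v 0 \<omega>)\<^sup>2) \<partial>M)"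
      using vm by (subst nn_integral_cmult[symmetric]) (auto simp: ennreal_mult)
    then have Q: "Q < \<infinity>" unfolding Q_def using v0 by (simp add: ennreal_mult_less_top)
    have le: "(\<integral>\<^sup>+\<omega>. ennreal (sq_norm (Y t \<omega>)) \<partial>M) \<le> Q" if t: "0 \<le> t" "t \<le> real m" for t
    proof -
      have "(\<integral>\<^sup>+\<omega>. ennreal (sq_norm (Y t \<omega>)) \<partial>M) \<le> (\<integral>\<^sup>+\<omega>. ?H \<omega> * ennreal (exp (?J ?\<psi> (real m) \<omega>)) \<partial>M)"
      proof (rule nn_integral_mono_AE)
        show "AE \<omega> in M. ennreal (sq_norm (Y t \<omega>)) \<le> ?H \<omega> * ennreal (exp (?J ?\<psi> (real m) \<omega>))"
          using trace_V_le fin[of "real m"]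
        proof eventually_elim
          case (elim \<omega>)
          have J: "?J ?\<phi> t \<omega> \<le> ?J ?\<phi> (real m) \<omega>"
            using elim(2) jump_sum_interval_mono[OF order.refl[of 0] t(2)] by (intro enn2real_mono) auto
          have "norm (Y t \<omega>) \<le> ?v t \<omega>"
            using norm_le_trace[OF Y_psd[OF t(1)]] psd_trace_nonneg[OF C_psd] by (simp add: trace_add add_increasing)
          also have "\<dots> \<le> ?v 0 \<omega> * exp (2 * b * t + ?J ?\<phi> t \<omega>)" using elim(1) t(1) by (simp add: a_def b_def)
          also have "\<dots> \<le> ?v 0 \<omega> * exp (2 * b * real m + ?J ?\<phi> (real m) \<omega>)"
            using J t ab trace_V_nonneg[of 0 \<omega>] by (intro mult_left_mono) (auto intro!: add_mono mult_left_mono)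
          finally have "sq_norm (Y t \<omega>) \<le> (?v 0 \<omega> * exp (2 * b * real m + ?J ?\<phi> (real m) \<omega>))\<^sup>2"
            by (intro power_mono) auto
          also have "\<dots> = ?e * (?v 0 \<omega>)\<^sup>2 * exp (?J ?\<psi> (real m) \<omega>)"
          proof -
            have d: "?J ?\<psi> (real m) \<omega> = 2 * ?J ?\<phi> (real m) \<omega>" unfolding dbl by (simp add: enn2real_mult)
            show ?thesis unfolding d by (simp add: power_mult_distrib exp_double[symmetric] exp_add mult_ac)
          qed
          finally show ?case by (simp add: ennreal_mult[symmetric])
        qed
      qed
      also have "\<dots> \<le> Q" unfolding Q_def by (rule I)
      finally show ?thesis .
    qed
    have "integrable M (\<lambda>\<omega>. sq_norm (Y t \<omega>)) \<and> (\<integral>\<omega>. sq_norm (Y t \<omega>) \<partial>M) \<le> enn2real Q" if t: "0 \<le> t" "t \<le> T" for t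
    proof
      have tm: "t \<le> real m" using t m by simp
      show int: "integrable M (\<lambda>\<omega>. sq_norm (Y t \<omega>))"
      proof (rule integrableI_nonneg)
        show "(\<integral>\<^sup>+\<omega>. ennreal (sq_norm (Y t \<omega>)) \<partial>M) < \<infinity>" using le[OF t(1) tm] Q by (rule order.strict_trans1)
      qed (use Y_measurable[OF t(1)] in auto)
      have "ennreal (\<integral>\<omega>. sq_norm (Y t \<omega>) \<partial>M) \<le> Q"
        using le[OF t(1) tm] nn_integral_eq_integral[OF int] by simp
      then show "(\<integral>\<omega>. sq_norm (Y t \<omega>) \<partial>M) \<le> enn2real Q"
        using Q by (cases Q) auto
    qed
    then show ?thesis by blast
  qed
  show "0 \<le> t \<Longrightarrow> integrable M (\<lambda>\<omega>. sq_norm (Y t \<omega>))" using main[of t] by auto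
  show "\<exists>K. \<forall>t. 0 \<le> t \<longrightarrow> t \<le> T \<longrightarrow> (\<integral>\<omega>. sq_norm (Y t \<omega>) \<partial>M) \<le> K" using main[of T] by blast
qed

end

section \<open>Passage to a version with regular paths\<close>

text \<open>Independence is given for sigma-algebras; those generated by \<open>H\<close> and by
  \<open>g\<close> of \<open>X\<close> are contained in them, so the product rule for independent
  variables applies.\<close>

lemma (in prob_space) nn_integral_mult_indep:
  fixes H :: "'a \<Rightarrow> ennreal" and g :: "'b::topological_space \<Rightarrow> ennreal"
  assumes G: "subalgebra M G" and indep: "indep_set (sets G) (sets (vimage_algebra (space M) X borel))"
    and X: "random_variable borel X" and H: "H \<in> borel_measurable G" and g: "g \<in> borel_measurable borel"
  shows "(\<integral>\<^sup>+\<omega>. H \<omega> * g (X \<omega>) \<partial>M) = (\<integral>\<^sup>+\<omega>. H \<omega> \<partial>M) * (\<integral>\<^sup>+\<omega>. g (X \<omega>) \<partial>M)"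
proof -
  let ?V = "vimage_algebra (space M) X borel"
  have sp: "space G = space M" using G by (simp add: subalgebra_def)
  have HM: "H \<in> borel_measurable M" by (rule measurable_from_subalg[OF G H])
  have gX: "(\<lambda>\<omega>. g (X \<omega>)) \<in> borel_measurable ?V"
    by (rule measurable_compose[OF measurable_vimage_algebra1 g]) simp
  have gM: "(\<lambda>\<omega>. g (X \<omega>)) \<in> borel_measurable M" by (rule measurable_compose[OF X g])
  have 1: "sigma_sets (space M) {H -` A \<inter> space M |A. A \<in> sets borel} \<subseteq> sets G"
    unfolding sp[symmetric] using measurable_sets[OF H] by (intro sets.sigma_sets_subset) auto
  have 2: "sigma_sets (space M) {(\<lambda>\<omega>. g (X \<omega>)) -` A \<inter> space M |A. A \<in> sets borel} \<subseteq> sets ?V"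
    using sets.sigma_sets_subset[of "{(\<lambda>\<omega>. g (X \<omega>)) -` A \<inter> space M |A. A \<in> sets borel}" ?V] measurable_sets[OF gX] by auto
  have "indep_var borel H borel (\<lambda>\<omega>. g (X \<omega>))"
    unfolding indep_var_eq indep_set_def
  proof (intro conjI HM gM indep_sets_mono_sets[OF indep[unfolded indep_set_def]])
    show "(case b of True \<Rightarrow> sigma_sets (space M) {H -` A \<inter> space M |A. A \<in> sets borel}
        | False \<Rightarrow> sigma_sets (space M) {(\<lambda>\<omega>. g (X \<omega>)) -` A \<inter> space M |A. A \<in> sets borel})
      \<subseteq> (case b of True \<Rightarrow> sets G | False \<Rightarrow> sets ?V)" for b
      using 1 2 by (simp split: bool.split)
  qed
  moreover have "case_bool borel borel = (\<lambda>_. borel :: ennreal measure)" by (auto simp: fun_eq_iff split: bool.split)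
  ultimately have "indep_vars (\<lambda>_. borel) (case_bool H (\<lambda>\<omega>. g (X \<omega>))) UNIV" by (simp add: indep_var_def)
  from indep_vars_nn_integral[OF _ this] show ?thesis by (simp add: UNIV_bool mult.commute)
qed

text \<open>Independence splits the mean, and equality of the image measures replaces the increment
  by \<open>L (t - s)\<close>.\<close>

lemma levy_process_increments:
  fixes g :: "real^'d \<Rightarrow> ennreal"
  assumes M: "prob_space M" and F: "\<And>t. 0 \<le> t \<Longrightarrow> subalgebra M (F t)" and L: "levy_process M F L"
    and st: "0 \<le> s" "s \<le> t" and H: "H \<in> borel_measurable (F s)" and g: "g \<in> borel_measurable borel"
  shows "(\<integral>\<^sup>+\<omega>. H \<omega> * g (L t \<omega> - L s \<omega>) \<partial>M) = (\<integral>\<^sup>+\<omega>. H \<omega> \<partial>M) * (\<integral>\<^sup>+\<omega>. g (L (t - s) \<omega>) \<partial>M)"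
proof -
  interpret prob_space M by (rule M)
  have Lm: "L t \<in> borel_measurable M" if "0 \<le> t" for t
    using L that measurable_from_subalg[OF F[OF that]] unfolding levy_process_def adapted_def by blast
  have X: "(\<lambda>\<omega>. L t \<omega> - L s \<omega>) \<in> borel_measurable M" using st by (intro borel_measurable_diff Lm) auto
  have "(\<integral>\<^sup>+\<omega>. H \<omega> * g (L t \<omega> - L s \<omega>) \<partial>M) = (\<integral>\<^sup>+\<omega>. H \<omega> \<partial>M) * (\<integral>\<^sup>+\<omega>. g (L t \<omega> - L s \<omega>) \<partial>M)"
    using L st unfolding levy_process_def by (intro nn_integral_mult_indep[OF F[OF st(1)] _ X H g]) blast
  also have "(\<integral>\<^sup>+\<omega>. g (L t \<omega> - L s \<omega>) \<partial>M) = (\<integral>\<^sup>+x. g x \<partial>distr M borel (\<lambda>\<omega>. L t \<omega> - L s \<omega>))"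
    using g by (intro nn_integral_distr[OF X, symmetric]) simp
  also have "distr M borel (\<lambda>\<omega>. L t \<omega> - L s \<omega>) = distr M borel (L (t - s))"
    using L st unfolding levy_process_def by blast
  also have "(\<integral>\<^sup>+x. g x \<partial>distr M borel (L (t - s))) = (\<integral>\<^sup>+\<omega>. g (L (t - s) \<omega>) \<partial>M)"
    using st g by (intro nn_integral_distr Lm) auto
  finally show ?thesis .
qed

lemma psd_0: "psd 0"
  by (simp add: psd_def transpose_def vec_eq_iff)

text \<open>Both processes are set to zero on a null set that contains all exceptional paths. By the
  usual conditions this set belongs to \<open>F 0\<close>, so adaptedness survives, and the law of
  the increments, the Levy measure and the equation do not see null sets.\<close>

lemma mucogarch_regular_version:
  fixes L :: "real \<Rightarrow> 'a \<Rightarrow> real^'d" and Y :: "real \<Rightarrow> 'a \<Rightarrow> real^'d^'d"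
  assumes M: "prob_space M" and usual: "usual_conditions M F" and L: "levy_process M F L"
    and \<nu>: "is_levy_measure M L \<nu>" and C: "pos_def C" and Y: "mucogarch_volatility M F L A B C Y"
    and \<sigma>: "\<sigma> \<ge> 0" and mom: "has_bochner_integral \<nu> (\<lambda>x. outer x x) (\<sigma> *\<^sub>R mat 1)"
  obtains L' Y' where "mucogarch_path M F L' \<nu> \<sigma> A B C Y'" and "AE \<omega> in M. \<forall>t. L' t \<omega> = L t \<omega> \<and> Y' t \<omega> = Y t \<omega>"
proof -
  interpret prob_space M by (rule M)
  have sub: "subalgebra M (F t)" if "0 \<le> t" for t using usual that unfolding usual_conditions_def by blast
  have filt: "filtration (space M) F" and complete: "complete_measure M" and null: "null_sets M \<subseteq> sets (F 0)"
    using usual unfolding usual_conditions_def by blast+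
  have mono: "sets (F s) \<subseteq> sets (F t)" if "s \<le> t" for s t using filtration.sets_F_mono[OF filt that] .
  let ?sde = "\<lambda>\<omega>. \<forall>t\<ge>0.
        let Ym = left_limit (\<lambda>r. Y r \<omega>) in
        \<exists>J. has_matrix_LS_integral (\<lambda>s. A ** psd_sqrt (C + Ym s)) (disc_qv (\<lambda>r. L r \<omega>))
              (\<lambda>s. psd_sqrt (C + Ym s) ** transpose A) 0 t J \<and>
            Y t \<omega> = Y 0 \<omega> + (LINT s:{0..t}|lborel. B ** Ym s + Ym s ** transpose B) + J"
  define P where "P \<omega> \<longleftrightarrow> cadlag (\<lambda>t. L t \<omega>) \<and> cadlag (\<lambda>t. Y t \<omega>) \<and> (\<forall>t\<ge>0. psd (Y t \<omega>)) \<and> ?sde \<omega>" for \<omega>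
  from L have L_cad: "AE \<omega> in M. cadlag (\<lambda>t. L t \<omega>)" unfolding levy_process_def by (elim conjE)
  from Y have Y_paths: "AE \<omega> in M. cadlag (\<lambda>t. Y t \<omega>)" "AE \<omega> in M. \<forall>t\<ge>0. psd (Y t \<omega>)" "AE \<omega> in M. ?sde \<omega>"
    unfolding mucogarch_volatility_def by blast+
  have "AE \<omega> in M. P \<omega>"
    using L_cad Y_paths by eventually_elim (unfold P_def, intro conjI)
  then obtain N where N: "{\<omega> \<in> space M. \<not> P \<omega>} \<subseteq> N" "N \<in> null_sets M"
    unfolding eventually_ae_filter by blast
  define \<Omega> where "\<Omega> = space M - N"
  have good: "cadlag (\<lambda>t. L t \<omega>)" "cadlag (\<lambda>t. Y t \<omega>)" "\<forall>t\<ge>0. psd (Y t \<omega>)" "?sde \<omega>" if "\<omega> \<in> \<Omega>" for \<omega>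
  proof -
    have "P \<omega>" using N(1) that unfolding \<Omega>_def by blast
    then show "cadlag (\<lambda>t. L t \<omega>)" "cadlag (\<lambda>t. Y t \<omega>)" "\<forall>t\<ge>0. psd (Y t \<omega>)" "?sde \<omega>"
      unfolding P_def by blast+
  qed
  have AE\<Omega>: "AE \<omega> in M. \<omega> \<in> \<Omega>" using AE_not_in[OF N(2)] AE_space by eventually_elim (simp add: \<Omega>_def)
  have \<Omega>F: "\<Omega> \<inter> space (F t) \<in> sets (F t)" if "0 \<le> t" for t
  proof -
    have "N \<in> sets (F t)" using N(2) null mono[OF that] by blast
    moreover have "space (F t) = space M" by (rule filtration.space_F[OF filt])
    ultimately show ?thesis using sets.compl_sets[of N "F t"] by (simp add: \<Omega>_def Int_absorb2)
  qed
  \<comment> \<open>The zero path is cadlag and positive semidefinite. It does not have to satisfy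
    the equation, which is required almost surely only.\<close>
  define L' where "L' t \<omega> = (if \<omega> \<in> \<Omega> then L t \<omega> else 0)" for t \<omega>
  define Y' where "Y' t \<omega> = (if \<omega> \<in> \<Omega> then Y t \<omega> else 0)" for t \<omega>
  have paths: "(\<lambda>t. L' t \<omega>) = (if \<omega> \<in> \<Omega> then (\<lambda>t. L t \<omega>) else (\<lambda>_. 0))"
    "(\<lambda>t. Y' t \<omega>) = (if \<omega> \<in> \<Omega> then (\<lambda>t. Y t \<omega>) else (\<lambda>_. 0))" for \<omega>
    by (auto simp: L'_def Y'_def)
  have L_F: "L t \<in> borel_measurable (F t)" and Y_F: "Y t \<in> borel_measurable (F t)" if "0 \<le> t" for t
    using L Y that by (auto simp: levy_process_def mucogarch_volatility_def adapted_def)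
  have eqL: "AE \<omega> in M. L' t \<omega> = L t \<omega>" for t using AE\<Omega> by eventually_elim (simp add: L'_def)
  have "mucogarch_path M F L' \<nu> \<sigma> A B C Y'"
  proof (intro mucogarch_path.intro second_moment_levy_path.intro levy_path.intro M complete
      levy_path_axioms.intro second_moment_levy_path_axioms.intro mucogarch_path_axioms.intro \<sigma> mom pos_def_imp_psd[OF C])
    show "subalgebra M (F t)" if "0 \<le> t" for t by (rule sub[OF that])
    show "sets (F s) \<subseteq> sets (F t)" if "s \<le> t" for s t by (rule mono[OF that])
    show "L' t \<in> borel_measurable (F t)" if "0 \<le> t" for t
      unfolding L'_def[abs_def] by (intro measurable_If_set L_F[OF that] \<Omega>F[OF that]) simp
    show "Y' t \<in> borel_measurable (F t)" if "0 \<le> t" for t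
      unfolding Y'_def[abs_def] by (intro measurable_If_set Y_F[OF that] \<Omega>F[OF that]) simp
    show "cadlag (\<lambda>t. L' t \<omega>)" "cadlag (\<lambda>t. Y' t \<omega>)" for \<omega>
      unfolding paths using good(1,2)[of \<omega>] by (simp_all add: cadlag_const)
    show "psd (Y' t \<omega>)" if "0 \<le> t" for t \<omega> using good(3)[of \<omega>] that by (simp add: Y'_def psd_0)
    show "(\<integral>\<^sup>+\<omega>. H \<omega> * g (L' t \<omega> - L' s \<omega>) \<partial>M) = (\<integral>\<^sup>+\<omega>. H \<omega> \<partial>M) * (\<integral>\<^sup>+\<omega>. g (L' (t - s) \<omega>) \<partial>M)"
      if "0 \<le> s" "s \<le> t" "H \<in> borel_measurable (F s)" "g \<in> borel_measurable borel"
      for s t H and g :: "real^'d \<Rightarrow> ennreal"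
    proof -
      have "(\<integral>\<^sup>+\<omega>. H \<omega> * g (L' t \<omega> - L' s \<omega>) \<partial>M) = (\<integral>\<^sup>+\<omega>. H \<omega> * g (L t \<omega> - L s \<omega>) \<partial>M)"
        using eqL[of t] eqL[of s] by (intro nn_integral_cong_AE, eventually_elim) simp
      moreover have "(\<integral>\<^sup>+\<omega>. g (L' (t - s) \<omega>) \<partial>M) = (\<integral>\<^sup>+\<omega>. g (L (t - s) \<omega>) \<partial>M)"
        using eqL[of "t - s"] by (intro nn_integral_cong_AE, eventually_elim) simp
      ultimately show ?thesis using levy_process_increments[OF M sub L that] by simp
    qed
    show "is_levy_measure M L' \<nu>"
    proof -
      have "(\<integral>\<^sup>+\<omega>. emeasure (count_space UNIV) {s \<in> {0<..1}. jump (\<lambda>r. L' r \<omega>) s \<in> D - {0}} \<partial>M)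
        = (\<integral>\<^sup>+\<omega>. emeasure (count_space UNIV) {s \<in> {0<..1}. jump (\<lambda>r. L r \<omega>) s \<in> D - {0}} \<partial>M)" for D
        using AE\<Omega> by (intro nn_integral_cong_AE, eventually_elim) (simp add: paths)
      then show ?thesis using \<nu> by (simp add: is_levy_measure_def)
    qed
    show "AE \<omega> in M. \<forall>t\<ge>0.
        let Ym = left_limit (\<lambda>r. Y' r \<omega>) in
        \<exists>J. has_matrix_LS_integral (\<lambda>s. A ** psd_sqrt (C + Ym s)) (disc_qv (\<lambda>r. L' r \<omega>))
              (\<lambda>s. psd_sqrt (C + Ym s) ** transpose A) 0 t J \<and>
            Y' t \<omega> = Y' 0 \<omega> + (LINT s:{0..t}|lborel. B ** Ym s + Ym s ** transpose B) + J"
      using AE\<Omega>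
    proof eventually_elim
      case (elim \<omega>)
      then have eq: "Y' t \<omega> = Y t \<omega>" for t by (simp add: Y'_def)
      show ?case unfolding paths eq if_P[OF elim] by (rule good(4)[OF elim])
    qed
  qed
  moreover have "AE \<omega> in M. \<forall>t. L' t \<omega> = L t \<omega> \<and> Y' t \<omega> = Y t \<omega>"
    using AE\<Omega> by eventually_elim (simp add: L'_def Y'_def)
  ultimately show ?thesis by (rule that)
qed

section \<open>Covariances of vectorised matrix processes\<close>

lemma vectorize_measurable: "X \<in> borel_measurable M \<Longrightarrow> (\<lambda>\<omega>. vectorize (X \<omega> :: real^'n^'m)) \<in> borel_measurable M"
  unfolding vectorize_def
  by (rule measurable_compose[OF _ borel_measurable_continuous_onI])
     (auto intro!: continuous_intros continuous_on_vec_lambda)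

lemma outer_measurable:
  fixes X :: "'a \<Rightarrow> real^'m" and Z :: "'a \<Rightarrow> real^'n"
  assumes "X \<in> borel_measurable M" "Z \<in> borel_measurable M"
  shows "(\<lambda>\<omega>. outer (X \<omega>) (Z \<omega>)) \<in> borel_measurable M"
  by (rule borel_measurable_continuous_Pair[OF assms])
     (unfold outer_def, intro continuous_intros continuous_on_vec_lambda)

text \<open>Carries covariances over from the version with regular paths to the given
  process.\<close>

lemma cov_cong_AE:
  assumes m: "X \<in> borel_measurable M" "X' \<in> borel_measurable M" "Z \<in> borel_measurable M" "Z' \<in> borel_measurable M"
    and eq: "AE \<omega> in M. X \<omega> = X' \<omega>" "AE \<omega> in M. Z \<omega> = Z' \<omega>"
  shows "cov M X Z = cov M X' Z'"
proof -
  have "(\<integral>\<omega>. outer (X \<omega>) (Z \<omega>) \<partial>M) = (\<integral>\<omega>. outer (X' \<omega>) (Z' \<omega>) \<partial>M)"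
  proof (rule integral_cong_AE)
    show "AE \<omega> in M. outer (X \<omega>) (Z \<omega>) = outer (X' \<omega>) (Z' \<omega>)" using eq by eventually_elim simp
  qed (intro outer_measurable m)+
  then show ?thesis unfolding cov_def integral_cong_AE[OF m(1,2) eq(1)] integral_cong_AE[OF m(3,4) eq(2)] by simp
qed

text \<open>Behind the equality of the covariances of \<open>Y\<close> and \<open>C + Y\<close>.
  Linearity of the integral is used entrywise and rests on integrability, since the integral of a
  function that is not integrable is 0 by default.\<close>

lemma (in prob_space) cov_add_const:
  fixes X :: "'a \<Rightarrow> real^'m" and Z :: "'a \<Rightarrow> real^'n"
  assumes i: "\<And>i. integrable M (\<lambda>\<omega>. X \<omega> $ i)" "\<And>j. integrable M (\<lambda>\<omega>. Z \<omega> $ j)" "\<And>i j. integrable M (\<lambda>\<omega>. X \<omega> $ i * Z \<omega> $ j)"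
  shows "cov M (\<lambda>\<omega>. c + X \<omega>) (\<lambda>\<omega>. e + Z \<omega>) = cov M X Z"
proof -
  have "cov M (\<lambda>\<omega>. c + X \<omega>) (\<lambda>\<omega>. e + Z \<omega>) $ k $ l = cov M X Z $ k $ l" for k l
  proof -
    have "cov M (\<lambda>\<omega>. c + X \<omega>) (\<lambda>\<omega>. e + Z \<omega>) $ k $ l
      = (\<integral>\<omega>. (c + X \<omega>) $ k * (e + Z \<omega>) $ l \<partial>M) - (\<integral>\<omega>. (c + X \<omega>) $ k \<partial>M) * (\<integral>\<omega>. (e + Z \<omega>) $ l \<partial>M)"
      using i by (intro cov_nth) (simp_all add: distrib_left distrib_right)
    also have "\<dots> = cov M X Z $ k $ l"
      unfolding cov_nth[OF i] using i by (simp add: distrib_left distrib_right prob_space algebra_simps)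
    finally show ?thesis .
  qed
  then show ?thesis by (simp add: vec_eq_iff)
qed

text \<open>Expresses the squared norm by the squares on the diagonal of a covariance matrix, so
  that stationarity controls its mean.\<close>

lemma sq_norm_vectorize: "sq_norm X = (\<Sum>p\<in>UNIV. (vectorize X $ p)\<^sup>2)" for X :: "real^'n^'m"
proof -
  have "(\<Sum>p\<in>UNIV. (vectorize X $ p)\<^sup>2) = (\<Sum>j\<in>UNIV. \<Sum>i\<in>UNIV. (X $ i $ j)\<^sup>2)"
    unfolding vectorize_def UNIV_Times_UNIV[symmetric] sum.cartesian_product by (intro sum.cong) auto
  also have "\<dots> = (\<Sum>i\<in>UNIV. \<Sum>j\<in>UNIV. (X $ i $ j)\<^sup>2)" by (rule sum.swap)
  finally show ?thesis unfolding power2_norm_eq_inner inner_vec_def by (simp add: power2_eq_square)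
qed

lemma abs_vectorize_le: "\<bar>vectorize X $ p\<bar> \<le> norm X"
  unfolding vectorize_def by (simp add: matrix_component_le_norm)

lemma (in prob_space) integrable_vectorize:
  fixes X W :: "'a \<Rightarrow> real^'n^'m"
  assumes X: "X \<in> borel_measurable M" "integrable M (\<lambda>\<omega>. sq_norm (X \<omega>))"
    and W: "W \<in> borel_measurable M" "integrable M (\<lambda>\<omega>. sq_norm (W \<omega>))"
  shows "integrable M (\<lambda>\<omega>. vectorize (X \<omega>) $ p)" and "integrable M (\<lambda>\<omega>. vectorize (X \<omega>) $ p * vectorize (W \<omega>) $ q)"
proof -
  have nth: "(\<lambda>\<omega>. vectorize (X \<omega>) $ p) \<in> borel_measurable M" if "X \<in> borel_measurable M" for X :: "'a \<Rightarrow> real^'n^'m" and p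
    by (rule measurable_compose[OF vectorize_measurable[OF that] measurable_component])
  have le: "\<bar>vectorize (X \<omega>) $ p\<bar> \<le> 0 + 1 * norm (X \<omega>)" for X :: "'a \<Rightarrow> real^'n^'m" and p \<omega>
    using abs_vectorize_le by simp
  have "integrable M (\<lambda>\<omega>. 1 * vectorize (X \<omega>) $ p)"
    using nth[OF X(1)] X(2) le by (intro integrable_mult_L2(1)[where a = 0 and b = 1 and V = "\<lambda>\<omega>. norm (X \<omega>)"]) auto
  then show "integrable M (\<lambda>\<omega>. vectorize (X \<omega>) $ p)" by simp
  have "integrable M (\<lambda>\<omega>. (vectorize (X \<omega>) $ p)\<^sup>2)"
  proof (rule Bochner_Integration.integrable_bound[OF X(2)])
    show "AE \<omega> in M. norm ((vectorize (X \<omega>) $ p)\<^sup>2) \<le> norm (sq_norm (X \<omega>))"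
      using abs_vectorize_le by (intro AE_I2) (simp add: abs_le_square_iff[symmetric])
  qed (use nth[OF X(1)] in measurable)
  then show "integrable M (\<lambda>\<omega>. vectorize (X \<omega>) $ p * vectorize (W \<omega>) $ q)"
    using nth[OF X(1)] nth[OF W(1)] W(2) le by (intro integrable_mult_L2(1)[where a = 0 and b = 1 and V = "\<lambda>\<omega>. norm (W \<omega>)"]) auto
qed

text \<open>The covariance equation is proved for the version with regular paths and carried back by
  almost sure equality at every time.\<close>

theorem theorem4p11:
  fixes M :: "'a measure" and F :: "real \<Rightarrow> 'a measure"
    and L :: "real \<Rightarrow> 'a \<Rightarrow> real^'d" and \<nu> :: "(real^'d) measure"
    and A B C :: "real^'d^'d" and Y :: "real \<Rightarrow> 'a \<Rightarrow> real^'d^'d" and \<sigma> :: real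
  assumes "prob_space M"
    and "usual_conditions M F"
    and "levy_process M F L"
    and "is_levy_measure M L \<nu>"
    and "pos_def C"
    and "mucogarch_volatility M F L A B C Y"
    and "\<sigma> \<ge> 0"
    and "has_bochner_integral \<nu> (\<lambda>x. outer x x) (\<sigma> *\<^sub>R mat 1)"
  shows "let V = (\<lambda>t \<omega>. C + Y t \<omega>);
             K = B \<otimes>\<^sub>K mat 1 + mat 1 \<otimes>\<^sub>K B + \<sigma> *\<^sub>R (A \<otimes>\<^sub>K A)
         in
      (second_order_stationary M Y \<longrightarrow>
         (\<forall>h\<ge>0. (acov M Y has_vector_derivative K ** acov M Y h) (at h within {0..})) \<and>
         (\<forall>h\<ge>0. acov M Y h = acov M V h \<and>
                 acov M V h = matrix_exp (h *\<^sub>R K) ** var M (\<lambda>\<omega>. vectorize (Y 0 \<omega>)))) \<and>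
      (integrable M (\<lambda>\<omega>. (norm (Y 0 \<omega>))\<^sup>2) \<and> integrable M (\<lambda>\<omega>. (norm (L 1 \<omega>)) ^ 4) \<longrightarrow>
         (\<forall>u\<ge>0. integrable M (\<lambda>\<omega>. (norm (Y u \<omega>))\<^sup>2)) \<and>
         (\<forall>u\<ge>0. \<forall>h\<ge>0.
            cov M (\<lambda>\<omega>. vectorize (Y (u + h) \<omega>)) (\<lambda>\<omega>. vectorize (Y u \<omega>)) =
              cov M (\<lambda>\<omega>. vectorize (V (u + h) \<omega>)) (\<lambda>\<omega>. vectorize (V u \<omega>)) \<and>
            cov M (\<lambda>\<omega>. vectorize (V (u + h) \<omega>)) (\<lambda>\<omega>. vectorize (V u \<omega>)) =
              matrix_exp (h *\<^sub>R K) ** var M (\<lambda>\<omega>. vectorize (Y u \<omega>))))"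
proof -
  define K where "K = B \<otimes>\<^sub>K mat 1 + mat 1 \<otimes>\<^sub>K B + \<sigma> *\<^sub>R (A \<otimes>\<^sub>K A)"
  let ?c = "\<lambda>Y u h. cov M (\<lambda>\<omega>. vectorize (Y (u + h) \<omega>)) (\<lambda>\<omega>. vectorize (Y u \<omega>))"
  obtain L' Y' where "mucogarch_path M F L' \<nu> \<sigma> A B C Y'" and version: "AE \<omega> in M. \<forall>t. L' t \<omega> = L t \<omega> \<and> Y' t \<omega> = Y t \<omega>"
    by (rule mucogarch_regular_version[OF assms])
  then interpret mucogarch_path M F L' \<nu> \<sigma> A B C Y' by simp
  have Ym: "Y t \<in> borel_measurable M" if "0 \<le> t" for t
    using assms(6) measurable_F_M[OF _ that] that unfolding mucogarch_volatility_def adapted_def by blast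
  have eqY: "AE \<omega> in M. Y' t \<omega> = Y t \<omega>" for t using version by eventually_elim blast
  have sq: "integrable M (\<lambda>\<omega>. sq_norm (Y' t \<omega>)) \<longleftrightarrow> integrable M (\<lambda>\<omega>. sq_norm (Y t \<omega>))"
    "(\<integral>\<omega>. sq_norm (Y' t \<omega>) \<partial>M) = (\<integral>\<omega>. sq_norm (Y t \<omega>) \<partial>M)" if "0 \<le> t" for t
  proof -
    have m: "(\<lambda>\<omega>. sq_norm (Y t \<omega>)) \<in> borel_measurable M" "(\<lambda>\<omega>. sq_norm (Y' t \<omega>)) \<in> borel_measurable M"
      using Ym[OF that] Y_measurable[OF that] by measurable
    have e: "AE \<omega> in M. sq_norm (Y' t \<omega>) = sq_norm (Y t \<omega>)" using eqY[of t] by eventually_elim simp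
    show "integrable M (\<lambda>\<omega>. sq_norm (Y' t \<omega>)) \<longleftrightarrow> integrable M (\<lambda>\<omega>. sq_norm (Y t \<omega>))" by (rule integrable_cong_AE[OF m(2,1) e])
    show "(\<integral>\<omega>. sq_norm (Y' t \<omega>) \<partial>M) = (\<integral>\<omega>. sq_norm (Y t \<omega>) \<partial>M)" by (rule integral_cong_AE[OF m(2,1) e])
  qed
  have bd_eq: "(\<exists>K. \<forall>t. 0 \<le> t \<longrightarrow> t \<le> T \<longrightarrow> (\<integral>\<omega>. sq_norm (Y t \<omega>) \<partial>M) \<le> K) \<longleftrightarrow>
      (\<exists>K. \<forall>t. 0 \<le> t \<longrightarrow> t \<le> T \<longrightarrow> (\<integral>\<omega>. sq_norm (Y' t \<omega>) \<partial>M) \<le> K)" for T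
    by (rule arg_cong[where f = Ex], rule ext) (metis sq(2))
  have cov_eq: "?c Y u h = ?c Y' u h" if "0 \<le> u" "0 \<le> h" for u h
  proof (rule cov_cong_AE)
    show "AE \<omega> in M. vectorize (Y (u + h) \<omega>) = vectorize (Y' (u + h) \<omega>)" "AE \<omega> in M. vectorize (Y u \<omega>) = vectorize (Y' u \<omega>)"
      using eqY[of "u + h"] eqY[of u] by (eventually_elim, simp)+
  qed (intro vectorize_measurable Ym Y_measurable; use that in simp)+
  have V: "cov M (\<lambda>\<omega>. vectorize (C + Y t \<omega>)) (\<lambda>\<omega>. vectorize (C + Y s \<omega>)) = cov M (\<lambda>\<omega>. vectorize (Y t \<omega>)) (\<lambda>\<omega>. vectorize (Y s \<omega>))"
    if sm: "\<And>t. 0 \<le> t \<Longrightarrow> integrable M (\<lambda>\<omega>. sq_norm (Y t \<omega>))" and t: "0 \<le> t" and s: "0 \<le> s" for s t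
  proof -
    have add: "vectorize (C + X) = vectorize C + vectorize X" for X by (simp add: vectorize_def vec_eq_iff)
    show ?thesis unfolding add
      by (intro cov_add_const integrable_vectorize(1)[OF Ym sm Ym sm] integrable_vectorize(2)[OF Ym sm Ym sm]; rule t s)
  qed
  have ode: "((\<lambda>h. ?c Y u h) has_vector_derivative K ** ?c Y u h) (at h within {0..})"
    "?c Y u h = matrix_exp (h *\<^sub>R K) ** var M (\<lambda>\<omega>. vectorize (Y u \<omega>))"
    if sm: "\<And>t. 0 \<le> t \<Longrightarrow> integrable M (\<lambda>\<omega>. sq_norm (Y t \<omega>))"
      and bd: "\<And>T. \<exists>K. \<forall>t. 0 \<le> t \<longrightarrow> t \<le> T \<longrightarrow> (\<integral>\<omega>. sq_norm (Y t \<omega>) \<partial>M) \<le> K"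
      and u: "0 \<le> u" and h: "0 \<le> h" for u h
  proof -
    have sm': "integrable M (\<lambda>\<omega>. sq_norm (Y' t \<omega>))" if "0 \<le> t" for t using sm[OF that] sq(1)[OF that] by simp
    have bd': "\<exists>K. \<forall>t. 0 \<le> t \<longrightarrow> t \<le> T \<longrightarrow> (\<integral>\<omega>. sq_norm (Y' t \<omega>) \<partial>M) \<le> K" for T
      using bd[of T] bd_eq[of T] by blast
    have ce: "((\<lambda>h. ?c Y' u h) has_vector_derivative K ** ?c Y' u h) (at h within {0..})"
      "?c Y' u h = matrix_exp (h *\<^sub>R K) ** ?c Y' u 0"
      unfolding K_def by (rule covariance_equation[OF sm' bd' u h]; assumption)+
    show "((\<lambda>h. ?c Y u h) has_vector_derivative K ** ?c Y u h) (at h within {0..})"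
      unfolding cov_eq[OF u h]
      by (rule has_vector_derivative_transform[OF _ _ ce(1)]) (use u h in \<open>auto intro: cov_eq\<close>)
    show "?c Y u h = matrix_exp (h *\<^sub>R K) ** var M (\<lambda>\<omega>. vectorize (Y u \<omega>))"
      unfolding cov_eq[OF u h] ce(2) cov_eq[OF u order.refl, symmetric] by (simp add: var_def)
  qed
  have "(\<forall>h\<ge>0. (acov M Y has_vector_derivative K ** acov M Y h) (at h within {0..})) \<and>
         (\<forall>h\<ge>0. acov M Y h = acov M (\<lambda>t \<omega>. C + Y t \<omega>) h \<and>
                 acov M (\<lambda>t \<omega>. C + Y t \<omega>) h = matrix_exp (h *\<^sub>R K) ** var M (\<lambda>\<omega>. vectorize (Y 0 \<omega>)))"
    if st: "second_order_stationary M Y"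
  proof -
    have sm: "integrable M (\<lambda>\<omega>. sq_norm (Y t \<omega>))" if "0 \<le> t" for t
      using st that by (simp add: second_order_stationary_def)
    \<comment> \<open>The mean squared norm is the trace of the covariance at lag 0 plus the squared
      norm of the mean, and stationarity fixes both.\<close>
    have "(\<integral>\<omega>. sq_norm (Y t \<omega>) \<partial>M) = (\<integral>\<omega>. sq_norm (Y 0 \<omega>) \<partial>M)" if t: "0 \<le> t" for t
    proof -
      let ?y = "\<lambda>t p \<omega>. vectorize (Y t \<omega>) $ p"
      have i: "integrable M (?y t p)" "integrable M (\<lambda>\<omega>. ?y t p \<omega> * ?y t q \<omega>)" if "0 \<le> t" for p q t
        using integrable_vectorize[OF Ym[OF that] sm[OF that] Ym[OF that] sm[OF that]] by blast+
      have mean: "(\<integral>\<omega>. ?y t p \<omega> \<partial>M) = (\<integral>\<omega>. Y t \<omega> \<partial>M) $ snd p $ fst p" if t: "0 \<le> t" for t p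
      proof -
        have "integrable M (Y t)"
        proof (rule integrable_matrixI)
          show "integrable M (\<lambda>\<omega>. Y t \<omega> $ i $ j)" for i j using i(1)[OF t, of "(j, i)"] by (simp add: vectorize_def)
        qed
        then show ?thesis by (simp add: integral_matrix_nth vectorize_def)
      qed
      have sqn: "(\<integral>\<omega>. sq_norm (Y t \<omega>) \<partial>M) = (\<Sum>p\<in>UNIV. ?c Y t 0 $ p $ p + ((\<integral>\<omega>. Y t \<omega> \<partial>M) $ snd p $ fst p)\<^sup>2)" if t: "0 \<le> t" for t
      proof -
        have "(\<integral>\<omega>. sq_norm (Y t \<omega>) \<partial>M) = (\<Sum>p\<in>UNIV. \<integral>\<omega>. ?y t p \<omega> * ?y t p \<omega> \<partial>M)"
          unfolding sq_norm_vectorize unfolding power2_eq_square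
          by (rule Bochner_Integration.integral_sum) (rule i(2)[OF t])
        moreover have "(\<integral>\<omega>. ?y t p \<omega> * ?y t p \<omega> \<partial>M) = ?c Y t 0 $ p $ p + ((\<integral>\<omega>. Y t \<omega> \<partial>M) $ snd p $ fst p)\<^sup>2" for p
          unfolding mean[OF t, symmetric] using cov_nth[of M "\<lambda>\<omega>. vectorize (Y t \<omega>)" "\<lambda>\<omega>. vectorize (Y t \<omega>)" p p] i[OF t] by (simp add: power2_eq_square)
        ultimately show ?thesis by (simp only:)
      qed
      have "?c Y t 0 = ?c Y 0 0" "(\<integral>\<omega>. Y t \<omega> \<partial>M) = (\<integral>\<omega>. Y 0 \<omega> \<partial>M)"
        using st t unfolding second_order_stationary_def by blast+
      then show ?thesis unfolding sqn[OF t] sqn[OF order.refl] by (simp only:)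
    qed
    then have bd: "\<exists>K. \<forall>t. 0 \<le> t \<longrightarrow> t \<le> T \<longrightarrow> (\<integral>\<omega>. sq_norm (Y t \<omega>) \<partial>M) \<le> K" for T by (metis order.refl)
    have acov: "acov M Y = (\<lambda>h. ?c Y 0 h)" by (simp add: acov_def fun_eq_iff)
    have "acov M (\<lambda>t \<omega>. C + Y t \<omega>) h = acov M Y h" if "0 \<le> h" for h
      unfolding acov_def by (rule V[OF sm that order.refl])
    then show ?thesis using ode[OF sm bd order.refl] unfolding acov by simp
  qed
  moreover have "(\<forall>u\<ge>0. integrable M (\<lambda>\<omega>. (norm (Y u \<omega>))\<^sup>2)) \<and>
         (\<forall>u\<ge>0. \<forall>h\<ge>0. ?c Y u h = ?c (\<lambda>t \<omega>. C + Y t \<omega>) u h \<and>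
            ?c (\<lambda>t \<omega>. C + Y t \<omega>) u h = matrix_exp (h *\<^sub>R K) ** var M (\<lambda>\<omega>. vectorize (Y u \<omega>)))"
    if Y0: "integrable M (\<lambda>\<omega>. sq_norm (Y 0 \<omega>))" and L1: "integrable M (\<lambda>\<omega>. norm (L 1 \<omega>) ^ 4)"
  proof -
    have Y0': "integrable M (\<lambda>\<omega>. sq_norm (Y' 0 \<omega>))" using Y0 sq(1)[of 0] by simp
    have "(\<integral>\<^sup>+\<omega>. ennreal (norm (L' 1 \<omega>) ^ 4) \<partial>M) = (\<integral>\<^sup>+\<omega>. ennreal (norm (L 1 \<omega>) ^ 4) \<partial>M)"
      by (rule nn_integral_cong_AE, use version in eventually_elim) simp
    also have "\<dots> < \<infinity>" using L1 by (simp add: integrable_iff_bounded)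
    finally have L1': "(\<integral>\<^sup>+\<omega>. ennreal (norm (L' 1 \<omega>) ^ 4) \<partial>M) < \<infinity>" .
    have sm: "integrable M (\<lambda>\<omega>. sq_norm (Y t \<omega>))" if "0 \<le> t" for t
      using second_moments(1)[OF Y0' L1' that] sq(1)[OF that] by simp
    have bd: "\<exists>K. \<forall>t. 0 \<le> t \<longrightarrow> t \<le> T \<longrightarrow> (\<integral>\<omega>. sq_norm (Y t \<omega>) \<partial>M) \<le> K" for T
      using second_moments(2)[OF Y0' L1', of T] bd_eq[of T] by blast
    show ?thesis using V[OF sm] ode(2)[OF sm bd] sm by simp
  qed
  ultimately show ?thesis unfolding Let_def K_def[symmetric] by blast
qed

end
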